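(* Let $A=A(\mathcal{A}^{(5)},W)$, where $W$ is any cell system on $\mathcal{A}^{(5)}$. Let $S=A_0$, and let $X_2$, $X_3$ be graded vector spaces with Hilbert series $H_{X_2}(t)=t^3$ and $H_{X_3}(t)=t^6$. Then the Hochschild and cyclic homology of $A$ are given, as graded vector spaces, by $HH_0(A) \cong S$, $HH_1(A)=0$, $HH_2(A) \cong X_2$, $HH_3(A) \cong X_2$, $HH_4(A) \cong X_3$, $HH_5(A) \cong X_3$, $HH_6(A) \cong X_3^{\ast}[15]$, $HH_7(A) \cong X_3^{\ast}[15]$, $HH_8(A) \cong X_2^{\ast}[15]$, $HH_9(A) \cong X_2^{\ast}[15]$, $HH_{10}(A)=HH_{11}(A)=HH_{12}(A)=0$, $HH_{12+i}(A) \cong HH_i(A)[15]$ for $i \geq 1$; and $HC_0(A) \cong S$, $HC_1(A)=0$, $HC_2(A) \cong X_2$, $HC_3(A)=0$, $HC_4(A) \cong X_3$, $HC_5(A)=0$, $HC_6(A) \cong X_3^{\ast}[15]$, $HC_7(A)=0$, $HC_8(A) \cong X_2^{\ast}[15]$, $HC_9(A)=HC_{10}(A)=HC_{11}(A)=HC_{12}(A)=0$, $HC_{12+i}(A) \cong HC_i(A)[15]$ for $i \geq 1$.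
   Context: All vector spaces and algebras are over $\mathbb{C}$. For a finite directed graph $\mathcal{G}$ (loops and multiple edges allowed), $s(a)$, $r(a)$ denote the source and range of an edge $a$. The path algebra $\mathbb{C}\mathcal{G}$ has as basis all finite paths (vertices are the paths of length 0), with product $ab$ the concatenation (first $a$, then $b$) if $r(a)=s(b)$ and $0$ otherwise; it is graded by path length. The graph $\mathcal{A}^{(n)}$, $n\ge4$ (Coxeter number $h=n$), has vertices $(\lambda_1,\lambda_2)$ with $\lambda_1,\lambda_2\ge0$ integers and $\lambda_1+\lambda_2\le n-3$, and one edge from $(\lambda_1,\lambda_2)$ to each of $(\lambda_1+1,\lambda_2)$, $(\lambda_1-1,\lambda_2+1)$, $(\lambda_1,\lambda_2-1)$ that is a vertex. Here $n=5$. Cell systems. Let $h$ be the Coxeter number of $\mathcal{G}$, $q=e^{i\pi/h}$, $[m]_q=(q^m-q^{-m})/(q-q^{-1})$, and let $(\phi_v)_v$ be the Perron-Frobenius eigenvector of $\mathcal{G}$ (eigenvalue $[3]_q$). A cell system $W$ on $\mathcal{G}$ assigns to each closed path $abc$ of length 3 a complex number $W(abc)=W(bca)=W(cab)$ such that: (I) for all vertices $i,j$ and edges $a,a'$ from $i$ to $j$, $\sum W(ab_1b_2)\overline{W(a'b_1b_2)}=\delta_{a,a'}[2]_q\phi_i\phi_j$, summed over all paths $b_1b_2$ of length 2 from $j$ to $i$; (II) for all edges $a_1:i_4\to i_1$, $a_2:i_2\to i_1$, $a_3:i_2\to i_3$, $a_4:i_4\to i_3$, $\sum \phi_k^{-1}W(a_2b_1b_2)\overline{W(a_3b_3b_2)}W(a_4b_3b_4)\overline{W(a_1b_1b_4)}=\delta_{a_1,a_4}\delta_{a_2,a_3}\phi_{i_4}\phi_{i_1}\phi_{i_2}+\delta_{a_1,a_2}\delta_{a_3,a_4}\phi_{i_1}\phi_{i_2}\phi_{i_3}$,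 summed over all vertices $k$ and edges $b_1:i_1\to k$, $b_2:k\to i_2$, $b_3:i_3\to k$, $b_4:k\to i_4$. The almost Calabi-Yau algebra $A(\mathcal{G},W)$ is the quotient of $\mathbb{C}\mathcal{G}$ by the two-sided ideal generated by the elements $\sum_{b,b'}W(abb')\,bb'$, one for each edge $a$, the sum being over all paths $bb'$ of length 2 from $r(a)$ to $s(a)$. It is graded by path length; $S=A_0=(\mathbb{C}\mathcal{G})_0$. Graded conventions. Isomorphisms are of graded vector spaces, with grading induced by path length. $V[n]$ is $V$ with degrees raised by $n$ ($V[n]_j=V_{j-n}$); $V^\ast$ is the graded dual, $(V^\ast)_j=(V_{-j})^\ast$. The Hilbert series of $V$ is $H_V(t)=\sum_j\dim(V_j)t^j$. $HH_n(A)=\mathrm{Tor}_n^{A^e}(A,A)$, where $A^e=A^{\mathrm{op}}\otimes A$ is the enveloping algebra. Reduced Hochschild homology: $\overline{HH}_0(A)=HH_0(A)/S$, $\overline{HH}_n(A)=HH_n(A)$ for $n>0$. With $B:\overline{HH}_n(A)\to\overline{HH}_{n+1}(A)$ the (degree-preserving) Connes differential, the sequence $0\to\overline{HH}_0(A)\to\overline{HH}_1(A)\to\overline{HH}_2(A)\to\cdots$ is exact, and reduced cyclic homology is $\overline{HC}_n(A)=\ker(B:\overline{HH}_{n+1}(A)\to\overline{HH}_{n+2}(A))=\mathrm{Im}(B:\overline{HH}_n(A)\to\overline{HH}_{n+1}(A))$. The convention for cyclic homology used here is $\overline{HC}_0(A)=HC_0(A)/S$ and $HC_n(A)=\overline{HC}_n(A)$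 for $n>0$. *)

theory Defs
  imports
    Complex_Main
    "HOL-Library.Poly_Mapping"
    "HOL-Computational_Algebra.Formal_Laurent_Series"
    "HOL-Algebra.Module"
    "HOL-Algebra.QuotRing"
    "Graph_Theory.Arc_Walk"
begin

section \<open>Complex vector spaces, graded vector spaces\<close>

text \<open>
  A vector space is a \<open>HOL-Algebra\<close> module over the following ring. The fields \<open>mult\<close> and \<open>one\<close> of the
  module record matter only for the algebras below.
\<close>

definition complex_ring :: "complex ring" where
  "complex_ring = \<lparr>carrier = UNIV, mult = (*), one = 1, zero = 0, add = (+)\<rparr>"

lemma cring_complex_ring: "cring complex_ring"
proof (rule cringI)
  show "abelian_group complex_ring"
    by (rule abelian_groupI)
      (auto simp: complex_ring_def algebra_simps intro: exI[of _ "- x" for x :: complex])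
  show "comm_monoid complex_ring"
    by (rule comm_monoidI) (auto simp: complex_ring_def)
qed (auto simp: complex_ring_def algebra_simps)

definition linear_iso ::
    "(complex, 'v, 'm) module_scheme \<Rightarrow> (complex, 'w, 'n) module_scheme \<Rightarrow> bool" where
  "linear_iso V W \<longleftrightarrow> (\<exists>f. bij_betw f (carrier V) (carrier W) \<and>
     (\<forall>x \<in> carrier V. \<forall>y \<in> carrier V. f (x \<oplus>\<^bsub>V\<^esub> y) = f x \<oplus>\<^bsub>W\<^esub> f y) \<and>
     (\<forall>c. \<forall>x \<in> carrier V. f (c \<odot>\<^bsub>V\<^esub> x) = c \<odot>\<^bsub>W\<^esub> f x))"

definition has_dim :: "(complex, 'v, 'm) module_scheme \<Rightarrow> nat \<Rightarrow> bool" where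
  "has_dim V n \<longleftrightarrow> (\<exists>b. b ` {..<n} \<subseteq> carrier V \<and>
     (\<forall>x \<in> carrier V. \<exists>!c. c \<in> {..<n} \<rightarrow>\<^sub>E UNIV \<and> x = (\<Oplus>\<^bsub>V\<^esub>i\<in>{..<n}. c i \<odot>\<^bsub>V\<^esub> b i)))"

definition dual_space :: "(complex, 'v, 'm) module_scheme \<Rightarrow> (complex, 'v \<Rightarrow> complex) module" where
  "dual_space V =
     \<lparr>carrier = {f \<in> extensional (carrier V).
        (\<forall>x \<in> carrier V. \<forall>y \<in> carrier V. f (x \<oplus>\<^bsub>V\<^esub> y) = f x + f y) \<and>
        (\<forall>c. \<forall>x \<in> carrier V. f (c \<odot>\<^bsub>V\<^esub> x) = c * f x)},
      mult = undefined, one = undefined,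
      zero = (\<lambda>x \<in> carrier V. 0),
      add = (\<lambda>f g. \<lambda>x \<in> carrier V. f x + g x),
      smult = (\<lambda>c f. \<lambda>x \<in> carrier V. c * f x)\<rparr>"

text \<open>A graded vector space is the family of its homogeneous components.\<close>

definition graded_space :: "(int \<Rightarrow> (complex, 'v, 'm) module_scheme) \<Rightarrow> bool" where
  "graded_space V \<longleftrightarrow> (\<forall>j. Module.module complex_ring (V j))"

definition graded_iso ::
    "(int \<Rightarrow> (complex, 'v, 'm) module_scheme) \<Rightarrow> (int \<Rightarrow> (complex, 'w, 'n) module_scheme) \<Rightarrow> bool"
    (infix \<open>\<cong>\<^sub>g\<^sub>r\<close> 50) where
  "V \<cong>\<^sub>g\<^sub>r W \<longleftrightarrow> (\<forall>j. linear_iso (V j) (W j))"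

definition graded_zero :: "(int \<Rightarrow> (complex, 'v, 'm) module_scheme) \<Rightarrow> bool" where
  "graded_zero V \<longleftrightarrow> (\<forall>j. carrier (V j) = {\<zero>\<^bsub>V j\<^esub>})"

definition gshift :: "int \<Rightarrow> (int \<Rightarrow> 'a) \<Rightarrow> int \<Rightarrow> 'a" where
  "gshift n V j = V (j - n)"

definition graded_dual ::
    "(int \<Rightarrow> (complex, 'v, 'm) module_scheme) \<Rightarrow> int \<Rightarrow> (complex, 'v \<Rightarrow> complex) module" where
  "graded_dual V j = dual_space (V (- j))"

definition has_hilbert_series ::
    "(int \<Rightarrow> (complex, 'v, 'm) module_scheme) \<Rightarrow> int fls \<Rightarrow> bool" where
  "has_hilbert_series V H \<longleftrightarrow> (\<forall>j. \<exists>n. has_dim (V j) n \<and> fls_nth H j = int n)"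


section \<open>Free vector spaces and quotients\<close>

definition fscale :: "complex \<Rightarrow> ('b \<Rightarrow>\<^sub>0 complex) \<Rightarrow> ('b \<Rightarrow>\<^sub>0 complex)" where
  "fscale c x = Poly_Mapping.map ((*) c) x"

lemma lookup_fscale [simp]: "Poly_Mapping.lookup (fscale c x) b = c * Poly_Mapping.lookup x b"
  unfolding fscale_def by transfer (simp add: when_def)

interpretation fvs: vector_space fscale
  by unfold_locales (auto intro!: poly_mapping_eqI simp: lookup_add algebra_simps)

definition lin_ext :: "('b \<Rightarrow> ('c \<Rightarrow>\<^sub>0 complex)) \<Rightarrow> ('b \<Rightarrow>\<^sub>0 complex) \<Rightarrow> ('c \<Rightarrow>\<^sub>0 complex)" where
  "lin_ext g x = (\<Sum>b \<in> Poly_Mapping.keys x. fscale (Poly_Mapping.lookup x b) (g b))"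

definition free_space :: "'b set \<Rightarrow> (complex, 'b \<Rightarrow>\<^sub>0 complex) module" where
  "free_space X = \<lparr>carrier = {f. Poly_Mapping.keys f \<subseteq> X}, mult = undefined, one = undefined,
     zero = 0, add = (+), smult = fscale\<rparr>"

text \<open>
  The quotient of a vector space by a subspace, and at the same time of an algebra by a two-sided
  ideal; on the ring fields it is \<^const>\<open>FactRing\<close>.
\<close>

definition quotient ::
    "(complex, 'v, 'm) module_scheme \<Rightarrow> 'v set \<Rightarrow> (complex, 'v set) module" where
  "quotient M N = \<lparr>carrier = a_rcosets\<^bsub>M\<^esub> N, mult = rcoset_mult M N, one = N +>\<^bsub>M\<^esub> \<one>\<^bsub>M\<^esub>,
     zero = N, add = set_add M, smult = (\<lambda>c X. \<Union>x\<in>X. N +>\<^bsub>M\<^esub> (c \<odot>\<^bsub>M\<^esub> x))\<rparr>"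

text \<open>The map into \<open>quotient M N\<close> induced on cosets by a map \<open>f\<close> into \<open>M\<close>.\<close>

definition induced :: "(complex, 'w, 'm) module_scheme \<Rightarrow> 'w set \<Rightarrow> ('v \<Rightarrow> 'w) \<Rightarrow> 'v set \<Rightarrow> 'w set" where
  "induced M N f X = (\<Union>x\<in>X. N +>\<^bsub>M\<^esub> f x)"


section \<open>Path algebras and almost Calabi-Yau algebras\<close>

record ('a, 'b) graded_algebra = "('a, 'b) module" +
  homog :: "int \<Rightarrow> 'b set"

text \<open>
  A path is its initial vertex together with its list of edges, so that the vertices are the pairs
  \<open>(v, [])\<close>.
\<close>

definition paths :: "('v, 'e) pre_digraph \<Rightarrow> ('v \<times> 'e list) set" where
  "paths G = {(u, p). \<exists>v. pre_digraph.awalk G u p v}"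

definition path_mult ::
    "('v, 'e) pre_digraph \<Rightarrow> ('v \<times> 'e list \<Rightarrow>\<^sub>0 complex) \<Rightarrow> ('v \<times> 'e list \<Rightarrow>\<^sub>0 complex)
      \<Rightarrow> ('v \<times> 'e list \<Rightarrow>\<^sub>0 complex)" where
  "path_mult G x y = lin_ext (\<lambda>(u, p). lin_ext (\<lambda>(v, p').
     if last (pre_digraph.awalk_verts G u p) = v then Poly_Mapping.single (u, p @ p') 1 else 0) y) x"

definition path_algebra ::
    "('v, 'e) pre_digraph \<Rightarrow> (complex, 'v \<times> 'e list \<Rightarrow>\<^sub>0 complex) graded_algebra" where
  "path_algebra G =
     \<lparr>carrier = {x. Poly_Mapping.keys x \<subseteq> paths G}, mult = path_mult G,
      one = (\<Sum>v \<in> verts G. Poly_Mapping.single (v, []) 1), zero = 0, add = (+), smult = fscale,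
      homog = (\<lambda>d. {x. Poly_Mapping.keys x \<subseteq> {(u, p). (u, p) \<in> paths G \<and> int (length p) = d}})\<rparr>"

definition edges :: "('v, 'e) pre_digraph \<Rightarrow> 'v \<Rightarrow> 'v \<Rightarrow> 'e set" where
  "edges G i j = {a \<in> arcs G. tail G a = i \<and> head G a = j}"

text \<open>\<open>graph_A n\<close> has no multiple edges; an edge is the pair of its source and its range.\<close>

definition verts_A :: "nat \<Rightarrow> (int \<times> int) set" where
  "verts_A n = {(l1, l2). 0 \<le> l1 \<and> 0 \<le> l2 \<and> l1 + l2 \<le> int n - 3}"

definition graph_A :: "nat \<Rightarrow> (int \<times> int, (int \<times> int) \<times> (int \<times> int)) pre_digraph" where
  "graph_A n =
     \<lparr>verts = verts_A n,
      arcs = {((l1, l2), w) | l1 l2 w. (l1, l2) \<in> verts_A n \<and> w \<in> verts_A n \<and>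
                w \<in> {(l1 + 1, l2), (l1 - 1, l2 + 1), (l1, l2 - 1)}},
      tail = fst, head = snd\<rparr>"

definition qnum :: "nat \<Rightarrow> nat \<Rightarrow> complex" where
  "qnum h m = (let q = exp (\<i> * of_real pi / of_nat h) in
     (q ^ m - inverse q ^ m) / (q - inverse q))"

definition perron_frobenius :: "('v, 'e) pre_digraph \<Rightarrow> nat \<Rightarrow> ('v \<Rightarrow> real) \<Rightarrow> bool" where
  "perron_frobenius G h \<phi> \<longleftrightarrow> (\<forall>i \<in> verts G. \<phi> i > 0 \<and>
     (\<Sum>j \<in> verts G. of_nat (card (edges G i j)) * complex_of_real (\<phi> j))
       = qnum h 3 * complex_of_real (\<phi> i))"

text \<open>
  The eigenvector is only determined up to a positive factor. Rescaling it by \<open>r\<close> turns cell systems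
  into cell systems by rescaling them by \<open>r\<close>, and the algebra below does not change.
  The values of \<open>W\<close> outside closed paths of length 3 are irrelevant.
\<close>

definition cell_system ::
    "('v, 'e) pre_digraph \<Rightarrow> nat \<Rightarrow> ('v \<Rightarrow> real) \<Rightarrow> ('e \<Rightarrow> 'e \<Rightarrow> 'e \<Rightarrow> complex) \<Rightarrow> bool" where
  "cell_system G h \<phi> W \<longleftrightarrow>
     (\<forall>i \<in> verts G. \<forall>j \<in> verts G. \<forall>k \<in> verts G.
        \<forall>a \<in> edges G i j. \<forall>b \<in> edges G j k. \<forall>c \<in> edges G k i. W a b c = W b c a) \<and>
     (\<forall>i \<in> verts G. \<forall>j \<in> verts G. \<forall>a \<in> edges G i j. \<forall>a' \<in> edges G i j.
        (\<Sum>k \<in> verts G. \<Sum>b1 \<in> edges G j k. \<Sum>b2 \<in> edges G k i. W a b1 b2 * cnj (W a' b1 b2))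
          = of_bool (a = a') * qnum h 2 * of_real (\<phi> i) * of_real (\<phi> j)) \<and>
     (\<forall>i1 \<in> verts G. \<forall>i2 \<in> verts G. \<forall>i3 \<in> verts G. \<forall>i4 \<in> verts G.
        \<forall>a1 \<in> edges G i4 i1. \<forall>a2 \<in> edges G i2 i1. \<forall>a3 \<in> edges G i2 i3. \<forall>a4 \<in> edges G i4 i3.
        (\<Sum>k \<in> verts G. \<Sum>b1 \<in> edges G i1 k. \<Sum>b2 \<in> edges G k i2.
          \<Sum>b3 \<in> edges G i3 k. \<Sum>b4 \<in> edges G k i4.
            inverse (of_real (\<phi> k)) *
              W a2 b1 b2 * cnj (W a3 b3 b2) * W a4 b3 b4 * cnj (W a1 b1 b4))
          = of_bool (a1 = a4 \<and> a2 = a3) * of_real (\<phi> i4) * of_real (\<phi> i1) * of_real (\<phi> i2)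
            + of_bool (a1 = a2 \<and> a3 = a4) * of_real (\<phi> i1) * of_real (\<phi> i2) * of_real (\<phi> i3))"

definition cell_relation ::
    "('v, 'e) pre_digraph \<Rightarrow> ('e \<Rightarrow> 'e \<Rightarrow> 'e \<Rightarrow> complex) \<Rightarrow> 'e \<Rightarrow> ('v \<times> 'e list \<Rightarrow>\<^sub>0 complex)" where
  "cell_relation G W a = (\<Sum>k \<in> verts G. \<Sum>b \<in> edges G (head G a) k. \<Sum>b' \<in> edges G k (tail G a).
     Poly_Mapping.single (head G a, [b, b']) (W a b b'))"

definition acy_algebra ::
    "('v, 'e) pre_digraph \<Rightarrow> ('e \<Rightarrow> 'e \<Rightarrow> 'e \<Rightarrow> complex)
      \<Rightarrow> (complex, ('v \<times> 'e list \<Rightarrow>\<^sub>0 complex) set) graded_algebra" where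
  "acy_algebra G W =
     (let P = path_algebra G; I = Idl\<^bsub>P\<^esub> (cell_relation G W ` arcs G) in
      module.extend (quotient P I) (graded_algebra.fields (\<lambda>d. (\<lambda>x. I +>\<^bsub>P\<^esub> x) ` homog P d)))"

text \<open>\<open>A\<^sub>0\<close> as a graded vector space concentrated in degree 0.\<close>

definition deg0 ::
    "(complex, 'a, 'm) graded_algebra_scheme \<Rightarrow> int \<Rightarrow> (complex, 'a, 'm) graded_algebra_scheme" where
  "deg0 A j = A\<lparr>carrier := (if j = 0 then homog A 0 else {\<zero>\<^bsub>A\<^esub>})\<rparr>"


section \<open>Hochschild homology\<close>

text \<open>
  \<open>Tor\<^sub>n\<close> over \<open>A\<^sup>e = A\<^bsup>op\<^esup> \<otimes> A\<close> of \<open>(A, A)\<close> is computed from the bar resolution of \<open>A\<close>, whose \<open>n\<close>-th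
  term is \<open>Bar\<^sub>n = A \<otimes> A\<^bsup>\<otimes>n\<^esup> \<otimes> A\<close>, a free \<open>A\<^sup>e\<close>-module. The left and right \<open>A\<^sup>e\<close>-actions are
  \<open>(u \<otimes> v) m = v m u\<close> and \<open>a (u \<otimes> v) = u a v\<close>.
  The elementary tensor \<open>a \<otimes> (x\<^sub>0 \<otimes> \<dots> \<otimes> x\<^bsub>n+1\<^esub>)\<close> in \<open>A \<otimes> Bar\<^sub>n\<close> is written as the list \<open>a # xs\<close> of length
  \<open>n + 3\<close>, and \<open>A \<otimes> Bar\<^sub>n\<close> over \<open>A\<^sup>e\<close> is the free vector space on all such lists modulo the multilinearity
  relations and the balancing relations \<open>a r \<otimes> m = a \<otimes> r m\<close> with \<open>r = u \<otimes> v\<close>.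
\<close>

definition tensor_lists :: "(complex, 'a, 'm) module_scheme \<Rightarrow> nat \<Rightarrow> 'a list set" where
  "tensor_lists A m = {xs. length xs = m \<and> set xs \<subseteq> carrier A}"

definition multilinear_rels :: "(complex, 'a, 'm) module_scheme \<Rightarrow> nat \<Rightarrow> ('a list \<Rightarrow>\<^sub>0 complex) set" where
  "multilinear_rels A m =
     {Poly_Mapping.single (xs @ (x \<oplus>\<^bsub>A\<^esub> y) # ys) 1 - Poly_Mapping.single (xs @ x # ys) 1
        - Poly_Mapping.single (xs @ y # ys) 1 | xs x y ys.
        xs @ x # ys \<in> tensor_lists A m \<and> y \<in> carrier A} \<union>
     {Poly_Mapping.single (xs @ (c \<odot>\<^bsub>A\<^esub> x) # ys) 1 - Poly_Mapping.single (xs @ x # ys) c | xs x c ys.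
        xs @ x # ys \<in> tensor_lists A m}"

definition balancing_rels :: "(complex, 'a, 'm) module_scheme \<Rightarrow> nat \<Rightarrow> ('a list \<Rightarrow>\<^sub>0 complex) set" where
  "balancing_rels A n =
     {Poly_Mapping.single ((u \<otimes>\<^bsub>A\<^esub> a \<otimes>\<^bsub>A\<^esub> v) # x # xs @ [z]) 1
        - Poly_Mapping.single (a # (v \<otimes>\<^bsub>A\<^esub> x) # xs @ [z \<otimes>\<^bsub>A\<^esub> u]) 1 | u v a x xs z.
        u \<in> carrier A \<and> v \<in> carrier A \<and> a # x # xs @ [z] \<in> tensor_lists A (n + 3)}"

definition tor_rels :: "(complex, 'a, 'm) module_scheme \<Rightarrow> nat \<Rightarrow> ('a list \<Rightarrow>\<^sub>0 complex) set" where
  "tor_rels A n = fvs.span (multilinear_rels A (n + 3) \<union> balancing_rels A n)"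

definition tor_chains ::
    "(complex, 'a, 'm) module_scheme \<Rightarrow> nat \<Rightarrow> (complex, ('a list \<Rightarrow>\<^sub>0 complex) set) module" where
  "tor_chains A n = quotient (free_space (tensor_lists A (n + 3))) (tor_rels A n)"

definition tor_chains_homog ::
    "(complex, 'a, 'm) graded_algebra_scheme \<Rightarrow> nat \<Rightarrow> int \<Rightarrow> ('a list \<Rightarrow>\<^sub>0 complex) set set" where
  "tor_chains_homog A n j =
     (\<lambda>x. tor_rels A n +>\<^bsub>free_space (tensor_lists A (n + 3))\<^esub> x) `
       fvs.span {Poly_Mapping.single xs 1 | xs. xs \<in> tensor_lists A (n + 3) \<and>
         (\<exists>ds. list_all2 (\<lambda>x d. x \<in> homog A d) xs ds \<and> sum_list ds = j)}"

text \<open>The differential \<open>b'\<close> of the bar resolution on \<open>x\<^sub>0 \<otimes> \<dots> \<otimes> x\<^bsub>n+1\<^esub>\<close>.\<close>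

definition bar_diff :: "(complex, 'a, 'm) module_scheme \<Rightarrow> 'a list \<Rightarrow> ('a list \<Rightarrow>\<^sub>0 complex)" where
  "bar_diff A xs = (\<Sum>i < length xs - 1.
     Poly_Mapping.single (take i xs @ (xs ! i \<otimes>\<^bsub>A\<^esub> xs ! Suc i) # drop (i + 2) xs) ((-1) ^ i))"

text \<open>\<open>tor_diff A n\<close> is \<open>id \<otimes> b'\<close> from degree \<open>n + 1\<close> to degree \<open>n\<close>.\<close>

definition tor_diff ::
    "(complex, 'a, 'm) module_scheme \<Rightarrow> nat \<Rightarrow> ('a list \<Rightarrow>\<^sub>0 complex) set \<Rightarrow> ('a list \<Rightarrow>\<^sub>0 complex) set" where
  "tor_diff A n = induced (free_space (tensor_lists A (n + 3))) (tor_rels A n)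
     (lin_ext (\<lambda>l. lin_ext (\<lambda>ys. Poly_Mapping.single (hd l # ys) 1) (bar_diff A (tl l))))"

definition cycles ::
    "(complex, 'a, 'm) graded_algebra_scheme \<Rightarrow> nat \<Rightarrow> int
      \<Rightarrow> (complex, ('a list \<Rightarrow>\<^sub>0 complex) set) module" where
  "cycles A n j = (tor_chains A n)\<lparr>carrier :=
     {X \<in> tor_chains_homog A n j.
        case n of 0 \<Rightarrow> True | Suc m \<Rightarrow> tor_diff A m X = \<zero>\<^bsub>tor_chains A m\<^esub>}\<rparr>"

definition boundaries ::
    "(complex, 'a, 'm) graded_algebra_scheme \<Rightarrow> nat \<Rightarrow> int \<Rightarrow> ('a list \<Rightarrow>\<^sub>0 complex) set set" where
  "boundaries A n j = tor_diff A n ` tor_chains_homog A (Suc n) j"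

definition HH ::
    "(complex, 'a, 'm) graded_algebra_scheme \<Rightarrow> nat \<Rightarrow> int
      \<Rightarrow> (complex, ('a list \<Rightarrow>\<^sub>0 complex) set set) module" where
  "HH A n j = quotient (cycles A n j) (boundaries A n j)"


section \<open>Reduced Hochschild homology, the Connes differential and cyclic homology\<close>

text \<open>
  \<open>HH\<^sub>0(A)/S\<close> is formed in one step, by dividing the cycles by the boundaries together with \<open>S\<close>. Under
  the isomorphism of \<open>A \<otimes> Bar\<^sub>0\<close> over \<open>A\<^sup>e\<close> with \<open>A\<close>, the element \<open>s\<close> of \<open>A\<close> corresponds to \<open>s \<otimes> (1 \<otimes> 1)\<close>.
\<close>

definition reduced_boundaries ::
    "(complex, 'a, 'm) graded_algebra_scheme \<Rightarrow> nat \<Rightarrow> int \<Rightarrow> ('a list \<Rightarrow>\<^sub>0 complex) set set" where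
  "reduced_boundaries A n j =
     (if n = 0 then boundaries A 0 j <+>\<^bsub>tor_chains A 0\<^esub>
        ({tor_rels A 0 +>\<^bsub>free_space (tensor_lists A 3)\<^esub> Poly_Mapping.single [s, \<one>\<^bsub>A\<^esub>, \<one>\<^bsub>A\<^esub>] 1 | s.
            s \<in> homog A 0} \<inter> tor_chains_homog A 0 j)
      else boundaries A n j)"

definition reduced_HH ::
    "(complex, 'a, 'm) graded_algebra_scheme \<Rightarrow> nat \<Rightarrow> int
      \<Rightarrow> (complex, ('a list \<Rightarrow>\<^sub>0 complex) set set) module" where
  "reduced_HH A n j = quotient (cycles A n j) (reduced_boundaries A n j)"

text \<open>
  The Connes operator \<open>B = (1 - t) s N\<close> on \<open>A\<^bsup>\<otimes>(n+1)\<^esup>\<close>, where \<open>t\<close> is the signed cyclic permutation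
  \<open>t(a\<^sub>0, \<dots>, a\<^sub>n) = (-1)\<^sup>n (a\<^sub>n, a\<^sub>0, \<dots>, a\<^bsub>n-1\<^esub>)\<close>, \<open>N = 1 + t + \<dots> + t\<^sup>n\<close> and \<open>s(a\<^sub>0, \<dots>, a\<^sub>n) = (1, a\<^sub>0, \<dots>, a\<^sub>n)\<close>.
\<close>

definition cyclic_t :: "('a list \<Rightarrow>\<^sub>0 complex) \<Rightarrow> ('a list \<Rightarrow>\<^sub>0 complex)" where
  "cyclic_t = lin_ext (\<lambda>xs. Poly_Mapping.single (last xs # butlast xs) ((-1) ^ (length xs - 1)))"

definition connes_list :: "(complex, 'a, 'm) module_scheme \<Rightarrow> 'a list \<Rightarrow> ('a list \<Rightarrow>\<^sub>0 complex)" where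
  "connes_list A xs =
     (let N = (\<Sum>i < length xs. (cyclic_t ^^ i) (Poly_Mapping.single xs 1));
          sN = lin_ext (\<lambda>ys. Poly_Mapping.single (\<one>\<^bsub>A\<^esub> # ys) 1) N
      in sN - cyclic_t sN)"

text \<open>
  \<open>B\<close> is transported along the isomorphism of complexes from \<open>A \<otimes> Bar\<^sub>n\<close> over \<open>A\<^sup>e\<close> to \<open>A\<^bsup>\<otimes>(n+1)\<^esup>\<close> that maps
  \<open>a \<otimes> (x\<^sub>0 \<otimes> \<dots> \<otimes> x\<^bsub>n+1\<^esub>)\<close> to \<open>x\<^bsub>n+1\<^esub> a x\<^sub>0 \<otimes> x\<^sub>1 \<otimes> \<dots> \<otimes> x\<^sub>n\<close>; its inverse maps \<open>a\<^sub>0 \<otimes> \<dots> \<otimes> a\<^sub>n\<close> to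
  \<open>a\<^sub>0 \<otimes> (1 \<otimes> a\<^sub>1 \<otimes> \<dots> \<otimes> a\<^sub>n \<otimes> 1)\<close>.
\<close>

definition to_hochschild :: "(complex, 'a, 'm) module_scheme \<Rightarrow> 'a list \<Rightarrow> 'a list" where
  "to_hochschild A l = (let a = hd l; xs = tl l in
     (last xs \<otimes>\<^bsub>A\<^esub> a \<otimes>\<^bsub>A\<^esub> hd xs) # butlast (tl xs))"

definition of_hochschild :: "(complex, 'a, 'm) module_scheme \<Rightarrow> 'a list \<Rightarrow> 'a list" where
  "of_hochschild A xs = hd xs # \<one>\<^bsub>A\<^esub> # tl xs @ [\<one>\<^bsub>A\<^esub>]"

definition connes_chains ::
    "(complex, 'a, 'm) module_scheme \<Rightarrow> nat \<Rightarrow> ('a list \<Rightarrow>\<^sub>0 complex) set \<Rightarrow> ('a list \<Rightarrow>\<^sub>0 complex) set" where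
  "connes_chains A n = induced (free_space (tensor_lists A (Suc n + 3))) (tor_rels A (Suc n))
     (lin_ext (\<lambda>l. lin_ext (\<lambda>ys. Poly_Mapping.single (of_hochschild A ys) 1)
        (connes_list A (to_hochschild A l))))"

definition connes ::
    "(complex, 'a, 'm) graded_algebra_scheme \<Rightarrow> nat \<Rightarrow> int
      \<Rightarrow> ('a list \<Rightarrow>\<^sub>0 complex) set set \<Rightarrow> ('a list \<Rightarrow>\<^sub>0 complex) set set" where
  "connes A n j = induced (cycles A (Suc n) j) (reduced_boundaries A (Suc n) j) (connes_chains A n)"

definition reduced_HC ::
    "(complex, 'a, 'm) graded_algebra_scheme \<Rightarrow> nat \<Rightarrow> int
      \<Rightarrow> (complex, ('a list \<Rightarrow>\<^sub>0 complex) set set) module" where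
  "reduced_HC A n j = (reduced_HH A (Suc n) j)\<lparr>carrier :=
     {X \<in> carrier (reduced_HH A (Suc n) j).
        connes A (Suc n) j X = \<zero>\<^bsub>reduced_HH A (Suc (Suc n)) j\<^esub>}\<rparr>"

text \<open>
  \<open>HC\<^sub>0(A) = A/[A, A] = HH\<^sub>0(A)\<close>. The isomorphism of \<open>HC\<^sub>0(A)/S\<close> with \<open>reduced_HC A 0\<close> is given by \<open>B\<close>.
\<close>

definition HC ::
    "(complex, 'a, 'm) graded_algebra_scheme \<Rightarrow> nat \<Rightarrow> int
      \<Rightarrow> (complex, ('a list \<Rightarrow>\<^sub>0 complex) set set) module" where
  "HC A n = (if n = 0 then HH A 0 else reduced_HC A n)"

end

theory Submission imports Defs begin

text \<open>
  The cell system equations and the Perron-Frobenius equation force all cells to be nonzero, so after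
  rescaling the arrows into the corners the algebra has a basis in which products of basis elements
  are basis elements or zero. Its bimodule resolution is periodic of period 12 with explicit
  generators, and a contracting homotopy of it compares the Hochschild complex, by homological
  perturbation, with the complex of closed generators, which a second perturbation reduces to its
  homology. The Connes operator need not be computed: by Goodwillie's formula
  \<open>e B + B e = deg\<close> up to homotopy, the Connes differential is injective from any degree whose
  predecessor is exact, and the dimensions of the cyclic homology follow.
\<close>


section \<open>Linear extension\<close>

text \<open>Tor is defined by the unnormalised bar complex over the ground field, on free spaces
  over all lists of algebra elements, so the periodic resolution has to be tied to it by explicit
  maps. The bridge is a double complex: bar chains with coefficients in each term of the resolution.
  The contraction of the resolution collapses it in one direction onto the Hochschild chains of A;
  in the other direction each term is projective, and only closed generators remain. The period 12
  is 4 times the order 3 of the Nakayama automorphism, and a block of four terms raises the internal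
  degree by 1 + 1 + 1 + 2 = 5, whence the shift 15. For cyclic homology no rank of a Connes map has
  to be found: in a fixed positive internal degree the homology occupies at most two adjacent
  homological degrees, 2m and 2m + 1. So a Connes map from HH of index n + 1 to HH of index n + 2
  either has target zero, or HH of index n is zero and the map is injective.\<close>

abbreviation sg :: "'b \<Rightarrow> ('b \<Rightarrow>\<^sub>0 complex)" where
  "sg b \<equiv> Poly_Mapping.single b 1"

lemma fscale_single [simp]: "fscale c (Poly_Mapping.single b a) = Poly_Mapping.single b (c * a)"
  by (rule poly_mapping_eqI) (simp add: lookup_single when_def)

lemma keys_fscale: "Poly_Mapping.keys (fscale c x) \<subseteq> Poly_Mapping.keys x"
  by (auto simp: in_keys_iff)

text \<open>Different vectors have different keys; a common finite superset makes the sums over them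
  comparable.\<close>

lemma lin_ext_superset:
  assumes "finite S" "Poly_Mapping.keys x \<subseteq> S"
  shows "lin_ext g x = (\<Sum>b\<in>S. fscale (Poly_Mapping.lookup x b) (g b))"
  unfolding lin_ext_def by (rule sum.mono_neutral_left) (use assms in \<open>auto simp: in_keys_iff\<close>)

lemma lin_ext_add: "lin_ext g (x + y) = lin_ext g x + lin_ext g y"
proof -
  let ?S = "Poly_Mapping.keys x \<union> Poly_Mapping.keys y"
  have *: "Poly_Mapping.keys (x + y) \<subseteq> ?S" by (rule Poly_Mapping.keys_add)
  show ?thesis
    using * by (simp add: lin_ext_superset[of ?S] lookup_add fvs.scale_left_distrib sum.distrib)
qed

lemma lin_ext_scale: "lin_ext g (fscale c x) = fscale c (lin_ext g x)"
  using keys_fscale[of c x]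
  by (simp add: lin_ext_superset[of "Poly_Mapping.keys x"] fvs.scale_sum_right)

lemma lin_ext_single [simp]: "lin_ext g (Poly_Mapping.single b c) = fscale c (g b)"
  by (simp add: lin_ext_superset[of "{b}"] lookup_single)

lemma lin_ext_zero [simp]: "lin_ext g 0 = 0"
  by (simp add: lin_ext_def)

lemma lin_ext_uminus: "lin_ext g (- x) = - lin_ext g x"
  using lin_ext_add[of g x "- x"] by (simp add: eq_neg_iff_add_eq_0 add.commute)

lemma lin_ext_diff: "lin_ext g (x - y) = lin_ext g x - lin_ext g y"
  using lin_ext_add[of g x "- y"] by (simp add: lin_ext_uminus)

lemma lin_ext_sum: "lin_ext g (\<Sum>i\<in>I. f i) = (\<Sum>i\<in>I. lin_ext g (f i))"
  by (induction I rule: infinite_finite_induct) (auto simp: lin_ext_add)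

lemmas lin_ext_linear = lin_ext_add lin_ext_scale lin_ext_uminus lin_ext_diff lin_ext_sum

lemma lin_ext_cong:
  assumes "\<And>b. b \<in> Poly_Mapping.keys x \<Longrightarrow> f b = g b"
  shows "lin_ext f x = lin_ext g x"
  unfolding lin_ext_def using assms by (intro sum.cong) auto

lemma lin_ext_comp: "lin_ext f (lin_ext g x) = lin_ext (\<lambda>b. lin_ext f (g b)) x"
  unfolding lin_ext_def[of g] lin_ext_def[of "\<lambda>b. lin_ext f (g b)"]
  by (simp add: lin_ext_sum lin_ext_scale)

lemma lin_ext_sg [simp]: "lin_ext sg x = x"
proof -
  have "lin_ext sg x = (\<Sum>b\<in>Poly_Mapping.keys x. Poly_Mapping.single b (Poly_Mapping.lookup x b))"
    unfolding lin_ext_def by simp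
  then show ?thesis 
    by (simp add: poly_mapping_eqI lookup_sum lookup_single when_def in_keys_iff sum.delta)
qed

lemma lin_ext_fun_add: "lin_ext (\<lambda>b. f b + g b) x = lin_ext f x + lin_ext g x"
  unfolding lin_ext_def by (simp add: fvs.scale_right_distrib sum.distrib)

lemma lin_ext_fun_diff: "lin_ext (\<lambda>b. f b - g b) x = lin_ext f x - lin_ext g x"
  unfolding lin_ext_def by (simp add: fvs.scale_right_diff_distrib sum_subtractf)

lemma lin_ext_fun_zero [simp]: "lin_ext (\<lambda>b. 0) x = 0"
  unfolding lin_ext_def by simp

lemma lin_ext_fun_scale: "lin_ext (\<lambda>b. fscale c (f b)) x = fscale c (lin_ext f x)"
  unfolding lin_ext_def by (simp add: fvs.scale_sum_right mult.commute)

lemma lin_ext_fun_uminus: "lin_ext (\<lambda>b. - f b) x = - lin_ext f x"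
  using lin_ext_fun_diff[of "\<lambda>b. 0" f x] by simp

lemma lin_ext_fun_sum: "lin_ext (\<lambda>b. \<Sum>i\<in>I. f i b) x = (\<Sum>i\<in>I. lin_ext (f i) x)"
  by (induction I rule: infinite_finite_induct) (auto simp: lin_ext_fun_add)

definition lin :: "(('b \<Rightarrow>\<^sub>0 complex) \<Rightarrow> ('c \<Rightarrow>\<^sub>0 complex)) \<Rightarrow> bool" where
  "lin f \<longleftrightarrow> (\<forall>x y. f (x + y) = f x + f y) \<and> (\<forall>c x. f (fscale c x) = fscale c (f x))"

lemma lin_add: "lin f \<Longrightarrow> f (x + y) = f x + f y"
  and lin_scale: "lin f \<Longrightarrow> f (fscale c x) = fscale c (f x)"
  by (auto simp: lin_def)

lemma lin_0: "lin f \<Longrightarrow> f 0 = 0"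
  using lin_scale[of f 0 0] by simp

lemma lin_uminus: "lin f \<Longrightarrow> f (- x) = - f x"
  using lin_add[of f x "- x"] lin_0[of f] by (simp add: eq_neg_iff_add_eq_0 add.commute)

lemma lin_diff: "lin f \<Longrightarrow> f (x - y) = f x - f y"
  using lin_add[of f x "- y"] by (simp add: lin_uminus)

lemma lin_lin_ext [simp]: "lin (lin_ext f)"
  by (simp add: lin_def lin_ext_linear)

lemma lin_sum: "lin f \<Longrightarrow> f (\<Sum>i\<in>I. g i) = (\<Sum>i\<in>I. f (g i))"
  by (induction I rule: infinite_finite_induct) (auto simp: lin_add lin_0)

lemma lin_eq_lin_ext: "lin f \<Longrightarrow> f x = lin_ext (\<lambda>b. f (sg b)) x"
proof -
  assume f: "lin f"
  have "f x = f (lin_ext sg x)" by simp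
  also have "\<dots> = lin_ext (\<lambda>b. f (sg b)) x"
    unfolding lin_ext_def lin_sum[OF f] by (intro sum.cong) (auto simp: lin_scale[OF f, symmetric])
  finally show ?thesis .
qed

lemma lin_comp: "lin f \<Longrightarrow> lin g \<Longrightarrow> lin (\<lambda>x. f (g x))"
  by (auto simp: lin_def)

lemma lin_plus: "lin f \<Longrightarrow> lin g \<Longrightarrow> lin (\<lambda>x. f x + g x)"
  by (simp add: lin_def fvs.scale_right_distrib ac_simps)

lemma lin_minus: "lin f \<Longrightarrow> lin g \<Longrightarrow> lin (\<lambda>x. f x - g x)"
  by (simp add: lin_def fvs.scale_right_diff_distrib)

lemma lin_neg: "lin f \<Longrightarrow> lin (\<lambda>x. - f x)"
  by (simp add: lin_def)

lemma lin_fscale: "lin f \<Longrightarrow> lin (\<lambda>x. fscale c (f x))"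
  by (simp add: lin_def fvs.scale_right_distrib mult.commute)

lemma lin_id: "lin (\<lambda>x. x)" and lin_const0: "lin (\<lambda>x. 0)"
  by (auto simp: lin_def)

lemma lin_sumI: "(\<And>i. i \<in> I \<Longrightarrow> lin (f i)) \<Longrightarrow> lin (\<lambda>x. \<Sum>i\<in>I. f i x)"
proof (induction I rule: infinite_finite_induct)
  case (insert i I)
  have "lin (f i)" using insert.prems by blast
  moreover have "lin (\<lambda>x. \<Sum>i\<in>I. f i x)" by (intro insert.IH insert.prems) blast
  ultimately have "lin (\<lambda>x. f i x + (\<Sum>i\<in>I. f i x))" by (rule lin_plus)
  then show ?case using insert by simp
qed (auto simp: lin_const0)


lemma subspace_lin_image:
  assumes f: "lin f" and S: "fvs.subspace S"
  shows "fvs.subspace (f ` S)"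
  unfolding fvs.subspace_def
proof (intro conjI ballI allI)
  show "0 \<in> f ` S" by (rule image_eqI[of _ f 0]) (simp_all add: lin_0 f fvs.subspace_0 S)
next
  fix x y assume "x \<in> f ` S" "y \<in> f ` S"
  then obtain a b where "a \<in> S" "b \<in> S" "x = f a" "y = f b" by (elim imageE)
  then show "x + y \<in> f ` S"
    by (intro image_eqI[of _ f "a + b"]) (simp_all add: lin_add f fvs.subspace_add S)
next
  fix c x assume "x \<in> f ` S"
  then obtain a where "a \<in> S" "x = f a" by (elim imageE)
  then show "fscale c x \<in> f ` S"
    by (intro image_eqI[of _ f "fscale c a"]) (simp_all add: lin_scale f fvs.subspace_scale S)
qed

lemma span_lin_ext: "fvs.subspace S \<Longrightarrow> (\<And>b. b \<in> Poly_Mapping.keys v \<Longrightarrow> h b \<in> S) \<Longrightarrow> lin_ext h v \<in> S"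
  unfolding lin_ext_def by (intro fvs.subspace_sum fvs.subspace_scale)

text \<open>The carrier of \<open>free_space X\<close> as a bare set, so that subspaces can be
  handled without module records.\<close>

definition fsp :: "'b set \<Rightarrow> ('b \<Rightarrow>\<^sub>0 complex) set" where
  "fsp X = {x. Poly_Mapping.keys x \<subseteq> X}"

lemma fsp_UNIV [simp]: "fsp UNIV = UNIV"
  by (simp add: fsp_def)

lemma fsp_0 [simp]: "0 \<in> fsp X"
  and fsp_single: "b \<in> X \<Longrightarrow> Poly_Mapping.single b c \<in> fsp X"
  by (auto simp: fsp_def)

lemma fsp_empty [simp]: "fsp {} = {0}"
  by (auto simp: fsp_def)

lemma fsp_add: "x \<in> fsp X \<Longrightarrow> y \<in> fsp X \<Longrightarrow> x + y \<in> fsp X"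
  unfolding fsp_def using Poly_Mapping.keys_add[of x y] by blast

lemma fsp_scale: "x \<in> fsp X \<Longrightarrow> fscale c x \<in> fsp X"
  unfolding fsp_def using keys_fscale[of c x] by blast

lemma fsp_uminus: "x \<in> fsp X \<Longrightarrow> - x \<in> fsp X"
  by (simp add: fsp_def)

lemma fsp_diff: "x \<in> fsp X \<Longrightarrow> y \<in> fsp X \<Longrightarrow> x - y \<in> fsp X"
  using fsp_add[OF _ fsp_uminus] by fastforce

lemma fsp_sum: "(\<And>i. i \<in> I \<Longrightarrow> f i \<in> fsp X) \<Longrightarrow> (\<Sum>i\<in>I. f i) \<in> fsp X"
  by (induction I rule: infinite_finite_induct) (auto intro: fsp_add)

lemma fsp_lin_ext:
  assumes "x \<in> fsp X" "\<And>b. b \<in> X \<Longrightarrow> g b \<in> fsp Y"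
  shows "lin_ext g x \<in> fsp Y"
  unfolding lin_ext_def using assms by (auto simp: fsp_def[of X] intro!: fsp_sum fsp_scale)

lemma fsp_lin:
  assumes "lin f" "x \<in> fsp X" "\<And>b. b \<in> X \<Longrightarrow> f (sg b) \<in> fsp Y"
  shows "f x \<in> fsp Y"
  using fsp_lin_ext[of x X "\<lambda>b. f (sg b)" Y] assms by (simp add: lin_eq_lin_ext[symmetric])

lemma lin_ext_eqI:
  assumes "x \<in> fsp X" "\<And>b. b \<in> X \<Longrightarrow> f b = g b"
  shows "lin_ext f x = lin_ext g x"
  using assms by (intro lin_ext_cong) (auto simp: fsp_def)

lemma lin_eqI:
  assumes "lin f" "lin g" "x \<in> fsp X" "\<And>b. b \<in> X \<Longrightarrow> f (sg b) = g (sg b)"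
  shows "f x = g x"
  using lin_ext_eqI[OF assms(3), of "\<lambda>b. f (sg b)" "\<lambda>b. g (sg b)"] assms
  by (simp add: lin_eq_lin_ext[symmetric])

lemma fsp_eq_span: "fsp X = fvs.span (sg ` X)"
proof
  show "fsp X \<subseteq> fvs.span (sg ` X)"
  proof
    fix x assume "x \<in> fsp X"
    then have "lin_ext sg x \<in> fvs.span (sg ` X)"
      unfolding lin_ext_def fsp_def by (intro fvs.span_sum fvs.span_scale fvs.span_base) auto
    then show "x \<in> fvs.span (sg ` X)" by simp
  qed
  show "fvs.span (sg ` X) \<subseteq> fsp X"
    by (rule fvs.span_minimal)
      (auto simp: fvs.subspace_def intro: fsp_single fsp_add fsp_scale)
qed


section \<open>Dimension of a homology space\<close>

text \<open>Encodes dim Z/N = k without forming the quotient: \<open>f\<close> induces an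
  isomorphism of Z/N with the space of k-tuples. Its values are extensional functions so that they
  can be elements of a carrier.\<close>

definition quot_dim :: "('b \<Rightarrow>\<^sub>0 complex) set \<Rightarrow> ('b \<Rightarrow>\<^sub>0 complex) set \<Rightarrow> nat \<Rightarrow> bool" where
  "quot_dim Z N k \<longleftrightarrow> (\<exists>f :: ('b \<Rightarrow>\<^sub>0 complex) \<Rightarrow> nat \<Rightarrow> complex.
     (\<forall>x\<in>Z. \<forall>y\<in>Z. f (x + y) = (\<lambda>i\<in>{..<k}. f x i + f y i)) \<and>
     (\<forall>c. \<forall>x\<in>Z. f (fscale c x) = (\<lambda>i\<in>{..<k}. c * f x i)) \<and>
     f ` Z = ({..<k} \<rightarrow>\<^sub>E UNIV) \<and> (\<forall>x\<in>Z. f x = (\<lambda>i\<in>{..<k}. 0) \<longleftrightarrow> x \<in> N))"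

lemma quot_dimI:
  assumes "\<And>x y. x \<in> Z \<Longrightarrow> y \<in> Z \<Longrightarrow> f (x + y) = (\<lambda>i\<in>{..<k}. f x i + f y i)"
    and "\<And>c x. x \<in> Z \<Longrightarrow> f (fscale c x) = (\<lambda>i\<in>{..<k}. c * f x i)"
    and "f ` Z = ({..<k} \<rightarrow>\<^sub>E UNIV)" and "\<And>x. x \<in> Z \<Longrightarrow> f x = (\<lambda>i\<in>{..<k}. 0) \<longleftrightarrow> x \<in> N"
  shows "quot_dim Z N k"
  unfolding quot_dim_def by (rule exI[of _ f]) (intro conjI ballI allI assms)

lemma quot_dimE:
  assumes "quot_dim Z N k"
  obtains f where "\<And>x y. x \<in> Z \<Longrightarrow> y \<in> Z \<Longrightarrow> f (x + y) = (\<lambda>i\<in>{..<k}. f x i + f y i)"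
    and "\<And>c x. x \<in> Z \<Longrightarrow> f (fscale c x) = (\<lambda>i\<in>{..<k}. c * f x i)"
    and "f ` Z = ({..<k} \<rightarrow>\<^sub>E UNIV)" and "\<And>x. x \<in> Z \<Longrightarrow> f x = (\<lambda>i\<in>{..<k}. 0) \<longleftrightarrow> x \<in> N"
proof -
  show thesis using assms unfolding quot_dim_def
  proof (elim exE conjE)
    fix f :: "('a \<Rightarrow>\<^sub>0 complex) \<Rightarrow> nat \<Rightarrow> complex"
    assume 1: "\<forall>x\<in>Z. \<forall>y\<in>Z. f (x + y) = (\<lambda>i\<in>{..<k}. f x i + f y i)"
      and 2: "\<forall>c. \<forall>x\<in>Z. f (fscale c x) = (\<lambda>i\<in>{..<k}. c * f x i)"
      and 3: "f ` Z = ({..<k} \<rightarrow>\<^sub>E UNIV)" and 4: "\<forall>x\<in>Z. f x = (\<lambda>i\<in>{..<k}. 0) \<longleftrightarrow> x \<in> N"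
    show thesis by (rule that[OF 1[rule_format] 2[rule_format] 3 4[rule_format]])
  qed
qed

lemma quot_dim_fsp:
  assumes "finite X"
  shows "quot_dim (fsp X) {0} (card X)"
proof -
  obtain e where e: "bij_betw e {..<card X} X"
    using ex_bij_betw_nat_finite[OF assms] by (auto simp: lessThan_atLeast0)
  define f where "f x = (\<lambda>i\<in>{..<card X}. Poly_Mapping.lookup x (e i))" for x :: "'a \<Rightarrow>\<^sub>0 complex"
  have surj: "f ` fsp X = {..<card X} \<rightarrow>\<^sub>E UNIV"
  proof (intro equalityI subsetI)
    fix c :: "nat \<Rightarrow> complex" assume c: "c \<in> {..<card X} \<rightarrow>\<^sub>E UNIV"
    let ?x = "\<Sum>i<card X. Poly_Mapping.single (e i) (c i)"
    have "Poly_Mapping.lookup ?x (e i) = c i" if "i < card X" for i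
    proof -
      have "Poly_Mapping.lookup ?x (e i) = (\<Sum>j<card X. if j = i then c j else 0)"
        unfolding lookup_sum using e that
        by (intro sum.cong) (auto simp: lookup_single when_def bij_betw_def inj_on_def)
      then show ?thesis using that by simp
    qed
    then have fx: "f ?x = c" using c by (auto simp: f_def fun_eq_iff PiE_def extensional_def)
    have "?x \<in> fsp X" using e by (intro fsp_sum fsp_single) (auto simp: bij_betw_def)
    then show "c \<in> f ` fsp X" by (rule image_eqI[of c f, OF fx[symmetric]])
  qed (auto simp: f_def split: if_splits)
  have ker: "f x = (\<lambda>i\<in>{..<card X}. 0) \<longleftrightarrow> x \<in> {0}" if "x \<in> fsp X" for x
  proof
    assume *: "f x = (\<lambda>i\<in>{..<card X}. 0)"
    have "Poly_Mapping.lookup x b = 0" for b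
    proof (cases "b \<in> X")
      case True
      then obtain i where "i < card X" "b = e i" using e by (auto simp: bij_betw_def)
      then show ?thesis using fun_cong[OF *, of i] by (simp add: f_def)
    qed (use that in \<open>auto simp: fsp_def in_keys_iff\<close>)
    then show "x \<in> {0}" by (simp add: poly_mapping_eqI)
  qed (auto simp: f_def)
  show ?thesis
    by (rule quot_dimI[of "fsp X" f "card X", OF _ _ surj ker]) (auto simp: f_def lookup_add fun_eq_iff)
qed

text \<open>\<open>g\<close> induces an isomorphism of Z/N onto Z'/N'. Coordinates on Z'/N' are
  pulled back by composition, coordinates on Z/N are pushed forward by choosing preimages.\<close>

lemma quot_dim_transfer:
  fixes g :: "('b \<Rightarrow>\<^sub>0 complex) \<Rightarrow> ('c \<Rightarrow>\<^sub>0 complex)"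
  assumes g: "lin g" "g ` Z = Z'" and ker: "\<And>x. x \<in> Z \<Longrightarrow> g x \<in> N' \<longleftrightarrow> x \<in> N"
    and Z: "fvs.subspace Z" and N': "fvs.subspace N'"
  shows "quot_dim Z N k \<longleftrightarrow> quot_dim Z' N' k"
proof
  assume "quot_dim Z' N' k"
  then obtain f :: "('c \<Rightarrow>\<^sub>0 complex) \<Rightarrow> nat \<Rightarrow> complex" where f:
    "\<And>x y. x \<in> Z' \<Longrightarrow> y \<in> Z' \<Longrightarrow> f (x + y) = (\<lambda>i\<in>{..<k}. f x i + f y i)"
    "\<And>c x. x \<in> Z' \<Longrightarrow> f (fscale c x) = (\<lambda>i\<in>{..<k}. c * f x i)"
    "f ` Z' = ({..<k} \<rightarrow>\<^sub>E UNIV)" "\<And>x. x \<in> Z' \<Longrightarrow> f x = (\<lambda>i\<in>{..<k}. 0) \<longleftrightarrow> x \<in> N'"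
    by (rule quot_dimE) (rule that)
  have gZ: "g x \<in> Z'" if "x \<in> Z" for x using that g(2) by blast
  have surj: "(\<lambda>x. f (g x)) ` Z = ({..<k} \<rightarrow>\<^sub>E UNIV)"
    using f(3) g(2) by (simp add: image_image[symmetric])
  have add: "f (g (x + y)) = (\<lambda>i\<in>{..<k}. f (g x) i + f (g y) i)" if "x \<in> Z" "y \<in> Z" for x y
    using f(1)[OF gZ gZ] that by (simp add: lin_add[OF g(1)])
  have scale: "f (g (fscale c x)) = (\<lambda>i\<in>{..<k}. c * f (g x) i)" if "x \<in> Z" for c x
    using f(2)[OF gZ] that by (simp add: lin_scale[OF g(1)])
  have ker': "f (g x) = (\<lambda>i\<in>{..<k}. 0) \<longleftrightarrow> x \<in> N" if "x \<in> Z" for x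
    using f(4)[OF gZ] ker that by blast
  show "quot_dim Z N k" by (rule quot_dimI[of Z "\<lambda>x. f (g x)" k N, OF add scale surj ker'])
next
  assume "quot_dim Z N k"
  then obtain f :: "('b \<Rightarrow>\<^sub>0 complex) \<Rightarrow> nat \<Rightarrow> complex" where f:
    "\<And>x y. x \<in> Z \<Longrightarrow> y \<in> Z \<Longrightarrow> f (x + y) = (\<lambda>i\<in>{..<k}. f x i + f y i)"
    "\<And>c x. x \<in> Z \<Longrightarrow> f (fscale c x) = (\<lambda>i\<in>{..<k}. c * f x i)"
    "f ` Z = ({..<k} \<rightarrow>\<^sub>E UNIV)" "\<And>x. x \<in> Z \<Longrightarrow> f x = (\<lambda>i\<in>{..<k}. 0) \<longleftrightarrow> x \<in> N"
    by (rule quot_dimE) (rule that)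
  \<comment> \<open>A section of \<open>g\<close> that need not be linear: the fact
    \<open>eq\<close> shows that \<open>f\<close> is constant on the fibres of
    \<open>g\<close>.\<close>
  define r where "r y = (SOME x. x \<in> Z \<and> g x = y)" for y
  have r: "r y \<in> Z" "g (r y) = y" if "y \<in> Z'" for y
    using someI_ex[of "\<lambda>x. x \<in> Z \<and> g x = y"] that g(2) unfolding r_def by blast+
  have Zd: "x - y \<in> Z" if "x \<in> Z" "y \<in> Z" for x y using that Z by (simp add: fvs.subspace_diff)
  have ext: "f x \<in> {..<k} \<rightarrow>\<^sub>E UNIV" if "x \<in> Z" for x using f(3) that by blast
  have eq: "f x = f y" if "x \<in> Z" "y \<in> Z" "g x = g y" for x y
  proof -
    have "g (x - y) \<in> N'" using that g(1) N' by (simp add: lin_diff fvs.subspace_0)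
    then have "x - y \<in> N" using ker Zd that by blast
    then have "f (x - y) = (\<lambda>i\<in>{..<k}. 0)" using f(4) Zd that by blast
    then have "f (y + (x - y)) = (\<lambda>i\<in>{..<k}. f y i)"
      by (subst f(1)) (use that Zd in \<open>auto simp: fun_eq_iff\<close>)
    then show ?thesis using ext[OF that(2)] by (auto simp: fun_eq_iff PiE_def extensional_def)
  qed
  let ?f = "\<lambda>y. f (r y)"
  have add: "?f (x + y) = (\<lambda>i\<in>{..<k}. ?f x i + ?f y i)" if "x \<in> Z'" "y \<in> Z'" for x y
  proof -
    have xy: "g (r x + r y) = x + y" "r x + r y \<in> Z"
      using r that g(1) Z by (auto simp: lin_add fvs.subspace_add)
    then have "x + y \<in> Z'" using g(2) by (metis imageI)
    then have "f (r (x + y)) = f (r x + r y)" using xy r by (intro eq) auto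
    then show ?thesis using f(1) r that by simp
  qed
  have scale: "?f (fscale c x) = (\<lambda>i\<in>{..<k}. c * ?f x i)" if "x \<in> Z'" for x c
  proof -
    have xy: "g (fscale c (r x)) = fscale c x" "fscale c (r x) \<in> Z"
      using r that g(1) Z by (auto simp: lin_scale fvs.subspace_scale)
    then have "fscale c x \<in> Z'" using g(2) by (metis imageI)
    then have "f (r (fscale c x)) = f (fscale c (r x))" using xy r by (intro eq) auto
    then show ?thesis using f(2) r that by simp
  qed
  have "?f ` Z' = f ` Z"
  proof (intro equalityI subsetI)
    fix c assume "c \<in> f ` Z"
    then obtain x where x: "x \<in> Z" "c = f x" by blast
    then have "g x \<in> Z'" using g(2) by blast
    moreover have "f (r (g x)) = f x" using x r calculation by (intro eq) auto
    ultimately show "c \<in> ?f ` Z'" using x by force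
  qed (use r in auto)
  then have surj: "?f ` Z' = {..<k} \<rightarrow>\<^sub>E UNIV" using f(3) by simp
  have ker': "?f y = (\<lambda>i\<in>{..<k}. 0) \<longleftrightarrow> y \<in> N'" if "y \<in> Z'" for y
    using f(4)[OF r(1)[OF that]] ker[OF r(1)[OF that]] r(2)[OF that] by simp
  show "quot_dim Z' N' k" by (rule quot_dimI[of Z' ?f k N', OF add scale surj ker'])
qed


section \<open>A perturbation lemma\<close>

text \<open>
  \<open>s\<close> contracts the complex \<open>(T, \<beta>)\<close> onto \<open>K\<close>, up to the perturbation \<open>\<delta>\<close>, and \<open>s\<delta> + \<delta>s\<close> is
  nilpotent by the filtration \<open>F\<close>. Then \<open>(T, \<beta> + \<delta>)\<close> and \<open>(K, \<pi>\<delta>\<sigma>)\<close> have the same homology.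
\<close>

locale perturbed_contraction =
  fixes T :: "nat \<Rightarrow> ('t \<Rightarrow>\<^sub>0 complex) set" and K :: "nat \<Rightarrow> ('k \<Rightarrow>\<^sub>0 complex) set"
    and \<beta> \<delta> s :: "('t \<Rightarrow>\<^sub>0 complex) \<Rightarrow> ('t \<Rightarrow>\<^sub>0 complex)"
    and \<sigma> :: "('k \<Rightarrow>\<^sub>0 complex) \<Rightarrow> ('t \<Rightarrow>\<^sub>0 complex)" and \<pi> :: "('t \<Rightarrow>\<^sub>0 complex) \<Rightarrow> ('k \<Rightarrow>\<^sub>0 complex)"
    and F :: "nat \<Rightarrow> ('t \<Rightarrow>\<^sub>0 complex) set"
  assumes lins: "lin \<beta>" "lin \<delta>" "lin s" "lin \<sigma>" "lin \<pi>"
    and T: "\<And>n. fvs.subspace (T n)" and K: "\<And>n. fvs.subspace (K n)"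
    and F: "\<And>m. fvs.subspace (F m)"
    and \<beta>T: "\<And>n z. z \<in> T n \<Longrightarrow> \<beta> z \<in> T (n - 1)" and \<delta>T: "\<And>n z. z \<in> T n \<Longrightarrow> \<delta> z \<in> T (n - 1)"
    and sT: "\<And>n z. z \<in> T n \<Longrightarrow> s z \<in> T (Suc n)" and \<sigma>T: "\<And>n k. k \<in> K n \<Longrightarrow> \<sigma> k \<in> T n"
    and \<pi>K: "\<And>n z. z \<in> T n \<Longrightarrow> \<pi> z \<in> K n"
    and T0: "\<And>z. z \<in> T 0 \<Longrightarrow> \<beta> z + \<delta> z = 0"
    and \<beta>\<beta>: "\<And>n z. z \<in> T n \<Longrightarrow> \<beta> (\<beta> z) = 0" and \<delta>\<delta>: "\<And>n z. z \<in> T n \<Longrightarrow> \<delta> (\<delta> z) = 0"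
    and \<beta>\<delta>: "\<And>n z. z \<in> T n \<Longrightarrow> \<beta> (\<delta> z) + \<delta> (\<beta> z) = 0"
    and s: "\<And>n z. z \<in> T n \<Longrightarrow> \<beta> (s z) + s (\<beta> z) = z - \<sigma> (\<pi> z)"
    and \<pi>\<beta>: "\<And>n z. z \<in> T n \<Longrightarrow> \<pi> (\<beta> z) = 0" and \<pi>s: "\<And>n z. z \<in> T n \<Longrightarrow> \<pi> (s z) = 0"
    and \<pi>\<delta>s: "\<And>n z. z \<in> T n \<Longrightarrow> \<pi> (\<delta> (s z)) = 0"
    and \<pi>\<sigma>: "\<And>n k. k \<in> K n \<Longrightarrow> \<pi> (\<sigma> k) = k"
    and F0: "F 0 \<subseteq> {0}" and TF: "\<And>n z. z \<in> T n \<Longrightarrow> z \<in> F (Suc n)"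
    and FS: "\<And>n m z. z \<in> T n \<Longrightarrow> z \<in> F (Suc m) \<Longrightarrow> s (\<delta> z) + \<delta> (s z) \<in> F m"
begin

definition D where "D z = \<beta> z + \<delta> z"
definition dK where "dK k = \<pi> (\<delta> (\<sigma> k))"
definition "ZT n = {z \<in> T n. D z = 0}"
definition "ZK n = {k \<in> K n. dK k = 0}"

lemma lin_D: "lin D"
  unfolding D_def by (rule lin_plus[OF lins(1,2)])

lemma lin_dK: "lin dK"
  unfolding dK_def by (rule lin_comp[OF lins(5) lin_comp[OF lins(2,4)]])

lemma D_T: "z \<in> T (Suc n) \<Longrightarrow> D z \<in> T n"
  using \<beta>T[of z "Suc n"] \<delta>T[of z "Suc n"] T by (simp add: fvs.subspace_add D_def)

lemma DD: "z \<in> T n \<Longrightarrow> D (D z) = 0"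
proof -
  assume z: "z \<in> T n"
  have "D (D z) = \<beta> (\<beta> z) + \<delta> (\<delta> z) + (\<beta> (\<delta> z) + \<delta> (\<beta> z))"
    by (simp add: lin_add lins D_def ac_simps)
  then show ?thesis by (simp only: \<beta>\<beta>[OF z] \<delta>\<delta>[OF z] \<beta>\<delta>[OF z] add_0)
qed

text \<open>\<pi> is a chain map although \<sigma> need not be one. Apply \<pi>\<delta> to the
  contraction identity: \<pi>\<delta>s is zero, and \<delta>\<beta>s = - \<beta>\<delta>s is killed
  because \<pi>\<beta> = 0.\<close>

lemma \<pi>D:
  assumes z: "z \<in> T n"
  shows "\<pi> (D z) = dK (\<pi> z)"
proof -
  have "\<pi> (\<delta> (\<beta> (s z) + s (\<beta> z))) = \<pi> (\<delta> (z - \<sigma> (\<pi> z)))" using s[OF z] by simp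
  moreover have "\<pi> (\<delta> (s (\<beta> z))) = 0" using \<pi>\<delta>s[OF \<beta>T[OF z]] .
  moreover have "\<pi> (\<delta> (\<beta> (s z))) = 0"
  proof -
    have "\<delta> (\<beta> (s z)) = - \<beta> (\<delta> (s z))"
      using \<beta>\<delta>[OF sT[OF z]] by (simp add: eq_neg_iff_add_eq_0 add.commute)
    then show ?thesis using \<pi>\<beta>[OF \<delta>T[OF sT[OF z]]] by (simp add: lin_uminus lins)
  qed
  ultimately show ?thesis using \<pi>\<beta>[OF z] by (simp add: lin_add lin_diff lins D_def dK_def)
qed

text \<open>Induction on the filtration. For a cycle, \<beta>z = - \<delta>z, so with \<pi>z = 0
  subtracting D(sz) leaves -(s\<delta> + \<delta>s)z, which lies one step lower.\<close>

lemma boundary_if_\<pi>_0: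
  "z \<in> T n \<Longrightarrow> z \<in> F m \<Longrightarrow> D z = 0 \<Longrightarrow> \<pi> z = 0 \<Longrightarrow> \<exists>y\<in>T (Suc n). D y = z \<and> \<pi> y = 0"
proof (induction m arbitrary: z)
  case 0
  then have "z = 0" using F0 by blast
  then show ?case using T by (intro bexI[of _ 0]) (simp_all add: lin_0 lins lin_D fvs.subspace_0)
next
  case (Suc m)
  define z' where "z' = z - D (s z)"
  have sz: "s z \<in> T (Suc n)" using sT Suc.prems by blast
  have zT: "z' \<in> T n" using D_T[OF sz] Suc.prems T by (simp add: fvs.subspace_diff z'_def)
  have "\<beta> z = - \<delta> z" using Suc.prems by (simp add: eq_neg_iff_add_eq_0 D_def)
  then have "\<beta> (s z) - s (\<delta> z) = z"
    using s[OF Suc.prems(1)] Suc.prems by (simp add: lin_0 lin_uminus lins)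
  then have "z' = - (s (\<delta> z) + \<delta> (s z))" by (simp add: algebra_simps D_def z'_def)
  then have zF: "z' \<in> F m" using fvs.subspace_neg[OF F FS[OF Suc.prems(1,2)]] by simp
  have "D z' = 0" using Suc.prems DD[OF sz] by (simp add: z'_def lin_diff lin_D)
  moreover have "\<pi> z' = 0"
    using Suc.prems \<pi>D[OF sz] \<pi>s[OF Suc.prems(1)] by (simp add: z'_def lin_diff lin_0 lins lin_dK)
  ultimately obtain y where y: "y \<in> T (Suc n)" "D y = z'" "\<pi> y = 0"
    using Suc.IH[OF zT zF] by blast
  then have "D (s z + y) = z" "\<pi> (s z + y) = 0"
    using \<pi>s[OF Suc.prems(1)] by (simp_all add: z'_def lin_add lin_D lins)
  moreover have "s z + y \<in> T (Suc n)" using sz y T by (simp add: fvs.subspace_add)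
  ultimately show ?case by blast
qed

lemma subspace_ZT: "fvs.subspace (ZT n)"
  unfolding fvs.subspace_def ZT_def using T[of n]
  by (simp add: fvs.subspace_def lin_add lin_scale lin_0 lin_D)

text \<open>Injectivity of \<pi> on homology: if \<pi>z is the boundary of k, then z - D(\<sigma>k)
  is a cycle killed by \<pi>.\<close>

lemma \<pi>_boundary_iff:
  assumes z: "z \<in> ZT n"
  shows "\<pi> z \<in> dK ` K (Suc n) \<longleftrightarrow> z \<in> D ` T (Suc n)"
proof
  have zT: "z \<in> T n" "D z = 0" using z by (simp_all add: ZT_def)
  assume "\<pi> z \<in> dK ` K (Suc n)"
  then obtain k where k: "k \<in> K (Suc n)" "\<pi> z = dK k" by blast
  have \<sigma>k: "\<sigma> k \<in> T (Suc n)" using \<sigma>T k by blast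
  have "z - D (\<sigma> k) \<in> T n" using D_T[OF \<sigma>k] zT T by (simp add: fvs.subspace_diff)
  moreover have "D (z - D (\<sigma> k)) = 0" using zT DD[OF \<sigma>k] by (simp add: lin_diff lin_D)
  moreover have "\<pi> (z - D (\<sigma> k)) = 0" using k \<pi>D[OF \<sigma>k] by (simp add: lin_diff lins \<pi>\<sigma>[OF k(1)])
  ultimately obtain y where y: "y \<in> T (Suc n)" "D y = z - D (\<sigma> k)"
    using boundary_if_\<pi>_0 TF by blast
  then have "z = D (\<sigma> k + y)" by (simp add: lin_add lin_D)
  then show "z \<in> D ` T (Suc n)" using fvs.subspace_add[OF T \<sigma>k y(1)] by blast
next
  assume "z \<in> D ` T (Suc n)"
  then show "\<pi> z \<in> dK ` K (Suc n)" using \<pi>D \<pi>K by fastforce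
qed

text \<open>Surjectivity of \<pi> on cycles: \<sigma>k need not be closed, but D(\<sigma>k) is
  closed and killed by \<pi>, hence equals D y with \<pi>y = 0, and \<sigma>k - y is a cycle over
  k.\<close>

lemma \<pi>_image: "\<pi> ` ZT n = ZK n"
proof (intro equalityI subsetI)
  fix k assume "k \<in> \<pi> ` ZT n"
  then obtain z where z: "z \<in> T n" "D z = 0" "k = \<pi> z" by (auto simp: ZT_def)
  then show "k \<in> ZK n" using \<pi>D[OF z(1)] \<pi>K[OF z(1)] by (simp add: ZK_def lin_0 lins)
next
  fix k assume "k \<in> ZK n"
  then have k: "k \<in> K n" "dK k = 0" by (auto simp: ZK_def)
  have \<sigma>k: "\<sigma> k \<in> T n" using \<sigma>T k by blast
  have "\<exists>y\<in>T n. D y = D (\<sigma> k) \<and> \<pi> y = 0"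
  proof (cases n)
    case 0
    \<comment> \<open>In degree 0 the index n - 1 is again 0, so the vanishing of D has to come from
      \<open>T0\<close>.\<close>
    then have "D (\<sigma> k) = 0" using T0 \<sigma>k by (simp add: D_def)
    then show ?thesis using T by (intro bexI[of _ 0]) (simp_all add: lin_0 lins lin_D fvs.subspace_0)
  next
    case (Suc m)
    have "D (\<sigma> k) \<in> T m" "D (D (\<sigma> k)) = 0" "\<pi> (D (\<sigma> k)) = 0"
      using D_T[of "\<sigma> k" m] DD[OF \<sigma>k] \<sigma>k Suc k(2) \<pi>D[OF \<sigma>k] by (simp_all add: \<pi>\<sigma>[OF k(1)])
    then show ?thesis using boundary_if_\<pi>_0 TF Suc by blast
  qed
  then obtain y where y: "y \<in> T n" "D y = D (\<sigma> k)" "\<pi> y = 0" by blast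
  have "\<sigma> k - y \<in> ZT n"
    using y \<sigma>k T[of n] by (simp add: ZT_def fvs.subspace_diff lin_diff lin_D)
  moreover have "k = \<pi> (\<sigma> k - y)" using y \<pi>\<sigma>[OF k(1)] by (simp add: lin_diff lins)
  ultimately show "k \<in> \<pi> ` ZT n" by blast
qed

text \<open>Lets the reduced complex serve as the contracted complex of a further application of the
  locale.\<close>

lemma dK_dK: "k \<in> K n \<Longrightarrow> dK (dK k) = 0"
proof -
  assume k: "k \<in> K n"
  have "D (\<sigma> k) \<in> T (n - 1)" using \<beta>T[OF \<sigma>T[OF k]] \<delta>T[OF \<sigma>T[OF k]] T by (simp add: D_def fvs.subspace_add)
  then have "dK (\<pi> (D (\<sigma> k))) = \<pi> (D (D (\<sigma> k)))" by (simp add: \<pi>D)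
  then show ?thesis using DD[OF \<sigma>T[OF k]] \<pi>D[OF \<sigma>T[OF k]] by (simp add: \<pi>\<sigma>[OF k] lin_0 lins)
qed

theorem quot_dim_iff: "quot_dim (ZT n) (D ` T (Suc n)) k \<longleftrightarrow> quot_dim (ZK n) (dK ` K (Suc n)) k"
  by (rule quot_dim_transfer[OF lins(5) \<pi>_image \<pi>_boundary_iff subspace_ZT
        subspace_lin_image[OF lin_dK K]])

end


section \<open>Algebras with a multiplicative basis and their Hochschild chains\<close>

definition osg :: "'b option \<Rightarrow> ('b \<Rightarrow>\<^sub>0 complex)" where
  "osg x = (case x of None \<Rightarrow> 0 | Some b \<Rightarrow> sg b)"

lemma osg_simps [simp]: "osg None = 0" "osg (Some b) = sg b"
  by (simp_all add: osg_def)

definition consv :: "'b \<Rightarrow> ('b list \<Rightarrow>\<^sub>0 complex) \<Rightarrow> ('b list \<Rightarrow>\<^sub>0 complex)" where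
  "consv a = lin_ext (\<lambda>xs. sg (a # xs))"

definition snocv :: "'b \<Rightarrow> ('b list \<Rightarrow>\<^sub>0 complex) \<Rightarrow> ('b list \<Rightarrow>\<^sub>0 complex)" where
  "snocv a = lin_ext (\<lambda>xs. sg (xs @ [a]))"

text \<open>
  The product of two basis elements is a basis element or zero. The unit is the sum of the
  idempotents in \<open>E\<close>.
\<close>

locale mult_basis =
  fixes mul :: "'b \<Rightarrow> 'b \<Rightarrow> 'b option" and src tgt :: "'b \<Rightarrow> 'b" and E :: "'b set"
    and deg :: "'b \<Rightarrow> int"
  assumes assoc: "Option.bind (mul a b) (\<lambda>x. mul x c) = Option.bind (mul b c) (mul a)"
    and finite_E: "finite E" and src_E: "src a \<in> E" and tgt_E: "tgt a \<in> E"
    and mul_E_left: "e \<in> E \<Longrightarrow> mul e a = (if e = src a then Some a else None)"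
    and mul_E_right: "e \<in> E \<Longrightarrow> mul a e = (if e = tgt a then Some a else None)"
    and deg_mul: "mul a b = Some c \<Longrightarrow> deg c = deg a + deg b"
    and deg_E: "e \<in> E \<Longrightarrow> deg e = 0"
begin


text \<open>The acyclic differential b' of the bar complex, without the cyclic face; the recursion
  splits off the first face.\<close>

fun bar :: "'b list \<Rightarrow> ('b list \<Rightarrow>\<^sub>0 complex)" where
  "bar (a # c # as) = lin_ext (\<lambda>x. sg (x # as)) (osg (mul a c)) - consv a (bar (c # as))"
| "bar _ = 0"

definition headmul :: "'b \<Rightarrow> 'b list \<Rightarrow> ('b list \<Rightarrow>\<^sub>0 complex)" where
  "headmul a xs = (case xs of [] \<Rightarrow> 0 | c # as \<Rightarrow> lin_ext (\<lambda>x. sg (x # as)) (osg (mul a c)))"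

lemma bar_consv:
  assumes "v \<in> fsp {xs. xs \<noteq> []}"
  shows "lin_ext bar (consv a v) = lin_ext (headmul a) v - consv a (lin_ext bar v)"
  unfolding consv_def lin_ext_comp lin_ext_fun_diff[symmetric]
proof (rule lin_ext_eqI[OF assms])
  fix xs :: "'b list" assume "xs \<in> {xs. xs \<noteq> []}"
  then obtain c as where "xs = c # as" by (cases xs) auto
  then show "lin_ext bar (sg (a # xs)) = headmul a xs - lin_ext (\<lambda>b. sg (a # b)) (bar xs)"
    by (simp add: headmul_def consv_def)
qed

lemma bar_fsp: "bar xs \<in> fsp {ys. length ys = length xs - 1 \<and> ys \<noteq> []}"
proof (induction xs rule: bar.induct)
  case (1 a c as)
  show ?case unfolding bar.simps
    by (intro fsp_diff)
      (auto simp: consv_def osg_def split: option.splits intro!: fsp_single fsp_lin_ext[OF 1])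
qed auto

text \<open>Associativity in chain form: b' is left linear in the first slot, which is all that b'b'
  = 0 needs beyond the recursion.\<close>

lemma bar_headmul: "lin_ext (headmul a) (bar (c # as)) = lin_ext bar (headmul a (c # as))"
proof (cases as)
  case (Cons d ds)
  have *: "lin_ext (headmul a) (lin_ext (\<lambda>x. sg (x # ds)) (osg (mul c d)))
      = lin_ext (\<lambda>y. lin_ext (\<lambda>x. sg (x # ds)) (osg (mul y d))) (osg (mul a c))"
    using assoc[of a c d] by (auto simp: osg_def headmul_def split: option.splits bind_splits)
  show ?thesis
    using * by (cases "mul a c") (simp_all add: Cons headmul_def consv_def lin_ext_diff lin_ext_comp)
qed (auto simp: headmul_def osg_def split: option.splits)

lemma bar_bar: "lin_ext bar (bar xs) = 0"
proof (induction xs rule: bar.induct)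
  case (1 a c as)
  have "bar (c # as) \<in> fsp {xs. xs \<noteq> []}" using bar_fsp[of "c # as"] by (auto simp: fsp_def)
  then have "lin_ext bar (consv a (bar (c # as))) = lin_ext bar (headmul a (c # as))"
    by (simp add: bar_consv 1 bar_headmul) (simp add: consv_def)
  then show ?case by (simp add: lin_ext_diff headmul_def)
qed auto

text \<open>The recursion of \<open>bar\<close> starts at the left; this mirror image is needed
  where the last letter acts on the coefficients.\<close>

lemma bar_snoc:
  assumes "as \<noteq> []"
  shows "bar (as @ [d]) = snocv d (bar as)
    - fscale ((-1) ^ length as) (lin_ext (\<lambda>x. sg (butlast as @ [x])) (osg (mul (last as) d)))"
  using assms
proof (induction as rule: bar.induct)
  case (1 a c as)
  have *: "consv a (snocv d v) = snocv d (consv a v)" for v :: "'b list \<Rightarrow>\<^sub>0 complex"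
    by (simp add: consv_def snocv_def lin_ext_comp)
  have "bar (c # as @ [d]) = snocv d (bar (c # as)) - fscale ((-1) ^ length (c # as))
      (lin_ext (\<lambda>x. sg (butlast (c # as) @ [x])) (osg (mul (last (c # as)) d)))"
    using 1 by simp
  then have "bar (a # c # as @ [d]) = lin_ext (\<lambda>x. sg (x # as @ [d])) (osg (mul a c))
     - consv a (snocv d (bar (c # as)) - fscale ((-1) ^ length (c # as))
      (lin_ext (\<lambda>x. sg (butlast (c # as) @ [x])) (osg (mul (last (c # as)) d))))"
    by (simp only: bar.simps)
  also have "\<dots> = lin_ext (\<lambda>x. sg (x # as @ [d])) (osg (mul a c))
     - snocv d (consv a (bar (c # as))) + fscale ((-1) ^ length (c # as))
      (lin_ext (\<lambda>x. sg (a # butlast (c # as) @ [x])) (osg (mul (last (c # as)) d)))"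
    unfolding *[symmetric] by (simp add: consv_def lin_ext_linear lin_ext_comp)
  also have "lin_ext (\<lambda>x. sg (x # as @ [d])) (osg (mul a c))
      = snocv d (lin_ext (\<lambda>x. sg (x # as)) (osg (mul a c)))"
    by (simp add: snocv_def lin_ext_comp)
  finally show ?case by (simp add: snocv_def lin_ext_diff fvs.scale_minus_left)
qed (auto simp: snocv_def consv_def)

definition last_face :: "'b list \<Rightarrow> ('b list \<Rightarrow>\<^sub>0 complex)" where
  "last_face xs = (if length xs < 2 then 0 else fscale ((-1) ^ (length xs - 1))
     (lin_ext (\<lambda>x. sg (x # butlast (tl xs))) (osg (mul (last xs) (hd xs)))))"

definition hoch :: "'b list \<Rightarrow> ('b list \<Rightarrow>\<^sub>0 complex)" where
  "hoch xs = bar xs + last_face xs"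

abbreviation b_op :: "('b list \<Rightarrow>\<^sub>0 complex) \<Rightarrow> ('b list \<Rightarrow>\<^sub>0 complex)" where
  "b_op \<equiv> lin_ext hoch"

end

section \<open>Hochschild chains with coefficients in a bimodule\<close>

locale basis_bimodule = mult_basis mul src tgt E deg
  for mul :: "'b \<Rightarrow> 'b \<Rightarrow> 'b option" and src tgt :: "'b \<Rightarrow> 'b" and E :: "'b set" and deg :: "'b \<Rightarrow> int" +
  fixes la :: "'b \<Rightarrow> 'm \<Rightarrow> 'm option" and ra :: "'m \<Rightarrow> 'b \<Rightarrow> 'm option"
  assumes ra_assoc: "Option.bind (ra m a) (\<lambda>n. ra n b) = Option.bind (mul a b) (ra m)"
    and la_assoc: "Option.bind (la a m) (la b) = Option.bind (mul b a) (\<lambda>c. la c m)"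
    and la_ra: "Option.bind (la a m) (\<lambda>n. ra n b) = Option.bind (ra m b) (la a)"
begin

definition ract :: "'m \<times> 'b list \<Rightarrow> ('m \<times> 'b list \<Rightarrow>\<^sub>0 complex)" where
  "ract c = (case snd c of [] \<Rightarrow> 0 | a # as \<Rightarrow> lin_ext (\<lambda>n. sg (n, as)) (osg (ra (fst c) a)))"

definition mid :: "'m \<times> 'b list \<Rightarrow> ('m \<times> 'b list \<Rightarrow>\<^sub>0 complex)" where
  "mid c = lin_ext (\<lambda>as. sg (fst c, as)) (bar (snd c))"

definition lact :: "'m \<times> 'b list \<Rightarrow> ('m \<times> 'b list \<Rightarrow>\<^sub>0 complex)" where
  "lact c = (if snd c = [] then 0 else fscale ((-1) ^ length (snd c))
     (lin_ext (\<lambda>n. sg (n, butlast (snd c))) (osg (la (last (snd c)) (fst c)))))"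

text \<open>The coefficient occupies slot 0, so b' of the remaining slots enters with a minus
  sign.\<close>

definition hochm :: "'m \<times> 'b list \<Rightarrow> ('m \<times> 'b list \<Rightarrow>\<^sub>0 complex)" where
  "hochm c = ract c - mid c + lact c"

text \<open>This identity and the next three are the pieces of d d = 0: associativity of the right
  action, b'b' = 0, commutation of the two actions, and associativity of the left action.\<close>

lemma ract_ract: "lin_ext ract (ract c) = lin_ext ract (mid c) + lin_ext mid (ract c)"
proof (cases c)
  case (Pair m as)
  show ?thesis
  proof (cases as rule: bar.cases)
    case (1 a d ds)
    have "lin_ext ract (ract c) = lin_ext (\<lambda>x. lin_ext (\<lambda>n. sg (n, ds)) (osg (ra m x))) (osg (mul a d))"
      using ra_assoc[of m a d] by (auto simp: Pair 1 ract_def osg_def split: option.splits bind_splits)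
    then show ?thesis
      by (cases "ra m a")
        (simp_all add: Pair 1 ract_def mid_def lin_ext_diff lin_ext_comp consv_def)
  qed (auto simp: Pair ract_def mid_def osg_def split: option.splits)
qed

lemma mid_mid: "lin_ext mid (mid c) = 0"
proof -
  have "lin_ext mid (mid c) = lin_ext (\<lambda>as. sg (fst c, as)) (lin_ext bar (bar (snd c)))"
    by (simp add: mid_def lin_ext_comp)
  then show ?thesis by (simp add: bar_bar)
qed

lemma ract_lact: "lin_ext ract (lact c) + lin_ext lact (ract c) = 0"
proof (cases c)
  case (Pair m as)
  show ?thesis
  proof (cases as)
    case (Cons a ds)
    show ?thesis
    proof (cases ds rule: rev_cases)
      case (snoc es d)
      have "lin_ext (\<lambda>n. lin_ext (\<lambda>n. sg (n, es)) (osg (ra n a))) (osg (la d m))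
          = lin_ext (\<lambda>n. lin_ext (\<lambda>n. sg (n, es)) (osg (la d n))) (osg (ra m a))"
        using la_ra[of d m a] by (auto simp: osg_def split: option.splits bind_splits)
      then show ?thesis
        by (simp add: Pair Cons snoc ract_def lact_def lin_ext_linear lin_ext_comp butlast_append
            lin_ext_fun_scale lin_ext_fun_uminus)
    qed (auto simp: Pair Cons ract_def lact_def osg_def lin_ext_uminus split: option.splits)
  qed (auto simp: Pair ract_def lact_def)
qed

lemma lact_lact: "lin_ext lact (lact c) = lin_ext mid (lact c) + lin_ext lact (mid c)"
proof (cases c)
  case (Pair m as)
  show ?thesis
  proof (cases as rule: rev_cases)
    case (snoc ds d)
    show ?thesis
    proof (cases ds rule: rev_cases)
      case Nil
      then show ?thesis by (simp add: Pair snoc lact_def mid_def osg_def lin_ext_uminus split: option.splits)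
    next
      case (snoc es c')
      have as: "as = es @ [c', d]" using \<open>as = ds @ [d]\<close> snoc by simp
      have 1: "lin_ext lact (lact c) = - lin_ext (\<lambda>x. lin_ext (\<lambda>n. sg (n, es)) (osg (la x m))) (osg (mul c' d))"
        using la_assoc[of d m c']
        by (auto simp: Pair as lact_def osg_def butlast_append split: option.splits bind_splits)
      let ?b = "bar (es @ [c'])"
      have 2: "bar as = snocv d ?b + fscale ((-1) ^ length es) (lin_ext (\<lambda>x. sg (es @ [x])) (osg (mul c' d)))"
        using bar_snoc[of "es @ [c']" d] by (simp add: as)
      have 3: "lin_ext lact (mid c)
        = lin_ext (\<lambda>xs. lact (m, xs)) (snocv d ?b)
          + fscale ((-1) ^ length es) (lin_ext (\<lambda>x. lact (m, es @ [x])) (osg (mul c' d)))"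
        using 2 by (simp add: mid_def Pair lin_ext_linear lin_ext_comp)
      have 4: "fscale ((-1) ^ length es) (lin_ext (\<lambda>x. lact (m, es @ [x])) (osg (mul c' d)))
          = - lin_ext (\<lambda>x. lin_ext (\<lambda>n. sg (n, es)) (osg (la x m))) (osg (mul c' d))"
        by (simp add: lact_def lin_ext_fun_uminus lin_ext_fun_scale power_add[symmetric])
      have "lin_ext (\<lambda>xs. lact (m, xs)) (snocv d ?b) = lin_ext (\<lambda>xs. lact (m, xs @ [d])) ?b"
        by (simp add: snocv_def lin_ext_comp)
      also have "\<dots> = lin_ext (\<lambda>xs. fscale ((-1) ^ length (es @ [c']))
          (lin_ext (\<lambda>n. sg (n, xs)) (osg (la d m)))) ?b"
        by (rule lin_ext_eqI[OF bar_fsp]) (auto simp: lact_def)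
      also have "\<dots> = fscale ((-1) ^ length (es @ [c']))
          (lin_ext (\<lambda>xs. lin_ext (\<lambda>n. sg (n, xs)) (osg (la d m))) ?b)"
        by (rule lin_ext_fun_scale)
      also have "\<dots> = - lin_ext mid (lact c)"
        by (cases "la d m")
          (simp_all add: lact_def Pair as butlast_append mid_def fvs.scale_minus_left)
      finally show ?thesis using 1 3 4 by simp
    qed
  qed (auto simp: Pair lact_def mid_def)
qed

lemma hochm_hochm: "lin_ext hochm (hochm c) = 0"
proof -
  have *: "lin_ext hochm v = lin_ext ract v - lin_ext mid v + lin_ext lact v" for v
    by (simp add: hochm_def[abs_def] lin_ext_fun_add lin_ext_fun_diff)
  have "lin_ext hochm (hochm c)
    = lin_ext ract (ract c) - lin_ext ract (mid c) - lin_ext mid (ract c) + lin_ext mid (mid c)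
      + (lin_ext ract (lact c) + lin_ext lact (ract c)) - lin_ext mid (lact c) - lin_ext lact (mid c)
      + lin_ext lact (lact c)"
    unfolding * by (simp add: hochm_def lin_ext_linear)
  then show ?thesis by (simp add: ract_ract mid_mid ract_lact lact_lact)
qed

end

sublocale mult_basis \<subseteq> reg: basis_bimodule mul src tgt E deg mul mul
  using assoc by unfold_locales auto

context mult_basis begin

text \<open>Identifies the Hochschild boundary with that of the regular bimodule, from which b b = 0
  and later the rule for the Euler derivation are inherited.\<close>

lemma hoch_Cons: "hoch (m # as) = lin_ext (\<lambda>c. sg (fst c # snd c)) (reg.hochm (m, as))"
proof (cases as)
  case (Cons a ds)
  then show ?thesis
    by (simp add: hoch_def last_face_def reg.hochm_def reg.ract_def reg.mid_def reg.lact_def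
        lin_ext_linear lin_ext_comp consv_def)
qed (simp add: hoch_def last_face_def reg.hochm_def reg.ract_def reg.mid_def reg.lact_def)

lemma hoch_hoch: "b_op (hoch xs) = 0"
proof (cases xs)
  case (Cons m as)
  have "b_op (hoch xs) = lin_ext (\<lambda>c. lin_ext (\<lambda>c. sg (fst c # snd c)) (reg.hochm c)) (reg.hochm (m, as))"
    by (simp add: Cons hoch_Cons lin_ext_comp)
  also have "\<dots> = lin_ext (\<lambda>c. sg (fst c # snd c)) (lin_ext reg.hochm (reg.hochm (m, as)))"
    by (simp add: lin_ext_comp)
  finally show ?thesis by (simp add: reg.hochm_hochm)
qed (simp add: hoch_def last_face_def)

end

locale basis_bimodule_hom =
  M: basis_bimodule mul src tgt E deg la ra + N: basis_bimodule mul src tgt E deg la' ra'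
  for mul :: "'b \<Rightarrow> 'b \<Rightarrow> 'b option" and src tgt :: "'b \<Rightarrow> 'b" and E :: "'b set" and deg :: "'b \<Rightarrow> int"
    and la :: "'b \<Rightarrow> 'm \<Rightarrow> 'm option" and ra :: "'m \<Rightarrow> 'b \<Rightarrow> 'm option"
    and la' :: "'b \<Rightarrow> 'n \<Rightarrow> 'n option" and ra' :: "'n \<Rightarrow> 'b \<Rightarrow> 'n option" +
  fixes f :: "'m \<Rightarrow> ('n \<Rightarrow>\<^sub>0 complex)"
  assumes f_la: "lin_ext f (osg (la a m)) = lin_ext (\<lambda>n. osg (la' a n)) (f m)"
    and f_ra: "lin_ext f (osg (ra m a)) = lin_ext (\<lambda>n. osg (ra' n a)) (f m)"
begin

definition hat :: "'m \<times> 'b list \<Rightarrow> ('n \<times> 'b list \<Rightarrow>\<^sub>0 complex)" where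
  "hat c = lin_ext (\<lambda>n. sg (n, snd c)) (f (fst c))"

lemma hat_hochm: "lin_ext hat (M.hochm c) = lin_ext N.hochm (hat c)"
proof (cases c)
  case (Pair m as)
  have r: "lin_ext hat (M.ract c) = lin_ext N.ract (hat c)"
  proof (cases as)
    case (Cons a ds)
    have "lin_ext (\<lambda>n. sg (n, ds)) (lin_ext f (osg (ra m a)))
        = lin_ext (\<lambda>n. sg (n, ds)) (lin_ext (\<lambda>n. osg (ra' n a)) (f m))" by (simp add: f_ra)
    then show ?thesis by (simp add: Pair Cons M.ract_def N.ract_def hat_def lin_ext_comp)
  qed (simp add: M.ract_def N.ract_def hat_def Pair lin_ext_comp)
  have l: "lin_ext hat (M.lact c) = lin_ext N.lact (hat c)"
  proof (cases as rule: rev_cases)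
    case (snoc ds a)
    have "lin_ext (\<lambda>n. sg (n, ds)) (lin_ext f (osg (la a m)))
        = lin_ext (\<lambda>n. sg (n, ds)) (lin_ext (\<lambda>n. osg (la' a n)) (f m))" by (simp add: f_la)
    then show ?thesis
      by (simp add: Pair snoc M.lact_def N.lact_def hat_def lin_ext_comp lin_ext_linear
          lin_ext_fun_uminus lin_ext_fun_scale)
  qed (simp add: M.lact_def N.lact_def hat_def Pair lin_ext_comp)
  have m: "lin_ext hat (M.mid c) = lin_ext N.mid (hat c)"
  proof -
    \<comment> \<open>Stated for an arbitrary \<open>bar'\<close>, since only the interchange of two
      independent finite sums is at stake.\<close>
    have "lin_ext (\<lambda>xs. lin_ext (\<lambda>n. sg (n, xs)) (f m)) (bar' as)
      = lin_ext (\<lambda>n. lin_ext (\<lambda>xs. sg (n, xs)) (bar' as)) (f m)"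
      for bar' :: "'b list \<Rightarrow> ('b list \<Rightarrow>\<^sub>0 complex)"
      unfolding lin_ext_def by (simp add: fvs.scale_sum_right mult.commute sum.swap[of _ "Poly_Mapping.keys (f m)"])
    then show ?thesis by (simp add: M.mid_def N.mid_def hat_def Pair lin_ext_comp)
  qed
  show ?thesis
    by (simp add: M.hochm_def N.hochm_def[abs_def] lin_ext_linear lin_ext_fun_add lin_ext_fun_diff r l m)
qed

end


section \<open>The multiplicative basis of the algebra\<close>

text \<open>The integers modulo 3, indexing the orbits under rotation of the triangle; a datatype
  makes every identity of labels a finite case split.\<close>

datatype ix = I0 | I1 | I2

fun nx :: "ix \<Rightarrow> ix" where "nx I0 = I1" | "nx I1 = I2" | "nx I2 = I0"
fun pv :: "ix \<Rightarrow> ix" where "pv I0 = I2" | "pv I1 = I0" | "pv I2 = I1"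

lemma ix_simps [simp]:
  "nx (nx i) = pv i" "pv (pv i) = nx i" "nx (pv i) = i" "pv (nx i) = i"
  "nx i \<noteq> i" "pv i \<noteq> i" "i \<noteq> nx i" "i \<noteq> pv i" "nx i \<noteq> pv i" "pv i \<noteq> nx i"
  "nx i = nx j \<longleftrightarrow> i = j" "pv i = pv j \<longleftrightarrow> i = j"
  by (cases i; cases j; simp)+

lemma ix_eq_simps [simp]: "nx i = j \<longleftrightarrow> i = pv j" "pv i = j \<longleftrightarrow> i = nx j"
  by (cases i; cases j; simp)+

text \<open>
  The corners of the triangular graph are \<open>vX i\<close>, the midpoints of its sides \<open>vM i\<close>. The arrows are
  \<open>eD i: vX i \<rightarrow> vM i\<close>, \<open>eC i: vM i \<rightarrow> vM (nx i)\<close> and \<open>eU i: vM (nx i) \<rightarrow> vX i\<close>, and the paths of length 2 are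
  \<open>pV i = eD i eU (pv i)\<close> and \<open>pW i = eC i eC (nx i) = eU (pv i) eD (pv i)\<close>.
\<close>

datatype 'i elt = vX 'i | vM 'i | eD 'i | eU 'i | eC 'i | pV 'i | pW 'i

type_synonym el = "ix elt"

fun el_src :: "el \<Rightarrow> el" where
  "el_src (vX i) = vX i" | "el_src (vM i) = vM i" | "el_src (eD i) = vX i" | "el_src (eU i) = vM (nx i)"
| "el_src (eC i) = vM i" | "el_src (pV i) = vX i" | "el_src (pW i) = vM i"

fun el_tgt :: "el \<Rightarrow> el" where
  "el_tgt (vX i) = vX i" | "el_tgt (vM i) = vM i" | "el_tgt (eD i) = vM i" | "el_tgt (eU i) = vX i"
| "el_tgt (eC i) = vM (nx i)" | "el_tgt (pV i) = vX (pv i)" | "el_tgt (pW i) = vM (pv i)"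

fun el_deg :: "el \<Rightarrow> int" where
  "el_deg (vX i) = 0" | "el_deg (vM i) = 0" | "el_deg (eD i) = 1" | "el_deg (eU i) = 1"
| "el_deg (eC i) = 1" | "el_deg (pV i) = 2" | "el_deg (pW i) = 2"

text \<open>The second index is not inspected, because \<open>el_mul\<close> calls this only for
  composable elements and then the first index determines it.\<close>

fun arrow_mul :: "el \<Rightarrow> el \<Rightarrow> el option" where
  "arrow_mul (eD i) (eU j) = Some (pV i)"
| "arrow_mul (eU i) (eD j) = Some (pW (nx i))"
| "arrow_mul (eC i) (eC j) = Some (pW i)"
| "arrow_mul a b = None"

definition el_mul :: "el \<Rightarrow> el \<Rightarrow> el option" where
  "el_mul a b = (if el_tgt a \<noteq> el_src b then None else if el_deg a = 0 then Some b
     else if el_deg b = 0 then Some a else arrow_mul a b)"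

definition el_vs :: "el set" where
  "el_vs = {vX I0, vX I1, vX I2, vM I0, vM I1, vM I2}"

lemma ix_UNIV: "(UNIV :: ix set) = {I0, I1, I2}"
  by (auto intro: ix.exhaust)

lemma el_vs_iff: "e \<in> el_vs \<longleftrightarrow> el_deg e = 0"
  by (cases e; cases "case e of vX i \<Rightarrow> i | vM i \<Rightarrow> i | _ \<Rightarrow> I0") (auto simp: el_vs_def)

lemma el_mul_Some:
  assumes "el_mul a b = Some c"
  shows "el_tgt a = el_src b" "el_src c = el_src a" "el_tgt c = el_tgt b" "el_deg c = el_deg a + el_deg b"
proof -
  have "el_tgt a = el_src b \<and> el_src c = el_src a \<and> el_tgt c = el_tgt b \<and> el_deg c = el_deg a + el_deg b"
    using assms by (cases a; cases b; simp add: el_mul_def split: if_splits; clarsimp)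
  then show "el_tgt a = el_src b" "el_src c = el_src a" "el_tgt c = el_tgt b" "el_deg c = el_deg a + el_deg b"
    by simp_all
qed

lemma el_mul_None: "el_tgt a \<noteq> el_src b \<Longrightarrow> el_mul a b = None"
  by (simp add: el_mul_def)

lemma el_mul_assoc:
  "Option.bind (el_mul a b) (\<lambda>x. el_mul x c) = Option.bind (el_mul b c) (el_mul a)"
  by (cases a; cases b; cases c; simp add: el_mul_def)

lemma el_src_idem [simp]: "el_src (el_src a) = el_src a" "el_tgt (el_src a) = el_src a"
  "el_src (el_tgt a) = el_tgt a" "el_tgt (el_tgt a) = el_tgt a"
  "el_deg (el_src a) = 0" "el_deg (el_tgt a) = 0"
  by (cases a; simp)+

lemma el_deg0: "el_deg e = 0 \<Longrightarrow> el_src e = e" "el_deg e = 0 \<Longrightarrow> el_tgt e = e"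
  by (cases e; simp)+

lemma el_mul_unit [simp]: "el_mul (el_src a) a = Some a" "el_mul a (el_tgt a) = Some a"
  by (cases a; simp add: el_mul_def)+


interpretation el: mult_basis el_mul el_src el_tgt el_vs el_deg
proof
  show "finite el_vs" by (simp add: el_vs_def)
  show "el_src a \<in> el_vs" "el_tgt a \<in> el_vs" for a by (simp_all add: el_vs_iff)
  show "el_mul e a = (if e = el_src a then Some a else None)"
    "el_mul a e = (if e = el_tgt a then Some a else None)" if "e \<in> el_vs" for e a
    using that el_deg0[of e] by (auto simp: el_mul_def el_vs_iff el_deg0)
qed (auto simp: el_vs_iff el_mul_assoc el_mul_Some)

lemma map_elt_src: "(\<And>i. f (nx i) = nx (f i)) \<Longrightarrow> el_src (map_elt f a) = map_elt f (el_src a)"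
  by (cases a) auto

lemma map_elt_tgt:
  "(\<And>i. f (nx i) = nx (f i)) \<Longrightarrow> (\<And>i. f (pv i) = pv (f i)) \<Longrightarrow> el_tgt (map_elt f a) = map_elt f (el_tgt a)"
  by (cases a) auto

lemma map_elt_deg [simp]: "el_deg (map_elt f a) = el_deg a"
  by (cases a) auto

text \<open>Relabelling by a rotation is an algebra automorphism; the case of interest is that of
  the twists \<open>tw p\<close> and \<open>twi p\<close>.\<close>

lemma map_elt_mul:
  assumes "inj f" "\<And>i. f (nx i) = nx (f i)" "\<And>i. f (pv i) = pv (f i)"
  shows "el_mul (map_elt f a) (map_elt f b) = map_option (map_elt f) (el_mul a b)"
proof -
  have "map_elt f x = map_elt f y \<longleftrightarrow> x = y" for x y :: el
    using elt.inj_map[OF assms(1)] by (auto dest: injD)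
  moreover have "arrow_mul (map_elt f a) (map_elt f b) = map_option (map_elt f) (arrow_mul a b)"
    using assms(2) by (cases a; cases b; simp)
  ultimately show ?thesis using assms(2,3) by (simp add: el_mul_def map_elt_src map_elt_tgt)
qed


section \<open>The periodic bimodule resolution\<close>

text \<open>
  The term of degree \<open>p\<close> of the resolution has generators indexed by the vertices, the arrows, the
  relations (one for each arrow) and again the vertices, according to \<open>p\<close> modulo 4. Its right action
  is twisted by the Nakayama automorphism \<open>map_elt pv\<close> to the power \<open>p div 4\<close>. As this automorphism has
  order 3, only the position of \<open>p\<close> modulo 12 matters; \<open>pos p = 12\<close> separates the positive multiples
  of 12 from 0.
\<close>

fun pos :: "nat \<Rightarrow> nat" where
  "pos 0 = 0"
| "pos (Suc p) = (if pos p = 12 then 1 else Suc (pos p))"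

text \<open>Stage 4 has the same generators as stage 0, but its differential is \<open>d4\<close>
  and it starts a new twist. Stage 0 occurs only at p = 0.\<close>

definition stage :: "nat \<Rightarrow> nat" where
  "stage p = (if pos p = 0 then 0 else (pos p - 1) mod 4 + 1)"

text \<open>The k-th power of \<open>pv\<close> for k = 0, 1, 2, 3, which are the values of
  \<open>pos p div 4\<close>.\<close>

definition twist :: "nat \<Rightarrow> ix \<Rightarrow> ix" where
  "twist k = (if k = 1 then pv else if k = 2 then nx else id)"

definition tw :: "nat \<Rightarrow> el \<Rightarrow> el" where "tw p = map_elt (twist (pos p div 4))"
text \<open>The inverse of \<open>tw p\<close>, written as its square because the twist has order
  dividing 3.\<close>

definition twi :: "nat \<Rightarrow> el \<Rightarrow> el" where "twi p = map_elt (twist (pos p div 4) \<circ> twist (pos p div 4))"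

text \<open>Internal degree of the generators: the entries of \<open>d4\<close> have total degree 2
  in the algebra, those of the other differentials degree 1.\<close>

fun gdeg :: "nat \<Rightarrow> int" where
  "gdeg 0 = 0"
| "gdeg (Suc p) = gdeg p + (if stage (Suc p) = 4 then 2 else 1)"

lemma pos_le: "pos p \<le> 12"
  by (induction p) auto

lemma pos_cases: "pos p \<in> {0, 1, 2, 3, 4, 5, 6, 7, 8, 9, 10, 11, 12}"
  unfolding insert_iff empty_iff using pos_le[of p] by presburger

lemma pos_eq_0 [simp]: "pos p = 0 \<longleftrightarrow> p = 0"
  by (cases p) auto

lemma stage_0 [simp]: "stage 0 = 0"
  by (simp add: stage_def)

lemma stage_Suc: "stage (Suc p) = (if stage p = 4 then 1 else Suc (stage p))"
  using pos_cases[of p] by (auto simp: stage_def)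

lemma stage_cases: "stage p \<in> {0, 1, 2, 3, 4}"
  using pos_cases[of p] by (auto simp: stage_def)

lemma stage_eq_0 [simp]: "stage p = 0 \<longleftrightarrow> p = 0"
  by (simp add: stage_def)

lemma twist_comm: "twist k (nx i) = nx (twist k i)" "twist k (pv i) = pv (twist k i)"
  by (auto simp: twist_def)

lemma twist_3: "twist k (twist k (twist k i)) = i"
  by (auto simp: twist_def)

lemma inj_twist: "inj (twist k)"
  by (rule injI) (metis twist_3)

lemma twist_Suc: "twist (pos (Suc p) div 4) = (if stage (Suc p) = 4 then twist (pos p div 4) \<circ> pv else twist (pos p div 4))"
  using pos_cases[of p] by (auto simp: stage_def fun_eq_iff twist_def)

lemma tw_twi [simp]: "tw p (twi p a) = a" "twi p (tw p a) = a"
  by (simp_all add: tw_def twi_def elt.map_comp o_def twist_3 elt.map_ident)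

lemma tw_simps [simp]:
  "el_src (tw p a) = tw p (el_src a)" "el_tgt (tw p a) = tw p (el_tgt a)" "el_deg (tw p a) = el_deg a"
  "el_src (twi p a) = twi p (el_src a)" "el_tgt (twi p a) = twi p (el_tgt a)" "el_deg (twi p a) = el_deg a"
  by (simp_all add: tw_def twi_def map_elt_src map_elt_tgt twist_comm)

lemma tw_mul: "el_mul (tw p a) (tw p b) = map_option (tw p) (el_mul a b)"
  unfolding tw_def by (rule map_elt_mul) (simp_all add: inj_twist twist_comm)

lemma twi_mul: "el_mul (twi p a) (twi p b) = map_option (twi p) (el_mul a b)"
  unfolding twi_def by (rule map_elt_mul) (simp_all add: inj_twist twist_comm inj_compose)

lemma tw_0 [simp]: "tw 0 a = a" "twi 0 a = a"
  by (simp_all add: tw_def twi_def twist_def elt.map_id)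

lemma twi_Suc: "(if stage (Suc p) = 4 then map_elt pv (twi (Suc p) a) else twi (Suc p) a) = twi p a"
  by (simp add: twi_def twist_Suc elt.map_comp o_def twist_comm del: pos.simps)

type_synonym pel = "nat \<times> el \<times> el \<times> el"

text \<open>\<open>(p, x, g, y)\<close> stands for \<open>x \<otimes> g \<otimes> y\<close>, where \<open>g\<close> goes from \<open>gen_l\<close> to \<open>gen_r\<close>.\<close>

definition gen_l :: "nat \<Rightarrow> el \<Rightarrow> el" where
  "gen_l s g = (if s = 1 then el_src g else if s = 2 then el_tgt g else g)"

definition gen_r :: "nat \<Rightarrow> el \<Rightarrow> el" where
  "gen_r s g = (if s = 1 then el_tgt g else if s = 2 then el_src g else g)"

definition pvalid :: "pel \<Rightarrow> bool" where
  "pvalid = (\<lambda>(p, x, g, y). el_deg g = (if stage p \<in> {1, 2} then 1 else 0) \<and>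
     el_tgt x = gen_l (stage p) g \<and> el_src y = gen_r (stage p) g)"

definition put :: "nat \<Rightarrow> el option \<Rightarrow> el \<Rightarrow> el option \<Rightarrow> (pel \<Rightarrow>\<^sub>0 complex)" where
  "put p a g b = (case (a, b) of (Some x, Some y) \<Rightarrow> sg (p, x, g, y) | _ \<Rightarrow> 0)"

lemma put_simps [simp]: "put p None g b = 0" "put p a g None = 0" "put p (Some x) g (Some y) = sg (p, x, g, y)"
  by (auto simp: put_def split: option.splits)

text \<open>Noncommutative derivatives of the relations \<open>eD i eC i\<close>,
  \<open>eC i eU i\<close> and \<open>eU i eD i - eC (nx i) eC (pv i)\<close>. The relation indexed
  by an arrow runs against it.\<close>

fun d2 :: "el \<Rightarrow> (el \<times> el \<times> el \<Rightarrow>\<^sub>0 complex)" where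
  "d2 (eU i) = sg (vX i, eD i, eC i) + sg (eD i, eC i, vM (nx i))"
| "d2 (eD i) = sg (vM i, eC i, eU i) + sg (eC i, eU i, vX i)"
| "d2 (eC i) = sg (vM (nx i), eU i, eD i) + sg (eU i, eD i, vM i)
    - sg (vM (nx i), eC (nx i), eC (pv i)) - sg (eC (nx i), eC (pv i), vM i)"
| "d2 _ = 0"

text \<open>Arrows leaving the vertex, each followed by its relation, minus relations followed by
  their arrow for the arrows arriving. The sum is a cycle because all relations are cyclic
  derivatives of one potential.\<close>

fun d3 :: "el \<Rightarrow> (el \<times> el \<times> el \<Rightarrow>\<^sub>0 complex)" where
  "d3 (vX i) = sg (eD i, eD i, vX i) - sg (vX i, eU i, eU i)"
| "d3 (vM i) = sg (eC i, eC i, vM i) + sg (eU (pv i), eU (pv i), vM i)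
    - sg (vM i, eD i, eD i) - sg (vM i, eC (pv i), eC (pv i))"
| "d3 _ = 0"

text \<open>A Casimir element: the sum of x \<otimes> x* over the basis elements x starting at the
  vertex, where x x* is \<open>pV i\<close> or \<open>pW i\<close>. These socle elements end at the
  vertex with index \<open>pv i\<close>, which causes the Nakayama twist.\<close>

fun d4 :: "el \<Rightarrow> (el \<times> el \<times> el \<Rightarrow>\<^sub>0 complex)" where
  "d4 (vX i) = sg (vX i, vX i, pV i) + sg (eD i, vM i, eU (pv i)) + sg (pV i, vX (pv i), vX (pv i))"
| "d4 (vM i) = sg (vM i, vM i, pW i) + sg (eC i, vM (nx i), eC (nx i))
    + sg (eU (pv i), vX (pv i), eD (pv i)) + sg (pW i, vM (pv i), vM (pv i))"
| "d4 _ = 0"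

definition dtab :: "nat \<Rightarrow> el \<Rightarrow> (el \<times> el \<times> el \<Rightarrow>\<^sub>0 complex)" where
  "dtab s g = (if s = 1 then sg (g, el_tgt g, el_tgt g) - sg (el_src g, el_src g, g)
     else if s = 2 then d2 g else if s = 3 then d3 g else if s = 4 then d4 g else 0)"

text \<open>The right factor is stored untwisted. Source and target carry different twists exactly
  when the source has stage 4, and \<open>pv\<close> accounts for the difference.\<close>

fun dP :: "pel \<Rightarrow> (pel \<Rightarrow>\<^sub>0 complex)" where
  "dP (0, x, g, y) = 0"
| "dP (Suc p, x, g, y) = lin_ext (\<lambda>(x', g', y'). put p (el_mul x x') g'
     (el_mul y' (if stage (Suc p) = 4 then map_elt pv y else y))) (dtab (stage (Suc p)) g)"

text \<open>The contraction \<open>hP\<close> is a homomorphism of left modules, found by linear algebra.\<close>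

fun h0 :: "el \<Rightarrow> (el \<times> el \<times> el \<Rightarrow>\<^sub>0 complex)" where
  "h0 (eD i) = - sg (vX i, eD i, vM i)"
| "h0 (eU i) = - sg (vM (nx i), eU i, vX i)"
| "h0 (eC i) = - sg (vM i, eC i, vM (nx i))"
| "h0 (pV i) = - sg (vX i, eD i, eU (pv i)) - sg (eD i, eU (pv i), vX (pv i))"
| "h0 (pW i) = - sg (eU (pv i), eD (pv i), vM (pv i)) - sg (vM i, eU (pv i), eD (pv i))"
| "h0 _ = 0"

fun h1 :: "el \<Rightarrow> el \<Rightarrow> (el \<times> el \<times> el \<Rightarrow>\<^sub>0 complex)" where
  "h1 (eD i) (eC _) = sg (vX i, eU i, vM (nx i))"
| "h1 (eD i) (pW _) = sg (vX i, eU i, eC (nx i)) + sg (eD i, eC (pv i), vM (pv i))"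
| "h1 (eU i) (pV _) = sg (eC (nx i), eD (pv i), vX (pv i)) + sg (vM (nx i), eC i, eU (pv i))"
| "h1 (eC i) (eU _) = sg (vM i, eD i, vX i)"
| "h1 (eC i) (eC _) = - sg (vM i, eC (pv i), vM (pv i))"
| "h1 (eC i) (pW _) = sg (vM i, eD i, eD i)"
| "h1 _ _ = 0"

fun h2 :: "el \<Rightarrow> el \<Rightarrow> (el \<times> el \<times> el \<Rightarrow>\<^sub>0 complex)" where
  "h2 (eD i) (pV _) = - sg (eU (pv i), vX (pv i), vX (pv i)) - sg (vM i, vM i, eU (pv i))"
| "h2 (eU i) (eU _) = - sg (vX i, vX i, vX i)"
| "h2 (eU i) (pW _) = - sg (vX i, vX i, eD i)"
| "h2 (eC i) (eC _) = - sg (vM (nx i), vM (nx i), vM (nx i))"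
| "h2 (eC i) (pW _) = - sg (vM (nx i), vM (nx i), eC (nx i)) - sg (eC (nx i), vM (pv i), vM (pv i))"
| "h2 _ _ = 0"

fun h3 :: "el \<Rightarrow> (el \<times> el \<times> el \<Rightarrow>\<^sub>0 complex)" where
  "h3 (pV i) = sg (vX i, vX i, vX i)"
| "h3 (pW i) = sg (vM i, vM i, vM i)"
| "h3 _ = 0"

definition htab :: "nat \<Rightarrow> el \<Rightarrow> el \<Rightarrow> (el \<times> el \<times> el \<Rightarrow>\<^sub>0 complex)" where
  "htab s g y = (if s = 1 then h1 g y else if s = 2 then h2 g y else if s = 3 then h3 y else h0 y)"

definition hP :: "pel \<Rightarrow> (pel \<Rightarrow>\<^sub>0 complex)" where
  "hP = (\<lambda>(p, x, g, y). lin_ext (\<lambda>(x', g', y'). put (Suc p) (el_mul x x') g' (Some y')) (htab (stage p) g y))"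

definition epsP :: "pel \<Rightarrow> (el \<Rightarrow>\<^sub>0 complex)" where
  "epsP = (\<lambda>(p, x, g, y). if p = 0 then osg (el_mul x y) else 0)"

definition etaP :: "el \<Rightarrow> pel" where
  "etaP a = (0, a, el_tgt a, el_tgt a)"

definition lmul :: "el \<Rightarrow> pel \<Rightarrow> (pel \<Rightarrow>\<^sub>0 complex)" where
  "lmul a = (\<lambda>(p, x, g, y). put p (el_mul a x) g (Some y))"

lemma lmul_eq: "lmul a (p, x, g, y) = put p (el_mul a x) g (Some y)"
  by (simp add: lmul_def)

lemma put_assoc:
  "lin_ext (lmul a) (put p (el_mul x x') g b) = (case el_mul a x of None \<Rightarrow> 0 | Some z \<Rightarrow> put p (el_mul z x') g b)"
  using el_mul_assoc[of a x x']
  by (cases b; cases "el_mul a x"; cases "el_mul x x'") (simp_all add: lmul_def)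

text \<open>Left linearity of \<open>dP\<close> and \<open>hP\<close> reduces the identities of the
  resolution to elements whose left factor is a vertex, which is a finite check.\<close>

lemma dP_lmul: "lin_ext dP (lmul a m) = lin_ext (lmul a) (dP m)"
proof -
  obtain p x g y where m: "m = (p, x, g, y)" by (cases m)
  show ?thesis
  proof (cases p)
    case (Suc q)
    show ?thesis
      by (cases "el_mul a x") (simp_all add: m Suc lin_ext_comp case_prod_unfold put_assoc lmul_eq)
  qed (cases "el_mul a x"; simp add: m lmul_def)
qed

lemma hP_lmul: "lin_ext hP (lmul a m) = lin_ext (lmul a) (hP m)"
proof -
  obtain p x g y where m: "m = (p, x, g, y)" by (cases m)
  show ?thesis
    by (cases "el_mul a x") (simp_all add: m hP_def lin_ext_comp case_prod_unfold put_assoc lmul_eq)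
qed

lemma contraction_unit:
  assumes "pvalid (p, x, g, y)" "el_deg x = 0"
  shows "lin_ext dP (hP (p, x, g, y)) + lin_ext hP (dP (p, x, g, y))
    = sg (p, x, g, y) - lin_ext (\<lambda>a. sg (etaP a)) (epsP (p, x, g, y))"
proof -
  have x: "x = gen_l (stage p) g" using assms by (simp add: pvalid_def el_deg0)
  have y: "el_src y = gen_r (stage p) g" and g: "el_deg g = (if stage p \<in> {1, 2} then 1 else 0)"
    using assms by (simp_all add: pvalid_def)
  \<comment> \<open>Only the stages of p - 1, p and p + 1 decide which tables enter, so the
    transitions between stages exhaust all degrees.\<close>
  consider "p = 0" | q where "p = Suc q" "stage q \<in> {0, 4}" "stage p = 1"
    | q where "p = Suc q" "stage q = 1" "stage p = 2" | q where "p = Suc q" "stage q = 2" "stage p = 3"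
    | q where "p = Suc q" "stage q = 3" "stage p = 4"
    using stage_cases[of p] stage_cases[of "p - 1"] by (cases p) (auto simp: stage_Suc split: if_splits)
  then show ?thesis
  proof cases
    case 1
    then show ?thesis using x y g
      by (cases g; cases y) (simp_all add: gen_l_def gen_r_def hP_def htab_def stage_Suc dtab_def epsP_def etaP_def
          el_mul_def lin_ext_linear)
  next
    case 2
    then show ?thesis using x y g
      by (cases g; cases y) (auto simp: gen_l_def gen_r_def hP_def htab_def stage_Suc dtab_def epsP_def etaP_def
          el_mul_def lin_ext_linear)
  next
    case 3
    then show ?thesis using x y g
      by (cases g; cases y) (simp_all add: gen_l_def gen_r_def hP_def htab_def stage_Suc dtab_def epsP_def etaP_def
          el_mul_def lin_ext_linear)
  next
    case 4
    then show ?thesis using x y g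
      by (cases g; cases y) (simp_all add: gen_l_def gen_r_def hP_def htab_def stage_Suc dtab_def epsP_def etaP_def
          el_mul_def lin_ext_linear)
  next
    case 5
    then show ?thesis using x y g
      by (cases g; cases y) (simp_all add: gen_l_def gen_r_def hP_def htab_def stage_Suc dtab_def epsP_def etaP_def
          el_mul_def lin_ext_linear)
  qed
qed


lemma dP_dP_unit:
  assumes "pvalid (p, x, g, y)" "el_deg x = 0"
  shows "lin_ext dP (dP (p, x, g, y)) = 0"
proof -
  have x: "x = gen_l (stage p) g" using assms by (simp add: pvalid_def el_deg0)
  have y: "el_src y = gen_r (stage p) g" and g: "el_deg g = (if stage p \<in> {1, 2} then 1 else 0)"
    using assms by (simp_all add: pvalid_def)
  consider "p = 0" | "p = 1" | q where "p = Suc (Suc q)" "stage (Suc q) = 4" "stage p = 1"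
    | q where "p = Suc (Suc q)" "stage (Suc q) = 1" "stage p = 2"
    | q where "p = Suc (Suc q)" "stage (Suc q) = 2" "stage p = 3"
    | q where "p = Suc (Suc q)" "stage (Suc q) = 3" "stage p = 4"
    using stage_cases[of "p - 1"] by (cases p rule: nat.exhaust; cases "p - 1") (auto simp: stage_Suc split: if_splits)
  then show ?thesis
  proof cases
    case 2
    then show ?thesis by (simp add: stage_Suc dtab_def lin_ext_linear put_def split: option.splits)
  next
    case 3
    then show ?thesis using x y g
      by (cases g; cases y) (auto simp: gen_l_def gen_r_def dtab_def el_mul_def lin_ext_linear)
  next
    case 4
    then show ?thesis using x y g
      by (cases g; cases y) (simp_all add: gen_l_def gen_r_def dtab_def el_mul_def lin_ext_linear)
  next
    case 5
    then show ?thesis using x y g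
      by (cases g; cases y) (simp_all add: gen_l_def gen_r_def dtab_def el_mul_def lin_ext_linear)
  next
    case 6
    then show ?thesis using x y g
      by (cases g; cases y) (simp_all add: gen_l_def gen_r_def dtab_def el_mul_def lin_ext_linear)
  qed simp
qed

lemma lmul_unit: "pvalid (p, x, g, y) \<Longrightarrow> lmul x (p, el_tgt x, g, y) = sg (p, x, g, y)"
  by (simp add: lmul_eq)

lemma pvalid_unit: "pvalid (p, x, g, y) \<Longrightarrow> pvalid (p, el_tgt x, g, y)"
  using el_src_idem(4)[of x] by (simp add: pvalid_def)

lemma
  assumes "pvalid (p, x, g, y)"
  shows dP_eq_lmul: "dP (p, x, g, y) = lin_ext (lmul x) (dP (p, el_tgt x, g, y))"
    and hP_eq_lmul: "hP (p, x, g, y) = lin_ext (lmul x) (hP (p, el_tgt x, g, y))"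
  using dP_lmul[of x "(p, el_tgt x, g, y)"] hP_lmul[of x "(p, el_tgt x, g, y)"] lmul_unit[OF assms] by simp_all

lemma dP_dP:
  assumes "pvalid m"
  shows "lin_ext dP (dP m) = 0"
proof -
  obtain p x g y where m: "m = (p, x, g, y)" by (cases m)
  have "lin_ext dP (dP m) = lin_ext (\<lambda>n. lin_ext dP (lmul x n)) (dP (p, el_tgt x, g, y))"
    using dP_eq_lmul assms by (simp add: m lin_ext_comp)
  also have "\<dots> = lin_ext (lmul x) (lin_ext dP (dP (p, el_tgt x, g, y)))"
    by (simp add: dP_lmul lin_ext_comp)
  also have "lin_ext dP (dP (p, el_tgt x, g, y)) = 0"
    using assms by (intro dP_dP_unit) (simp_all add: m pvalid_unit)
  finally show ?thesis by simp
qed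

lemma contraction:
  assumes "pvalid m"
  shows "lin_ext dP (hP m) + lin_ext hP (dP m) = sg m - lin_ext (\<lambda>a. sg (etaP a)) (epsP m)"
proof -
  obtain p x g y where m: "m = (p, x, g, y)" by (cases m)
  let ?u = "(p, el_tgt x, g, y)"
  have "lin_ext dP (hP m) + lin_ext hP (dP m)
    = lin_ext (\<lambda>n. lin_ext dP (lmul x n)) (hP ?u) + lin_ext (\<lambda>n. lin_ext hP (lmul x n)) (dP ?u)"
    using dP_eq_lmul hP_eq_lmul assms by (simp add: m lin_ext_comp)
  also have "\<dots> = lin_ext (lmul x) (lin_ext dP (hP ?u) + lin_ext hP (dP ?u))"
    by (simp add: dP_lmul hP_lmul lin_ext_comp lin_ext_add)
  also have "lin_ext dP (hP ?u) + lin_ext hP (dP ?u) = sg ?u - lin_ext (\<lambda>a. sg (etaP a)) (epsP ?u)"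
    using assms by (intro contraction_unit) (simp_all add: m pvalid_unit)
  also have "lin_ext (lmul x) (sg ?u - lin_ext (\<lambda>a. sg (etaP a)) (epsP ?u))
    = sg m - lin_ext (lmul x) (lin_ext (\<lambda>a. sg (etaP a)) (epsP ?u))"
    using lmul_unit assms by (simp add: m lin_ext_diff)
  also have "lin_ext (lmul x) (lin_ext (\<lambda>a. sg (etaP a)) (epsP ?u)) = lin_ext (\<lambda>a. sg (etaP a)) (epsP m)"
  proof (cases "p = 0")
    case True
    have "el_tgt x = el_src y" using assms True by (simp add: pvalid_def m gen_l_def gen_r_def)
    then have "epsP ?u = sg y" using True by (simp add: epsP_def)
    moreover have "epsP m = osg (el_mul x y)" using True by (simp add: epsP_def m)
    ultimately show ?thesis
      by (cases "el_mul x y") (simp_all add: etaP_def lmul_eq el_mul_Some)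
  qed (simp add: epsP_def m)
  finally show ?thesis .
qed

definition gen_ok :: "nat \<Rightarrow> el \<Rightarrow> bool" where
  "gen_ok s g \<longleftrightarrow> el_deg g = (if s \<in> {1, 2} then 1 else 0)"

text \<open>Endpoints and degrees of the table entries. At stage 4 the right end is shifted by
  \<open>pv\<close>, in accordance with the twist in \<open>dP\<close>.\<close>

lemma dtab_fsp:
  assumes "gen_ok (stage (Suc q)) g"
  shows "dtab (stage (Suc q)) g \<in> fsp {(x', g', y'). gen_ok (stage q) g' \<and>
    el_src x' = gen_l (stage (Suc q)) g \<and> el_tgt x' = gen_l (stage q) g' \<and> el_src y' = gen_r (stage q) g' \<and>
    el_tgt y' = (if stage (Suc q) = 4 then map_elt pv (gen_r (stage (Suc q)) g) else gen_r (stage (Suc q)) g) \<and>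
    el_deg x' + el_deg y' = (if stage (Suc q) = 4 then 2 else 1)}"
proof -
  consider "stage q = 0" | "stage q = 4" | "stage q = 1" | "stage q = 2" | "stage q = 3"
    using stage_cases[of q] by auto
  then show ?thesis
    using assms
    by cases (cases g; simp add: stage_Suc gen_ok_def dtab_def gen_l_def gen_r_def;
      intro fsp_diff fsp_add fsp_single; simp)+
qed

lemma htab_fsp:
  assumes "gen_ok (stage p) g" "el_src y = gen_r (stage p) g"
  shows "htab (stage p) g y \<in> fsp {(x', g', y'). gen_ok (stage (Suc p)) g' \<and>
    el_src x' = gen_l (stage p) g \<and> el_tgt x' = gen_l (stage (Suc p)) g' \<and> el_src y' = gen_r (stage (Suc p)) g' \<and>
    (if stage (Suc p) = 4 then 2 else 1) + el_deg x' + el_deg y' = el_deg y}"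
proof -
  consider "stage p = 0" | "stage p = 4" | "stage p = 1" | "stage p = 2" | "stage p = 3"
    using stage_cases[of p] by auto
  then show ?thesis
    using assms
    by cases (cases g; cases y; simp add: stage_Suc gen_ok_def htab_def gen_l_def gen_r_def;
      intro fsp_diff fsp_add fsp_uminus fsp_0 fsp_single; simp)+
qed

definition pdeg :: "pel \<Rightarrow> int" where
  "pdeg = (\<lambda>(p, x, g, y). gdeg p + el_deg x + el_deg y)"

definition PB :: "nat \<Rightarrow> int \<Rightarrow> pel set" where
  "PB p j = {m. fst m = p \<and> pvalid m \<and> pdeg m = j}"

lemma PB_iff: "(p', x, g, y) \<in> PB p j \<longleftrightarrow> p' = p \<and> gen_ok (stage p) g \<and> el_tgt x = gen_l (stage p) g \<and>
    el_src y = gen_r (stage p) g \<and> gdeg p + el_deg x + el_deg y = j"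
  by (auto simp: PB_def pvalid_def pdeg_def gen_ok_def)

lemma put_fsp:
  assumes "\<And>x y. a = Some x \<Longrightarrow> b = Some y \<Longrightarrow> (p, x, g, y) \<in> Y"
  shows "put p a g b \<in> fsp Y"
  using assms by (auto simp: put_def split: option.splits intro!: fsp_single)

lemma dP_0: "fst m = 0 \<Longrightarrow> dP m = 0"
  by (cases m) auto

lemma dP_PB: "m \<in> PB (Suc q) j \<Longrightarrow> dP m \<in> fsp (PB q j)"
proof -
  assume m: "m \<in> PB (Suc q) j"
  obtain x g y where eq: "m = (Suc q, x, g, y)" using m by (cases m) (auto simp: PB_def)
  have "gen_ok (stage (Suc q)) g" using m by (simp add: eq PB_iff)
  note * = dtab_fsp[OF this]
  show ?thesis unfolding eq dP.simps
    by (rule fsp_lin_ext[OF *])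
      (use m in \<open>auto simp: eq PB_iff el_mul_Some intro!: put_fsp split: if_splits\<close>)
qed

lemma hP_PB: "m \<in> PB p j \<Longrightarrow> hP m \<in> fsp (PB (Suc p) j)"
proof -
  assume m: "m \<in> PB p j"
  obtain x g y where eq: "m = (p, x, g, y)" using m by (cases m) (auto simp: PB_def)
  have *: "htab (stage p) g y \<in> fsp {(x', g', y'). gen_ok (stage (Suc p)) g' \<and>
    el_src x' = gen_l (stage p) g \<and> el_tgt x' = gen_l (stage (Suc p)) g' \<and> el_src y' = gen_r (stage (Suc p)) g' \<and>
    (if stage (Suc p) = 4 then 2 else 1) + el_deg x' + el_deg y' = el_deg y}"
    using m by (intro htab_fsp) (simp_all add: eq PB_iff)
  show ?thesis unfolding eq hP_def case_prod_conv
    by (rule fsp_lin_ext[OF *])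
      (use m in \<open>auto simp: eq PB_iff el_mul_Some intro!: put_fsp split: if_splits\<close>)
qed

section \<open>The bimodule structure of the resolution\<close>

definition la_p :: "el \<Rightarrow> pel \<Rightarrow> pel option" where
  "la_p a = (\<lambda>(p, x, g, y). map_option (\<lambda>x'. (p, x', g, y)) (el_mul a x))"

text \<open>A stored right factor y stands for right multiplication of the generator by
  \<open>tw p y\<close>, so a acts through the inverse twist.\<close>

definition ra_p :: "pel \<Rightarrow> el \<Rightarrow> pel option" where
  "ra_p m a = (case m of (p, x, g, y) \<Rightarrow> map_option (\<lambda>y'. (p, x, g, y')) (el_mul y (twi p a)))"

lemma osg_la_p: "osg (la_p a m) = lmul a m"
  by (cases m) (auto simp: la_p_def lmul_eq osg_def put_def split: option.splits)

interpretation P: basis_bimodule el_mul el_src el_tgt el_vs el_deg la_p ra_p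
proof
  fix m :: pel and a b
  obtain p x g y where m: "m = (p, x, g, y)" by (cases m)
  show "Option.bind (ra_p m a) (\<lambda>n. ra_p n b) = Option.bind (el_mul a b) (ra_p m)"
    using el_mul_assoc[of y "twi p a" "twi p b"] twi_mul[of p a b]
    by (auto simp: m ra_p_def split: option.splits bind_splits)
  show "Option.bind (la_p a m) (la_p b) = Option.bind (el_mul b a) (\<lambda>c. la_p c m)"
    using el_mul_assoc[of b a x] by (auto simp: m la_p_def split: option.splits bind_splits)
  show "Option.bind (la_p a m) (\<lambda>n. ra_p n b) = Option.bind (ra_p m b) (la_p a)"
    by (auto simp: m ra_p_def la_p_def split: option.splits bind_splits)
qed

lemma dP_ra: "lin_ext dP (osg (ra_p m a)) = lin_ext (\<lambda>n. osg (ra_p n a)) (dP m)"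
proof -
  obtain p x g y where m: "m = (p, x, g, y)" by (cases m)
  show ?thesis
  proof (cases p)
    case 0
    then show ?thesis by (auto simp: m ra_p_def osg_def split: option.splits)
  next
    case (Suc q)
    let ?f = "\<lambda>b. if stage (Suc q) = 4 then map_elt pv b else b"
    \<comment> \<open>\<open>?f\<close> is an automorphism carrying \<open>twi (Suc q) a\<close> to
      \<open>twi q a\<close>; this is where the change of twist in \<open>dP\<close> is
      absorbed.\<close>
    have f: "el_mul (?f y) (twi q a) = map_option ?f (el_mul y (twi (Suc q) a))"
      using map_elt_mul[of pv y "twi (Suc q) a"] twi_Suc[of q a]
      by (auto simp: inj_def option.map_ident split: if_splits)
    have put: "lin_ext (\<lambda>n. osg (ra_p n a)) (put q u g' (el_mul y' (?f y)))
      = (case el_mul y (twi (Suc q) a) of None \<Rightarrow> 0 | Some z \<Rightarrow> put q u g' (el_mul y' (?f z)))" for u g' y'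
      using el_mul_assoc[of y' "?f y" "twi q a"] unfolding f
      by (cases u; cases "el_mul y (twi (Suc q) a)"; cases "el_mul y' (?f y)")
        (auto simp: ra_p_def put_def osg_def split: option.splits)
    show ?thesis
      by (cases "el_mul y (twi (Suc q) a)")
        (simp_all add: m Suc ra_p_def[of "(_, _)"] lin_ext_comp case_prod_unfold put)
  qed
qed

interpretation dP: basis_bimodule_hom el_mul el_src el_tgt el_vs el_deg la_p ra_p la_p ra_p dP
proof
  show "lin_ext dP (osg (la_p a m)) = lin_ext (\<lambda>n. osg (la_p a n)) (dP m)" for a m
    unfolding osg_la_p by (rule dP_lmul)
  show "lin_ext dP (osg (ra_p m a)) = lin_ext (\<lambda>n. osg (ra_p n a)) (dP m)" for a m
    by (rule dP_ra)
qed

interpretation epsP: basis_bimodule_hom el_mul el_src el_tgt el_vs el_deg la_p ra_p el_mul el_mul epsP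
proof
  fix a and m :: pel
  obtain p x g y where m: "m = (p, x, g, y)" by (cases m)
  show "lin_ext epsP (osg (la_p a m)) = lin_ext (\<lambda>n. osg (el_mul a n)) (epsP m)"
    using el_mul_assoc[of a x y]
    by (cases "el_mul a x"; cases "el_mul x y") (auto simp: m la_p_def epsP_def)
  show "lin_ext epsP (osg (ra_p m a)) = lin_ext (\<lambda>n. osg (el_mul n a)) (epsP m)"
    using el_mul_assoc[of x y a]
    by (cases "p = 0"; cases "el_mul x y"; cases "el_mul y a") (auto simp: m ra_p_def epsP_def osg_def split: option.splits)
qed

lemma epsP_dP: "lin_ext epsP (dP m) = 0"
proof -
  obtain p x g y where m: "m = (p, x, g, y)" by (cases m)
  have e: "lin_ext epsP (put 0 u g' v) = (case (u, v) of (Some x, Some y) \<Rightarrow> osg (el_mul x y) | _ \<Rightarrow> 0)" for u g' v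
    by (auto simp: put_def epsP_def split: option.splits)
  have e': "lin_ext epsP (put (Suc q) u g' v) = 0" for u g' v q
    by (auto simp: put_def epsP_def split: option.splits)
  consider "p = 0" | "p = 1" | q where "p = Suc (Suc q)" by (cases p rule: nat.exhaust; cases "p - 1") auto
  then show ?thesis
  proof cases
    case 2
    have 1: "lin_ext epsP (put 0 (el_mul x g) (el_tgt g) (el_mul (el_tgt g) y)) = osg (Option.bind (el_mul x g) (\<lambda>z. el_mul z y))"
    proof (cases "el_src y = el_tgt g")
      case True
      then have "el_mul (el_tgt g) y = Some y" by (metis el_mul_unit(1))
      then show ?thesis by (simp add: e split: option.splits)
    next
      case False
      then have "el_mul (el_tgt g) y = None" by (intro el_mul_None) simp
      moreover have "el_mul z y = None" if "el_mul x g = Some z" for z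
        by (rule el_mul_None) (use el_mul_Some(3)[OF that] False in simp)
      ultimately show ?thesis by (cases "el_mul x g") simp_all
    qed
    have 2: "lin_ext epsP (put 0 (el_mul x (el_src g)) (el_src g) (el_mul g y)) = osg (Option.bind (el_mul g y) (el_mul x))"
    proof (cases "el_tgt x = el_src g")
      case True
      then have "el_mul x (el_src g) = Some x" by (metis el_mul_unit(2))
      then show ?thesis by (simp add: e split: option.splits)
    next
      case False
      then have "el_mul x (el_src g) = None" by (intro el_mul_None) simp
      moreover have "el_mul x z = None" if "el_mul g y = Some z" for z
        by (rule el_mul_None) (use el_mul_Some(2)[OF that] False in simp)
      ultimately show ?thesis by (cases "el_mul g y") simp_all
    qed
    show ?thesis using 1 2 el_mul_assoc[of x g y]
      by (simp add: m \<open>p = 1\<close> stage_Suc dtab_def lin_ext_diff)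
  qed (simp_all add: m lin_ext_comp case_prod_unfold e')
qed


section \<open>Comparison of the bar complex with the periodic resolution\<close>

text \<open>Basis of the total complex of the double complex in homological degree n and internal
  degree j.\<close>

definition TB :: "nat \<Rightarrow> int \<Rightarrow> (pel \<times> el list) set" where
  "TB n j = {(m, as). \<exists>p i. m \<in> PB p i \<and> p + length as = n \<and> i + sum_list (map el_deg as) = j}"

definition (in mult_basis) CB :: "nat \<Rightarrow> int \<Rightarrow> 'b list set" where
  "CB n j = {xs. length xs = Suc n \<and> sum_list (map deg xs) = j}"

lemma (in mult_basis) bar_CB: "bar as \<in> fsp {bs. length bs = length as - 1 \<and> sum_list (map deg bs) = sum_list (map deg as)}"
proof (induction as rule: bar.induct)
  case (1 a c as)
  show ?case unfolding bar.simps consv_def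
    by (intro fsp_diff fsp_lin_ext[OF 1])
      (auto simp: osg_def deg_mul intro!: fsp_single split: option.splits)
qed auto


lemma la_p_PB: "m \<in> PB p i \<Longrightarrow> la_p a m = Some n \<Longrightarrow> n \<in> PB p (i + el_deg a)"
  by (cases m) (auto simp: la_p_def PB_def pvalid_def pdeg_def el_mul_Some)

lemma ra_p_PB: "m \<in> PB p i \<Longrightarrow> ra_p m a = Some n \<Longrightarrow> n \<in> PB p (i + el_deg a)"
  by (cases m) (auto simp: ra_p_def PB_def pvalid_def pdeg_def el_mul_Some)

lemma sum_list_butlast_last:
  fixes f :: "'b \<Rightarrow> 'c::comm_monoid_add"
  shows "xs \<noteq> [] \<Longrightarrow> sum_list (map f xs) = sum_list (map f (butlast xs)) + f (last xs)"
  by (cases xs rule: rev_cases) simp_all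

lemma hochm_nil: "P.hochm (m, []) = 0"
  by (simp add: P.hochm_def P.ract_def P.mid_def P.lact_def)

lemma hochm_fsp:
  assumes "m \<in> PB p i"
  shows "P.hochm (m, as) \<in> fsp {(n, bs). length as = Suc (length bs) \<and>
    (\<exists>i'. n \<in> PB p i' \<and> i' + sum_list (map el_deg bs) = i + sum_list (map el_deg as))}"
proof (cases as)
  case (Cons a ds)
  have r: "P.ract (m, as) \<in> fsp {(n, bs). length as = Suc (length bs) \<and>
    (\<exists>i'. n \<in> PB p i' \<and> i' + sum_list (map el_deg bs) = i + sum_list (map el_deg as))}"
    using ra_p_PB[OF assms]
    by (auto simp: P.ract_def Cons osg_def split: option.splits intro!: fsp_single exI[of _ "i + el_deg a"])
  have m: "P.mid (m, as) \<in> fsp {(n, bs). length as = Suc (length bs) \<and>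
    (\<exists>i'. n \<in> PB p i' \<and> i' + sum_list (map el_deg bs) = i + sum_list (map el_deg as))}"
    unfolding P.mid_def
    by (rule fsp_lin_ext[OF _ fsp_single], simp, rule el.bar_CB) (use assms in \<open>auto simp: Cons intro: exI[of _ i]\<close>)
  have sum: "sum_list (map el_deg as) = sum_list (map el_deg (butlast as)) + el_deg (last as)"
    by (rule sum_list_butlast_last) (simp add: Cons)
  have ne: "as \<noteq> []" by (simp add: Cons)
  have l: "P.lact (m, as) \<in> fsp {(n, bs). length as = Suc (length bs) \<and>
    (\<exists>i'. n \<in> PB p i' \<and> i' + sum_list (map el_deg bs) = i + sum_list (map el_deg as))}"
  proof (cases "la_p (last as) m")
    case (Some n)
    then have "P.lact (m, as) = fscale ((-1) ^ length as) (sg (n, butlast as))"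
      by (simp add: P.lact_def ne)
    moreover have "n \<in> PB p (i + el_deg (last as))" using la_p_PB[OF assms Some] .
    ultimately show ?thesis
      using ne sum by (auto simp del: fscale_single intro!: fsp_scale fsp_single)
  qed (simp add: P.lact_def)
  show ?thesis unfolding P.hochm_def by (intro fsp_add fsp_diff r m l)
qed (simp add: hochm_nil)

lemma fsp_mono: "x \<in> fsp X \<Longrightarrow> X \<subseteq> Y \<Longrightarrow> x \<in> fsp Y"
  by (auto simp: fsp_def)

section \<open>The double complex and its contraction onto Hochschild chains\<close>

definition bT :: "(pel \<times> el list \<Rightarrow>\<^sub>0 complex) \<Rightarrow> (pel \<times> el list \<Rightarrow>\<^sub>0 complex)" where
  "bT = lin_ext P.hochm"

text \<open>The sign makes \<open>dT\<close> anticommute with \<open>bT\<close>, which lowers the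
  length by one.\<close>

definition dT :: "(pel \<times> el list \<Rightarrow>\<^sub>0 complex) \<Rightarrow> (pel \<times> el list \<Rightarrow>\<^sub>0 complex)" where
  "dT = lin_ext (\<lambda>c. fscale ((-1) ^ length (snd c)) (dP.hat c))"

definition hT :: "(pel \<times> el list \<Rightarrow>\<^sub>0 complex) \<Rightarrow> (pel \<times> el list \<Rightarrow>\<^sub>0 complex)" where
  "hT = lin_ext (\<lambda>c. fscale ((-1) ^ length (snd c)) (lin_ext (\<lambda>n. sg (n, snd c)) (hP (fst c))))"

definition piC :: "(pel \<times> el list \<Rightarrow>\<^sub>0 complex) \<Rightarrow> (el list \<Rightarrow>\<^sub>0 complex)" where
  "piC = lin_ext (\<lambda>c. lin_ext (\<lambda>a. sg (a # snd c)) (epsP (fst c)))"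

definition sigC :: "(el list \<Rightarrow>\<^sub>0 complex) \<Rightarrow> (pel \<times> el list \<Rightarrow>\<^sub>0 complex)" where
  "sigC = lin_ext (\<lambda>xs. sg (etaP (hd xs), tl xs))"

lemma lin_T [simp]: "lin bT" "lin dT" "lin hT" "lin piC" "lin sigC"
  by (simp_all add: bT_def dT_def hT_def piC_def sigC_def)

lemma bT_sg: "bT (sg c) = P.hochm c"
  by (simp add: bT_def)

lemma dT_sg: "dT (sg (m, as)) = fscale ((-1) ^ length as) (lin_ext (\<lambda>n. sg (n, as)) (dP m))"
  by (simp add: dT_def dP.hat_def)

lemma hT_sg: "hT (sg (m, as)) = fscale ((-1) ^ length as) (lin_ext (\<lambda>n. sg (n, as)) (hP m))"
  by (simp add: hT_def)

lemma dT_tensor: "dT (lin_ext (\<lambda>n. sg (n, as)) v) = fscale ((-1) ^ length as) (lin_ext (\<lambda>n. sg (n, as)) (lin_ext dP v))"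
  by (simp add: dT_def dP.hat_def lin_ext_comp lin_ext_fun_scale)

lemma hT_tensor: "hT (lin_ext (\<lambda>n. sg (n, as)) v) = fscale ((-1) ^ length as) (lin_ext (\<lambda>n. sg (n, as)) (lin_ext hP v))"
  by (simp add: hT_def lin_ext_comp lin_ext_fun_scale)

lemma minus1_square [simp]: "(-1 :: complex) ^ n * (-1) ^ n = 1"
  by (simp flip: power_add)

lemma TB_E:
  assumes "c \<in> TB n j"
  obtains m as p i where "c = (m, as)" "m \<in> PB p i" "pvalid m" "fst m = p" "p + length as = n"
    "i + sum_list (map el_deg as) = j"
  using assms by (auto simp: TB_def PB_def)

lemma dT_TB: "c \<in> TB n j \<Longrightarrow> dT (sg c) \<in> fsp (TB (n - 1) j)"
proof (erule TB_E)
  fix m as p i assume *: "c = (m, as)" "m \<in> PB p i" "fst m = p" "p + length as = n" "i + sum_list (map el_deg as) = j"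
  show ?thesis
  proof (cases p)
    case (Suc q)
    then show ?thesis
      using * dP_PB[of m q i] unfolding *(1) dT_sg
      by (intro fsp_scale fsp_lin_ext[of _ "PB q i"]) (auto simp: TB_def intro!: fsp_single)
  qed (use * in \<open>simp add: dT_sg dP_0\<close>)
qed

lemma hT_TB: "c \<in> TB n j \<Longrightarrow> hT (sg c) \<in> fsp (TB (Suc n) j)"
proof (erule TB_E)
  fix m as p i assume *: "c = (m, as)" "m \<in> PB p i" "fst m = p" "p + length as = n" "i + sum_list (map el_deg as) = j"
  show ?thesis
    using * hP_PB[of m p i] unfolding *(1) hT_sg
    by (intro fsp_scale fsp_lin_ext[of _ "PB (Suc p) i"]) (auto simp: TB_def intro!: fsp_single)
qed

lemma bT_TB: "c \<in> TB n j \<Longrightarrow> bT (sg c) \<in> fsp (TB (n - 1) j)"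
proof (erule TB_E)
  fix m as p i assume *: "c = (m, as)" "m \<in> PB p i" "fst m = p" "p + length as = n" "i + sum_list (map el_deg as) = j"
  show ?thesis
    unfolding *(1) bT_sg by (rule fsp_mono[OF hochm_fsp[OF *(2), of as]]) (use * in \<open>fastforce simp: TB_def\<close>)
qed

lemma bT_bT: "bT (bT z) = 0"
  by (simp add: bT_def lin_ext_comp P.hochm_hochm)

text \<open>\<open>dP\<close> is a bimodule map, so without signs both orders agree; the length
  differs by one between them, so with signs they cancel.\<close>

lemma dT_bT_sg: "m \<in> PB p i \<Longrightarrow> bT (dT (sg (m, as))) + dT (bT (sg (m, as))) = 0"
proof -
  assume m: "m \<in> PB p i"
  have "dT (bT (sg (m, as))) = lin_ext (\<lambda>c. fscale ((-1) ^ length (snd c)) (dP.hat c)) (P.hochm (m, as))"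
    by (simp add: bT_sg dT_def)
  also have "\<dots> = lin_ext (\<lambda>c. - fscale ((-1) ^ length as) (dP.hat c)) (P.hochm (m, as))"
    by (rule lin_ext_eqI[OF hochm_fsp[OF m]]) auto
  also have "\<dots> = - fscale ((-1) ^ length as) (lin_ext P.hochm (dP.hat (m, as)))"
    by (simp add: lin_ext_fun_uminus lin_ext_fun_scale dP.hat_hochm)
  finally show ?thesis by (simp add: bT_def dT_def lin_ext_scale)
qed

lemma dT_dT_sg: "pvalid m \<Longrightarrow> dT (dT (sg (m, as))) = 0"
  by (simp add: dT_sg lin_scale dT_tensor dP_dP)

lemma hT_contraction_sg:
  "pvalid m \<Longrightarrow> dT (hT (sg (m, as))) + hT (dT (sg (m, as))) = sg (m, as) - sigC (piC (sg (m, as)))"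
proof -
  assume m: "pvalid m"
  have "dT (hT (sg (m, as))) + hT (dT (sg (m, as)))
     = lin_ext (\<lambda>n. sg (n, as)) (lin_ext dP (hP m) + lin_ext hP (dP m))"
    by (simp add: dT_sg hT_sg lin_scale hT_tensor dT_tensor lin_ext_add)
  also have "\<dots> = sg (m, as) - lin_ext (\<lambda>a. sg (etaP a, as)) (epsP m)"
    by (simp add: contraction[OF m] lin_ext_diff lin_ext_comp)
  also have "lin_ext (\<lambda>a. sg (etaP a, as)) (epsP m) = sigC (piC (sg (m, as)))"
    by (simp add: sigC_def piC_def lin_ext_comp)
  finally show ?thesis .
qed

lemma etaP_PB: "etaP a \<in> PB 0 (el_deg a)"
  by (auto simp: etaP_def PB_iff gen_ok_def gen_l_def gen_r_def)

lemma epsP_fsp: "m \<in> PB p i \<Longrightarrow> epsP m \<in> fsp {a. el_deg a = i}"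
  by (cases m) (auto simp: epsP_def PB_iff osg_def el_mul_Some split: option.splits intro!: fsp_single)

lemma epsP_pos: "fst m \<noteq> 0 \<Longrightarrow> epsP m = 0"
  by (cases m) (simp add: epsP_def)

lemma piC_0: "z \<in> fsp {(m, as). fst m \<noteq> 0} \<Longrightarrow> piC z = 0"
proof -
  assume "z \<in> fsp {(m :: pel, as :: el list). fst m \<noteq> 0}"
  then have "piC z = lin_ext (\<lambda>c. 0) z" unfolding piC_def
    by (rule lin_ext_eqI) (auto simp: epsP_pos)
  then show ?thesis by simp
qed

text \<open>The augmentation is a bimodule map. Hence the reduced differential on the Hochschild
  chains is exactly b, with no correction terms.\<close>

lemma piC_bT: "piC (bT z) = lin_ext el.hoch (piC z)"
proof -
  have "piC (P.hochm c) = lin_ext el.hoch (piC (sg c))" for c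
  proof -
    have "piC (P.hochm c) = lin_ext (\<lambda>c. sg (fst c # snd c)) (lin_ext epsP.hat (P.hochm c))"
      by (simp add: piC_def lin_ext_comp epsP.hat_def)
    also have "\<dots> = lin_ext (\<lambda>c. lin_ext (\<lambda>c. sg (fst c # snd c)) (el.reg.hochm c)) (epsP.hat c)"
      by (simp add: epsP.hat_hochm lin_ext_comp)
    also have "\<dots> = lin_ext (\<lambda>c. el.hoch (fst c # snd c)) (epsP.hat c)"
      by (simp add: el.hoch_Cons)
    finally show ?thesis by (simp add: piC_def epsP.hat_def lin_ext_comp)
  qed
  then show ?thesis by (simp add: bT_def piC_def lin_ext_comp)
qed

lemma fsp_linD: "lin f \<Longrightarrow> (\<And>c. c \<in> X \<Longrightarrow> f (sg c) \<in> fsp Y) \<Longrightarrow> z \<in> fsp X \<Longrightarrow> f z \<in> fsp Y"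
  by (rule fsp_lin)

lemma subspace_fsp: "fvs.subspace (fsp X)"
  by (auto simp: fvs.subspace_def intro: fsp_add fsp_scale)

lemma hT_pos: "c \<in> TB n j \<Longrightarrow> hT (sg c) \<in> fsp {(m, as). fst m \<noteq> 0}"
proof (erule TB_E)
  fix m as p i assume *: "c = (m, as)" "m \<in> PB p i"
  show ?thesis
    using hP_PB[OF *(2)] unfolding *(1) hT_sg
    by (intro fsp_scale fsp_lin_ext[of _ "PB (Suc p) i"]) (auto simp: PB_def intro!: fsp_single)
qed

text \<open>\<open>bT\<close> does not change p, while \<open>hT\<close> makes p positive and
  \<open>piC\<close> sees only p = 0; this gives the side condition
  \<open>\<pi>\<delta>s\<close>.\<close>

lemma bT_pos: "z \<in> fsp {(m, as). pvalid m \<and> fst m \<noteq> 0} \<Longrightarrow> bT z \<in> fsp {(m, as). fst m \<noteq> 0}"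
proof (rule fsp_lin[of bT], simp, assumption)
  fix c assume "c \<in> {(m, as :: el list). pvalid m \<and> fst m \<noteq> 0}"
  then obtain m as where c: "c = (m, as)" "m \<in> PB (fst m) (pdeg m)" "fst m \<noteq> 0" by (auto simp: PB_def)
  then show "bT (sg c) \<in> fsp {(m, as). fst m \<noteq> 0}"
    using hochm_fsp[OF c(2), of as] unfolding bT_sg by (auto simp: fsp_def PB_def)
qed

lemma TB_pos_Int: "TB n j \<inter> {(m, as). fst m \<noteq> 0} \<subseteq> {(m, as). pvalid m \<and> fst m \<noteq> 0}"
  by (auto simp: TB_def PB_def)

text \<open>Here \<open>dT\<close> is contracted by \<open>hT\<close>, and \<open>bT\<close> is the
  perturbation. The filtration counts bar factors: \<open>bT\<close> lowers their number and
  \<open>hT\<close> keeps it.\<close>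

interpretation row: perturbed_contraction "\<lambda>n. fsp (TB n j)" "\<lambda>n. fsp (el.CB n j)" dT bT hT sigC piC
  "\<lambda>k. fsp {(m, as). pvalid m \<and> length as < k}" for j
proof
  fix n z assume z: "z \<in> fsp (TB n j)"
  note eqI = lin_eqI[OF _ _ z]
  show dz: "dT z \<in> fsp (TB (n - 1) j)" by (rule fsp_linD[of dT, OF _ _ z], simp, erule dT_TB)
  show bz: "bT z \<in> fsp (TB (n - 1) j)" by (rule fsp_linD[of bT, OF _ _ z], simp, erule bT_TB)
  show hz: "hT z \<in> fsp (TB (Suc n) j)" by (rule fsp_linD[of hT, OF _ _ z], simp, erule hT_TB)
  show "piC z \<in> fsp (el.CB n j)"
  proof (rule fsp_linD[OF _ _ z])
    fix c assume "c \<in> TB n j"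
    then obtain m as p i where *: "c = (m, as)" "m \<in> PB p i" "fst m = p" "p + length as = n" "i + sum_list (map el_deg as) = j"
      by (rule TB_E)
    show "piC (sg c) \<in> fsp (el.CB n j)"
    proof (cases "p = 0")
      case True
      then show ?thesis using * epsP_fsp[OF *(2)]
        by (auto simp: piC_def el.CB_def intro!: fsp_lin_ext[OF epsP_fsp[OF *(2)]] fsp_single)
    qed (use * in \<open>simp add: piC_def epsP_pos\<close>)
  qed simp
  show "bT (bT z) = 0" by (rule bT_bT)
  show "dT (dT z) = 0"
    by (rule eqI[of "\<lambda>z. dT (dT z)" "\<lambda>z. 0"]) (auto simp: lin_comp lin_const0 dT_dT_sg elim!: TB_E)
  show "dT (bT z) + bT (dT z) = 0"
    by (rule eqI[of "\<lambda>z. dT (bT z) + bT (dT z)" "\<lambda>z. 0"])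
      (auto simp: lin_comp lin_plus lin_const0 add.commute[of "dT _"] dT_bT_sg elim!: TB_E)
  show "dT (hT z) + hT (dT z) = z - sigC (piC z)"
    by (rule eqI[of "\<lambda>z. dT (hT z) + hT (dT z)" "\<lambda>z. z - sigC (piC z)"])
      (auto simp: lin_comp lin_plus lin_minus lin_id hT_contraction_sg elim!: TB_E)
  show "piC (dT z) = 0"
  proof (rule eqI[of "\<lambda>z. piC (dT z)" "\<lambda>z. 0"])
    fix c assume "c \<in> TB n j"
    obtain m as where c: "c = (m, as)" by (cases c)
    have "piC (dT (sg c)) = fscale ((-1) ^ length as) (lin_ext (\<lambda>a. sg (a # as)) (lin_ext epsP (dP m)))"
      by (simp add: c dT_sg piC_def lin_ext_scale lin_ext_comp)
    then show "piC (dT (sg c)) = 0" by (simp add: epsP_dP)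
  qed (auto simp: lin_comp lin_const0)
  have hp: "hT z \<in> fsp {(m, as). fst m \<noteq> 0}"
    by (rule fsp_linD[of hT, OF _ hT_pos z]) simp_all
  show "piC (hT z) = 0" by (rule piC_0[OF hp])
  have "hT z \<in> fsp {(m, as). pvalid m \<and> fst m \<noteq> 0}"
    using hp hz TB_pos_Int[of "Suc n" j] unfolding fsp_def by blast
  then show "piC (bT (hT z)) = 0" by (intro piC_0 bT_pos)
  show "z \<in> fsp {(m, as). pvalid m \<and> length as < Suc n}"
    using z by (auto simp: fsp_def TB_def PB_def)
  fix k assume "z \<in> fsp {(m, as). pvalid m \<and> length as < Suc k}"
  then have zk: "z \<in> fsp (TB n j \<inter> {(m, as). pvalid m \<and> length as < Suc k})"
    using z by (auto simp: fsp_def)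
  show "hT (bT z) + bT (hT z) \<in> fsp {(m, as). pvalid m \<and> length as < k}"
  proof (rule fsp_linD[of "\<lambda>z. hT (bT z) + bT (hT z)", OF _ _ zk])
    fix c assume "c \<in> TB n j \<inter> {(m, as). pvalid m \<and> length as < Suc k}"
    then obtain m as p i where *: "c = (m, as)" "m \<in> PB p i" "length as < Suc k"
      by (auto elim!: TB_E)
    let ?Y = "{(m, as :: el list). \<exists>p i. m \<in> PB p i \<and> Suc (length as) = length (snd c)}"
    have Y: "?Y \<subseteq> {(m, as). pvalid m \<and> length as < k}" using * by (auto simp: PB_def)
    have h: "hT (sg (m', bs)) \<in> fsp {(m, as). (\<exists>p i. m \<in> PB p i) \<and> length as = length bs}"
      if "m' \<in> PB p i" for m' bs p i
      unfolding hT_sg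
      by (rule fsp_scale, rule fsp_lin_ext[OF hP_PB[OF that]]) (auto intro!: fsp_single)
    have b: "bT (sg (m', bs)) \<in> fsp {(m, as). (\<exists>p i. m \<in> PB p i) \<and> length bs = Suc (length as)}"
      if "m' \<in> PB p i" for m' bs p i
      using hochm_fsp[OF that, of bs] unfolding bT_sg fsp_def by blast
    have "hT (bT (sg c)) \<in> fsp ?Y"
      unfolding *(1) by (rule fsp_linD[OF _ _ b[OF *(2), of as]], simp) (use h in \<open>fastforce simp: fsp_def *(1)\<close>)
    moreover have "bT (hT (sg c)) \<in> fsp ?Y"
      unfolding *(1) by (rule fsp_linD[OF _ _ h[OF *(2), of as]], simp) (use b in \<open>fastforce simp: fsp_def *(1)\<close>)
    ultimately have "hT (bT (sg c)) + bT (hT (sg c)) \<in> fsp ?Y" by (rule fsp_add)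
    then show "hT (bT (sg c)) + bT (hT (sg c)) \<in> fsp {(m, as). pvalid m \<and> length as < k}"
      using Y unfolding fsp_def by blast
  qed (simp add: lin_comp lin_plus)
next
  fix z assume z: "z \<in> fsp (TB 0 j)"
  show "dT z + bT z = 0"
    by (rule lin_eqI[OF _ _ z, of "\<lambda>z. dT z + bT z" "\<lambda>z. 0"])
      (auto simp: lin_plus lin_const0 dT_sg bT_sg dP_0 hochm_nil elim!: TB_E)
next
  fix n k assume k: "k \<in> fsp (el.CB n j)"
  show "sigC k \<in> fsp (TB n j)"
  proof (rule fsp_linD[OF _ _ k])
    fix xs assume "xs \<in> el.CB n j"
    then obtain a as where "xs = a # as" "length as = n" "el_deg a + sum_list (map el_deg as) = j"
      by (cases xs) (auto simp: el.CB_def)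
    then show "sigC (sg xs) \<in> fsp (TB n j)"
      using etaP_PB[of a] by (auto simp: sigC_def TB_def intro!: fsp_single)
  qed simp
  show "piC (sigC k) = k"
  proof (rule lin_eqI[OF _ _ k, of "\<lambda>k. piC (sigC k)" "\<lambda>k. k"])
    fix xs assume "xs \<in> el.CB n j"
    then obtain a as where "xs = a # as" by (cases xs) (auto simp: el.CB_def)
    then show "piC (sigC (sg xs)) = sg xs" by (simp add: sigC_def piC_def etaP_def epsP_def)
  qed (simp_all add: lin_comp lin_id)
qed (auto simp: subspace_fsp)

lemma row_dK: "row.dK k = el.b_op k" if "k \<in> fsp (el.CB n j)"
  using row.\<pi>\<sigma>[OF that] by (simp add: row.dK_def piC_bT)


section \<open>Contraction of the columns onto the closed generators\<close>

definition KB :: "nat \<Rightarrow> int \<Rightarrow> (nat \<times> el \<times> el) set" where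
  "KB n j = {(p, g, z). p = n \<and> gen_ok (stage n) g \<and> el_src z = tw n (gen_r (stage n) g) \<and>
     el_tgt z = gen_l (stage n) g \<and> gdeg n + el_deg z = j}"

text \<open>Splits the right factor off as a new first bar slot: the standard contraction of
  Hochschild chains with coefficients in a projective bimodule.\<close>

definition sT :: "(pel \<times> el list \<Rightarrow>\<^sub>0 complex) \<Rightarrow> (pel \<times> el list \<Rightarrow>\<^sub>0 complex)" where
  "sT = lin_ext (\<lambda>((p, x, g, y), as). sg ((p, x, g, gen_r (stage p) g), tw p y # as))"

text \<open>Closes x \<otimes> g \<otimes> y up to a loop: in bar length 0 the homology of a
  projective bimodule is the space of generators decorated with cyclic products, and in positive
  length it is zero.\<close>

definition piK :: "(pel \<times> el list \<Rightarrow>\<^sub>0 complex) \<Rightarrow> (nat \<times> el \<times> el \<Rightarrow>\<^sub>0 complex)" where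
  "piK = lin_ext (\<lambda>((p, x, g, y), as). if as = [] then lin_ext (\<lambda>z. sg (p, g, z)) (osg (el_mul (tw p y) x)) else 0)"

definition sigK :: "(nat \<times> el \<times> el \<Rightarrow>\<^sub>0 complex) \<Rightarrow> (pel \<times> el list \<Rightarrow>\<^sub>0 complex)" where
  "sigK = lin_ext (\<lambda>(p, g, z). sg ((p, z, g, gen_r (stage p) g), []))"

lemma lin_K [simp]: "lin sT" "lin piK" "lin sigK"
  by (simp_all add: sT_def piK_def sigK_def)

lemma sT_sg: "sT (sg ((p, x, g, y), as)) = sg ((p, x, g, gen_r (stage p) g), tw p y # as)"
  by (simp add: sT_def)

lemma piK_sg: "piK (sg ((p, x, g, y), as)) =
    (if as = [] then lin_ext (\<lambda>z. sg (p, g, z)) (osg (el_mul (tw p y) x)) else 0)"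
  by (simp add: piK_def)

lemma piK_0: "z \<in> fsp {(m, as). as \<noteq> []} \<Longrightarrow> piK z = 0"
proof -
  assume "z \<in> fsp {(m :: pel, as :: el list). as \<noteq> []}"
  then have "piK z = lin_ext (\<lambda>c. 0) z" unfolding piK_def
    by (rule lin_ext_eqI) (auto split: prod.splits)
  then show ?thesis by simp
qed

lemma gen_r_idem: "gen_ok s g \<Longrightarrow> el_src (gen_r s g) = gen_r s g" "gen_ok s g \<Longrightarrow> el_deg (gen_r s g) = 0"
  by (auto simp: gen_ok_def gen_r_def el_deg0 split: if_splits)

lemma ra_top: "el_src y = e \<Longrightarrow> ra_p (p, x, g, e) (tw p y) = Some (p, x, g, y)"
  using el_mul_unit(1)[of y] by (auto simp: ra_p_def)

text \<open>The first face of the split chain undoes the split and the other faces cancel against sT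
  bT. In length 0 the last face survives, and it is the closing map.\<close>

lemma sT_contraction_sg:
  assumes "pvalid m"
  shows "bT (sT (sg (m, as))) + sT (bT (sg (m, as))) = sg (m, as) - sigK (piK (sg (m, as)))"
proof -
  obtain p x g y where m: "m = (p, x, g, y)" by (cases m)
  define e where "e = gen_r (stage p) g"
  have e: "el_src y = e" using assms by (simp add: m pvalid_def e_def)
  define me where "me = (p, x, g, e)"
  have s: "sT (sg (m, as)) = sg (me, tw p y # as)" for as by (simp add: m sT_sg e_def me_def)
  have ra: "ra_p me (tw p y) = Some m" using e by (simp add: me_def m ra_top)
  have la: "lin_ext (\<lambda>n. sT (sg (n, bs))) (osg (la_p a m)) = lin_ext (\<lambda>n. sg (n, tw p y # bs)) (osg (la_p a me))"
    for a bs by (cases "el_mul a x") (simp_all add: la_p_def m me_def sT_sg e_def)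
  show ?thesis
  proof (cases as)
    case Nil
    have "bT (sT (sg (m, as))) = sg (m, []) - lin_ext (\<lambda>n. sg (n, [])) (osg (la_p (tw p y) me))"
      by (simp add: Nil s bT_sg P.hochm_def P.ract_def P.mid_def P.lact_def ra)
    moreover have "bT (sg (m, as)) = 0" by (simp add: Nil bT_sg hochm_nil)
    moreover have "sigK (piK (sg (m, as))) = lin_ext (\<lambda>n. sg (n, [])) (osg (la_p (tw p y) me))"
      by (cases "el_mul (tw p y) x") (simp_all add: Nil m me_def piK_sg sigK_def la_p_def e_def)
    ultimately show ?thesis by (simp add: Nil lin_0)
  next
    case (Cons a ds)
    have sr: "sT (P.ract (m, as)) = lin_ext (\<lambda>w. sg (me, w # ds)) (osg (el_mul (tw p y) a))"
    proof -
      have "el_mul (tw p y) a = map_option (tw p) (el_mul y (twi p a))"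
        using tw_mul[of p y "twi p a"] by simp
      then show ?thesis
        by (cases "el_mul y (twi p a)") (simp_all add: Cons P.ract_def m ra_p_def sT_sg me_def e_def lin_0)
    qed
    have sm: "sT (P.mid (m, as)) = lin_ext (\<lambda>bs. sg (me, tw p y # bs)) (el.bar as)"
      by (simp add: P.mid_def sT_def lin_ext_comp m me_def e_def)
    have sl: "sT (P.lact (m, as)) = fscale ((-1) ^ length as)
        (lin_ext (\<lambda>n. sg (n, tw p y # butlast as)) (osg (la_p (last as) me)))"
      using la[of "butlast as" "last as"] by (simp add: P.lact_def Cons sT_def lin_ext_scale lin_ext_comp lin_ext_uminus)
    have r: "P.ract (me, tw p y # as) = sg (m, as)" by (simp add: P.ract_def ra)
    have mi: "P.mid (me, tw p y # as) = lin_ext (\<lambda>w. sg (me, w # ds)) (osg (el_mul (tw p y) a))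
        - lin_ext (\<lambda>bs. sg (me, tw p y # bs)) (el.bar as)"
      by (simp add: P.mid_def Cons lin_ext_diff lin_ext_comp consv_def)
    have l: "P.lact (me, tw p y # as) = - fscale ((-1) ^ length as)
        (lin_ext (\<lambda>n. sg (n, tw p y # butlast as)) (osg (la_p (last as) me)))"
      by (simp add: P.lact_def Cons)
    have "bT (sT (sg (m, as))) + sT (bT (sg (m, as))) = sg (m, as)"
      unfolding s bT_sg P.hochm_def[of "(me, _)"] P.hochm_def[of "(m, as)"] r mi l
      by (simp add: lin_add lin_diff sr sm sl)
    moreover have "piK (sg (m, as)) = 0" by (simp add: Cons m piK_sg)
    ultimately show ?thesis by (simp add: lin_0)
  qed
qed

lemma sT_TB: "c \<in> TB n j \<Longrightarrow> sT (sg c) \<in> fsp (TB (Suc n) j)"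
proof (erule TB_E)
  fix m as p i assume *: "c = (m, as)" "m \<in> PB p i" "fst m = p" "p + length as = n" "i + sum_list (map el_deg as) = j"
  obtain x g y where m: "m = (p, x, g, y)" using *(3) by (cases m) auto
  have "(p, x, g, gen_r (stage p) g) \<in> PB p (gdeg p + el_deg x)"
    using *(2) by (simp add: m PB_iff gen_r_idem)
  moreover have "i = gdeg p + el_deg x + el_deg y" using *(2) by (simp add: m PB_iff)
  ultimately show ?thesis
    using * unfolding *(1) m sT_sg
    by (intro fsp_single) (auto simp: TB_def intro!: exI[of _ "gdeg p + el_deg x"])
qed

lemma sT_nonempty: "sT z \<in> fsp {(m, as). as \<noteq> []}"
  by (rule fsp_lin[of sT _ UNIV]) (auto simp: sT_def intro!: fsp_single)

lemma dT_nonempty: "z \<in> fsp {(m, as). as \<noteq> []} \<Longrightarrow> dT z \<in> fsp {(m, as). as \<noteq> []}"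
proof (rule fsp_lin[of dT], simp, assumption)
  fix c :: "pel \<times> el list" assume "c \<in> {(m, as). as \<noteq> []}"
  then obtain m as where c: "c = (m, as)" "as \<noteq> []" by auto
  then show "dT (sg c) \<in> fsp {(m, as). as \<noteq> []}" unfolding c(1) dT_sg
    by (intro fsp_scale fsp_lin_ext[of _ UNIV]) (auto intro!: fsp_single)
qed

text \<open>With a single bar factor a, the right and the left action close up to the same cyclic
  product (tw p y) a x.\<close>

lemma piK_bT_sg: "m \<in> PB p i \<Longrightarrow> piK (bT (sg (m, as))) = 0"
proof -
  assume m: "m \<in> PB p i"
  obtain x g y where eq: "m = (p, x, g, y)" using m by (cases m) (auto simp: PB_def)
  consider "as = []" | a where "as = [a]" | a c ds where "as = a # c # ds" by (cases as rule: el.bar.cases) auto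
  then show ?thesis
  proof cases
    case 2
    have "el_mul (tw p y) a = map_option (tw p) (el_mul y (twi p a))"
      using tw_mul[of p y "twi p a"] by (simp add: eq)
    then have "Option.bind (el_mul y (twi p a)) (\<lambda>w. el_mul (tw p w) x) = Option.bind (el_mul a x) (el_mul (tw p y))"
      using el_mul_assoc[of "tw p y" a x] by (cases "el_mul y (twi p a)") (simp_all add: eq)
    then show ?thesis
      by (cases "el_mul y (twi p a)"; cases "el_mul a x")
        (simp_all add: 2 eq bT_sg P.hochm_def P.ract_def P.mid_def P.lact_def piK_def lin_ext_linear
          ra_p_def la_p_def eq_commute[of None])
  next
    case 3
    have "bT (sg (m, as)) \<in> fsp {(m, as). as \<noteq> []}"
      unfolding bT_sg by (rule fsp_mono[OF hochm_fsp[OF m, of as]]) (auto simp: 3)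
    then show ?thesis by (rule piK_0)
  qed (simp add: bT_sg hochm_nil lin_0)
qed

text \<open>The roles are exchanged: \<open>bT\<close> is contracted by \<open>sT\<close>, and
  \<open>dT\<close> is the perturbation. The filtration is by p, which \<open>dT\<close> lowers and
  \<open>sT\<close> keeps.\<close>

interpretation col: perturbed_contraction "\<lambda>n. fsp (TB n j)" "\<lambda>n. fsp (KB n j)" bT dT sT sigK piK
  "\<lambda>k. fsp {(m, as). fst m < k}" for j
proof
  fix n z assume z: "z \<in> fsp (TB n j)"
  note eqI = lin_eqI[OF _ _ z]
  show "dT z \<in> fsp (TB (n - 1) j)" using row.\<beta>T[OF z] .
  show "bT z \<in> fsp (TB (n - 1) j)" using row.\<delta>T[OF z] .
  show "bT (bT z) = 0" by (rule bT_bT)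
  show "dT (dT z) = 0" using row.\<beta>\<beta>[OF z] .
  show "bT (dT z) + dT (bT z) = 0" using row.\<beta>\<delta>[OF z] by (simp add: add.commute)
  show "sT z \<in> fsp (TB (Suc n) j)" by (rule fsp_linD[of sT, OF _ _ z], simp, erule sT_TB)
  show "piK z \<in> fsp (KB n j)"
  proof (rule fsp_linD[of piK, OF _ _ z])
    fix c assume "c \<in> TB n j"
    then obtain m as p i where *: "c = (m, as)" "m \<in> PB p i" "fst m = p" "p + length as = n" "i + sum_list (map el_deg as) = j"
      by (rule TB_E)
    obtain x g y where m: "m = (p, x, g, y)" using *(3) by (cases m) auto
    show "piK (sg c) \<in> fsp (KB n j)"
    proof (cases "el_mul (tw p y) x")
      case (Some w)
      then show ?thesis using * el_mul_Some[OF Some]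
        by (auto simp: m piK_sg KB_def PB_iff intro!: fsp_single)
    qed (simp add: * m piK_sg)
  qed simp
  show "bT (sT z) + sT (bT z) = z - sigK (piK z)"
    by (rule eqI[of "\<lambda>z. bT (sT z) + sT (bT z)" "\<lambda>z. z - sigK (piK z)"])
      (auto simp: lin_comp lin_plus lin_minus lin_id sT_contraction_sg elim!: TB_E)
  show "piK (bT z) = 0"
    by (rule eqI[of "\<lambda>z. piK (bT z)" "\<lambda>z. 0"]) (auto simp: lin_comp lin_const0 piK_bT_sg elim!: TB_E)
  show "piK (sT z) = 0" by (rule piK_0[OF sT_nonempty])
  show "piK (dT (sT z)) = 0" by (rule piK_0[OF dT_nonempty[OF sT_nonempty]])
  show "z \<in> fsp {(m, as). fst m < Suc n}"
    using z by (auto simp: fsp_def TB_def PB_def)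
  fix k assume "z \<in> fsp {(m, as). fst m < Suc k}"
  then have zk: "z \<in> fsp (TB n j \<inter> {(m, as). fst m < Suc k})"
    using z by (auto simp: fsp_def)
  show "sT (dT z) + dT (sT z) \<in> fsp {(m, as). fst m < k}"
  proof (rule fsp_linD[of "\<lambda>z. sT (dT z) + dT (sT z)", OF _ _ zk])
    fix c assume "c \<in> TB n j \<inter> {(m, as). fst m < Suc k}"
    then obtain m as p i where *: "c = (m, as)" "m \<in> PB p i" "fst m = p" "p < Suc k"
      by (auto elim!: TB_E)
    have s: "sT y \<in> fsp {(m, as). fst m < l}" if "y \<in> fsp {(m, as). fst m < l}" for y l
      by (rule fsp_linD[of sT, OF _ _ that]) (auto simp: sT_sg intro!: fsp_single)
    have d: "dT (sg (m', bs)) \<in> fsp {(m, as). fst m < k}" if m': "m' \<in> PB p i'" for m' bs i'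
    proof (cases p)
      case 0
      then show ?thesis using m' by (simp add: dT_sg dP_0 PB_def)
    next
      case (Suc q)
      then show ?thesis using dP_PB[of m' q i'] m' *(4) unfolding dT_sg
        by (intro fsp_scale fsp_lin_ext[of _ "PB q i'"]) (auto simp: PB_def intro!: fsp_single)
    qed
    obtain x g y where m: "m = (p, x, g, y)" using *(3) by (cases m) auto
    have "(p, x, g, gen_r (stage p) g) \<in> PB p (gdeg p + el_deg x)"
      using *(2) by (simp add: m PB_iff gen_r_idem)
    then have "dT (sT (sg c)) \<in> fsp {(m, as). fst m < k}"
      unfolding *(1) m sT_sg by (rule d)
    moreover have "sT (dT (sg c)) \<in> fsp {(m, as). fst m < k}"
      unfolding *(1) by (rule s[OF d[OF *(2)]])
    ultimately show "sT (dT (sg c)) + dT (sT (sg c)) \<in> fsp {(m, as). fst m < k}" by (intro fsp_add)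
  qed (simp add: lin_comp lin_plus)
next
  fix z assume "z \<in> fsp (TB 0 j)"
  then show "bT z + dT z = 0" using row.T0 by (simp add: add.commute)
next
  fix n k assume k: "k \<in> fsp (KB n j)"
  show "sigK k \<in> fsp (TB n j)"
  proof (rule fsp_linD[of sigK, OF _ _ k])
    fix c assume "c \<in> KB n j"
    then obtain g z where "c = (n, g, z)" "(n, z, g, gen_r (stage n) g) \<in> PB n j"
      by (auto simp: KB_def PB_iff gen_r_idem)
    then show "sigK (sg c) \<in> fsp (TB n j)" by (auto simp: sigK_def TB_def intro!: fsp_single)
  qed simp
  show "piK (sigK k) = k"
  proof (rule lin_eqI[OF _ _ k, of "\<lambda>k. piK (sigK k)" "\<lambda>k. k"])
    fix c assume "c \<in> KB n j"
    then obtain g z where c: "c = (n, g, z)" "el_src z = tw n (gen_r (stage n) g)" by (auto simp: KB_def)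
    then show "piK (sigK (sg c)) = sg c"
      using el_mul_unit(1)[of z] by (simp add: sigK_def piK_sg)
  qed (simp_all add: lin_comp lin_id)
qed (auto simp: subspace_fsp)

lemma row_D_eq_col_D: "row.D = col.D"
  by (simp add: fun_eq_iff row.D_def col.D_def add.commute)

text \<open>Both perturbations have the same total complex, so their reduced complexes have the same
  homology.\<close>

lemma quot_dim_CB_KB:
  "quot_dim {z \<in> fsp (el.CB n j). el.b_op z = 0} (el.b_op ` fsp (el.CB (Suc n) j)) k
    \<longleftrightarrow> quot_dim (col.ZK j n) (col.dK ` fsp (KB (Suc n) j)) k"
proof -
  have "row.ZK j n = {z \<in> fsp (el.CB n j). el.b_op z = 0}"
    using row_dK by (auto simp: row.ZK_def)
  moreover have "row.dK ` fsp (el.CB (Suc n) j) = el.b_op ` fsp (el.CB (Suc n) j)"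
    using row_dK by (intro image_cong) auto
  moreover have "row.ZT j n = col.ZT j n" by (simp add: row.ZT_def col.ZT_def row_D_eq_col_D)
  ultimately show ?thesis using row.quot_dim_iff[of j n k] col.quot_dim_iff[of j n k]
    by (simp add: row_D_eq_col_D)
qed


section \<open>The homology of the small complex\<close>

text \<open>
  Everything at the homological degree \<open>n\<close> depends only on \<open>r = pos n\<close>. The element \<open>z\<close> in a basis
  element \<open>(g, z)\<close> is determined by \<open>g\<close>.
\<close>

definition st :: "nat \<Rightarrow> nat" where
  "st r = (if r = 0 then 0 else (r - 1) mod 4 + 1)"

lemma stage_st: "stage n = st (pos n)"
  by (simp add: stage_def st_def)

definition kb :: "nat \<Rightarrow> (el \<times> el) set" where
  "kb r = {(g, z). gen_ok (st r) g \<and> el_src z = map_elt (twist (r div 4)) (gen_r (st r) g) \<and> el_tgt z = gen_l (st r) g}"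

lemma KB_iff: "(p, g, z) \<in> KB n j \<longleftrightarrow> p = n \<and> (g, z) \<in> kb (pos n) \<and> gdeg n + el_deg z = j"
  by (auto simp: KB_def kb_def stage_st tw_def)

text \<open>The twist belongs to the preceding term. Writing its exponent as (r - 1) div 4 serves r
  = 1 too, whose predecessor has position 0 or 12, both with trivial twist.\<close>

definition kd :: "nat \<Rightarrow> el \<times> el \<Rightarrow> (el \<times> el \<Rightarrow>\<^sub>0 complex)" where
  "kd r = (\<lambda>(g, z). lin_ext (\<lambda>(x', g', y'). lin_ext (\<lambda>w. sg (g', w))
     (osg (Option.bind (el_mul z x') (el_mul (map_elt (twist ((r - 1) div 4)) y'))))) (dtab (st r) g))"

lemma tw_pred: "tw q = map_elt (twist ((pos (Suc q) - 1) div 4))"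
  using pos_cases[of q] by (auto simp: tw_def twist_def)

lemma dK_sg:
  assumes "(Suc q, g, z) \<in> KB n j"
  shows "col.dK (sg (Suc q, g, z)) = lin_ext (\<lambda>(g', w). sg (q, g', w)) (kd (pos (Suc q)) (g, z))"
proof -
  have ok: "gen_ok (stage (Suc q)) g" using assms by (auto simp: KB_def)
  let ?e = "gen_r (stage (Suc q)) g"
  have "col.dK (sg (Suc q, g, z)) = lin_ext (\<lambda>(x', g', y'). piK (lin_ext (\<lambda>m. sg (m, []))
     (put q (el_mul z x') g' (el_mul y' (if stage (Suc q) = 4 then map_elt pv ?e else ?e)))))
     (dtab (stage (Suc q)) g)"
  proof -
    have "sigK (sg (Suc q, g, z)) = sg ((Suc q, z, g, ?e), [])" by (simp add: sigK_def)
    moreover have "piK (lin_ext f v) = lin_ext (\<lambda>b. piK (f b)) v" for f :: "el \<times> el \<times> el \<Rightarrow> _" and v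
      by (simp add: piK_def lin_ext_comp)
    ultimately show ?thesis by (simp add: col.dK_def dT_sg lin_ext_comp case_prod_unfold)
  qed
  also have "\<dots> = lin_ext (\<lambda>(x', g', y'). lin_ext (\<lambda>w. sg (q, g', w))
     (osg (Option.bind (el_mul z x') (el_mul (tw q y'))))) (dtab (stage (Suc q)) g)"
  proof (rule lin_ext_eqI[OF dtab_fsp[OF ok]], clarify)
    fix x' g' y' assume "el_tgt y' = (if stage (Suc q) = 4 then map_elt pv ?e else ?e)"
    then have *: "el_mul y' (if stage (Suc q) = 4 then map_elt pv ?e else ?e) = Some y'"
      using el_mul_unit(2)[of y'] by simp
    show "piK (lin_ext (\<lambda>m. sg (m, [])) (put q (el_mul z x') g' (el_mul y' (if stage (Suc q) = 4 then map_elt pv ?e else ?e))))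
      = lin_ext (\<lambda>w. sg (q, g', w)) (osg (Option.bind (el_mul z x') (el_mul (tw q y'))))"
      unfolding * by (cases "el_mul z x'") (simp_all add: piK_sg lin_0)
  qed
  finally show ?thesis
    by (simp add: kd_def stage_st tw_pred lin_ext_comp case_prod_unfold del: pos.simps)
qed

fun kh2 :: "el \<Rightarrow> (el \<times> el \<Rightarrow>\<^sub>0 complex)" where
  "kh2 (eU i) = - sg (vX i, vX i)"
| "kh2 (eC I1) = sg (vX I0, vX I0) + sg (vM I1, vM I1)"
| "kh2 (eC I2) = - sg (vX I2, vX I2) - sg (vM I0, vM I0)"
| "kh2 _ = 0"

fun kh4 :: "el \<Rightarrow> (el \<times> el \<Rightarrow>\<^sub>0 complex)" where
  "kh4 (vM I1) = sg (eC I0, vM I0)"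
| "kh4 (vM I2) = sg (eC I0, vM I0) + sg (eC I1, vM I1)"
| "kh4 _ = 0"

fun kh6 :: "el \<Rightarrow> (el \<times> el \<Rightarrow>\<^sub>0 complex)" where
  "kh6 (eC I1) = sg (vM I1, eC I0)"
| "kh6 (eC I2) = - sg (vM I0, eC I2)"
| "kh6 _ = 0"

fun kh8 :: "el \<Rightarrow> (el \<times> el \<Rightarrow>\<^sub>0 complex)" where
  "kh8 (vX I1) = - sg (eD I1, eU I1) - sg (eU I0, eD I1)"
| "kh8 (vX I2) = - sg (eD I1, eU I1) - sg (eD I2, eU I2) - sg (eU I0, eD I1) - sg (eU I1, eD I2)"
| "kh8 (vM I0) = sg (eD I0, eU I0)"
| "kh8 (vM I1) = - sg (eU I0, eD I1)"
| "kh8 (vM I2) = - sg (eD I1, eU I1) - sg (eU I0, eD I1) - sg (eU I1, eD I2)"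
| "kh8 _ = 0"

text \<open>On the \<open>eC\<close> components \<open>kd 10\<close> is minus the 3 by 3 matrix with
  zeros on the diagonal and ones elsewhere. Its determinant has absolute value 2, and this is its
  inverse.\<close>

fun kh9 :: "el \<Rightarrow> (el \<times> el \<Rightarrow>\<^sub>0 complex)" where
  "kh9 (eC i) = fscale (1/2) (sg (eC i, vM (nx i)) - sg (eC (nx i), vM (pv i)) - sg (eC (pv i), vM i))"
| "kh9 _ = 0"

text \<open>\<open>kd 12\<close> sends the sum of the \<open>vX\<close> generators to 2X + M and the
  sum of the \<open>vM\<close> generators to X + 3M, where X and M are the corresponding sums at
  position 11. The determinant 5 explains the denominators.\<close>

fun kh11 :: "el \<Rightarrow> (el \<times> el \<Rightarrow>\<^sub>0 complex)" where
  "kh11 (vX i) = sg (vM (nx i), vM (nx i))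
    + fscale (1/5) (sg (vX I0, vX I0) + sg (vX I1, vX I1) + sg (vX I2, vX I2))
    - fscale (2/5) (sg (vM I0, vM I0) + sg (vM I1, vM I1) + sg (vM I2, vM I2))"
| "kh11 (vM i) = sg (vX i, vX i) + sg (vM (pv i), vM (pv i))
    - fscale (2/5) (sg (vX I0, vX I0) + sg (vX I1, vX I1) + sg (vX I2, vX I2))
    - fscale (1/5) (sg (vM I0, vM I0) + sg (vM I1, vM I1) + sg (vM I2, vM I2))"
| "kh11 _ = 0"

text \<open>The contraction \<open>kh\<close> of \<open>kd\<close> onto the cycles \<open>ks\<close>, which was found by Gaussian elimination.\<close>

definition kh :: "nat \<Rightarrow> el \<Rightarrow> (el \<times> el \<Rightarrow>\<^sub>0 complex)" where
  "kh r g = (if r = 1 then (case g of eC i \<Rightarrow> sg (eD i, eD i) | _ \<Rightarrow> 0) else if r = 2 then kh2 g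
    else if r = 4 then kh4 g else if r = 6 then kh6 g else if r = 8 then kh8 g
    else if r = 9 then kh9 g else if r = 11 then kh11 g else 0)"

definition ks :: "nat \<Rightarrow> (el \<times> el \<Rightarrow>\<^sub>0 complex)" where
  "ks r = (if r = 2 then sg (eC I0, eC I0) + sg (eD I1, eD I1) + sg (eD I2, eD I2)
    else if r = 3 then sg (vX I0, vX I0) + sg (vX I1, vX I1) + sg (vX I2, vX I2)
      + sg (vM I0, vM I0) + sg (vM I1, vM I1) + sg (vM I2, vM I2)
    else if r = 4 then sg (vM I0, eC I2)
    else if r = 5 then sg (eC I0, vM I0) + sg (eC I1, vM I1) + sg (eC I2, vM I2)
    else if r = 6 then sg (eC I0, pW I2)
    else if r = 7 then sg (vM I0, eC I2) + sg (vM I1, eC I0) + sg (vM I2, eC I1)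
    else if r = 8 then sg (vX I0, pV I1)
    else if r = 9 then sg (eU I2, eD I0) + sg (eD I0, eU I0) + sg (eD I1, eU I1) + sg (eD I2, eU I2)
      + sg (eU I0, eD I1) + sg (eU I1, eD I2)
    else 0)"

text \<open>A functional vanishing on boundaries, with value 1 on \<open>ks r\<close> for r = 2,
  ..., 9; at other positions it is zero, as no class lives there. Degree 0 is treated apart.\<close>

definition kp :: "nat \<Rightarrow> el \<Rightarrow> complex" where
  "kp r g = (if r = 2 then (case g of eC i \<Rightarrow> 1 | _ \<Rightarrow> 0)
    else if r \<in> {3, 7} then (if g = vM I2 then 1 else 0)
    else if r \<in> {4, 6, 8} then 1
    else if r = 5 then (if g = eC I2 then 1 else 0)
    else if r = 9 then (if g = eU I2 then 1 else case g of eC i \<Rightarrow> (if i = I2 then - 1/2 else 1/2) | _ \<Rightarrow> 0)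
    else 0)"

text \<open>For r = 2, ..., 9 all z in \<open>kb r\<close> have this degree, so each such position
  carries a single internal degree.\<close>

definition hz :: "nat \<Rightarrow> int" where
  "hz r = (if r \<in> {3, 5} then 0 else if r \<in> {6, 8} then 2 else 1)"

text \<open>The algebra has at most one basis element between two given vertices, so the endpoint
  conditions leave at most one z for each g.\<close>

lemma kb_cases:
  "(g, z) \<in> kb 0 \<Longrightarrow> \<exists>i. g = vX i \<and> z = vX i \<or> g = vM i \<and> z = vM i"
  "(g, z) \<in> kb 1 \<Longrightarrow> \<exists>i. g = eC i \<and> z = pW (nx i)"
  "(g, z) \<in> kb 2 \<Longrightarrow> \<exists>i. g = eD i \<and> z = eD i \<or> g = eU i \<and> z = eU i \<or> g = eC i \<and> z = eC i"
  "(g, z) \<in> kb 3 \<Longrightarrow> \<exists>i. g = vX i \<and> z = vX i \<or> g = vM i \<and> z = vM i"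
  "(g, z) \<in> kb 4 \<Longrightarrow> \<exists>i. g = vM i \<and> z = eC (pv i)"
  "(g, z) \<in> kb 5 \<Longrightarrow> \<exists>i. g = eC i \<and> z = vM i"
  "(g, z) \<in> kb 6 \<Longrightarrow> \<exists>i. g = eC i \<and> z = pW (pv i)"
  "(g, z) \<in> kb 7 \<Longrightarrow> \<exists>i. g = vM i \<and> z = eC (pv i)"
  "(g, z) \<in> kb 8 \<Longrightarrow> \<exists>i. g = vX i \<and> z = pV (nx i) \<or> g = vM i \<and> z = pW (nx i)"
  "(g, z) \<in> kb 9 \<Longrightarrow> \<exists>i. g = eD i \<and> z = eU i \<or> g = eU i \<and> z = eD (nx i) \<or> g = eC i \<and> z = eC (pv i)"
  "(g, z) \<in> kb 10 \<Longrightarrow> \<exists>i. g = eC i \<and> z = vM (nx i)"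
  "(g, z) \<in> kb 11 \<Longrightarrow> \<exists>i. g = vX i \<and> z = pV (nx i) \<or> g = vM i \<and> z = pW (nx i)"
  "(g, z) \<in> kb 12 \<Longrightarrow> \<exists>i. g = vX i \<and> z = vX i \<or> g = vM i \<and> z = vM i"
  by (cases g; cases z; simp add: kb_def st_def gen_ok_def gen_r_def gen_l_def twist_def elt.map_id; fastforce)+

text \<open>Everything the contraction needs at position r, gathered so that one finite case split
  proves it. At r = 0 all of the complex is homology. The functional \<open>kp\<close> takes values
  in a free space on \<open>()\<close> so that linear extension applies.\<close>

definition ktable :: "nat \<Rightarrow> el \<times> el \<Rightarrow> bool" where
  "ktable r = (\<lambda>(g, z).
     lin_ext (kd (Suc r)) (kh r g) + (if r = 0 then 0 else lin_ext (\<lambda>c. kh (r - 1) (fst c)) (kd r (g, z)))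
       = sg (g, z) - (if r = 0 then sg (g, z) else fscale (kp r g) (ks r)) \<and>
     lin_ext (\<lambda>c. Poly_Mapping.single () (kp (r - 1) (fst c))) (kd r (g, z)) = 0 \<and>
     lin_ext (\<lambda>c. Poly_Mapping.single () (kp (Suc r) (fst c))) (kh r g) = 0 \<and>
     kh r g \<in> fsp {(g', w). (g', w) \<in> kb (Suc r) \<and> (if st (Suc r) = 4 then 2 else 1) + el_deg w = el_deg z} \<and>
     (r = 1 \<longrightarrow> kd r (g, z) = 0) \<and>
     (if r \<in> {2..9} then el_deg z = hz r else kp r g = 0))"

lemmas ktable_simps = ktable_def kd_def kh_def ks_def kp_def st_def dtab_def twist_def el_mul_def hz_def
  kb_def gen_ok_def gen_l_def gen_r_def lin_ext_linear elt.map_id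

lemmas ktable_intros = fsp_add fsp_diff fsp_uminus fsp_scale fsp_single poly_mapping_eqI

lemmas lookup_simps = lookup_add lookup_minus lookup_single when_def

lemma ktable_0: "(g, z) \<in> kb 0 \<Longrightarrow> ktable 0 (g, z)"
  by (drule kb_cases, elim exE disjE conjE; rename_tac i, case_tac i;
      auto simp: ktable_simps lookup_simps intro!: ktable_intros)

lemma ktable_1: "(g, z) \<in> kb 1 \<Longrightarrow> ktable 1 (g, z)"
  by (drule kb_cases, elim exE disjE conjE; rename_tac i, case_tac i;
      auto simp: ktable_simps lookup_simps intro!: ktable_intros)

lemma ktable_2: "(g, z) \<in> kb 2 \<Longrightarrow> ktable 2 (g, z)"
  by (drule kb_cases, elim exE disjE conjE; rename_tac i, case_tac i;
      auto simp: ktable_simps lookup_simps intro!: ktable_intros)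

lemma ktable_3: "(g, z) \<in> kb 3 \<Longrightarrow> ktable 3 (g, z)"
  by (drule kb_cases, elim exE disjE conjE; rename_tac i, case_tac i;
      auto simp: ktable_simps lookup_simps intro!: ktable_intros)

lemma ktable_4: "(g, z) \<in> kb 4 \<Longrightarrow> ktable 4 (g, z)"
  by (drule kb_cases, elim exE disjE conjE; rename_tac i, case_tac i;
      auto simp: ktable_simps lookup_simps intro!: ktable_intros)

lemma ktable_5: "(g, z) \<in> kb 5 \<Longrightarrow> ktable 5 (g, z)"
  by (drule kb_cases, elim exE disjE conjE; rename_tac i, case_tac i;
      auto simp: ktable_simps lookup_simps intro!: ktable_intros)

lemma ktable_6: "(g, z) \<in> kb 6 \<Longrightarrow> ktable 6 (g, z)"
  by (drule kb_cases, elim exE disjE conjE; rename_tac i, case_tac i;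
      auto simp: ktable_simps lookup_simps intro!: ktable_intros)

lemma ktable_7: "(g, z) \<in> kb 7 \<Longrightarrow> ktable 7 (g, z)"
  by (drule kb_cases, elim exE disjE conjE; rename_tac i, case_tac i;
      auto simp: ktable_simps lookup_simps intro!: ktable_intros)

lemma ktable_8: "(g, z) \<in> kb 8 \<Longrightarrow> ktable 8 (g, z)"
  by (drule kb_cases, elim exE disjE conjE; rename_tac i, case_tac i;
      auto simp: ktable_simps lookup_simps intro!: ktable_intros)

lemma ktable_9: "(g, z) \<in> kb 9 \<Longrightarrow> ktable 9 (g, z)"
  by (drule kb_cases, elim exE disjE conjE; rename_tac i, case_tac i;
      simp add: ktable_simps; (intro conjI ktable_intros)?; simp add: lookup_simps)

lemma ktable_10: "(g, z) \<in> kb 10 \<Longrightarrow> ktable 10 (g, z)"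
  by (drule kb_cases, elim exE disjE conjE; rename_tac i, case_tac i;
      auto simp: ktable_simps lookup_simps intro!: ktable_intros)

lemma ktable_11: "(g, z) \<in> kb 11 \<Longrightarrow> ktable 11 (g, z)"
  by (drule kb_cases, elim exE disjE conjE; rename_tac i, case_tac i;
      simp add: ktable_simps; (intro conjI ktable_intros)?; simp add: lookup_simps)

lemma ktable_12: "(g, z) \<in> kb 12 \<Longrightarrow> ktable 12 (g, z)"
  by (drule kb_cases, elim exE disjE conjE; rename_tac i, case_tac i;
      simp add: ktable_simps; (intro conjI ktable_intros)?; simp add: lookup_simps)


lemma ktable: "c \<in> kb (pos n) \<Longrightarrow> ktable (pos n) c"
  using pos_cases[of n] ktable_0 ktable_1 ktable_2 ktable_3 ktable_4 ktable_5 ktable_6 ktable_7 ktable_8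
    ktable_9 ktable_10 ktable_11 ktable_12
  by (cases c) (elim insertE emptyE; simp)

lemma ktableD:
  assumes "(g, z) \<in> kb (pos n)"
  shows "lin_ext (kd (Suc (pos n))) (kh (pos n) g) +
      (if n = 0 then 0 else lin_ext (\<lambda>c. kh (pos n - 1) (fst c)) (kd (pos n) (g, z)))
      = sg (g, z) - (if n = 0 then sg (g, z) else fscale (kp (pos n) g) (ks (pos n)))"
    and "lin_ext (\<lambda>c. Poly_Mapping.single () (kp (pos n - 1) (fst c))) (kd (pos n) (g, z)) = 0"
    and "lin_ext (\<lambda>c. Poly_Mapping.single () (kp (Suc (pos n)) (fst c))) (kh (pos n) g) = 0"
    and "kh (pos n) g \<in> fsp {(g', w). (g', w) \<in> kb (Suc (pos n)) \<and>
      (if st (Suc (pos n)) = 4 then 2 else 1) + el_deg w = el_deg z}"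
    and "pos n = 1 \<Longrightarrow> kd (pos n) (g, z) = 0"
    and "pos n \<in> {2..9} \<Longrightarrow> el_deg z = hz (pos n)"
    and "pos n \<notin> {2..9} \<Longrightarrow> kp (pos n) g = 0"
  using ktable[OF assms] unfolding ktable_def by (simp_all split: if_splits)

lemma kh_12: "kh 12 g = 0"
  by (simp add: kh_def)

definition emb :: "nat \<Rightarrow> (el \<times> el \<Rightarrow>\<^sub>0 complex) \<Rightarrow> (nat \<times> el \<times> el \<Rightarrow>\<^sub>0 complex)" where
  "emb n = lin_ext (\<lambda>(g, z). sg (n, g, z))"

lemma lin_emb [simp]: "lin (emb n)"
  by (simp add: emb_def)

text \<open>Basis of the homology: the vertices in degree 0, and one class at each of the positions
  2 to 9. \<open>vM I0\<close> is merely the label of that class.\<close>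

definition HB :: "nat \<Rightarrow> int \<Rightarrow> (nat \<times> el) set" where
  "HB n j = (if n = 0 then (if j = 0 then {0} \<times> el_vs else {})
     else if pos n \<in> {2..9} \<and> j = gdeg n + hz (pos n) then {(n, vM I0)} else {})"

definition hK :: "(nat \<times> el \<times> el \<Rightarrow>\<^sub>0 complex) \<Rightarrow> (nat \<times> el \<times> el \<Rightarrow>\<^sub>0 complex)" where
  "hK = lin_ext (\<lambda>(n, g, z). emb (Suc n) (kh (pos n) g))"

definition sigH :: "(nat \<times> el \<Rightarrow>\<^sub>0 complex) \<Rightarrow> (nat \<times> el \<times> el \<Rightarrow>\<^sub>0 complex)" where
  "sigH = lin_ext (\<lambda>(n, v). if n = 0 then sg (0, v, v) else emb n (ks (pos n)))"

definition piH :: "(nat \<times> el \<times> el \<Rightarrow>\<^sub>0 complex) \<Rightarrow> (nat \<times> el \<Rightarrow>\<^sub>0 complex)" where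
  "piH = lin_ext (\<lambda>(n, g, z). if n = 0 then sg (0, g) else Poly_Mapping.single (n, vM I0) (kp (pos n) g))"

lemma lin_H [simp]: "lin hK" "lin sigH" "lin piH"
  by (simp_all add: hK_def sigH_def piH_def)

lemma hK_emb: "hK (emb n v) = emb (Suc n) (lin_ext (\<lambda>c. kh (pos n) (fst c)) v)"
  by (simp add: hK_def emb_def lin_ext_comp case_prod_unfold)

lemma KB_E:
  assumes "c \<in> KB n j"
  obtains g z where "c = (n, g, z)" "(g, z) \<in> kb (pos n)" "j = gdeg n + el_deg z"
  using assms by (cases c) (auto simp: KB_iff)

lemma kh_KB:
  assumes "(g, z) \<in> kb (pos n)" "j = gdeg n + el_deg z"
  shows "kh (pos n) g \<in> fsp {(g', w). (Suc n, g', w) \<in> KB (Suc n) j}"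
proof (cases "pos n = 12")
  case False
  then show ?thesis
    by (intro fsp_mono[OF ktableD(4)[OF assms(1)]]) (auto simp: KB_iff stage_st assms(2))
qed (simp add: kh_12)

lemma dK_hK_sg:
  assumes "(g, z) \<in> kb (pos n)"
  shows "col.dK (hK (sg (n, g, z))) = emb n (lin_ext (kd (Suc (pos n))) (kh (pos n) g))"
proof (cases "pos n = 12")
  case True
  then show ?thesis by (simp add: hK_def kh_12 lin_0 col.lin_dK)
next
  case False
  let ?j = "gdeg n + el_deg z"
  have "col.dK (hK (sg (n, g, z))) = lin_ext (\<lambda>c. col.dK (emb (Suc n) (sg c))) (kh (pos n) g)"
    using lin_eq_lin_ext[OF lin_comp[OF col.lin_dK lin_emb[of "Suc n"]], of "kh (pos n) g"]
    unfolding hK_def lin_ext_single case_prod_conv fvs.scale_one .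
  also have "\<dots> = lin_ext (\<lambda>c. emb n (kd (Suc (pos n)) c)) (kh (pos n) g)"
  proof (rule lin_ext_eqI[OF kh_KB[OF assms refl]], clarify)
    fix g' w assume "(Suc n, g', w) \<in> KB (Suc n) ?j"
    then show "col.dK (emb (Suc n) (sg (g', w))) = emb n (kd (Suc (pos n)) (g', w))"
      using dK_sg False by (simp add: emb_def)
  qed
  finally show ?thesis by (simp add: emb_def lin_ext_comp)
qed

lemma sigK_sg: "sigK (sg (p, g, z)) = sg ((p, z, g, gen_r (stage p) g), [])"
  by (simp add: sigK_def)

lemma dK_sg_0: "c \<in> KB 0 j \<Longrightarrow> col.dK (sg c) = 0"
  by (auto simp: col.dK_def sigK_sg dT_sg lin_0 elim!: KB_E)

lemma dK_sg_emb: "(Suc q, g, z) \<in> KB (Suc q) j \<Longrightarrow> col.dK (sg (Suc q, g, z)) = emb q (kd (pos (Suc q)) (g, z))"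
  using dK_sg by (simp add: emb_def)

lemma dK_KB: "k \<in> fsp (KB n j) \<Longrightarrow> col.dK k \<in> fsp (KB (n - 1) j)"
  unfolding col.dK_def by (intro col.\<pi>K col.\<delta>T col.\<sigma>T)

text \<open>Only the passage from position 12 to position 1 breaks the relation between consecutive
  positions, and there the differential is zero.\<close>

lemma pos_pred: "(g, z) \<in> kb (pos (Suc q)) \<Longrightarrow> kd (pos (Suc q)) (g, z) = 0 \<or> pos q = pos (Suc q) - 1"
  using ktableD(5)[of g z "Suc q"] by (auto split: if_splits)

text \<open>The perturbation is zero, so the filtration is trivial and the locale just turns the
  contraction \<open>kh\<close> into an isomorphism with the homology.\<close>

interpretation small: perturbed_contraction "\<lambda>n. fsp (KB n j)" "\<lambda>n. fsp (HB n j)" col.dK "\<lambda>z. 0" hK sigH piH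
  "\<lambda>m. if m = 0 then {0} else UNIV" for j
proof
  fix n z assume z: "z \<in> fsp (KB n j)"
  note eqI = lin_eqI[OF _ _ z]
  show "col.dK z \<in> fsp (KB (n - 1) j)" by (rule dK_KB[OF z])
  show "col.dK (col.dK z) = 0" by (rule col.dK_dK[OF z])
  show "hK z \<in> fsp (KB (Suc n) j)"
  proof (rule fsp_linD[of hK, OF _ _ z])
    fix c assume "c \<in> KB n j"
    then obtain g z where *: "c = (n, g, z)" "(g, z) \<in> kb (pos n)" "j = gdeg n + el_deg z" by (rule KB_E)
    then show "hK (sg c) \<in> fsp (KB (Suc n) j)"
      using kh_KB[OF *(2,3)] by (auto simp: hK_def emb_def intro!: fsp_lin_ext fsp_single)
  qed simp
  show "piH z \<in> fsp (HB n j)"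
  proof (rule fsp_linD[of piH, OF _ _ z])
    fix c assume "c \<in> KB n j"
    then obtain g z where *: "c = (n, g, z)" "(g, z) \<in> kb (pos n)" "j = gdeg n + el_deg z" by (rule KB_E)
    show "piH (sg c) \<in> fsp (HB n j)"
    proof (cases "n = 0")
      case True
      then have "g = z" "g \<in> el_vs" using kb_cases(1)[of g z] * by (auto simp: el_vs_iff)
      then show ?thesis using True * by (auto simp: piH_def HB_def el_vs_iff intro!: fsp_single)
    next
      case False
      then show ?thesis using * ktableD(6,7)[OF *(2)]
        by (cases "pos n \<in> {2..9}") (auto simp: piH_def HB_def intro!: fsp_single)
    qed
  qed simp
  show "col.dK (hK z) + hK (col.dK z) = z - sigH (piH z)"
  proof (rule eqI[of "\<lambda>z. col.dK (hK z) + hK (col.dK z)" "\<lambda>z. z - sigH (piH z)"])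
    fix c assume "c \<in> KB n j"
    then obtain g z where *: "c = (n, g, z)" "(g, z) \<in> kb (pos n)" "j = gdeg n + el_deg z" by (rule KB_E)
    have "hK (col.dK (sg c)) = emb n (if n = 0 then 0 else lin_ext (\<lambda>c. kh (pos n - 1) (fst c)) (kd (pos n) (g, z)))"
    proof (cases n)
      case 0
      then show ?thesis using dK_sg_0 \<open>c \<in> KB n j\<close> by (simp add: lin_0)
    next
      case (Suc q)
      then have "hK (col.dK (sg c)) = emb n (lin_ext (\<lambda>c. kh (pos q) (fst c)) (kd (pos n) (g, z)))"
        using dK_sg_emb[of q g z j] \<open>c \<in> KB n j\<close> *(1) by (simp add: hK_emb del: pos.simps)
      then show ?thesis using pos_pred[of g z q] *(2) Suc by (auto simp del: pos.simps)
    qed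
    then have "col.dK (hK (sg c)) + hK (col.dK (sg c))
      = emb n (sg (g, z) - (if n = 0 then sg (g, z) else fscale (kp (pos n) g) (ks (pos n))))"
      using ktableD(1)[OF *(2)] dK_hK_sg[OF *(2)] by (simp add: *(1) lin_add[symmetric])
    also have "\<dots> = sg c - sigH (piH (sg c))"
    proof (cases "n = 0")
      case True
      then have "g = z" using kb_cases(1)[of g z] * by auto
      then show ?thesis using True by (simp add: *(1) sigH_def piH_def lin_0)
    qed (simp add: *(1) sigH_def piH_def lin_diff lin_scale, simp add: emb_def)
    finally show "col.dK (hK (sg c)) + hK (col.dK (sg c)) = sg c - sigH (piH (sg c))" .
  qed (simp_all add: lin_comp lin_plus lin_minus lin_id col.lin_dK)
  have pe: "piH (emb n v) = lin_ext (\<lambda>u. sg (n, vM I0)) (lin_ext (\<lambda>c. Poly_Mapping.single () (kp (pos n) (fst c))) v)"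
    if "n > 0" for n v using that by (simp add: piH_def emb_def lin_ext_comp case_prod_unfold)
  show "piH (col.dK z) = 0"
  proof (rule eqI[of "\<lambda>z. piH (col.dK z)" "\<lambda>z. 0"])
    fix c assume "c \<in> KB n j"
    then obtain g z where *: "c = (n, g, z)" "(g, z) \<in> kb (pos n)" "j = gdeg n + el_deg z" by (rule KB_E)
    show "piH (col.dK (sg c)) = 0"
    proof (cases n)
      case 0
      then show ?thesis using dK_sg_0 \<open>c \<in> KB n j\<close> by (simp add: lin_0)
    next
      case (Suc q)
      show ?thesis
      proof (cases "kd (pos n) (g, z) = 0")
        case False
        then have q: "pos q = pos n - 1" "pos n \<noteq> 1"
          using pos_pred[of g z q] ktableD(5)[OF *(2)] *(2) Suc by (auto simp del: pos.simps)
        then have "q > 0" using Suc by (cases q) auto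
        then show ?thesis
          using dK_sg_emb[of q g z j] \<open>c \<in> KB n j\<close> *(1) ktableD(2)[OF *(2)] q Suc
          by (simp add: pe del: pos.simps)
      qed (use dK_sg_emb[of q g z j] \<open>c \<in> KB n j\<close> *(1) Suc in \<open>simp add: lin_0 del: pos.simps\<close>)
    qed
  qed (simp_all add: lin_comp lin_const0 col.lin_dK)
  show "piH (hK z) = 0"
  proof (rule eqI[of "\<lambda>z. piH (hK z)" "\<lambda>z. 0"])
    fix c assume "c \<in> KB n j"
    then obtain g z where *: "c = (n, g, z)" "(g, z) \<in> kb (pos n)" by (rule KB_E)
    show "piH (hK (sg c)) = 0"
      using ktableD(3)[OF *(2)] by (cases "pos n = 12") (simp_all add: *(1) hK_def kh_12 lin_0 pe)
  qed (simp_all add: lin_comp lin_const0)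
  show "z \<in> (if Suc n = 0 then {0} else UNIV)" by simp
next
  fix z assume "z \<in> fsp (KB 0 j)"
  then show "col.dK z + 0 = 0"
    using lin_eqI[of col.dK "\<lambda>z. 0" z "KB 0 j"] dK_sg_0 by (simp add: lin_const0 col.lin_dK)
next
  fix n k assume k: "k \<in> fsp (HB n j)"
  have *: "ks (pos n) \<in> fsp {(g, z). (g, z) \<in> kb (pos n) \<and> el_deg z = hz (pos n)} \<and>
    lin_ext (\<lambda>c. Poly_Mapping.single () (kp (pos n) (fst c))) (ks (pos n)) = sg ()" if "pos n \<in> {2..9}"
  proof -
    have "pos n \<in> {2, 3, 4, 5, 6, 7, 8, 9}" using that by auto
    then show ?thesis
      by (elim insertE emptyE; simp; intro conjI;
        (simp add: ks_def kp_def hz_def kb_def st_def gen_ok_def gen_l_def gen_r_def twist_def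
          lin_ext_linear elt.map_id flip: single_add; fail)?;
        simp add: ks_def hz_def; intro fsp_add fsp_single;
        simp add: kb_def st_def gen_ok_def gen_l_def gen_r_def twist_def elt.map_id)
  qed
  show "sigH k \<in> fsp (KB n j)"
  proof (rule fsp_linD[of sigH, OF _ _ k])
    fix c assume c: "c \<in> HB n j"
    show "sigH (sg c) \<in> fsp (KB n j)"
    proof (cases "n = 0")
      case True
      then show ?thesis using c
        by (auto simp: HB_def sigH_def KB_iff kb_def st_def gen_ok_def gen_l_def gen_r_def twist_def el_vs_iff
            elt.map_id el_deg0 split: if_splits intro!: fsp_single)
    next
      case False
      then have "c = (n, vM I0)" "pos n \<in> {2..9}" "j = gdeg n + hz (pos n)" using c by (auto simp: HB_def split: if_splits)
      then show ?thesis using False *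
        by (auto simp: sigH_def emb_def KB_iff intro!: fsp_lin_ext[of "ks (pos n)"] fsp_single)
    qed
  qed simp
  show "piH (sigH k) = k"
  proof (rule lin_eqI[OF _ _ k, of "\<lambda>k. piH (sigH k)" "\<lambda>k. k"])
    fix c assume c: "c \<in> HB n j"
    show "piH (sigH (sg c)) = sg c"
    proof (cases "n = 0")
      case True
      then show ?thesis using c by (auto simp: HB_def sigH_def piH_def split: if_splits)
    next
      case False
      then have c': "c = (n, vM I0)" "pos n \<in> {2..9}" using c by (auto simp: HB_def split: if_splits)
      have "piH (sigH (sg c)) = lin_ext (\<lambda>u. sg (n, vM I0)) (lin_ext (\<lambda>c. Poly_Mapping.single () (kp (pos n) (fst c))) (ks (pos n)))"
        using False by (simp add: c'(1) sigH_def piH_def emb_def lin_ext_comp case_prod_unfold)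
      then show ?thesis using * c' by simp
    qed
  qed (simp_all add: lin_comp lin_id)
qed (auto simp: subspace_fsp lin_0 lin_const0 col.lin_dK fvs.subspace_single_0 fvs.subspace_UNIV split: if_splits)

theorem hochschild_homology_dim:
  "quot_dim {z \<in> fsp (el.CB n j). el.b_op z = 0} (el.b_op ` fsp (el.CB (Suc n) j)) (card (HB n j))"
proof -
  have "finite (HB n j)" by (simp add: HB_def el_vs_def)
  then have "quot_dim (fsp (HB n j)) {0} (card (HB n j))" by (rule quot_dim_fsp)
  moreover have "small.ZK j n = fsp (HB n j)" by (simp add: small.ZK_def small.dK_def lin_0)
  moreover have "small.dK ` fsp (HB (Suc n) j) = {0}"
    using fsp_0[of "HB (Suc n) j"] by (auto simp: small.dK_def lin_0 image_def simp del: fsp_0)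
  moreover have "small.D = col.dK" by (simp add: fun_eq_iff small.D_def)
  moreover have "small.ZT j n = col.ZK j n" by (simp add: small.ZT_def col.ZK_def small.D_def)
  ultimately show ?thesis
    using small.quot_dim_iff[of j n "card (HB n j)"] quot_dim_CB_KB[of n j "card (HB n j)"] by simp
qed


section \<open>The Connes operator in positive degrees\<close>

lemma lin_ll: "lin (\<lambda>x. lin_ext f (lin_ext g x))"
  by (simp add: lin_ext_comp)

context mult_basis begin

section \<open>Faces, the cyclic operator and its norm\<close>

definition face :: "nat \<Rightarrow> 'b list \<Rightarrow> ('b list \<Rightarrow>\<^sub>0 complex)" where
  "face l xs = (if Suc l < length xs then fscale ((-1) ^ l)
       (lin_ext (\<lambda>y. sg (take l xs @ y # drop (l + 2) xs)) (osg (mul (xs ! l) (xs ! Suc l))))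
     else if Suc l = length xs then last_face xs else 0)"

lemma face_Cons: "Suc l < length xs \<Longrightarrow> face (Suc l) (a # xs) = - consv a (face l xs)"
  by (simp add: face_def consv_def lin_ext_scale lin_ext_comp fvs.scale_minus_left)

lemma bar_eq_sum: "bar xs = (\<Sum>l<length xs - 1. face l xs)"
proof (induction xs rule: bar.induct)
  case (1 a c as)
  have "(\<Sum>l<length (a # c # as) - 1. face l (a # c # as))
    = face 0 (a # c # as) + (\<Sum>l<length (c # as) - 1. face (Suc l) (a # c # as))"
    by (simp add: sum.lessThan_Suc_shift del: sum.lessThan_Suc)
  also have "(\<Sum>l<length (c # as) - 1. face (Suc l) (a # c # as)) = - consv a (bar (c # as))"
    unfolding 1 by (simp add: face_Cons consv_def lin_ext_sum sum_negf)
  finally show ?case by (simp add: face_def)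
qed auto

lemma hoch_eq_sum: "xs \<noteq> [] \<Longrightarrow> hoch xs = (\<Sum>l<length xs. face l xs)"
  by (cases "length xs") (simp_all add: hoch_def bar_eq_sum face_def)

definition tlist :: "'b list \<Rightarrow> ('b list \<Rightarrow>\<^sub>0 complex)" where
  "tlist xs = fscale ((-1) ^ (length xs - 1)) (sg (last xs # butlast xs))"

abbreviation "t_op \<equiv> lin_ext tlist"


text \<open>Partial sums of faces interpolate between 0, b' (all but the cyclic face) and b.\<close>

definition part :: "nat \<Rightarrow> ('b list \<Rightarrow>\<^sub>0 complex) \<Rightarrow> ('b list \<Rightarrow>\<^sub>0 complex)" where
  "part k = lin_ext (\<lambda>xs. \<Sum>l<k. face l xs)"

text \<open>Together with \<open>face_0_t\<close> these are the cyclic identities d_(l+1) t = t d_l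
  and d_0 t = d_n; the signs are already contained in \<open>face\<close> and
  \<open>tlist\<close>.\<close>

lemma face_t:
  assumes "length xs = Suc n" "l < n"
  shows "lin_ext (face (Suc l)) (tlist xs) = t_op (face l xs)"
proof -
  obtain ys a where xs: "xs = ys @ [a]" using assms(1) by (cases xs rule: rev_cases) auto
  have n: "length ys = n" using assms by (simp add: xs)
  show ?thesis
  proof (cases "Suc l < n")
    case True
    have "lin_ext (face (Suc l)) (tlist xs) = - fscale ((-1) ^ n) (consv a (face l ys))"
      using True n by (simp add: xs tlist_def face_Cons)
    moreover obtain m where m: "n = Suc (Suc m)" using True by (cases n; cases "n - 1") auto
    have "t_op (face l xs) = fscale ((-1) ^ (n - 1)) (consv a (face l ys))"
      using True n unfolding m by (simp add: lin_ext_fun_uminus xs face_def tlist_def nth_append consv_def lin_ext_scale lin_ext_comp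
          butlast_append lin_ext_fun_scale mult.commute fvs.scale_minus_left del: fscale_single)
    ultimately show ?thesis using True by (cases n) (simp_all add: fvs.scale_minus_left)
  next
    case False
    then have l: "n = Suc l" using assms by simp
    then obtain zs b where ys: "ys = zs @ [b]" using n by (cases ys rule: rev_cases) auto
    have "length zs = l" using n l by (simp add: ys)
    then show ?thesis
      by (simp add: xs ys tlist_def face_def last_face_def nth_append lin_ext_linear lin_ext_comp l
          lin_ext_fun_scale butlast_append fvs.scale_minus_left del: fscale_single)
  qed
qed

lemma face_0_t:
  assumes "length xs = Suc n" "0 < n"
  shows "lin_ext (face 0) (tlist xs) = face n xs"
proof -
  obtain ys a where xs: "xs = ys @ [a]" using assms(1) by (cases xs rule: rev_cases) auto
  then obtain b zs where ys: "ys = b # zs" using assms by (cases ys) auto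
  show ?thesis using assms by (simp add: xs ys face_def tlist_def last_face_def butlast_append)
qed

abbreviation len :: "nat \<Rightarrow> 'b list set" where
  "len n \<equiv> {xs. length xs = n}"

lemma t_len: "x \<in> fsp (len (Suc n)) \<Longrightarrow> t_op x \<in> fsp (len (Suc n))"
  by (rule fsp_lin_ext) (auto simp: tlist_def intro!: fsp_single)

lemma face_len: "face l xs \<in> fsp (len (length xs - 1))"
  by (auto simp: face_def last_face_def intro!: fsp_scale fsp_lin_ext[of _ UNIV] fsp_single)

lemma part_len: "x \<in> fsp (len (Suc n)) \<Longrightarrow> part k x \<in> fsp (len n)"
  unfolding part_def by (rule fsp_lin_ext) (auto intro!: fsp_sum face_len[THEN fsp_mono])

lemma part_0 [simp]: "part 0 x = 0"
  by (simp add: part_def)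

lemma lin_part [simp]: "lin (part k)"
  by (simp add: part_def)

lemma part_full: "x \<in> fsp (len (Suc n)) \<Longrightarrow> part (Suc n) x = b_op x"
  unfolding part_def
  by (rule lin_ext_eqI, assumption) (metis hoch_eq_sum length_0_conv mem_Collect_eq nat.distinct(1))

lemma part_bar: "x \<in> fsp (len (Suc n)) \<Longrightarrow> part n x = lin_ext bar x"
  unfolding part_def by (rule lin_ext_eqI) (auto simp: bar_eq_sum)

lemma part_t:
  assumes "x \<in> fsp (len (Suc n))" "0 < n" "k \<le> n"
  shows "part (Suc k) (t_op x) = b_op x - part n x + t_op (part k x)"
proof -
  have "part (Suc k) (t_op x) = lin_ext (\<lambda>xs. face n xs + t_op (\<Sum>l<k. face l xs)) x"
    unfolding part_def lin_ext_comp
  proof (rule lin_ext_eqI[OF assms(1)])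
    fix xs assume xs: "xs \<in> len (Suc n)"
    have "lin_ext (\<lambda>xs. \<Sum>l<Suc k. face l xs) (tlist xs)
      = lin_ext (face 0) (tlist xs) + (\<Sum>l<k. lin_ext (face (Suc l)) (tlist xs))"
      by (simp add: sum.lessThan_Suc_shift lin_ext_fun_add lin_ext_fun_sum del: sum.lessThan_Suc)
    then show "lin_ext (\<lambda>xs. \<Sum>l<Suc k. face l xs) (tlist xs) = face n xs + t_op (\<Sum>l<k. face l xs)"
      using xs assms(2,3) by (simp add: face_0_t face_t lin_ext_sum)
  qed
  also have "\<dots> = lin_ext (face n) x + t_op (part k x)"
    by (simp add: lin_ext_fun_add part_def lin_ext_comp)
  also have "lin_ext (face n) x = part (Suc n) x - part n x"
    by (simp add: part_def lin_ext_fun_add)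
  also have "part (Suc n) x = b_op x" by (rule part_full[OF assms(1)])
  finally show ?thesis .
qed

definition tpow :: "nat \<Rightarrow> ('b list \<Rightarrow>\<^sub>0 complex) \<Rightarrow> ('b list \<Rightarrow>\<^sub>0 complex)" where
  "tpow r = (t_op ^^ r)"

lemma tpow_0 [simp]: "tpow 0 x = x" and tpow_Suc: "tpow (Suc r) x = t_op (tpow r x)"
  and tpow_Suc2: "tpow (Suc r) x = tpow r (t_op x)"
  by (simp_all add: tpow_def funpow_swap1)

lemma lin_tpow [simp]: "lin (tpow r)"
  by (induction r) (simp_all add: lin_def tpow_Suc lin_ext_linear tpow_def)

lemma tpow_len: "x \<in> fsp (len (Suc n)) \<Longrightarrow> tpow r x \<in> fsp (len (Suc n))"
  by (induction r) (simp_all add: tpow_Suc t_len)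

text \<open>After r + 1 rotations the last r + 1 faces of x have become the first ones;
  \<open>b_op x - part (n - r) x\<close> is their sum.\<close>

lemma part_tpow:
  assumes "x \<in> fsp (len (Suc n))" "0 < n" "Suc r \<le> k" "k \<le> n"
  shows "part k (tpow (Suc r) x) = tpow (Suc r) (part (k - Suc r) x) + tpow r (b_op x - part (n - r) x)"
  using assms
proof (induction r arbitrary: x)
  case 0
  then obtain k' where "k = Suc k'" by (cases k) auto
  then show ?case using part_t[of x n k'] 0 by (simp add: tpow_Suc)
next
  case (Suc r)
  have t: "t_op x \<in> fsp (len (Suc n))" using Suc.prems t_len by blast
  obtain k' where k': "k - Suc r = Suc k'" using Suc.prems by (cases "k - Suc r") auto
  obtain m where m: "n - r = Suc m" using Suc.prems by (cases "n - r") auto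
  have "part k (tpow (Suc (Suc r)) x) = part k (tpow (Suc r) (t_op x))" by (simp add: tpow_Suc2)
  also have "\<dots> = tpow (Suc r) (part (Suc k') (t_op x)) + tpow r (b_op (t_op x) - part (Suc m) (t_op x))"
    using Suc.IH[OF t] Suc.prems k' m by simp
  also have "part (Suc k') (t_op x) = b_op x - part n x + t_op (part k' x)"
    using part_t[of x n k'] Suc.prems k' by simp
  also have "b_op (t_op x) = b_op x - part n x + t_op (part n x)"
    using part_t[of x n n] Suc.prems part_full[OF t] by simp
  also have "part (Suc m) (t_op x) = b_op x - part n x + t_op (part m x)"
    using part_t[of x n m] Suc.prems m by simp
  finally have "part k (tpow (Suc (Suc r)) x)
    = tpow (Suc r) (b_op x - part n x) + tpow (Suc (Suc r)) (part k' x) + tpow (Suc r) (part n x - part m x)"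
    by (simp add: lin_add lin_diff tpow_Suc2)
  moreover have "k - Suc (Suc r) = k'" "n - Suc r = m" using k' m by simp_all
  ultimately show ?case by (simp add: lin_diff)
qed

text \<open>Summation by parts over the cyclic rotations; the coefficients vanish beyond \<open>n\<close>.\<close>

lemma bar_weighted_rotations:
  assumes "x \<in> fsp (len (Suc n))" "0 < n"
  shows "lin_ext bar (\<Sum>r\<le>n. fscale (c r) (tpow r x))
    = (\<Sum>r<n. tpow r (fscale (c r) (part (n - r) x) + fscale (c (Suc r)) (b_op x - part (n - r) x)))"
proof -
  have bar: "lin_ext bar (tpow r x) = part n (tpow r x)" for r
    using part_bar[OF tpow_len[OF assms(1)]] by simp
  have "lin_ext bar (\<Sum>r\<le>n. fscale (c r) (tpow r x)) = (\<Sum>r\<le>n. fscale (c r) (part n (tpow r x)))"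
    by (simp add: lin_ext_sum lin_ext_scale bar)
  also have "\<dots> = fscale (c 0) (part n x) + (\<Sum>r<n. fscale (c (Suc r)) (part n (tpow (Suc r) x)))"
    by (simp add: sum.atMost_shift)
  also have "(\<Sum>r<n. fscale (c (Suc r)) (part n (tpow (Suc r) x)))
    = (\<Sum>r<n. fscale (c (Suc r)) (tpow (Suc r) (part (n - Suc r) x)))
      + (\<Sum>r<n. fscale (c (Suc r)) (tpow r (b_op x - part (n - r) x)))"
    unfolding sum.distrib[symmetric]
    by (intro sum.cong) (simp_all add: part_tpow[OF assms] Suc_le_eq fvs.scale_right_distrib)
  also have "fscale (c 0) (part n x) + ((\<Sum>r<n. fscale (c (Suc r)) (tpow (Suc r) (part (n - Suc r) x)))
      + (\<Sum>r<n. fscale (c (Suc r)) (tpow r (b_op x - part (n - r) x))))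
    = (\<Sum>r\<le>n. fscale (c r) (tpow r (part (n - r) x)))
      + (\<Sum>r<n. fscale (c (Suc r)) (tpow r (b_op x - part (n - r) x)))"
    by (simp add: sum.atMost_shift)
  also have "(\<Sum>r\<le>n. fscale (c r) (tpow r (part (n - r) x))) = (\<Sum>r<n. fscale (c r) (tpow r (part (n - r) x)))"
    by (simp add: lessThan_Suc_atMost[symmetric] lin_0)
  finally show ?thesis by (simp add: sum.distrib lin_add lin_scale)
qed

definition Nop :: "nat \<Rightarrow> ('b list \<Rightarrow>\<^sub>0 complex) \<Rightarrow> ('b list \<Rightarrow>\<^sub>0 complex)" where
  "Nop n x = (\<Sum>r<n. tpow r x)"

text \<open>The classical b' N = N b: with constant weights the partial sums of faces
  cancel.\<close>

lemma bar_N: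
  assumes "x \<in> fsp (len (Suc n))" "0 < n"
  shows "lin_ext bar (Nop (Suc n) x) = Nop n (b_op x)"
  using bar_weighted_rotations[OF assms, of "\<lambda>_. 1"] by (simp add: Nop_def lessThan_Suc_atMost[symmetric])

section \<open>Weighted rotations and the Euler derivation\<close>

definition weight :: "nat \<Rightarrow> 'b list \<Rightarrow> complex" where
  "weight k xs = of_int (\<Sum>m\<in>{1..k}. deg (xs ! m))"

text \<open>Composed with the insertion of the unit this is Goodwillie's homotopy: in rotation r the
  derivation is applied to one of the slots a_1, ..., a_(n-r), which stand after a_0.\<close>

definition Qop :: "nat \<Rightarrow> ('b list \<Rightarrow>\<^sub>0 complex) \<Rightarrow> ('b list \<Rightarrow>\<^sub>0 complex)" where
  "Qop n = lin_ext (\<lambda>xs. \<Sum>r\<le>n. fscale (weight (n - r) xs) (tpow r (sg xs)))"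

text \<open>Contraction with the Euler derivation D: the chain (a_0 D(a_1), a_2, ...).\<close>

definition elist :: "'b list \<Rightarrow> ('b list \<Rightarrow>\<^sub>0 complex)" where
  "elist xs = fscale (of_int (deg (xs ! 1))) (face 0 xs)"

lemma weight_0 [simp]: "weight 0 xs = 0"
  by (simp add: weight_def)

lemma weight_Suc: "weight (Suc k) xs = weight k xs + of_int (deg (xs ! Suc k))"
  by (simp add: weight_def)

lemma weight_Cons: "k < length xs \<Longrightarrow> weight (Suc k) (a # xs) = of_int (sum_list (map deg (take (Suc k) xs)))"
  by (induction k) (simp_all add: weight_Suc weight_def take_Suc_conv_app_nth)

definition wop :: "nat \<Rightarrow> 'b list \<Rightarrow> ('b list \<Rightarrow>\<^sub>0 complex)" where
  "wop k xs = fscale (weight k xs) (sg xs)"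

text \<open>A face with 1 \<le> l \<le> k merges weighted slots, so k + 1 slots of \<open>xs\<close>
  count. The face l = 0 swallows slot 1 into the unweighted slot 0, and faces beyond k do not touch
  the weighted slots.\<close>

lemma weight_face:
  assumes "length xs = Suc n" "k < n" "l \<le> n"
  shows "lin_ext (wop k) (face l xs) = fscale (if l = 0 then weight (Suc k) xs - of_int (deg (xs ! 1))
     else if l \<le> k then weight (Suc k) xs else weight k xs) (face l xs)"
proof -
  have w: "weight k ys = of_int (sum_list (map deg (take k (tl ys))))" if "length ys = n" for ys
    using that assms(2) weight_Cons[of "k - 1" "tl ys" "hd ys"] by (cases ys; cases k) auto
  have w': "weight i xs = of_int (sum_list (map deg (take i (tl xs))))" if "i \<le> n" for i
    using that assms(1) weight_Cons[of "i - 1" "tl xs" "hd xs"] by (cases xs; cases i) auto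
  obtain a as where xs: "xs = a # as" and as: "length as = n" using assms(1) by (cases xs) auto
  have key: "lin_ext (wop k) (fscale c (lin_ext (\<lambda>y. sg (f y)) (osg u))) = fscale d (fscale c (lin_ext (\<lambda>y. sg (f y)) (osg u)))"
    if "\<And>y. u = Some y \<Longrightarrow> weight k (f y) = d" for f u c d
    using that by (cases u) (auto simp: wop_def mult.commute)
  show ?thesis
  proof (cases "l < n")
    case True
    have f: "face l xs = fscale ((-1) ^ l) (lin_ext (\<lambda>y. sg (take l xs @ y # drop (l + 2) xs)) (osg (mul (xs ! l) (xs ! Suc l))))"
      using True assms by (simp add: face_def)
    show ?thesis
    proof (cases l)
      case 0
      obtain b bs where bs: "as = b # bs" using as assms by (cases as) auto
      show ?thesis unfolding f
        by (rule key) (use w'[of "Suc k"] assms as in \<open>simp add: w bs xs 0\<close>)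
    next
      case (Suc i)
      have i: "Suc i < length as" using True as Suc by simp
      have tk: "sum_list (map deg (take k (take i as @ y # drop (i + 2) as)))
          = sum_list (map deg (take (if i < k then Suc k else k) as))"
        if y: "mul (as ! i) (as ! Suc i) = Some y" for y
      proof (cases "i < k")
        case True
        have "as = take i as @ as ! i # as ! Suc i # drop (i + 2) as"
          using i by (metis Cons_nth_drop_Suc Suc_lessD add_2_eq_Suc' append_take_drop_id)
        then have "take (Suc k) as = take (Suc k) (take i as @ as ! i # as ! Suc i # drop (i + 2) as)" by metis
        also have "\<dots> = take i as @ as ! i # as ! Suc i # take (k - Suc i) (drop (i + 2) as)"
        proof -
          have "Suc k - i = Suc (Suc (k - Suc i))" using True by simp
          then show ?thesis using i True by simp
        qed
        finally have "take (Suc k) as = take i as @ as ! i # as ! Suc i # take (k - Suc i) (drop (i + 2) as)" .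
        moreover have "k - i = Suc (k - Suc i)" using True by simp
        ultimately show ?thesis using True i deg_mul[OF y] by simp
      qed (use i in simp)
      show ?thesis unfolding f
        by (rule key) (use w'[of "Suc k"] w'[of k] assms as i tk in \<open>auto simp: w xs Suc\<close>)
    qed
  next
    case False
    then have l: "l = n" using assms by simp
    obtain b bs where bs: "as = bs @ [b]" using as assms by (cases as rule: rev_cases) auto
    have tk: "take k bs = take k as" using assms as by (simp add: bs)
    have f: "face l xs = fscale ((-1) ^ l) (lin_ext (\<lambda>x. sg (x # butlast (tl xs))) (osg (mul (last xs) (hd xs))))"
      using l assms as by (simp add: face_def last_face_def xs bs)
    have "weight k (y # butlast (tl xs)) = weight k xs" for y
    proof -
      have "weight k (y # bs) = of_int (sum_list (map deg (take k bs)))" using w[of "y # bs"] as by (simp add: bs)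
      moreover have "weight k xs = of_int (sum_list (map deg (take k as)))" using w'[of k] assms by (simp add: xs)
      ultimately show ?thesis by (simp only: xs bs tk list.sel butlast_snoc)
    qed
    moreover have "\<not> l \<le> k" "l \<noteq> 0" using l assms by simp_all
    ultimately show ?thesis unfolding f by (intro key) simp
  qed
qed


lemma wop_hoch:
  assumes xs: "length xs = Suc n" and "k < n"
  shows "lin_ext (wop k) (hoch xs) = fscale (weight (Suc k) xs) (part (Suc k) (sg xs))
    + fscale (weight k xs) (hoch xs - part (Suc k) (sg xs)) - elist xs"
proof -
  have h: "hoch xs = part (Suc k) (sg xs) + (\<Sum>l\<in>{Suc k..n}. face l xs)"
  proof -
    have U: "{..<Suc n} = {..<Suc k} \<union> {Suc k..n}" using assms by auto
    have "(\<Sum>l<Suc n. face l xs) = (\<Sum>l<Suc k. face l xs) + (\<Sum>l\<in>{Suc k..n}. face l xs)"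
      unfolding U by (rule sum.union_disjoint) auto
    moreover have "hoch xs = (\<Sum>l<Suc n. face l xs)" using xs hoch_eq_sum[of xs] by (metis length_0_conv nat.distinct(1))
    ultimately show ?thesis by (simp add: part_def del: sum.lessThan_Suc)
  qed
  have "lin_ext (wop k) (part (Suc k) (sg xs)) = fscale (weight (Suc k) xs) (part (Suc k) (sg xs)) - elist xs"
  proof -
    have "lin_ext (wop k) (part (Suc k) (sg xs)) = lin_ext (wop k) (face 0 xs) + (\<Sum>l<k. lin_ext (wop k) (face (Suc l) xs))"
      by (simp add: part_def sum.lessThan_Suc_shift lin_ext_sum lin_ext_add del: sum.lessThan_Suc)
    also have "(\<Sum>l<k. lin_ext (wop k) (face (Suc l) xs)) = (\<Sum>l<k. fscale (weight (Suc k) xs) (face (Suc l) xs))"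
      by (rule sum.cong) (use assms in \<open>simp_all add: weight_face\<close>)
    also have "lin_ext (wop k) (face 0 xs) = fscale (weight (Suc k) xs - of_int (deg (xs ! 1))) (face 0 xs)"
      using assms by (simp add: weight_face)
    finally show ?thesis
      by (simp add: part_def elist_def sum.lessThan_Suc_shift fvs.scale_right_distrib fvs.scale_sum_right
          fvs.scale_left_diff_distrib del: sum.lessThan_Suc)
  qed
  moreover have "lin_ext (wop k) (\<Sum>l\<in>{Suc k..n}. face l xs) = fscale (weight k xs) (\<Sum>l\<in>{Suc k..n}. face l xs)"
    unfolding lin_ext_sum fvs.scale_sum_right by (rule sum.cong) (use assms in \<open>simp_all add: weight_face\<close>)
  ultimately show ?thesis unfolding h by (simp add: lin_ext_add)
qed

lemma Qop_sg: "Qop n (sg xs) = (\<Sum>r\<le>n. fscale (weight (n - r) xs) (tpow r (sg xs)))"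
  by (simp add: Qop_def)

lemma Qop_wop:
  assumes "v \<in> fsp (len n)"
  shows "Qop k v = (\<Sum>r\<le>k. tpow r (lin_ext (wop (k - r)) v))"
proof -
  have "tpow r (lin_ext (wop m) v) = lin_ext (\<lambda>xs. fscale (weight m xs) (tpow r (sg xs))) v" for r m
    using lin_eq_lin_ext[OF lin_comp[OF lin_tpow[of r] lin_lin_ext[of "wop m"]], of v]
    by (simp add: wop_def lin_scale[OF lin_tpow] del: fscale_single)
  then show ?thesis unfolding Qop_def lin_ext_fun_sum by simp
qed

text \<open>With the weights \<open>weight (n - r)\<close> the coefficients of the summation by
  parts are those of \<open>wop_hoch\<close>, except for face 0; these exceptions add up to N
  e.\<close>

lemma bar_Q_sg:
  assumes xs: "length xs = Suc n" and n: "0 < n"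
  shows "lin_ext bar (Qop n (sg xs)) = Qop (n - 1) (hoch xs) + Nop n (elist xs)"
proof -
  have x: "sg xs \<in> fsp (len (Suc n))" using xs by (auto intro: fsp_single)
  have h: "hoch xs \<in> fsp (len n)" using part_len[OF x, of "Suc n"] part_full[OF x] by simp
  let ?w = "\<lambda>m. weight m xs"
  have "lin_ext bar (Qop n (sg xs)) = (\<Sum>r<n. tpow r (fscale (?w (n - r)) (part (n - r) (sg xs))
      + fscale (?w (n - Suc r)) (hoch xs - part (n - r) (sg xs))))"
    unfolding Qop_sg using bar_weighted_rotations[OF x n, of "\<lambda>r. ?w (n - r)"] by simp
  also have "\<dots> = (\<Sum>r<n. tpow r (lin_ext (wop (n - Suc r)) (hoch xs) + elist xs))"
  proof (rule sum.cong)
    fix r assume "r \<in> {..<n}"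
    then have "n - Suc r < n" "Suc (n - Suc r) = n - r" by auto
    then show "tpow r (fscale (?w (n - r)) (part (n - r) (sg xs)) + fscale (?w (n - Suc r)) (hoch xs - part (n - r) (sg xs)))
      = tpow r (lin_ext (wop (n - Suc r)) (hoch xs) + elist xs)"
      using wop_hoch[OF xs, of "n - Suc r"] by simp
  qed simp
  also have "\<dots> = (\<Sum>r<n. tpow r (lin_ext (wop (n - Suc r)) (hoch xs))) + Nop n (elist xs)"
    by (simp add: lin_add sum.distrib Nop_def)
  also have "(\<Sum>r<n. tpow r (lin_ext (wop (n - Suc r)) (hoch xs))) = Qop (n - 1) (hoch xs)"
    using n unfolding Qop_wop[OF h] by (cases n) (simp_all add: lessThan_Suc_atMost)
  finally show ?thesis .
qed

lemma tlist_rotate1: "ys \<noteq> [] \<Longrightarrow> tlist (rotate1 ys) = fscale ((-1) ^ (length ys - 1)) (sg ys)"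
  by (cases ys) (simp_all add: tlist_def del: fscale_single)

lemma tpow_sg: "xs \<noteq> [] \<Longrightarrow> r \<le> length xs \<Longrightarrow>
  tpow r (sg xs) = fscale (((-1) ^ (length xs - 1)) ^ r) (sg (rotate (length xs - r) xs))"
proof (induction r)
  case (Suc r)
  let ?ys = "rotate (length xs - Suc r) xs"
  have ys: "?ys \<noteq> []" using Suc.prems by simp
  have "rotate (length xs - r) xs = rotate1 ?ys"
    using Suc.prems by (metis Suc_diff_le diff_Suc_Suc rotate_Suc)
  then have "tlist (rotate (length xs - r) xs) = fscale ((-1) ^ (length xs - 1)) (sg ?ys)"
    using tlist_rotate1[OF ys] by simp
  then show ?case
    using Suc by (simp add: tpow_Suc lin_ext_scale mult.commute del: fscale_single)
qed simp

definition D0 :: "'b list \<Rightarrow> ('b list \<Rightarrow>\<^sub>0 complex)" where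
  "D0 xs = fscale (of_int (deg (hd xs))) (sg xs)"

text \<open>Rotation r + 1 has a_(n-r) in front, whose degree is the difference of two consecutive
  weights; the sum is therefore of the form (t - 1) Q up to the total degree.\<close>

lemma D0_N_sg:
  assumes "length xs = Suc n"
  shows "lin_ext D0 (Nop (Suc n) (sg xs)) = fscale (of_int (sum_list (map deg xs))) (sg xs) - (Qop n (sg xs) - t_op (Qop n (sg xs)))"
proof -
  have ne: "xs \<noteq> []" using assms by auto
  have w: "of_int (sum_list (map deg xs)) = weight n xs + of_int (deg (hd xs))"
  proof -
    obtain a as where xs: "xs = a # as" using ne by (cases xs) auto
    show ?thesis using assms weight_Cons[of "n - 1" as a] by (cases n) (simp_all add: xs)
  qed
  have D: "lin_ext D0 (tpow (Suc r) (sg xs)) = fscale (weight (n - r) xs - weight (n - Suc r) xs) (tpow (Suc r) (sg xs))"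
    if "r < n" for r
  proof -
    have "hd (rotate (length xs - Suc r) xs) = xs ! (n - r)"
      using hd_rotate_conv_nth[OF ne, of "length xs - Suc r"] assms that by simp
    moreover have "weight (n - r) xs = weight (n - Suc r) xs + of_int (deg (xs ! (n - r)))"
      using weight_Suc[of "n - Suc r" xs] that by (simp add: Suc_diff_Suc)
    ultimately show ?thesis
      using tpow_sg[OF ne, of "Suc r"] assms that by (simp add: lin_ext_scale D0_def mult.commute)
  qed
  have Q: "t_op (Qop n (sg xs)) = (\<Sum>r<n. fscale (weight (n - r) xs) (tpow (Suc r) (sg xs)))"
    by (simp add: Qop_sg lin_ext_sum lin_ext_scale tpow_Suc flip: lessThan_Suc_atMost)
  have 1: "Qop n (sg xs) = fscale (weight n xs) (sg xs) + (\<Sum>r<n. fscale (weight (n - Suc r) xs) (tpow (Suc r) (sg xs)))"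
    by (simp add: Qop_sg sum.atMost_shift del: fscale_single)
  have 2: "lin_ext D0 (Nop (Suc n) (sg xs)) = D0 xs
     + (\<Sum>r<n. fscale (weight (n - r) xs - weight (n - Suc r) xs) (tpow (Suc r) (sg xs)))"
    by (simp add: Nop_def sum.lessThan_Suc_shift lin_ext_add lin_ext_sum D del: sum.lessThan_Suc)
  show ?thesis unfolding 2 Q unfolding 1
    by (simp add: w D0_def fvs.scale_left_diff_distrib sum_subtractf fvs.scale_left_distrib del: fscale_single)
qed

section \<open>Insertion of the unit, the Connes operator and the Cartan formula\<close>

definition slist :: "'b list \<Rightarrow> ('b list \<Rightarrow>\<^sub>0 complex)" where
  "slist xs = (\<Sum>e\<in>E. sg (e # xs))"

abbreviation "s_op \<equiv> lin_ext slist"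

lemma sum_mul_E_left: "(\<Sum>e\<in>E. lin_ext f (osg (mul e a))) = f a"
proof -
  have "(\<Sum>e\<in>E. lin_ext f (osg (mul e a))) = (\<Sum>e\<in>E. if e = src a then f a else 0)"
    by (rule sum.cong) (simp_all add: mul_E_left)
  then show ?thesis using finite_E src_E by simp
qed

lemma sum_mul_E_right: "(\<Sum>e\<in>E. lin_ext f (osg (mul a e))) = f a"
proof -
  have "(\<Sum>e\<in>E. lin_ext f (osg (mul a e))) = (\<Sum>e\<in>E. if e = tgt a then f a else 0)"
    by (rule sum.cong) (simp_all add: mul_E_right)
  then show ?thesis using finite_E tgt_E by simp
qed

lemma s_consv: "(\<Sum>e\<in>E. consv e v) = s_op v"
  by (simp add: consv_def slist_def[abs_def] lin_ext_fun_sum)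

lemma bar_s: "x \<in> fsp {xs. xs \<noteq> []} \<Longrightarrow> lin_ext bar (s_op x) = x - s_op (lin_ext bar x)"
proof -
  have *: "lin_ext bar (slist xs) = sg xs - s_op (bar xs)" if "xs \<noteq> []" for xs
  proof -
    from that obtain a as where xs: "xs = a # as" by (cases xs) auto
    show ?thesis by (simp add: slist_def lin_ext_sum xs sum_subtractf sum_mul_E_left s_consv)
  qed
  assume x: "x \<in> fsp {xs. xs \<noteq> []}"
  show ?thesis
    by (rule lin_eqI[OF _ _ x, of "\<lambda>x. lin_ext bar (s_op x)" "\<lambda>x. x - s_op (lin_ext bar x)"])
      (simp_all add: * lin_ll lin_minus lin_id)
qed

text \<open>The unit in slot 0 gives back the chain at the first face and the signed rotation at the
  cyclic face.\<close>

lemma b_s: "x \<in> fsp {xs. xs \<noteq> []} \<Longrightarrow> b_op (s_op x) = x - t_op x - s_op (lin_ext bar x)"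
proof -
  have *: "b_op (slist xs) = sg xs - tlist xs - s_op (bar xs)" if "xs \<noteq> []" for xs
  proof -
    from that obtain a as where xs: "xs = a # as" by (cases xs) auto
    have "(\<Sum>e\<in>E. bar (e # xs)) = sg xs - s_op (bar xs)"
      by (simp add: xs sum_subtractf sum_mul_E_left s_consv)
    moreover have "(\<Sum>e\<in>E. last_face (e # xs)) = - tlist xs"
    proof -
      have "(\<Sum>e\<in>E. last_face (e # xs))
        = fscale ((-1) ^ length xs) (\<Sum>e\<in>E. lin_ext (\<lambda>x. sg (x # butlast xs)) (osg (mul (last xs) e)))"
        by (simp add: last_face_def xs fvs.scale_sum_right)
      then show ?thesis by (simp add: sum_mul_E_right tlist_def xs fvs.scale_minus_left del: fscale_single)
    qed
    ultimately show ?thesis by (simp add: slist_def lin_ext_sum hoch_def sum.distrib)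
  qed
  assume x: "x \<in> fsp {xs. xs \<noteq> []}"
  show ?thesis
    by (rule lin_eqI[OF _ _ x, of "\<lambda>x. b_op (s_op x)" "\<lambda>x. x - t_op x - s_op (lin_ext bar x)"])
      (simp_all add: * lin_ll lin_minus lin_id)
qed

abbreviation "e_op \<equiv> lin_ext elist"

lemma e_s: "xs \<noteq> [] \<Longrightarrow> e_op (slist xs) = D0 xs"
proof -
  assume "xs \<noteq> []"
  then obtain a as where xs: "xs = a # as" by (cases xs) auto
  have "e_op (slist xs) = fscale (of_int (deg a)) (\<Sum>e\<in>E. lin_ext (\<lambda>y. sg (y # as)) (osg (mul e a)))"
    by (simp add: slist_def lin_ext_sum xs elist_def face_def fvs.scale_sum_right)
  then show ?thesis by (simp add: sum_mul_E_left D0_def xs)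
qed

text \<open>After the rotation the unit sits in slot 1, and its degree is zero.\<close>

lemma e_t_s: "xs \<noteq> [] \<Longrightarrow> e_op (t_op (slist xs)) = 0"
  by (simp add: slist_def lin_ext_sum tlist_def lin_ext_scale elist_def deg_E del: fscale_single)

definition Bop :: "nat \<Rightarrow> ('b list \<Rightarrow>\<^sub>0 complex) \<Rightarrow> ('b list \<Rightarrow>\<^sub>0 complex)" where
  "Bop n x = s_op (Nop (Suc n) x) - t_op (s_op (Nop (Suc n) x))"

lemma lin_Nop [simp]: "lin (Nop n)"
  unfolding Nop_def[abs_def] by (rule lin_sumI) simp

lemma lin_Qop [simp]: "lin (Qop n)"
  by (simp add: Qop_def)

lemma fsp_len_ne: "x \<in> fsp (len (Suc n)) \<Longrightarrow> x \<in> fsp {xs. xs \<noteq> []}"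
  by (erule fsp_mono) auto

lemma Nop_len: "x \<in> fsp (len (Suc n)) \<Longrightarrow> Nop m x \<in> fsp (len (Suc n))"
  unfolding Nop_def by (intro fsp_sum tpow_len)

lemma e_B:
  assumes "x \<in> fsp (len (Suc n))"
  shows "e_op (Bop n x) = lin_ext D0 (Nop (Suc n) x)"
proof -
  have N: "Nop (Suc n) x \<in> fsp {xs. xs \<noteq> []}" by (rule fsp_len_ne[OF Nop_len[OF assms]])
  have "e_op (s_op y) - e_op (t_op (s_op y)) = lin_ext D0 y" if "y \<in> fsp {xs. xs \<noteq> []}" for y
    by (rule lin_eqI[OF _ _ that, of "\<lambda>y. e_op (s_op y) - e_op (t_op (s_op y))" "lin_ext D0"])
      (simp_all add: e_s e_t_s lin_minus lin_ll lin_comp[OF lin_ll lin_lin_ext])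
  then show ?thesis using N by (simp add: Bop_def lin_ext_diff)
qed


text \<open>The cap product \<open>e_op\<close> with the Euler derivation, in terms of the right action.\<close>

definition rw :: "'b \<times> 'b list \<Rightarrow> ('b \<times> 'b list \<Rightarrow>\<^sub>0 complex)" where
  "rw c = fscale (of_int (deg (hd (snd c)))) (reg.ract c)"

lemma elist_Cons: "elist (m # as) = lin_ext (\<lambda>c. sg (fst c # snd c)) (rw (m, as))"
  by (cases as) (simp_all add: elist_def face_def last_face_def rw_def reg.ract_def lin_ext_scale lin_ext_comp)

text \<open>Here the derivation property enters: the degree of a product splits the weight of a
  merged slot into two.\<close>

lemma rw_mid: "lin_ext rw (reg.mid c) + lin_ext reg.mid (rw c) = lin_ext rw (reg.ract c) + lin_ext reg.ract (rw c)"
proof -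
  obtain m as where c: "c = (m, as)" by (cases c)
  consider "as = []" | a where "as = [a]" | a d ds where "as = a # d # ds" by (cases as rule: bar.cases) auto
  then show ?thesis
  proof cases
    case (3 a d ds)
    let ?X = "lin_ext (\<lambda>x. lin_ext (\<lambda>n. sg (n, ds)) (osg (mul x d))) (osg (mul m a))"
    let ?Y = "lin_ext (\<lambda>bs. lin_ext (\<lambda>n. sg (n, bs)) (osg (mul m a))) (bar (d # ds))"
    have X: "lin_ext (\<lambda>x. lin_ext (\<lambda>n. sg (n, ds)) (osg (mul m x))) (osg (mul a d)) = ?X"
      using assoc[of m a d] by (auto simp: osg_def split: option.splits bind_splits)
    have Y: "?Y = lin_ext (\<lambda>x. lin_ext (\<lambda>bs. sg (x, bs)) (bar (d # ds))) (osg (mul m a))"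
      by (cases "mul m a") (simp_all del: bar.simps)
    have "lin_ext (\<lambda>x. rw (m, x # ds)) (osg (mul a d))
       = fscale (of_int (deg a + deg d)) (lin_ext (\<lambda>x. lin_ext (\<lambda>n. sg (n, ds)) (osg (mul m x))) (osg (mul a d)))"
      by (cases "mul a d") (simp_all add: rw_def reg.ract_def deg_mul)
    moreover have "lin_ext (\<lambda>bs. rw (m, a # bs)) (bar (d # ds)) = fscale (of_int (deg a)) ?Y"
      by (simp add: rw_def reg.ract_def lin_ext_fun_scale del: bar.simps)
    moreover have "lin_ext rw (reg.mid c) = lin_ext (\<lambda>x. rw (m, x # ds)) (osg (mul a d)) - lin_ext (\<lambda>bs. rw (m, a # bs)) (bar (d # ds))"
    proof -
      have "reg.mid c = lin_ext (\<lambda>x. sg (m, x # ds)) (osg (mul a d)) - lin_ext (\<lambda>bs. sg (m, a # bs)) (bar (d # ds))"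
        unfolding reg.mid_def c 3 snd_conv bar.simps(1)[of a d ds] by (simp add: lin_ext_diff lin_ext_comp consv_def del: bar.simps)
      then show ?thesis by (simp add: lin_ext_diff lin_ext_comp del: bar.simps)
    qed
    ultimately have 1: "lin_ext rw (reg.mid c) = fscale (of_int (deg a + deg d)) ?X - fscale (of_int (deg a)) ?Y"
      by (simp only: X)
    have 2: "lin_ext reg.mid (rw c) = fscale (of_int (deg a)) ?Y"
      unfolding Y by (simp add: c 3 rw_def reg.ract_def lin_ext_scale lin_ext_comp reg.mid_def del: bar.simps)
    have 3: "lin_ext rw (reg.ract c) = fscale (of_int (deg d)) ?X"
      by (simp add: c 3 rw_def reg.ract_def lin_ext_comp lin_ext_fun_scale)
    have 4: "lin_ext reg.ract (rw c) = fscale (of_int (deg a)) ?X"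
      by (simp add: c \<open>as = a # d # ds\<close> rw_def reg.ract_def lin_ext_scale lin_ext_comp)
    show ?thesis unfolding 1 2 3 4 by (simp add: fvs.scale_left_distrib)
  qed (auto simp: c rw_def reg.mid_def reg.ract_def osg_def split: option.splits)
qed

lemma rw_lact: "lin_ext rw (reg.lact c) + lin_ext reg.lact (rw c) = 0"
proof -
  obtain m as where c: "c = (m, as)" by (cases c)
  consider "as = []" | a where "as = [a]" | a ds d where "as = a # ds @ [d]"
    by (cases as; cases "tl as" rule: rev_cases) auto
  then show ?thesis
  proof cases
    case (3 a ds d)
    have "lin_ext rw (reg.lact c) = fscale (of_int (deg a)) (lin_ext reg.ract (reg.lact c))"
      by (simp add: c 3 rw_def reg.lact_def lin_ext_scale lin_ext_uminus lin_ext_comp lin_ext_fun_scale fvs.scale_scale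
          butlast_append del: fscale_single)
    moreover have "lin_ext reg.lact (rw c) = fscale (of_int (deg a)) (lin_ext reg.lact (reg.ract c))"
      by (simp add: c 3 rw_def lin_ext_scale)
    ultimately show ?thesis using reg.ract_lact[of c] by (simp flip: fvs.scale_right_distrib)
  qed (auto simp: c rw_def reg.lact_def reg.ract_def osg_def lin_ext_uminus split: option.splits)
qed

lemma rw_hochm: "lin_ext rw (reg.hochm c) = - lin_ext reg.hochm (rw c)"
proof -
  have *: "lin_ext reg.hochm v = lin_ext reg.ract v - lin_ext reg.mid v + lin_ext reg.lact v" for v
    by (simp add: reg.hochm_def[abs_def] lin_ext_fun_add lin_ext_fun_diff)
  have "lin_ext rw (reg.hochm c) + lin_ext reg.hochm (rw c)
    = (lin_ext rw (reg.ract c) + lin_ext reg.ract (rw c)) - (lin_ext rw (reg.mid c) + lin_ext reg.mid (rw c))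
      + (lin_ext rw (reg.lact c) + lin_ext reg.lact (rw c))"
    unfolding * by (simp add: reg.hochm_def lin_ext_linear)
  then show ?thesis by (simp add: rw_mid rw_lact eq_neg_iff_add_eq_0)
qed

lemma e_hoch: "xs \<noteq> [] \<Longrightarrow> e_op (hoch xs) = - b_op (elist xs)"
proof -
  assume "xs \<noteq> []"
  then obtain m as where xs: "xs = m # as" by (cases xs) auto
  let ?J = "lin_ext (\<lambda>c. sg (fst c # snd c))"
  have "e_op (hoch xs) = ?J (lin_ext rw (reg.hochm (m, as)))"
    by (simp add: xs hoch_Cons lin_ext_comp elist_Cons)
  moreover have "b_op (elist xs) = ?J (lin_ext reg.hochm (rw (m, as)))"
    by (simp add: xs hoch_Cons lin_ext_comp elist_Cons)
  ultimately show ?thesis by (simp add: rw_hochm lin_ext_uminus)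
qed

text \<open>The Cartan formula for the Euler derivation (Goodwillie).\<close>

lemma cartan:
  assumes "x \<in> fsp (CB n j)" "0 < n"
  shows "fscale (of_int j) x = e_op (Bop n x) + s_op (Nop n (e_op x)) + b_op (s_op (Qop n x)) + s_op (Qop (n - 1) (b_op x))"
proof -
  have xl: "x \<in> fsp (len (Suc n))" using assms(1) by (rule fsp_mono) (auto simp: CB_def)
  have bQ: "lin_ext bar (Qop n x) = Qop (n - 1) (b_op x) + Nop n (e_op x)"
    by (rule lin_eqI[OF _ _ xl, of "\<lambda>x. lin_ext bar (Qop n x)" "\<lambda>x. Qop (n - 1) (b_op x) + Nop n (e_op x)"])
      (simp_all add: bar_Q_sg[OF _ assms(2)] lin_plus lin_comp[OF lin_lin_ext lin_Qop] lin_comp[OF lin_Qop lin_lin_ext]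
        lin_comp[OF lin_Nop lin_lin_ext])
  have D: "lin_ext D0 (Nop (Suc n) x) = fscale (of_int j) x - (Qop n x - t_op (Qop n x))"
  proof (rule lin_eqI[OF _ _ assms(1), of "\<lambda>x. lin_ext D0 (Nop (Suc n) x)" "\<lambda>x. fscale (of_int j) x - (Qop n x - t_op (Qop n x))"])
    show "lin_ext D0 (Nop (Suc n) (sg xs)) = fscale (of_int j) (sg xs) - (Qop n (sg xs) - t_op (Qop n (sg xs)))"
      if "xs \<in> CB n j" for xs using that D0_N_sg[of xs n] by (simp add: CB_def del: fscale_single)
  qed (simp_all add: lin_comp[OF lin_lin_ext lin_Nop] lin_minus lin_fscale lin_id lin_comp[OF lin_lin_ext lin_Qop])
  have Q: "Qop n x \<in> fsp {xs. xs \<noteq> []}"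
  proof -
    have "Qop n x \<in> fsp (len (Suc n))" unfolding Qop_def
      by (rule fsp_lin_ext[OF xl]) (auto intro!: fsp_sum fsp_scale tpow_len fsp_single)
    then show ?thesis by (rule fsp_len_ne)
  qed
  \<comment> \<open>By \<open>b_s\<close>, b s Q = (1 - t) Q - s b' Q, and b' Q = Q b + N e. The
    term (1 - t) Q cancels the one in D0 N = e B.\<close>
  show ?thesis using e_B[OF xl] b_s[OF Q] D bQ by (simp add: lin_ext_add)
qed

text \<open>The rotation has order n + 1, also with signs, because n (n + 1) is even.\<close>

lemma t_N:
  assumes "w \<in> fsp (len (Suc n))"
  shows "t_op (Nop (Suc n) w) = Nop (Suc n) w"
proof -
  have "tpow (Suc n) w = w"
  proof (rule lin_eqI[OF _ _ assms(1), of "tpow (Suc n)" "\<lambda>w. w"])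
    fix xs :: "'b list" assume "xs \<in> len (Suc n)"
    moreover have "((-1::complex) ^ n) ^ Suc n = 1"
    proof -
      have "even (n * Suc n)" by simp
      then show ?thesis by (simp only: power_mult[symmetric] neg_one_even_power)
    qed
    ultimately show "tpow (Suc n) (sg xs) = sg xs" using tpow_sg[of xs "Suc n"] by (cases "xs = []") auto
  qed (simp_all add: lin_id)
  then have "(\<Sum>r<Suc n. tpow (Suc r) w) = (\<Sum>r<Suc n. tpow r w)"
    by (simp add: sum.lessThan_Suc_shift[of "\<lambda>r. tpow r w"] del: sum.lessThan_Suc) (simp add: add.commute)
  then show ?thesis by (simp add: Nop_def lin_ext_sum tpow_Suc del: sum.lessThan_Suc)
qed

lemma b_s_N:
  assumes "w \<in> fsp (len (Suc n))" "0 < n"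
  shows "b_op (s_op (Nop (Suc n) w)) = - s_op (Nop n (b_op w))"
  using b_s[OF fsp_len_ne[OF Nop_len[OF assms(1)]]] bar_N[OF assms] t_N[OF assms(1)] by simp

lemma s_len: "x \<in> fsp (len n) \<Longrightarrow> s_op x \<in> fsp (len (Suc n))"
  by (rule fsp_lin_ext, assumption) (auto simp: slist_def intro!: fsp_sum fsp_single)


lemma CB_len: "x \<in> fsp (CB n j) \<Longrightarrow> x \<in> fsp (len (Suc n))"
  by (erule fsp_mono) (auto simp: CB_def)

lemma t_CB: "x \<in> fsp (CB n j) \<Longrightarrow> t_op x \<in> fsp (CB n j)"
proof (rule fsp_lin_ext, assumption)
  fix xs assume "xs \<in> CB n j"
  then show "tlist xs \<in> fsp (CB n j)"
    by (cases xs rule: rev_cases) (auto simp: tlist_def CB_def simp del: fscale_single intro!: fsp_scale fsp_single)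
qed

lemma tpow_CB: "x \<in> fsp (CB n j) \<Longrightarrow> tpow r x \<in> fsp (CB n j)"
  by (induction r) (simp_all add: tpow_Suc t_CB)

lemma s_CB: "x \<in> fsp (CB n j) \<Longrightarrow> s_op x \<in> fsp (CB (Suc n) j)"
  by (rule fsp_lin_ext, assumption) (auto simp: slist_def CB_def deg_E intro!: fsp_sum fsp_single)

lemma N_CB: "x \<in> fsp (CB n j) \<Longrightarrow> Nop m x \<in> fsp (CB n j)"
  unfolding Nop_def by (intro fsp_sum tpow_CB)

lemma Q_CB: "x \<in> fsp (CB n j) \<Longrightarrow> Qop m x \<in> fsp (CB n j)"
  unfolding Qop_def by (rule fsp_lin_ext, assumption) (auto intro!: fsp_sum fsp_scale tpow_CB fsp_single)

lemma e_CB: "x \<in> fsp (CB (Suc n) j) \<Longrightarrow> e_op x \<in> fsp (CB n j)"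
proof (rule fsp_lin_ext, assumption)
  fix xs assume "xs \<in> CB (Suc n) j"
  then obtain a c as where "xs = a # c # as" "length as = n" "deg a + deg c + sum_list (map deg as) = j"
    by (cases xs rule: bar.cases) (auto simp: CB_def)
  then show "elist xs \<in> fsp (CB n j)"
    by (cases "mul a c") (auto simp: elist_def face_def CB_def deg_mul simp del: fscale_single intro!: fsp_scale fsp_single)
qed

text \<open>By the Cartan formula j x is a sum of boundaries: B x = b y gives e B x = - b e y; the
  cycle e x is some b w by exactness one degree lower, so s N e x = - b s N w; and the term with b x
  vanishes. Dividing by j proves the claim.\<close>

theorem connes_injective:
  assumes x: "x \<in> fsp (CB (Suc n) j)" "b_op x = 0" and j: "j \<noteq> 0" and n: "0 < n"
    and B: "Bop (Suc n) x \<in> b_op ` fsp (CB (Suc (Suc (Suc n))) j)"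
    and exact: "\<And>z. z \<in> fsp (CB n j) \<Longrightarrow> b_op z = 0 \<Longrightarrow> z \<in> b_op ` fsp (CB (Suc n) j)"
  shows "x \<in> b_op ` fsp (CB (Suc (Suc n)) j)"
proof -
  obtain y where y: "y \<in> fsp (CB (Suc (Suc (Suc n))) j)" "Bop (Suc n) x = b_op y" using B by blast
  have eb: "e_op (b_op z) = - b_op (e_op z)" if "z \<in> fsp (len (Suc m))" for z m
    by (rule lin_eqI[OF _ _ fsp_len_ne[OF that], of "\<lambda>z. e_op (b_op z)" "\<lambda>z. - b_op (e_op z)"])
      (simp_all add: e_hoch lin_ll lin_neg)
  have "b_op (e_op x) = 0" using eb[OF CB_len[OF x(1)]] x(2) by simp
  then obtain w where w: "w \<in> fsp (CB (Suc n) j)" "e_op x = b_op w" using exact[OF e_CB[OF x(1)]] by blast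
  have "fscale (of_int j) x = b_op (- e_op y - s_op (Nop (Suc (Suc n)) w) + s_op (Qop (Suc n) x))"
    using cartan[OF x(1)] y(2) eb[OF CB_len[OF y(1)]] w(2) b_s_N[OF CB_len[OF w(1)]] x(2)
    by (simp add: lin_ext_linear lin_0)
  then have "x = b_op (fscale (1 / of_int j) (- e_op y - s_op (Nop (Suc (Suc n)) w) + s_op (Qop (Suc n) x)))"
    using j by (metis divide_self_if fvs.scale_one fvs.scale_scale lin_ext_scale of_int_eq_0_iff times_divide_eq_left mult_1)
  moreover have "fscale (1 / of_int j) (- e_op y - s_op (Nop (Suc (Suc n)) w) + s_op (Qop (Suc n) x)) \<in> fsp (CB (Suc (Suc n)) j)"
    using x(1) y(1) w(1) by (intro fsp_scale fsp_add fsp_diff fsp_uminus s_CB N_CB Q_CB e_CB)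
  ultimately show ?thesis by blast
qed

end


section \<open>Chains over an algebra in coordinates\<close>

lemma lin_ext_swap: "lin_ext (\<lambda>a. lin_ext (\<lambda>b. f a b) y) x = lin_ext (\<lambda>b. lin_ext (\<lambda>a. f a b) x) y"
  unfolding lin_ext_def by (simp add: fvs.scale_sum_right mult.commute) (rule sum.swap)

context mult_basis begin

definition mulv :: "('b \<Rightarrow>\<^sub>0 complex) \<Rightarrow> ('b \<Rightarrow>\<^sub>0 complex) \<Rightarrow> ('b \<Rightarrow>\<^sub>0 complex)" where
  "mulv x y = lin_ext (\<lambda>a. lin_ext (\<lambda>b. osg (mul a b)) y) x"

definition vcons :: "('b \<Rightarrow>\<^sub>0 complex) \<Rightarrow> ('b list \<Rightarrow>\<^sub>0 complex) \<Rightarrow> ('b list \<Rightarrow>\<^sub>0 complex)" where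
  "vcons x v = lin_ext (\<lambda>b. consv b v) x"

text \<open>An elementary tensor of vectors, expanded in words of basis elements.\<close>

fun tens :: "('b \<Rightarrow>\<^sub>0 complex) list \<Rightarrow> ('b list \<Rightarrow>\<^sub>0 complex)" where
  "tens [] = sg []"
| "tens (x # xs) = vcons x (tens xs)"

lemma mulv_sg: "mulv (sg a) (sg b) = osg (mul a b)"
  by (simp add: mulv_def)

lemma mulv_lin_left: "lin (\<lambda>x. mulv x y)"
  by (simp add: mulv_def)

lemma mulv_lin_right: "lin (mulv x)"
  unfolding mulv_def lin_def by (simp add: lin_ext_linear lin_ext_fun_add lin_ext_fun_scale)

lemma vcons_lin_left: "lin (\<lambda>x. vcons x v)"
  by (simp add: vcons_def)

lemma vcons_lin_right: "lin (vcons x)"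
  unfolding vcons_def consv_def lin_def by (simp add: lin_ext_linear lin_ext_fun_add lin_ext_fun_scale)

lemma vcons_sg: "vcons (sg b) v = consv b v" "vcons x (sg bs) = lin_ext (\<lambda>b. sg (b # bs)) x"
  by (simp_all add: vcons_def consv_def)

lemma lin_eq_UNIV: "lin f \<Longrightarrow> lin g \<Longrightarrow> (\<And>b. f (sg b) = g (sg b)) \<Longrightarrow> f x = g x"
  by (rule lin_eqI[of f g x UNIV]) simp_all

lemma mulv_assoc: "mulv (mulv x y) z = mulv x (mulv y z)"
proof (rule lin_eq_UNIV[of "\<lambda>x. mulv (mulv x y) z" "\<lambda>x. mulv x (mulv y z)"])
  fix a show "mulv (mulv (sg a) y) z = mulv (sg a) (mulv y z)"
  proof (rule lin_eq_UNIV[of "\<lambda>y. mulv (mulv (sg a) y) z" "\<lambda>y. mulv (sg a) (mulv y z)"])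
    fix b show "mulv (mulv (sg a) (sg b)) z = mulv (sg a) (mulv (sg b) z)"
    proof (rule lin_eq_UNIV[of "mulv (mulv (sg a) (sg b))" "\<lambda>z. mulv (sg a) (mulv (sg b) z)"])
      fix c show "mulv (mulv (sg a) (sg b)) (sg c) = mulv (sg a) (mulv (sg b) (sg c))"
        using assoc[of a b c] by (cases "mul a b"; cases "mul b c") (simp_all add: mulv_def)
    qed (auto intro: lin_comp mulv_lin_left mulv_lin_right)
  qed (rule lin_comp[OF mulv_lin_left mulv_lin_right] lin_comp[OF mulv_lin_right mulv_lin_left])+
qed (rule lin_comp[OF mulv_lin_left mulv_lin_left] mulv_lin_left)+

lemma tens_len: "tens xs \<in> fsp (len (length xs))"
proof (induction xs)
  case (Cons x xs)
  have "consv b (tens xs) \<in> fsp (len (length (x # xs)))" for b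
    unfolding consv_def by (rule fsp_lin_ext[OF Cons]) (auto intro: fsp_single)
  then show ?case unfolding tens.simps vcons_def by (intro fsp_lin_ext[of x UNIV]) simp_all
qed (auto intro: fsp_single)

lemma bar_tens: "lin_ext bar (tens (x # y # zs)) = tens (mulv x y # zs) - vcons x (lin_ext bar (tens (y # zs)))"
proof -
  have *: "lin_ext bar (vcons (sg a) (vcons (sg b) v)) = vcons (mulv (sg a) (sg b)) v - vcons (sg a) (lin_ext bar (vcons (sg b) v))" for a b v
  proof (rule lin_eq_UNIV[of "\<lambda>v. lin_ext bar (vcons (sg a) (vcons (sg b) v))"])
    show "lin (\<lambda>v. lin_ext bar (vcons (sg a) (vcons (sg b) v)))"
      by (rule lin_comp[OF lin_lin_ext lin_comp[OF vcons_lin_right vcons_lin_right]])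
    show "lin (\<lambda>v. vcons (mulv (sg a) (sg b)) v - vcons (sg a) (lin_ext bar (vcons (sg b) v)))"
      by (rule lin_minus[OF vcons_lin_right lin_comp[OF vcons_lin_right lin_comp[OF lin_lin_ext vcons_lin_right]]])
    show "lin_ext bar (vcons (sg a) (vcons (sg b) (sg cs)))
        = vcons (mulv (sg a) (sg b)) (sg cs) - vcons (sg a) (lin_ext bar (vcons (sg b) (sg cs)))" for cs
      by (simp add: vcons_sg consv_def mulv_sg)
  qed
  have "lin_ext bar (vcons x (vcons y v)) = vcons (mulv x y) v - vcons x (lin_ext bar (vcons y v))" for v
  proof (rule lin_eq_UNIV[of "\<lambda>x. lin_ext bar (vcons x (vcons y v))"])
    fix a show "lin_ext bar (vcons (sg a) (vcons y v)) = vcons (mulv (sg a) y) v - vcons (sg a) (lin_ext bar (vcons y v))"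
    proof (rule lin_eq_UNIV[of "\<lambda>y. lin_ext bar (vcons (sg a) (vcons y v))"])
      show "lin (\<lambda>y. lin_ext bar (vcons (sg a) (vcons y v)))"
        by (rule lin_comp[OF lin_lin_ext lin_comp[OF vcons_lin_right vcons_lin_left]])
      show "lin (\<lambda>y. vcons (mulv (sg a) y) v - vcons (sg a) (lin_ext bar (vcons y v)))"
        by (rule lin_minus[OF lin_comp[OF vcons_lin_left mulv_lin_right]
              lin_comp[OF vcons_lin_right lin_comp[OF lin_lin_ext vcons_lin_left]]])
    qed (rule *)
    show "lin (\<lambda>x. lin_ext bar (vcons x (vcons y v)))"
      by (rule lin_comp[OF lin_lin_ext vcons_lin_left])
    show "lin (\<lambda>x. vcons (mulv x y) v - vcons x (lin_ext bar (vcons y v)))"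
      by (rule lin_minus[OF lin_comp[OF vcons_lin_left mulv_lin_left] vcons_lin_left])
  qed
  then show ?thesis by simp
qed

lemma tens_snoc: "tens (xs @ [y]) = lin_ext (\<lambda>b. snocv b (tens xs)) y"
proof (induction xs)
  case Nil
  then show ?case by (simp add: vcons_def consv_def snocv_def)
next
  case (Cons x xs)
  have "vcons x (lin_ext (\<lambda>b. snocv b v) y) = lin_ext (\<lambda>a. lin_ext (\<lambda>b. snocv b (consv a v)) y) x" for v
    unfolding vcons_def consv_def snocv_def by (simp add: lin_ext_comp)
  also have "lin_ext (\<lambda>a. lin_ext (\<lambda>b. snocv b (consv a v)) y) x = lin_ext (\<lambda>b. snocv b (vcons x v)) y" for v
    unfolding lin_ext_swap[of _ y x] by (simp add: vcons_def snocv_def lin_ext_comp)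
  finally have "vcons x (lin_ext (\<lambda>b. snocv b v) y) = lin_ext (\<lambda>b. snocv b (vcons x v)) y" for v .
  then show ?case using Cons by simp
qed

lemma t_tens: "t_op (tens (xs @ [y])) = fscale ((-1) ^ length xs) (tens (y # xs))"
proof -
  have *: "t_op (snocv b v) = fscale ((-1) ^ length xs) (consv b v)" if "v \<in> fsp (len (length xs))" for b v
    unfolding snocv_def consv_def lin_ext_comp lin_ext_fun_scale[symmetric]
    by (rule lin_ext_eqI[OF that]) (simp add: tlist_def)
  show ?thesis
    by (simp add: tens_snoc lin_ext_comp *[OF tens_len] lin_ext_fun_scale vcons_def)
qed

lemma last_face_tens:
  "lin_ext last_face (tens (x # ys @ [z])) = fscale ((-1) ^ Suc (length ys)) (tens (mulv z x # ys))"
proof -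
  have *: "lin_ext last_face (consv a (snocv c v)) = fscale ((-1) ^ Suc (length ys)) (lin_ext (\<lambda>b. consv b v) (osg (mul c a)))"
    if "v \<in> fsp (len (length ys))" for a c v
  proof -
    have "lin_ext (\<lambda>b. consv b v) (osg (mul c a)) = lin_ext (\<lambda>bs. lin_ext (\<lambda>b. sg (b # bs)) (osg (mul c a))) v"
      by (cases "mul c a") (simp_all add: consv_def)
    moreover have "lin_ext last_face (consv a (snocv c v))
        = lin_ext (\<lambda>bs. fscale ((-1) ^ Suc (length ys)) (lin_ext (\<lambda>b. sg (b # bs)) (osg (mul c a)))) v"
      unfolding snocv_def consv_def lin_ext_comp
      by (rule lin_ext_eqI[OF that]) (simp add: last_face_def)
    ultimately show ?thesis by (simp only: lin_ext_fun_scale)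
  qed
  have "lin_ext last_face (tens (x # ys @ [z])) = lin_ext (\<lambda>a. lin_ext (\<lambda>c. lin_ext last_face (consv a (snocv c (tens ys)))) z) x"
    unfolding tens.simps tens_snoc vcons_def lin_ext_comp
    by (rule lin_ext_cong) (simp add: consv_def lin_ext_comp)
  also have "\<dots> = fscale ((-1) ^ Suc (length ys)) (lin_ext (\<lambda>a. lin_ext (\<lambda>c. lin_ext (\<lambda>b. consv b (tens ys)) (osg (mul c a))) z) x)"
    by (simp only: *[OF tens_len] lin_ext_fun_scale)
  also have "lin_ext (\<lambda>a. lin_ext (\<lambda>c. lin_ext (\<lambda>b. consv b (tens ys)) (osg (mul c a))) z) x
    = lin_ext (\<lambda>c. lin_ext (\<lambda>a. lin_ext (\<lambda>b. consv b (tens ys)) (osg (mul c a))) x) z"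
    by (rule lin_ext_swap)
  finally show ?thesis by (simp add: mulv_def vcons_def lin_ext_comp)
qed

lemma s_tens: "s_op (tens xs) = tens ((\<Sum>e\<in>E. sg e) # xs)"
  by (simp add: vcons_def lin_ext_sum s_consv)

end

section \<open>Algebras with coordinates and their Tor chains\<close>

locale algebra_coords = mult_basis mul src tgt E deg
  for mul :: "'b \<Rightarrow> 'b \<Rightarrow> 'b option" and src tgt :: "'b \<Rightarrow> 'b" and E :: "'b set" and deg :: "'b \<Rightarrow> int" +
  fixes A :: "(complex, 'a) graded_algebra" and \<kappa> :: "'a \<Rightarrow> ('b \<Rightarrow>\<^sub>0 complex)"
  assumes \<kappa>_bij: "bij_betw \<kappa> (carrier A) UNIV"
    and add_closed: "x \<in> carrier A \<Longrightarrow> y \<in> carrier A \<Longrightarrow> x \<oplus>\<^bsub>A\<^esub> y \<in> carrier A"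
    and smult_closed: "x \<in> carrier A \<Longrightarrow> c \<odot>\<^bsub>A\<^esub> x \<in> carrier A"
    and mult_closed: "x \<in> carrier A \<Longrightarrow> y \<in> carrier A \<Longrightarrow> x \<otimes>\<^bsub>A\<^esub> y \<in> carrier A"
    and one_closed: "\<one>\<^bsub>A\<^esub> \<in> carrier A"
    and \<kappa>_add: "x \<in> carrier A \<Longrightarrow> y \<in> carrier A \<Longrightarrow> \<kappa> (x \<oplus>\<^bsub>A\<^esub> y) = \<kappa> x + \<kappa> y"
    and \<kappa>_smult: "x \<in> carrier A \<Longrightarrow> \<kappa> (c \<odot>\<^bsub>A\<^esub> x) = fscale c (\<kappa> x)"
    and \<kappa>_mult: "x \<in> carrier A \<Longrightarrow> y \<in> carrier A \<Longrightarrow> \<kappa> (x \<otimes>\<^bsub>A\<^esub> y) = mulv (\<kappa> x) (\<kappa> y)"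
    and \<kappa>_one: "\<kappa> \<one>\<^bsub>A\<^esub> = (\<Sum>e\<in>E. sg e)"
    and homog: "homog A d = {x \<in> carrier A. \<kappa> x \<in> fsp {b. deg b = d}}"
begin

lemma \<kappa>_inj: "x \<in> carrier A \<Longrightarrow> y \<in> carrier A \<Longrightarrow> \<kappa> x = \<kappa> y \<Longrightarrow> x = y"
  using \<kappa>_bij by (auto simp: bij_betw_def inj_on_def)

definition \<iota> :: "('b \<Rightarrow>\<^sub>0 complex) \<Rightarrow> 'a" where
  "\<iota> = the_inv_into (carrier A) \<kappa>"

lemma \<iota>_carrier [simp]: "\<iota> v \<in> carrier A" and \<kappa>_\<iota> [simp]: "\<kappa> (\<iota> v) = v"
  using \<kappa>_bij f_the_inv_into_f[of \<kappa> "carrier A" v] the_inv_into_into[of \<kappa> "carrier A" v "carrier A"]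
  by (auto simp: \<iota>_def bij_betw_def)

lemma \<iota>_\<kappa>: "x \<in> carrier A \<Longrightarrow> \<iota> (\<kappa> x) = x"
  by (rule \<kappa>_inj) simp_all

lemma one_v: "mulv (\<Sum>e\<in>E. sg e) x = x" "mulv x (\<Sum>e\<in>E. sg e) = x"
proof -
  have l: "mulv (\<Sum>e\<in>E. sg e) (sg a) = sg a" for a
    using sum_mul_E_left[of sg a] by (simp add: mulv_def lin_ext_sum)
  show "mulv (\<Sum>e\<in>E. sg e) x = x"
    by (rule lin_eq_UNIV[of "mulv (\<Sum>e\<in>E. sg e)" "\<lambda>x. x"]) (simp_all add: mulv_lin_right lin_id l)
  have r: "mulv (sg a) (\<Sum>e\<in>E. sg e) = sg a" for a
    using sum_mul_E_right[of sg a] by (simp add: mulv_def lin_ext_sum)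
  show "mulv x (\<Sum>e\<in>E. sg e) = x"
    by (rule lin_eq_UNIV[of "\<lambda>x. mulv x (\<Sum>e\<in>E. sg e)" "\<lambda>x. x"]) (simp_all add: mulv_lin_left lin_id r)
qed

lemma A_assoc: "x \<in> carrier A \<Longrightarrow> y \<in> carrier A \<Longrightarrow> z \<in> carrier A \<Longrightarrow> x \<otimes>\<^bsub>A\<^esub> y \<otimes>\<^bsub>A\<^esub> z = x \<otimes>\<^bsub>A\<^esub> (y \<otimes>\<^bsub>A\<^esub> z)"
  by (rule \<kappa>_inj) (simp_all add: mult_closed \<kappa>_mult mulv_assoc)

lemma A_one: "x \<in> carrier A \<Longrightarrow> \<one>\<^bsub>A\<^esub> \<otimes>\<^bsub>A\<^esub> x = x" "x \<in> carrier A \<Longrightarrow> x \<otimes>\<^bsub>A\<^esub> \<one>\<^bsub>A\<^esub> = x"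
  by (rule \<kappa>_inj; simp add: mult_closed one_closed \<kappa>_mult \<kappa>_one one_v)+

definition tau :: "'a list \<Rightarrow> ('b list \<Rightarrow>\<^sub>0 complex)" where
  "tau xs = tens (map \<kappa> xs)"

text \<open>The isomorphism of A \<otimes> Bar_n over the enveloping algebra with the Hochschild
  chains, in coordinates; \<open>Psi\<close> is its section on basis words.\<close>

definition Phi :: "'a list \<Rightarrow> ('b list \<Rightarrow>\<^sub>0 complex)" where
  "Phi l = tau (to_hochschild A l)"

definition Psi :: "'b list \<Rightarrow> ('a list \<Rightarrow>\<^sub>0 complex)" where
  "Psi bs = sg (of_hochschild A (map (\<lambda>b. \<iota> (sg b)) bs))"

lemma TL_E:
  assumes "l \<in> tensor_lists A (n + 3)"
  obtains a x xs z where "l = a # x # xs @ [z]" "a \<in> carrier A" "x \<in> carrier A" "z \<in> carrier A"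
    "set xs \<subseteq> carrier A" "length xs = n"
proof -
  obtain a x ys where l: "l = a # x # ys" "length ys = Suc n"
    using assms by (cases l; cases "tl l") (auto simp: tensor_lists_def)
  then obtain xs z where "ys = xs @ [z]" by (cases ys rule: rev_cases) auto
  then show thesis using that assms l by (auto simp: tensor_lists_def)
qed

lemma to_hochschild_simp: "to_hochschild A (a # x # xs @ [z]) = (z \<otimes>\<^bsub>A\<^esub> a \<otimes>\<^bsub>A\<^esub> x) # xs"
  by (simp add: to_hochschild_def)

lemma to_hochschild_TL: "l \<in> tensor_lists A (n + 3) \<Longrightarrow> to_hochschild A l \<in> tensor_lists A (n + 1)"
  by (erule TL_E) (simp add: to_hochschild_simp tensor_lists_def mult_closed)

lemma of_hochschild_TL: "ys \<in> tensor_lists A (n + 1) \<Longrightarrow> of_hochschild A ys \<in> tensor_lists A (n + 3)"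
  by (cases ys) (auto simp: of_hochschild_def tensor_lists_def one_closed)

lemma to_of_hochschild: "ys \<in> tensor_lists A (n + 1) \<Longrightarrow> to_hochschild A (of_hochschild A ys) = ys"
  by (cases ys) (auto simp: of_hochschild_def to_hochschild_simp tensor_lists_def A_one one_closed)


lemma tau_basis: "tau (map (\<lambda>b. \<iota> (sg b)) bs) = sg bs"
  by (induction bs) (simp_all add: tau_def vcons_sg consv_def)

lemma basis_TL: "length bs = n \<Longrightarrow> map (\<lambda>b. \<iota> (sg b)) bs \<in> tensor_lists A n"
  by (auto simp: tensor_lists_def)

lemma Phi_Psi: "length bs = Suc n \<Longrightarrow> lin_ext Phi (Psi bs) = sg bs"
  using to_of_hochschild[OF basis_TL, of bs n] by (simp add: Psi_def Phi_def tau_basis)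

lemma bar_diff_Cons: "bar_diff A (x # y # zs) = sg ((x \<otimes>\<^bsub>A\<^esub> y) # zs) - lin_ext (\<lambda>ys. sg (x # ys)) (bar_diff A (y # zs))"
  by (simp add: bar_diff_def sum.lessThan_Suc_shift lin_ext_sum sum_negf[symmetric] single_uminus del: sum.lessThan_Suc)

lemma bar_diff_snoc:
  assumes "ys \<noteq> []"
  shows "bar_diff A (ys @ [z]) = lin_ext (\<lambda>zs. sg (zs @ [z])) (bar_diff A ys)
    - fscale ((-1) ^ length ys) (sg (butlast ys @ [last ys \<otimes>\<^bsub>A\<^esub> z]))"
  using assms
proof (induction ys rule: induct_list012)
  case (3 x y zs)
  have "bar_diff A (x # y # zs @ [z]) = sg ((x \<otimes>\<^bsub>A\<^esub> y) # zs @ [z]) - lin_ext (\<lambda>ys. sg (x # ys)) (bar_diff A ((y # zs) @ [z]))"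
    using bar_diff_Cons[of x y "zs @ [z]"] by simp
  also have "bar_diff A ((y # zs) @ [z]) = lin_ext (\<lambda>zs. sg (zs @ [z])) (bar_diff A (y # zs))
    - fscale ((-1) ^ length (y # zs)) (sg (butlast (y # zs) @ [last (y # zs) \<otimes>\<^bsub>A\<^esub> z]))"
    using 3 by simp
  finally show ?case
    by (simp add: bar_diff_Cons lin_ext_linear lin_ext_comp fvs.scale_minus_left del: fscale_single)
qed (simp_all add: bar_diff_def fvs.scale_minus_left del: fscale_single)

lemma tau_Cons: "lin_ext (\<lambda>ys. tau (a # ys)) v = vcons (\<kappa> a) (lin_ext tau v)"
  using lin_eq_lin_ext[OF lin_comp[OF vcons_lin_right[of "\<kappa> a"] lin_lin_ext[of tau]], of v] by (simp add: tau_def)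

lemma tau_bar_diff: "xs \<in> tensor_lists A n \<Longrightarrow> lin_ext tau (bar_diff A xs) = lin_ext bar (tau xs)"
proof (induction xs arbitrary: n rule: induct_list012)
  case (3 a c as)
  have c: "c # as \<in> tensor_lists A (n - 1)" "a \<in> carrier A" "c \<in> carrier A" using 3(3) by (auto simp: tensor_lists_def)
  then have IH: "lin_ext tau (bar_diff A (c # as)) = lin_ext bar (tau (c # as))" using 3(2) by blast
  have eq: "lin_ext tau (bar_diff A (a # c # as)) = tau ((a \<otimes>\<^bsub>A\<^esub> c) # as) - vcons (\<kappa> a) (lin_ext bar (tau (c # as)))"
    by (simp add: bar_diff_Cons lin_ext_diff lin_ext_comp tau_Cons IH)
  have "tau ((a \<otimes>\<^bsub>A\<^esub> c) # as) = tens (mulv (\<kappa> a) (\<kappa> c) # map \<kappa> as)" using c by (simp add: tau_def \<kappa>_mult)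
  then show ?case unfolding eq using bar_tens[of "\<kappa> a" "\<kappa> c" "map \<kappa> as"]
    by (simp only: tau_def[of "a # c # as"] tau_def[of "c # as"] list.map)
qed (simp_all add: bar_diff_def tau_def vcons_def consv_def lin_ext_comp)

definition cdiff :: "'a list \<Rightarrow> ('a list \<Rightarrow>\<^sub>0 complex)" where
  "cdiff l = lin_ext (\<lambda>ys. sg (hd l # ys)) (bar_diff A (tl l))"

text \<open>The list (a, x, ys, z) closes up to v = z a x. So the outer faces of b', which multiply
  x by the first and z by the last letter of ys, become v y and w v: the first and the cyclic face
  of b.\<close>

lemma Phi_cdiff:
  assumes "l \<in> tensor_lists A (Suc n + 3)"
  shows "lin_ext Phi (cdiff l) = b_op (Phi l)"
proof -
  obtain a x ys z where l: "l = a # x # ys @ [z]" and c: "a \<in> carrier A" "x \<in> carrier A" "z \<in> carrier A"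
    "set ys \<subseteq> carrier A" "length ys = Suc n" using assms by (rule TL_E)
  obtain y ys' where y: "ys = y # ys'" using c(5) by (cases ys) auto
  obtain us w where w: "ys = us @ [w]" using c(5) by (cases ys rule: rev_cases) auto
  have cy: "y \<in> carrier A" using c(4) by (simp add: y)
  have cw: "w \<in> carrier A" "set us \<subseteq> carrier A" using c(4) by (simp_all add: w)
  define v where "v = \<kappa> (z \<otimes>\<^bsub>A\<^esub> a \<otimes>\<^bsub>A\<^esub> x)"
  have "bar_diff A (x # ys @ [z]) = sg ((x \<otimes>\<^bsub>A\<^esub> y) # ys' @ [z])
      - lin_ext (\<lambda>bs. sg (x # bs @ [z])) (bar_diff A ys) + fscale ((-1) ^ length ys) (sg (x # us @ [w \<otimes>\<^bsub>A\<^esub> z]))"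
  proof -
    have "bar_diff A (x # ys @ [z]) = sg ((x \<otimes>\<^bsub>A\<^esub> y) # ys' @ [z]) - lin_ext (\<lambda>ys. sg (x # ys)) (bar_diff A (ys @ [z]))"
      using bar_diff_Cons[of x y "ys' @ [z]"] by (simp add: y)
    moreover have "bar_diff A (ys @ [z]) = lin_ext (\<lambda>zs. sg (zs @ [z])) (bar_diff A ys)
        - fscale ((-1) ^ length ys) (sg (us @ [w \<otimes>\<^bsub>A\<^esub> z]))"
      using bar_diff_snoc[of ys z] by (simp add: w)
    ultimately show ?thesis by (simp add: lin_ext_linear lin_ext_comp del: fscale_single)
  qed
  then have "lin_ext Phi (cdiff l) = Phi (a # (x \<otimes>\<^bsub>A\<^esub> y) # ys' @ [z])
      - lin_ext (\<lambda>bs. Phi (a # x # bs @ [z])) (bar_diff A ys) + fscale ((-1) ^ length ys) (Phi (a # x # us @ [w \<otimes>\<^bsub>A\<^esub> z]))"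
    by (simp add: cdiff_def l lin_ext_linear lin_ext_comp)
  also have "Phi (a # (x \<otimes>\<^bsub>A\<^esub> y) # ys' @ [z]) = tens (mulv v (\<kappa> y) # map \<kappa> ys')"
    using c cy A_assoc[of "z \<otimes>\<^bsub>A\<^esub> a" x y, symmetric]
    by (simp add: Phi_def to_hochschild_simp tau_def v_def \<kappa>_mult mult_closed)
  also have "lin_ext (\<lambda>bs. Phi (a # x # bs @ [z])) (bar_diff A ys) = vcons v (lin_ext bar (tau ys))"
  proof -
    have "lin_ext (\<lambda>bs. Phi (a # x # bs @ [z])) u = vcons v (lin_ext tau u)" for u
      using lin_eq_lin_ext[OF lin_comp[OF vcons_lin_right[of v] lin_lin_ext[of tau]], of u]
      by (simp add: Phi_def to_hochschild_simp v_def tau_def)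
    then show ?thesis using tau_bar_diff[of ys "Suc n"] c by (simp add: tensor_lists_def)
  qed
  also have "Phi (a # x # us @ [w \<otimes>\<^bsub>A\<^esub> z]) = tens (mulv (\<kappa> w) v # map \<kappa> us)"
    using c cw A_assoc[of w z a] A_assoc[of w "z \<otimes>\<^bsub>A\<^esub> a" x]
    by (simp add: Phi_def to_hochschild_simp tau_def v_def \<kappa>_mult mult_closed)
  also have "tens (mulv v (\<kappa> y) # map \<kappa> ys') - vcons v (lin_ext bar (tau ys))
      + fscale ((-1) ^ length ys) (tens (mulv (\<kappa> w) v # map \<kappa> us)) = b_op (tens (v # map \<kappa> ys))"
  proof -
    have "map \<kappa> ys = \<kappa> y # map \<kappa> ys'" by (simp add: y)
    then have "lin_ext bar (tens (v # map \<kappa> ys)) = tens (mulv v (\<kappa> y) # map \<kappa> ys') - vcons v (lin_ext bar (tau ys))"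
      using bar_tens[of v "\<kappa> y" "map \<kappa> ys'"] by (simp only: tau_def)
    moreover have "map \<kappa> ys = map \<kappa> us @ [\<kappa> w]" "length ys = Suc (length us)" by (simp_all add: w)
    then have "lin_ext last_face (tens (v # map \<kappa> ys)) = fscale ((-1) ^ length ys) (tens (mulv (\<kappa> w) v # map \<kappa> us))"
      using last_face_tens[of v "map \<kappa> us" "\<kappa> w"] by (simp only: length_map)
    ultimately show ?thesis by (simp add: hoch_def[abs_def] lin_ext_fun_add del: tens.simps)
  qed
  also have "tens (v # map \<kappa> ys) = Phi l"
    by (simp add: Phi_def l to_hochschild_simp tau_def v_def)
  finally show ?thesis .
qed

end


section \<open>Hochschild and cyclic homology in coordinates\<close>

definition cspace :: "nat \<Rightarrow> (complex, nat \<Rightarrow> complex) module" where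
  "cspace k = \<lparr>carrier = {..<k} \<rightarrow>\<^sub>E UNIV, mult = undefined, one = undefined, zero = (\<lambda>i\<in>{..<k}. 0),
     add = (\<lambda>f g. \<lambda>i\<in>{..<k}. f i + g i), smult = (\<lambda>c f. \<lambda>i\<in>{..<k}. c * f i)\<rparr>"

lemma linear_iso_cspace:
  fixes V :: "(complex, 'v, 'm) module_scheme" and Z N :: "('b \<Rightarrow>\<^sub>0 complex) set"
  assumes "quot_dim Z N k" and Z: "fvs.subspace Z"
    and car: "carrier V = cls ` Z"
    and cls: "\<And>x y. x \<in> Z \<Longrightarrow> y \<in> Z \<Longrightarrow> cls x = cls y \<longleftrightarrow> x - y \<in> N"
    and add: "\<And>x y. x \<in> Z \<Longrightarrow> y \<in> Z \<Longrightarrow> cls x \<oplus>\<^bsub>V\<^esub> cls y = cls (x + y)"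
    and smult: "\<And>c x. x \<in> Z \<Longrightarrow> c \<odot>\<^bsub>V\<^esub> cls x = cls (fscale c x)"
  shows "linear_iso V (cspace k)"
proof -
  obtain f where f:
    "\<And>x y. x \<in> Z \<Longrightarrow> y \<in> Z \<Longrightarrow> f (x + y) = (\<lambda>i\<in>{..<k}. f x i + f y i)"
    "\<And>c x. x \<in> Z \<Longrightarrow> f (fscale c x) = (\<lambda>i\<in>{..<k}. c * f x i)"
    "f ` Z = ({..<k} \<rightarrow>\<^sub>E UNIV)" "\<And>x. x \<in> Z \<Longrightarrow> f x = (\<lambda>i\<in>{..<k}. 0) \<longleftrightarrow> x \<in> N"
    using assms(1) by (rule quot_dimE) (rule that)
  have fZ: "f x \<in> {..<k} \<rightarrow>\<^sub>E UNIV" if "x \<in> Z" for x using f(3) that by (metis image_eqI)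
  have feq: "f x = f y \<longleftrightarrow> x - y \<in> N" if "x \<in> Z" "y \<in> Z" for x y
  proof -
    have xy: "x - y \<in> Z" using that Z by (simp add: fvs.subspace_diff)
    have "f (y + (x - y)) = (\<lambda>i\<in>{..<k}. f y i + f (x - y) i)" by (rule f(1)[OF that(2) xy])
    then have eq: "f x = (\<lambda>i\<in>{..<k}. f y i + f (x - y) i)" by simp
    have "f x = f y \<longleftrightarrow> f (x - y) = (\<lambda>i\<in>{..<k}. 0)"
    proof
      assume "f x = f y"
      then have "f y i = f y i + f (x - y) i" if "i < k" for i using eq that by (metis lessThan_iff restrict_apply')
      then show "f (x - y) = (\<lambda>i\<in>{..<k}. 0)" using fZ[OF xy] by (intro ext) (auto simp: PiE_def extensional_def)
    next
      assume "f (x - y) = (\<lambda>i\<in>{..<k}. 0)"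
      then show "f x = f y" using eq fZ[OF that(2)] by (intro ext) (auto simp: PiE_def extensional_def)
    qed
    then show ?thesis using f(4)[OF xy] by simp
  qed
  define r where "r X = (SOME x. x \<in> Z \<and> X = cls x)" for X
  have r: "r (cls x) \<in> Z" "cls x = cls (r (cls x))" if "x \<in> Z" for x
    using someI_ex[of "\<lambda>y. y \<in> Z \<and> cls x = cls y"] that unfolding r_def by blast+
  have fr: "f (r (cls x)) = f x" if "x \<in> Z" for x
    using feq[OF r(1)[OF that] that] cls[OF r(1)[OF that] that] r(2)[OF that] by simp
  have "inj_on (\<lambda>X. f (r X)) (cls ` Z)"
    by (rule inj_onI) (auto simp: fr feq cls)
  moreover have "(\<lambda>X. f (r X)) ` cls ` Z = f ` Z"
    unfolding image_image by (rule image_cong) (simp_all add: fr)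
  ultimately have bij: "bij_betw (\<lambda>X. f (r X)) (carrier V) (carrier (cspace k))"
    unfolding bij_betw_def car cspace_def using f(3) by simp
  have a: "f (r (X \<oplus>\<^bsub>V\<^esub> Y)) = f (r X) \<oplus>\<^bsub>cspace k\<^esub> f (r Y)" if XY: "X \<in> carrier V" "Y \<in> carrier V" for X Y
  proof -
    obtain x y where xy: "x \<in> Z" "y \<in> Z" "X = cls x" "Y = cls y" using XY car by auto
    then have "x + y \<in> Z" using Z by (simp add: fvs.subspace_add)
    then show ?thesis using xy by (simp add: add fr f(1) cspace_def)
  qed
  have s: "f (r (c \<odot>\<^bsub>V\<^esub> X)) = c \<odot>\<^bsub>cspace k\<^esub> f (r X)" if X: "X \<in> carrier V" for X c
  proof -
    obtain x where x: "x \<in> Z" "X = cls x" using X car by auto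
    then have "fscale c x \<in> Z" using Z by (simp add: fvs.subspace_scale)
    then show ?thesis using x by (simp add: smult fr f(2) cspace_def)
  qed
  show ?thesis unfolding linear_iso_def using bij a s by (intro exI[of _ "\<lambda>X. f (r X)"] conjI) simp_all
qed

context algebra_coords begin

abbreviation TL :: "nat \<Rightarrow> 'a list set" where
  "TL n \<equiv> tensor_lists A (n + 3)"

abbreviation FS :: "nat \<Rightarrow> (complex, 'a list \<Rightarrow>\<^sub>0 complex) module" where
  "FS n \<equiv> free_space (TL n)"

text \<open>The coset of the Tor relations with coordinates c; every Tor chain is such a fibre of
  \<open>Phi\<close>.\<close>

definition fib :: "nat \<Rightarrow> ('b list \<Rightarrow>\<^sub>0 complex) \<Rightarrow> ('a list \<Rightarrow>\<^sub>0 complex) set" where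
  "fib n c = {x \<in> fsp (TL n). lin_ext Phi x = c}"

lemma FS_simps: "carrier (FS n) = fsp (TL n)" "add (FS n) = (+)" "smult (FS n) = fscale" "zero (FS n) = 0"
  by (simp_all add: free_space_def fsp_def)


lemma Psi_fsp: "c \<in> fsp (len (Suc n)) \<Longrightarrow> lin_ext Psi c \<in> fsp (TL n)"
  by (rule fsp_lin_ext, assumption)
    (auto simp: Psi_def intro!: fsp_single of_hochschild_TL basis_TL)

lemma Phi_Psi_ext: "c \<in> fsp (len (Suc n)) \<Longrightarrow> lin_ext Phi (lin_ext Psi c) = c"
  using lin_ext_eqI[of c "len (Suc n)" "\<lambda>bs. lin_ext Phi (Psi bs)" sg] by (simp add: lin_ext_comp Phi_Psi)

lemma Psi_fib: "c \<in> fsp (len (Suc n)) \<Longrightarrow> lin_ext Psi c \<in> fib n c"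
  by (simp add: fib_def Psi_fsp Phi_Psi_ext)

lemma multilinear_add:
  "xs @ x # ys \<in> tensor_lists A m \<Longrightarrow> y \<in> carrier A \<Longrightarrow>
   sg (xs @ (x \<oplus>\<^bsub>A\<^esub> y) # ys) - sg (xs @ x # ys) - sg (xs @ y # ys) \<in> multilinear_rels A m"
  unfolding multilinear_rels_def by blast

lemma multilinear_smult:
  "xs @ x # ys \<in> tensor_lists A m \<Longrightarrow>
   sg (xs @ (c \<odot>\<^bsub>A\<^esub> x) # ys) - Poly_Mapping.single (xs @ x # ys) c \<in> multilinear_rels A m"
  unfolding multilinear_rels_def by blast

lemma balancing_mem:
  "u \<in> carrier A \<Longrightarrow> v \<in> carrier A \<Longrightarrow> a # x # xs @ [z] \<in> tensor_lists A (n + 3) \<Longrightarrow>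
   sg ((u \<otimes>\<^bsub>A\<^esub> a \<otimes>\<^bsub>A\<^esub> v) # x # xs @ [z]) - sg (a # (v \<otimes>\<^bsub>A\<^esub> x) # xs @ [z \<otimes>\<^bsub>A\<^esub> u]) \<in> balancing_rels A n"
  unfolding balancing_rels_def by blast

text \<open>By the multilinearity relations the vectors for which this holds form a subspace, and
  that subspace contains the basis.\<close>

lemma expand_slot:
  assumes y: "y \<in> carrier A" and l: "pre @ y # post \<in> tensor_lists A m"
  shows "sg (pre @ y # post) - lin_ext (\<lambda>b. sg (pre @ \<iota> (sg b) # post)) (\<kappa> y) \<in> fvs.span (multilinear_rels A m)"
proof -
  let ?R = "fvs.span (multilinear_rels A m)"
  let ?F = "\<lambda>v. sg (pre @ \<iota> v # post)"
  let ?G = "\<lambda>v. ?F v - lin_ext (\<lambda>b. ?F (sg b)) v"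
  have TLv: "pre @ x # post \<in> tensor_lists A m" if "x \<in> carrier A" for x
    using l that by (auto simp: tensor_lists_def)
  have add: "?F (v + w) - ?F v - ?F w \<in> ?R" for v w
  proof -
    have "\<iota> (v + w) = \<iota> v \<oplus>\<^bsub>A\<^esub> \<iota> w" by (rule \<kappa>_inj) (simp_all add: add_closed \<kappa>_add)
    then show ?thesis using multilinear_add[OF TLv[of "\<iota> v"], of "\<iota> w"] by (simp add: fvs.span_base)
  qed
  have scale: "?F (fscale c v) - fscale c (?F v) \<in> ?R" for c v
  proof -
    have "\<iota> (fscale c v) = c \<odot>\<^bsub>A\<^esub> \<iota> v" by (rule \<kappa>_inj) (simp_all add: smult_closed \<kappa>_smult)
    then show ?thesis using multilinear_smult[OF TLv[of "\<iota> v"], of c] by (simp add: fvs.span_base)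
  qed
  have "fvs.subspace {v. ?G v \<in> ?R}"
    unfolding fvs.subspace_def
  proof (intro conjI ballI allI)
    show "0 \<in> {v. ?G v \<in> ?R}" using scale[of 0 0] by simp
    fix v w assume "v \<in> {v. ?G v \<in> ?R}" "w \<in> {v. ?G v \<in> ?R}"
    then have "(?F (v + w) - ?F v - ?F w) + ?G v + ?G w \<in> ?R"
      using add[of v w] by (intro fvs.span_add) simp_all
    then show "v + w \<in> {v. ?G v \<in> ?R}" by (simp add: lin_ext_add algebra_simps)
  next
    fix c v assume "v \<in> {v. ?G v \<in> ?R}"
    then have "(?F (fscale c v) - fscale c (?F v)) + fscale c (?G v) \<in> ?R"
      using scale[of c v] by (intro fvs.span_add fvs.span_scale) simp_all
    then show "fscale c v \<in> {v. ?G v \<in> ?R}"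
      by (simp add: lin_ext_scale fvs.scale_right_diff_distrib del: fscale_single)
  qed
  moreover have "sg ` UNIV \<subseteq> {v. ?G v \<in> ?R}" by (auto simp: fvs.span_zero)
  ultimately have "fvs.span (sg ` UNIV) \<subseteq> {v. ?G v \<in> ?R}" by (intro fvs.span_minimal)
  then have "?G (\<kappa> y) \<in> ?R" using fsp_eq_span[of "UNIV :: 'b set"] by auto
  then show ?thesis using y by (simp add: \<iota>_\<kappa>)
qed

lemma expand_list:
  "pre @ ys @ post \<in> tensor_lists A m \<Longrightarrow>
   sg (pre @ ys @ post) - lin_ext (\<lambda>bs. sg (pre @ map (\<lambda>b. \<iota> (sg b)) bs @ post)) (tau ys) \<in> fvs.span (multilinear_rels A m)"
proof (induction ys arbitrary: pre)
  case (Cons y ys)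
  let ?R = "fvs.span (multilinear_rels A m)"
  have 1: "sg (pre @ y # ys @ post) - lin_ext (\<lambda>b. sg (pre @ \<iota> (sg b) # ys @ post)) (\<kappa> y) \<in> ?R"
    using Cons.prems by (intro expand_slot) (auto simp: tensor_lists_def)
  let ?h = "\<lambda>b. sg (pre @ \<iota> (sg b) # ys @ post)
      - lin_ext (\<lambda>bs. sg (pre @ \<iota> (sg b) # map (\<lambda>b. \<iota> (sg b)) bs @ post)) (tau ys)"
  have "?h b \<in> ?R" for b
    using Cons.IH[of "pre @ [\<iota> (sg b)]"] Cons.prems by (auto simp: tensor_lists_def)
  then have 2: "lin_ext ?h (\<kappa> y) \<in> ?R" by (intro span_lin_ext fvs.subspace_span)
  have "tau (y # ys) = lin_ext (\<lambda>b. consv b (tau ys)) (\<kappa> y)" by (simp add: tau_def vcons_def)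
  then show ?case using fvs.span_add[OF 1 2]
    by (simp add: lin_ext_fun_diff lin_ext_comp consv_def)
qed (simp add: tau_def fvs.span_zero)

lemma tor_rels_subspace: "fvs.subspace (tor_rels A n)"
  by (simp add: tor_rels_def fvs.subspace_span)

text \<open>Balancing with u = z and v = x brings the list to the form (z a x, 1, xs, 1); the
  multilinearity relations then expand the remaining slots.\<close>

lemma Phi_reduce:
  assumes l: "l \<in> TL n"
  shows "sg l - lin_ext Psi (Phi l) \<in> tor_rels A n"
proof -
  obtain a x xs z where eq: "l = a # x # xs @ [z]" and c: "a \<in> carrier A" "x \<in> carrier A" "z \<in> carrier A"
    "set xs \<subseteq> carrier A" "length xs = n" using l by (rule TL_E)
  let ?one = "\<one>\<^bsub>A\<^esub>" and ?\<beta> = "\<lambda>b. \<iota> (sg b)"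
  define y where "y = z \<otimes>\<^bsub>A\<^esub> a \<otimes>\<^bsub>A\<^esub> x"
  have y: "y \<in> carrier A" using c by (simp add: y_def mult_closed)
  have ml: "v \<in> fvs.span (multilinear_rels A (n + 3)) \<Longrightarrow> v \<in> tor_rels A n" for v
    unfolding tor_rels_def using fvs.span_mono[of "multilinear_rels A (n + 3)"] by blast
  have "sg (y # ?one # xs @ [?one]) - sg (a # (x \<otimes>\<^bsub>A\<^esub> ?one) # xs @ [?one \<otimes>\<^bsub>A\<^esub> z]) \<in> balancing_rels A n"
    unfolding y_def using c one_closed by (intro balancing_mem) (auto simp: tensor_lists_def)
  then have 1: "sg (y # ?one # xs @ [?one]) - sg l \<in> tor_rels A n"
    unfolding tor_rels_def using c by (intro fvs.span_base) (simp add: eq A_one)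
  have 2: "sg (y # ?one # xs @ [?one]) - lin_ext (\<lambda>b. sg (?\<beta> b # ?one # xs @ [?one])) (\<kappa> y) \<in> tor_rels A n"
    using expand_slot[of y "[]" "?one # xs @ [?one]" "n + 3"] y c one_closed by (intro ml) (auto simp: tensor_lists_def)
  let ?h = "\<lambda>b. sg (?\<beta> b # ?one # xs @ [?one]) - lin_ext (\<lambda>bs. sg (?\<beta> b # ?one # map ?\<beta> bs @ [?one])) (tau xs)"
  have "?h b \<in> tor_rels A n" for b
    using expand_list[of "[?\<beta> b, ?one]" xs "[?one]" "n + 3"] c one_closed by (intro ml) (auto simp: tensor_lists_def)
  then have 3: "lin_ext ?h (\<kappa> y) \<in> tor_rels A n" by (intro span_lin_ext tor_rels_subspace)
  have "Phi l = lin_ext (\<lambda>b. consv b (tau xs)) (\<kappa> y)"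
    by (simp add: Phi_def eq to_hochschild_simp tau_def vcons_def y_def)
  then have "sg l - lin_ext Psi (Phi l)
    = (sg (y # ?one # xs @ [?one]) - lin_ext (\<lambda>b. sg (?\<beta> b # ?one # xs @ [?one])) (\<kappa> y))
      + lin_ext ?h (\<kappa> y) - (sg (y # ?one # xs @ [?one]) - sg l)"
    by (simp add: lin_ext_comp consv_def lin_ext_fun_diff Psi_def of_hochschild_def)
  then show ?thesis
    using fvs.subspace_diff[OF tor_rels_subspace fvs.subspace_add[OF tor_rels_subspace 2 3] 1] by (simp only:)
qed

lemma tens_mid: "lin (\<lambda>v. tens (xs @ v # ys))"
proof (induction xs)
  case (Cons x xs)
  then show ?case using lin_comp[OF vcons_lin_right Cons] by simp
qed (simp add: vcons_lin_left)

lemma multilinear_Phi: "r \<in> multilinear_rels A (n + 3) \<Longrightarrow> r \<in> fsp (TL n) \<and> lin_ext Phi r = 0"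
proof -
  assume r: "r \<in> multilinear_rels A (n + 3)"
  have key: "lin_ext Phi (sg (xs @ (x \<oplus>\<^bsub>A\<^esub> y) # ys) - sg (xs @ x # ys) - sg (xs @ y # ys)) = 0 \<and>
      lin_ext Phi (sg (xs @ (c \<odot>\<^bsub>A\<^esub> x) # ys) - Poly_Mapping.single (xs @ x # ys) c) = 0"
    if l: "xs @ x # ys \<in> TL n" and y: "y \<in> carrier A" for xs x y ys c
  proof -
    have x: "x \<in> carrier A" using l by (auto simp: tensor_lists_def)
    define f where "f v = Phi (xs @ \<iota> v # ys)" for v
    have lf: "lin f"
    proof -
      \<comment> \<open>The altered slot is a, x, z or an inner one. The first three all end up in
        the product z a x.\<close>
      consider "xs = []" | a where "xs = [a]" | a b zs where "xs = a # b # zs" "ys = []"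
        | a b zs us z where "xs = a # b # zs" "ys = us @ [z]"
        by (cases xs; cases "tl xs"; cases ys rule: rev_cases) auto
      then show ?thesis
      proof cases
        case 1
        then obtain w ws z where "ys = w # ws @ [z]" and c: "w \<in> carrier A" "z \<in> carrier A" "set ws \<subseteq> carrier A"
          using l by (elim TL_E) auto
        then have "f v = vcons (mulv (mulv (\<kappa> z) v) (\<kappa> w)) (tau ws)" for v
          using c 1 by (simp add: f_def Phi_def to_hochschild_simp tau_def \<kappa>_mult mult_closed)
        then show ?thesis
          using lin_comp[OF vcons_lin_left[of "tau ws"] lin_comp[OF mulv_lin_left[of "\<kappa> w"] mulv_lin_right[of "\<kappa> z"]]]
          by (simp add: lin_def)
      next
        case 2
        then obtain ws z where "ys = ws @ [z]" and c: "a \<in> carrier A" "z \<in> carrier A" "set ws \<subseteq> carrier A"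
          using l by (elim TL_E) auto
        then have "f v = vcons (mulv (mulv (\<kappa> z) (\<kappa> a)) v) (tau ws)" for v
          using c 2 by (simp add: f_def Phi_def to_hochschild_simp tau_def \<kappa>_mult mult_closed)
        then show ?thesis
          using lin_comp[OF vcons_lin_left[of "tau ws"] mulv_lin_right[of "mulv (\<kappa> z) (\<kappa> a)"]]
          by (simp add: lin_def)
      next
        case 3
        then have c: "a \<in> carrier A" "b \<in> carrier A" using l by (auto simp: tensor_lists_def)
        have "f v = vcons (mulv (mulv v (\<kappa> a)) (\<kappa> b)) (tau zs)" for v
          using c 3 to_hochschild_simp[of a b zs "\<iota> v"] by (simp add: f_def Phi_def tau_def \<kappa>_mult mult_closed)
        then show ?thesis
          using lin_comp[OF vcons_lin_left[of "tau zs"] lin_comp[OF mulv_lin_left[of "\<kappa> b"] mulv_lin_left[of "\<kappa> a"]]]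
          by (simp add: lin_def)
      next
        case 4
        have "f v = tens ((\<kappa> (z \<otimes>\<^bsub>A\<^esub> a \<otimes>\<^bsub>A\<^esub> b) # map \<kappa> zs) @ v # map \<kappa> us)" for v
          using 4 to_hochschild_simp[of a b "zs @ \<iota> v # us" z] by (simp add: f_def Phi_def tau_def)
        then show ?thesis using tens_mid[of "\<kappa> (z \<otimes>\<^bsub>A\<^esub> a \<otimes>\<^bsub>A\<^esub> b) # map \<kappa> zs" "map \<kappa> us"] by (simp add: lin_def)
      qed
    qed
    have "Phi (xs @ w # ys) = f (\<kappa> w)" if "w \<in> carrier A" for w using that by (simp add: f_def \<iota>_\<kappa>)
    then show ?thesis using x y
      by (simp add: lin_ext_diff add_closed smult_closed \<kappa>_add \<kappa>_smult lin_add[OF lf] lin_scale[OF lf])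
  qed
  have TLv: "xs @ w # ys \<in> TL n" if "xs @ x # ys \<in> TL n" "w \<in> carrier A" for xs x w ys
    using that by (auto simp: tensor_lists_def)
  have TLx: "x \<in> carrier A" if "xs @ x # ys \<in> TL n" for xs x ys using that by (auto simp: tensor_lists_def)
  from r consider (add) xs x y ys where "r = sg (xs @ (x \<oplus>\<^bsub>A\<^esub> y) # ys) - sg (xs @ x # ys) - sg (xs @ y # ys)"
      "xs @ x # ys \<in> TL n" "y \<in> carrier A"
    | (smult) xs x c ys where "r = sg (xs @ (c \<odot>\<^bsub>A\<^esub> x) # ys) - Poly_Mapping.single (xs @ x # ys) c" "xs @ x # ys \<in> TL n"
    unfolding multilinear_rels_def by blast
  then show ?thesis
  proof cases
    case add
    have "r \<in> fsp (TL n)" unfolding add(1)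
      by (intro fsp_diff fsp_single TLv[OF add(2)] add_closed TLx[OF add(2)] add(2,3))
    then show ?thesis using key[OF add(2,3)] add(1) by simp
  next
    case smult
    have "r \<in> fsp (TL n)" unfolding smult(1)
      by (intro fsp_diff fsp_single TLv[OF smult(2)] smult_closed TLx[OF smult(2)] smult(2))
    then show ?thesis using key[OF smult(2) one_closed] smult(1) by simp
  qed
qed

lemma balancing_Phi: "r \<in> balancing_rels A n \<Longrightarrow> r \<in> fsp (TL n) \<and> lin_ext Phi r = 0"
proof -
  assume "r \<in> balancing_rels A n"
  then obtain u v a x xs z where r: "r = sg ((u \<otimes>\<^bsub>A\<^esub> a \<otimes>\<^bsub>A\<^esub> v) # x # xs @ [z]) - sg (a # (v \<otimes>\<^bsub>A\<^esub> x) # xs @ [z \<otimes>\<^bsub>A\<^esub> u])"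
    and c: "u \<in> carrier A" "v \<in> carrier A" "a # x # xs @ [z] \<in> TL n"
    unfolding balancing_rels_def by blast
  then have cs: "a \<in> carrier A" "x \<in> carrier A" "z \<in> carrier A" "set xs \<subseteq> carrier A" "length xs = n"
    by (auto simp: tensor_lists_def)
  have "z \<otimes>\<^bsub>A\<^esub> (u \<otimes>\<^bsub>A\<^esub> a \<otimes>\<^bsub>A\<^esub> v) \<otimes>\<^bsub>A\<^esub> x = z \<otimes>\<^bsub>A\<^esub> u \<otimes>\<^bsub>A\<^esub> a \<otimes>\<^bsub>A\<^esub> (v \<otimes>\<^bsub>A\<^esub> x)"
    using c cs by (intro \<kappa>_inj) (simp_all add: mult_closed \<kappa>_mult mulv_assoc)
  then have "Phi ((u \<otimes>\<^bsub>A\<^esub> a \<otimes>\<^bsub>A\<^esub> v) # x # xs @ [z]) = Phi (a # (v \<otimes>\<^bsub>A\<^esub> x) # xs @ [z \<otimes>\<^bsub>A\<^esub> u])"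
    by (simp add: Phi_def to_hochschild_simp)
  then show ?thesis using c cs
    by (auto simp: r lin_ext_diff tensor_lists_def mult_closed intro!: fsp_diff fsp_single)
qed

text \<open>\<open>Phi\<close> kills the relations, and \<open>Phi_reduce\<close> shows that modulo
  them a chain is determined by its image.\<close>

lemma tor_rels_eq: "tor_rels A n = fib n 0"
proof
  have sub: "fvs.subspace (fib n 0)"
    by (auto simp: fvs.subspace_def fib_def fsp_add fsp_scale lin_ext_linear)
  show "tor_rels A n \<subseteq> fib n 0" unfolding tor_rels_def
    using multilinear_Phi balancing_Phi by (intro fvs.span_minimal sub) (auto simp: fib_def)
  show "fib n 0 \<subseteq> tor_rels A n"
  proof
    fix x assume "x \<in> fib n 0"
    then have x: "x \<in> fsp (TL n)" "lin_ext Phi x = 0" by (auto simp: fib_def)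
    have "lin_ext (\<lambda>l. sg l - lin_ext Psi (Phi l)) x \<in> tor_rels A n"
      using x(1) by (intro span_lin_ext tor_rels_subspace Phi_reduce) (auto simp: fsp_def)
    moreover have "lin_ext (\<lambda>l. sg l - lin_ext Psi (Phi l)) x = x - lin_ext Psi (lin_ext Phi x)"
      by (simp add: lin_ext_fun_diff lin_ext_comp)
    ultimately show "x \<in> tor_rels A n" using x(2) by simp
  qed
qed

end


text \<open>Closure is recorded because \<open>linear_iso\<close> does not imply it, and an
  isomorphism can be inverted only with closure of the operations.\<close>

definition lin_dim :: "(complex, 'v, 'm) module_scheme \<Rightarrow> nat \<Rightarrow> bool" where
  "lin_dim V k \<longleftrightarrow> linear_iso V (cspace k) \<and>
     (\<forall>x\<in>carrier V. \<forall>y\<in>carrier V. x \<oplus>\<^bsub>V\<^esub> y \<in> carrier V) \<and> (\<forall>c. \<forall>x\<in>carrier V. c \<odot>\<^bsub>V\<^esub> x \<in> carrier V)"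

lemma lin_dim_quotient:
  fixes V :: "(complex, 'v, 'm) module_scheme" and Z N :: "('b \<Rightarrow>\<^sub>0 complex) set"
  assumes "quot_dim Z N k" and Z: "fvs.subspace Z"
    and car: "carrier V = cls ` Z"
    and "\<And>x y. x \<in> Z \<Longrightarrow> y \<in> Z \<Longrightarrow> cls x = cls y \<longleftrightarrow> x - y \<in> N"
    and add: "\<And>x y. x \<in> Z \<Longrightarrow> y \<in> Z \<Longrightarrow> cls x \<oplus>\<^bsub>V\<^esub> cls y = cls (x + y)"
    and smult: "\<And>c x. x \<in> Z \<Longrightarrow> c \<odot>\<^bsub>V\<^esub> cls x = cls (fscale c x)"
  shows "lin_dim V k"
  using linear_iso_cspace[OF assms] unfolding lin_dim_def car
  by (auto simp: add smult fvs.subspace_add[OF Z] fvs.subspace_scale[OF Z])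

text \<open>One frame for chains modulo the Tor relations, cycles modulo boundaries, and the path
  algebra modulo its relations. Hypotheses on the operations concern only the image of Z, since M is
  a bare record.\<close>

locale coords_quotient =
  fixes M :: "(complex, 'v, 'm) module_scheme" and \<phi> :: "('c \<Rightarrow>\<^sub>0 complex) \<Rightarrow> 'v" and Z B :: "('c \<Rightarrow>\<^sub>0 complex) set"
  assumes Z: "fvs.subspace Z" and B: "fvs.subspace B" and BZ: "B \<subseteq> Z"
    and add: "x \<in> Z \<Longrightarrow> y \<in> Z \<Longrightarrow> \<phi> x \<oplus>\<^bsub>M\<^esub> \<phi> y = \<phi> (x + y)"
    and smult: "x \<in> Z \<Longrightarrow> c \<odot>\<^bsub>M\<^esub> \<phi> x = \<phi> (fscale c x)"
begin

definition cls :: "('c \<Rightarrow>\<^sub>0 complex) \<Rightarrow> 'v set" where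
  "cls z = (\<lambda>b. \<phi> (b + z)) ` B"

lemma cls_0: "cls 0 = \<phi> ` B"
  by (simp add: cls_def)

lemma coset: "z \<in> Z \<Longrightarrow> \<phi> ` B +>\<^bsub>M\<^esub> \<phi> z = cls z"
  using BZ by (auto simp: a_r_coset_def r_coset_def cls_def add subset_iff)

lemma cls_eqI:
  assumes "z - w \<in> B"
  shows "cls z = cls w"
proof -
  have "w - z \<in> B" using fvs.subspace_neg[OF B assms] by simp
  moreover have "cls z \<subseteq> cls w" if "z - w \<in> B" for z w
  proof
    fix X assume "X \<in> cls z"
    then obtain b where b: "b \<in> B" "X = \<phi> (b + z)" by (auto simp: cls_def)
    then have "b + (z - w) \<in> B" "X = \<phi> (b + (z - w) + w)"
      using fvs.subspace_add[OF B _ that] by simp_all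
    then show "X \<in> cls w" unfolding cls_def by (rule image_eqI[rotated])
  qed
  ultimately show ?thesis using assms by blast
qed

lemma cls_mem: "\<phi> z \<in> cls z"
  using fvs.subspace_0[OF B] unfolding cls_def by (intro image_eqI[of _ _ 0]) simp_all

lemma cls_eq_iff:
  assumes "inj_on \<phi> Z" "z \<in> Z" "w \<in> Z"
  shows "cls z = cls w \<longleftrightarrow> z - w \<in> B"
proof
  assume "cls z = cls w"
  then obtain b where b: "b \<in> B" "\<phi> z = \<phi> (b + w)" using cls_mem[of z] by (auto simp: cls_def)
  then have "z = b + w" using assms BZ fvs.subspace_add[OF Z] by (auto dest: inj_onD)
  then show "z - w \<in> B" using b by simp
qed (rule cls_eqI)

lemma cls_add:
  assumes "z \<in> Z" "w \<in> Z"
  shows "set_add M (cls z) (cls w) = cls (z + w)"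
proof -
  have *: "\<phi> (b + z) \<oplus>\<^bsub>M\<^esub> \<phi> (c + w) = \<phi> (b + c + (z + w))" if "b \<in> B" "c \<in> B" for b c
    using that assms BZ by (subst add) (auto simp: fvs.subspace_add[OF Z] algebra_simps)
  show ?thesis
  proof
    show "set_add M (cls z) (cls w) \<subseteq> cls (z + w)"
      using fvs.subspace_add[OF B] by (auto simp: set_add_def set_mult_def cls_def *)
    show "cls (z + w) \<subseteq> set_add M (cls z) (cls w)"
    proof
      fix X assume "X \<in> cls (z + w)"
      then obtain b where b: "b \<in> B" "X = \<phi> (b + 0 + (z + w))" by (auto simp: cls_def)
      then have "X = \<phi> (b + z) \<oplus>\<^bsub>M\<^esub> \<phi> (0 + w)" using *[OF b(1) fvs.subspace_0[OF B]] by simp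
      moreover have "\<phi> (b + z) \<in> cls z" "\<phi> (0 + w) \<in> cls w" using b(1) cls_mem[of w] by (auto simp: cls_def)
      ultimately show "X \<in> set_add M (cls z) (cls w)" unfolding set_add_def set_mult_def by auto
    qed
  qed
qed

lemma cls_UN:
  assumes "\<And>b. b \<in> B \<Longrightarrow> f (\<phi> (b + z)) = \<phi> (g b)" "\<And>b. b \<in> B \<Longrightarrow> g b \<in> Z" "\<And>b. b \<in> B \<Longrightarrow> g b - w \<in> B"
  shows "(\<Union>x\<in>cls z. \<phi> ` B +>\<^bsub>M\<^esub> f x) = cls w"
proof -
  have "\<phi> ` B +>\<^bsub>M\<^esub> f (\<phi> (b + z)) = cls w" if "b \<in> B" for b
    using assms(1-3)[OF that] coset cls_eqI by simp
  moreover have "0 \<in> B" by (rule fvs.subspace_0[OF B])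
  ultimately show ?thesis unfolding cls_def[of z] by auto
qed

lemma cls_smult:
  assumes "z \<in> Z"
  shows "(\<Union>x\<in>cls z. \<phi> ` B +>\<^bsub>M\<^esub> (c \<odot>\<^bsub>M\<^esub> x)) = cls (fscale c z)"
  using assms BZ
  by (intro cls_UN[of _ _ "\<lambda>b. fscale c (b + z)"] smult)
    (auto simp: fvs.subspace_add[OF Z] fvs.subspace_scale[OF Z] fvs.subspace_scale[OF B] fvs.scale_right_distrib)

lemma carrier_quotient: "carrier M = \<phi> ` Z \<Longrightarrow> carrier (quotient M (\<phi> ` B)) = cls ` Z"
  using coset by (auto simp: quotient_def A_RCOSETS_def RCOSETS_def a_r_coset_def)

lemma quotient_simps:
  "zero (quotient M (\<phi> ` B)) = cls 0"
  "z \<in> Z \<Longrightarrow> w \<in> Z \<Longrightarrow> cls z \<oplus>\<^bsub>quotient M (\<phi> ` B)\<^esub> cls w = cls (z + w)"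
  "z \<in> Z \<Longrightarrow> c \<odot>\<^bsub>quotient M (\<phi> ` B)\<^esub> cls z = cls (fscale c z)"
  by (simp_all add: quotient_def cls_0 cls_add cls_smult)

lemma iso:
  assumes "quot_dim Z B k" "inj_on \<phi> Z" "carrier M = \<phi> ` Z"
  shows "lin_dim (quotient M (\<phi> ` B)) k"
  by (rule lin_dim_quotient[OF assms(1) Z carrier_quotient[OF assms(3)]])
    (simp_all add: cls_eq_iff[OF assms(2)] quotient_simps)

end

lemma image_eq_singletonI: "(\<And>z. z \<in> S \<Longrightarrow> f z = y) \<Longrightarrow> a \<in> S \<Longrightarrow> f ` S = {y}"
  by auto

lemma Collect_image: "{X \<in> f ` S. P X} = f ` {x \<in> S. P (f x)}"
  by auto

context mult_basis begin

text \<open>Because b (1 - t) = (1 - t) b', b' s N = N - s N b and (1 - t) N = 0, this holds already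
  on unnormalised chains.\<close>

lemma b_B_anticommute:
  assumes x: "x \<in> fsp (len (Suc (Suc n)))"
  shows "b_op (Bop (Suc n) x) = - Bop n (b_op x)"
proof -
  let ?y = "s_op (Nop (Suc (Suc n)) x)"
  have N: "Nop (Suc (Suc n)) x \<in> fsp (len (Suc (Suc n)))" by (rule Nop_len[OF x])
  then have y: "?y \<in> fsp (len (Suc (Suc (Suc n))))" by (rule s_len)
  have ty: "t_op ?y \<in> fsp (len (Suc (Suc (Suc n))))" by (rule t_len[OF y])
  have "lin_ext bar ?y = Nop (Suc (Suc n)) x - s_op (Nop (Suc n) (b_op x))"
    using bar_s[OF fsp_len_ne[OF N]] bar_N[OF x] by simp
  moreover have "b_op (t_op ?y) = b_op ?y - lin_ext bar ?y + t_op (lin_ext bar ?y)"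
    using part_t[OF y, of "Suc (Suc n)"] part_full[OF ty] part_bar[OF y] by simp
  ultimately show ?thesis using t_N[OF x] by (simp add: Bop_def lin_ext_diff)
qed

lemma lin_Bop [simp]: "lin (Bop n)"
  unfolding Bop_def[abs_def] by (intro lin_minus lin_comp[OF lin_lin_ext] lin_Nop lin_comp[OF lin_lin_ext, of "\<lambda>x. s_op (Nop (Suc n) x)"])

lemma B_CB: "x \<in> fsp (CB n j) \<Longrightarrow> Bop n x \<in> fsp (CB (Suc n) j)"
  unfolding Bop_def by (intro fsp_diff t_CB s_CB N_CB)

lemma b_CB: "x \<in> fsp (CB (Suc n) j) \<Longrightarrow> b_op x \<in> fsp (CB n j)"
proof (rule fsp_lin_ext, assumption)
  fix xs assume "xs \<in> CB (Suc n) j"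
  then have xs: "length xs = Suc (Suc n)" "sum_list (map deg xs) = j" by (auto simp: CB_def)
  then obtain a ys z where eq: "xs = a # ys @ [z]" by (cases xs; cases "tl xs" rule: rev_cases) auto
  have "bar xs \<in> fsp (CB n j)" using fsp_mono[OF bar_CB[of xs], of "CB n j"] xs by (auto simp: CB_def)
  moreover have "last_face xs \<in> fsp (CB n j)"
    using xs unfolding eq last_face_def
    by (cases "mul z a") (auto simp: CB_def deg_mul simp del: fscale_single intro!: fsp_uminus fsp_scale fsp_single)
  ultimately show "hoch xs \<in> fsp (CB n j)" by (simp add: hoch_def fsp_add)
qed

lemma b_CB_0: "x \<in> fsp (CB 0 j) \<Longrightarrow> b_op x = 0"
proof -
  assume "x \<in> fsp (CB 0 j)"
  moreover have "hoch xs = 0" if "xs \<in> CB 0 j" for xs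
    using that by (cases xs) (auto simp: CB_def hoch_def last_face_def)
  ultimately show ?thesis using lin_ext_eqI[of x "CB 0 j" hoch "\<lambda>_. 0"] by simp
qed

lemma mulv_homog: "x \<in> fsp {b. deg b = c} \<Longrightarrow> y \<in> fsp {b. deg b = d} \<Longrightarrow> mulv x y \<in> fsp {b. deg b = c + d}"
  unfolding mulv_def
proof (rule fsp_lin_ext, assumption, rule fsp_lin_ext, assumption)
  fix a b assume "a \<in> {b. deg b = c}" "b \<in> {b. deg b = d}"
  then show "osg (mul a b) \<in> fsp {b. deg b = c + d}" by (cases "mul a b") (auto simp: deg_mul intro: fsp_single)
qed

lemma tens_homog:
  "list_all2 (\<lambda>v d. v \<in> fsp {b. deg b = d}) vs ds \<Longrightarrow>
   tens vs \<in> fsp {bs. length bs = length vs \<and> sum_list (map deg bs) = sum_list ds}"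
proof (induction rule: list_all2_induct)
  case (Cons v vs d ds)
  show ?case unfolding tens.simps vcons_def
  proof (rule fsp_lin_ext[OF Cons(1)])
    fix b assume "b \<in> {b. deg b = d}"
    then show "consv b (tens vs) \<in> fsp {bs. length bs = length (v # vs) \<and> sum_list (map deg bs) = sum_list (d # ds)}"
      unfolding consv_def by (intro fsp_lin_ext[OF Cons(3)] fsp_single) auto
  qed
qed (auto intro: fsp_single)

definition "cyc n j = {c \<in> fsp (CB n j). b_op c = 0}"
definition "bd n j = b_op ` fsp (CB (Suc n) j)"

lemma bd_cyc: "bd n j \<subseteq> cyc n j"
proof
  fix c assume "c \<in> bd n j"
  then obtain x where x: "x \<in> fsp (CB (Suc n) j)" "c = b_op x" by (auto simp: bd_def)
  then show "c \<in> cyc n j" by (simp add: cyc_def b_CB lin_ext_comp hoch_hoch)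
qed

lemma subspace_cyc: "fvs.subspace (cyc n j)"
  by (auto simp: fvs.subspace_def cyc_def fsp_add fsp_scale lin_ext_linear)

lemma subspace_bd: "fvs.subspace (bd n j)"
  unfolding bd_def fvs.subspace_def
proof (intro conjI ballI allI)
  show "0 \<in> b_op ` fsp (CB (Suc n) j)" by (rule image_eqI[of _ _ 0]) simp_all
  fix x y assume "x \<in> b_op ` fsp (CB (Suc n) j)" "y \<in> b_op ` fsp (CB (Suc n) j)"
  then obtain u v where "u \<in> fsp (CB (Suc n) j)" "v \<in> fsp (CB (Suc n) j)" "x = b_op u" "y = b_op v" by auto
  then show "x + y \<in> b_op ` fsp (CB (Suc n) j)" by (intro image_eqI[of _ _ "u + v"]) (simp_all add: lin_ext_add fsp_add)
next
  fix c x assume "x \<in> b_op ` fsp (CB (Suc n) j)"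
  then obtain u where "u \<in> fsp (CB (Suc n) j)" "x = b_op u" by auto
  then show "fscale c x \<in> b_op ` fsp (CB (Suc n) j)"
    by (intro image_eqI[of _ _ "fscale c u"]) (simp_all add: lin_ext_scale fsp_scale)
qed

lemma B_cyc: "c \<in> cyc (Suc n) j \<Longrightarrow> Bop (Suc n) c \<in> cyc (Suc (Suc n)) j"
  using b_B_anticommute[OF CB_len, of c n j] by (simp add: cyc_def B_CB lin_0)

lemma B_bd: "c \<in> bd n j \<Longrightarrow> Bop n c \<in> bd (Suc n) j"
proof -
  assume "c \<in> bd n j"
  then obtain x where x: "x \<in> fsp (CB (Suc n) j)" "c = b_op x" by (auto simp: bd_def)
  have "Bop n c = b_op (- Bop (Suc n) x)" using b_B_anticommute[OF CB_len[OF x(1)]] x(2) by (simp add: lin_ext_uminus)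
  moreover have "- Bop (Suc n) x \<in> fsp (CB (Suc (Suc n)) j)" by (intro fsp_uminus B_CB x)
  ultimately show ?thesis unfolding bd_def by (rule image_eqI)
qed

end

context algebra_coords begin

interpretation ch: coords_quotient "FS n" "\<lambda>x. x" "fsp (TL n)" "fib n 0" for n
  by unfold_locales (auto simp: subspace_fsp fib_def FS_simps fvs.subspace_def fsp_add fsp_scale lin_ext_linear)

lemma ch_cls: "x \<in> fsp (TL n) \<Longrightarrow> ch.cls n x = fib n (lin_ext Phi x)"
proof
  assume x: "x \<in> fsp (TL n)"
  then show "ch.cls n x \<subseteq> fib n (lin_ext Phi x)" unfolding ch.cls_def by (auto simp: fib_def fsp_add lin_ext_add)
  show "fib n (lin_ext Phi x) \<subseteq> ch.cls n x"
  proof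
    fix y assume "y \<in> fib n (lin_ext Phi x)"
    then have "y - x \<in> fib n 0" using x by (simp add: fib_def fsp_diff lin_ext_diff)
    then show "y \<in> ch.cls n x" unfolding ch.cls_def by (rule image_eqI[rotated]) simp
  qed
qed

lemma chain_coset: "x \<in> fsp (TL n) \<Longrightarrow> tor_rels A n +>\<^bsub>FS n\<^esub> x = fib n (lin_ext Phi x)"
  using ch.coset[of x n] by (simp add: tor_rels_eq ch_cls)

lemma tor_chains_ops:
  "zero (tor_chains A n) = fib n 0"
  "c \<in> fsp (len (Suc n)) \<Longrightarrow> d \<in> fsp (len (Suc n)) \<Longrightarrow> fib n c \<oplus>\<^bsub>tor_chains A n\<^esub> fib n d = fib n (c + d)"
  "c \<in> fsp (len (Suc n)) \<Longrightarrow> k \<odot>\<^bsub>tor_chains A n\<^esub> fib n c = fib n (fscale k c)"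
proof -
  show "zero (tor_chains A n) = fib n 0" by (simp add: tor_chains_def quotient_def tor_rels_eq)
  assume c: "c \<in> fsp (len (Suc n))"
  have eq: "tor_chains A n = quotient (FS n) (fib n 0)" by (simp add: tor_chains_def tor_rels_eq)
  show "k \<odot>\<^bsub>tor_chains A n\<^esub> fib n c = fib n (fscale k c)"
    using ch.quotient_simps(3)[OF Psi_fsp[OF c], of k]
    by (simp add: eq ch_cls Psi_fsp[OF c] fsp_scale lin_ext_scale Phi_Psi_ext[OF c])
  assume d: "d \<in> fsp (len (Suc n))"
  show "fib n c \<oplus>\<^bsub>tor_chains A n\<^esub> fib n d = fib n (c + d)"
    using ch.quotient_simps(2)[OF Psi_fsp[OF c] Psi_fsp[OF d]]
    by (simp add: eq ch_cls Psi_fsp[OF c] Psi_fsp[OF d] fsp_add lin_ext_add Phi_Psi_ext[OF c] Phi_Psi_ext[OF d])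
qed

lemma inj_fib: "inj_on (fib n) (fsp (len (Suc n)))"
proof (rule inj_onI)
  fix c d assume "c \<in> fsp (len (Suc n))" "fib n c = fib n d"
  then have "lin_ext Psi c \<in> fib n d" "lin_ext Phi (lin_ext Psi c) = c" using Psi_fib Phi_Psi_ext by auto
  then show "c = d" by (simp add: fib_def)
qed

text \<open>Transports maps given on lists to coordinates: the Tor differential becomes b and the
  Connes map becomes B.\<close>

lemma induced_fib:
  assumes c: "c \<in> fsp (len (Suc m))"
    and f: "\<And>l. l \<in> TL m \<Longrightarrow> f l \<in> fsp (TL n)" "\<And>l. l \<in> TL m \<Longrightarrow> lin_ext Phi (f l) = g (Phi l)" and g: "lin g"
  shows "induced (FS n) (tor_rels A n) (lin_ext f) (fib m c) = fib n (g c)"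
proof -
  have "tor_rels A n +>\<^bsub>FS n\<^esub> lin_ext f x = fib n (g c)" if "x \<in> fib m c" for x
  proof -
    have x: "x \<in> fsp (TL m)" "lin_ext Phi x = c" using that by (auto simp: fib_def)
    have "lin_ext Phi (lin_ext f x) = lin_ext (\<lambda>l. g (Phi l)) x"
      unfolding lin_ext_comp by (rule lin_ext_eqI[OF x(1)]) (simp add: f)
    also have "\<dots> = g c" using lin_eq_lin_ext[OF lin_comp[OF g lin_lin_ext[of Phi]], of x] x(2) by simp
    finally show ?thesis using chain_coset[OF fsp_lin_ext[OF x(1) f(1)]] by simp
  qed
  moreover have "fib m c \<noteq> {}" using Psi_fib[OF c] by blast
  ultimately show ?thesis unfolding induced_def by auto
qed

lemma bar_diff_TL: "xs \<in> tensor_lists A (Suc m) \<Longrightarrow> bar_diff A xs \<in> fsp (tensor_lists A m)"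
proof -
  assume xs: "xs \<in> tensor_lists A (Suc m)"
  then have "xs ! i \<in> carrier A" if "i < Suc m" for i using that nth_mem[of i xs] by (auto simp: tensor_lists_def)
  then show ?thesis unfolding bar_diff_def using xs
    by (intro fsp_sum fsp_single) (auto simp: tensor_lists_def mult_closed dest: in_set_takeD in_set_dropD)
qed

lemma cdiff_TL: "l \<in> TL (Suc n) \<Longrightarrow> cdiff l \<in> fsp (TL n)"
  unfolding cdiff_def
  by (rule fsp_lin_ext[OF bar_diff_TL[of "tl l" "n + 2"]], (cases l; auto simp: tensor_lists_def intro!: fsp_single)+)

lemma tor_diff_fib: "c \<in> fsp (len (Suc (Suc n))) \<Longrightarrow> tor_diff A n (fib (Suc n) c) = fib n (b_op c)"
  unfolding tor_diff_def cdiff_def[abs_def, symmetric]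
  by (rule induced_fib) (simp_all add: cdiff_TL Phi_cdiff)

lemma cyclic_t_TL: "v \<in> fsp (tensor_lists A (Suc m)) \<Longrightarrow> cyclic_t v \<in> fsp (tensor_lists A (Suc m))"
  unfolding cyclic_t_def
proof (rule fsp_lin_ext, assumption)
  fix xs assume "xs \<in> tensor_lists A (Suc m)"
  then show "Poly_Mapping.single (last xs # butlast xs) ((- 1) ^ (length xs - 1)) \<in> fsp (tensor_lists A (Suc m))"
    by (cases xs rule: rev_cases) (auto simp: tensor_lists_def intro!: fsp_single)
qed

lemma tau_cyclic_t: "v \<in> fsp (tensor_lists A (Suc m)) \<Longrightarrow> lin_ext tau (cyclic_t v) = t_op (lin_ext tau v)"
  unfolding cyclic_t_def lin_ext_comp
proof (rule lin_ext_eqI, assumption)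
  fix xs assume "xs \<in> tensor_lists A (Suc m)"
  then obtain ys y where "xs = ys @ [y]" by (cases xs rule: rev_cases) (auto simp: tensor_lists_def)
  then show "lin_ext tau (Poly_Mapping.single (last xs # butlast xs) ((- 1) ^ (length xs - 1))) = t_op (tau xs)"
    using t_tens[of "map \<kappa> ys" "\<kappa> y"] by (simp add: tau_def)
qed

lemma cyclic_t_pow:
  "v \<in> fsp (tensor_lists A (Suc m)) \<Longrightarrow>
   (cyclic_t ^^ i) v \<in> fsp (tensor_lists A (Suc m)) \<and> lin_ext tau ((cyclic_t ^^ i) v) = tpow i (lin_ext tau v)"
  by (induction i) (simp_all add: cyclic_t_TL[of _ m] tau_cyclic_t[of _ m] tpow_Suc)

lemma connes_list_TL:
  assumes xs: "xs \<in> tensor_lists A (Suc n)"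
  shows "connes_list A xs \<in> fsp (tensor_lists A (Suc (Suc n)))" "lin_ext tau (connes_list A xs) = Bop n (tau xs)"
proof -
  define N where "N = (\<Sum>i<length xs. (cyclic_t ^^ i) (sg xs))"
  define sN where "sN = lin_ext (\<lambda>ys. sg (\<one>\<^bsub>A\<^esub> # ys)) N"
  have sx: "sg xs \<in> fsp (tensor_lists A (Suc n))" using xs by (rule fsp_single)
  have len: "length xs = Suc n" using xs by (simp add: tensor_lists_def)
  have N: "N \<in> fsp (tensor_lists A (Suc n))" "lin_ext tau N = Nop (Suc n) (tau xs)"
    using cyclic_t_pow[OF sx] by (auto simp: N_def Nop_def lin_ext_sum len simp del: sum.lessThan_Suc intro!: fsp_sum)
  have sN: "sN \<in> fsp (tensor_lists A (Suc (Suc n)))"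
    unfolding sN_def by (rule fsp_lin_ext[OF N(1)]) (auto simp: tensor_lists_def one_closed intro!: fsp_single)
  have "tau (\<one>\<^bsub>A\<^esub> # ys) = s_op (tau ys)" for ys using s_tens[of "map \<kappa> ys"] by (simp add: tau_def \<kappa>_one)
  then have tsN: "lin_ext tau sN = s_op (Nop (Suc n) (tau xs))"
    by (simp add: sN_def lin_ext_comp N(2)[symmetric])
  have eq: "connes_list A xs = sN - cyclic_t sN" by (simp add: connes_list_def Let_def N_def sN_def)
  show "connes_list A xs \<in> fsp (tensor_lists A (Suc (Suc n)))" unfolding eq by (intro fsp_diff sN cyclic_t_TL)
  show "lin_ext tau (connes_list A xs) = Bop n (tau xs)"
    unfolding eq by (simp add: lin_ext_diff tau_cyclic_t[OF sN] tsN Bop_def)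
qed

lemma connes_chains_fib: "c \<in> fsp (len (Suc n)) \<Longrightarrow> connes_chains A n (fib n c) = fib (Suc n) (Bop n c)"
  unfolding connes_chains_def
proof (rule induced_fib)
  fix l assume "l \<in> TL n"
  then have l: "to_hochschild A l \<in> tensor_lists A (Suc n)" using to_hochschild_TL by simp
  have ys: "of_hochschild A ys \<in> TL (Suc n)" "Phi (of_hochschild A ys) = tau ys" if "ys \<in> tensor_lists A (Suc (Suc n))" for ys
    using that of_hochschild_TL[of ys "Suc n"] to_of_hochschild[of ys "Suc n"] by (simp_all add: Phi_def)
  show "lin_ext (\<lambda>ys. sg (of_hochschild A ys)) (connes_list A (to_hochschild A l)) \<in> fsp (TL (Suc n))"
    by (rule fsp_lin_ext[OF connes_list_TL(1)[OF l]]) (intro fsp_single ys(1))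
  have "lin_ext Phi (lin_ext (\<lambda>ys. sg (of_hochschild A ys)) (connes_list A (to_hochschild A l)))
      = lin_ext tau (connes_list A (to_hochschild A l))"
    unfolding lin_ext_comp by (rule lin_ext_eqI[OF connes_list_TL(1)[OF l]]) (simp add: ys)
  then show "lin_ext Phi (lin_ext (\<lambda>ys. sg (of_hochschild A ys)) (connes_list A (to_hochschild A l))) = Bop n (Phi l)"
    using connes_list_TL(2)[OF l] by (simp add: Phi_def)
qed simp_all

lemma homog_0_one: "\<one>\<^bsub>A\<^esub> \<in> homog A 0"
  unfolding homog using deg_E by (auto simp: one_closed \<kappa>_one intro!: fsp_sum fsp_single)

lemma Phi_homog:
  assumes "l \<in> TL n" "list_all2 (\<lambda>x d. x \<in> homog A d) l ds" "sum_list ds = j"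
  shows "Phi l \<in> fsp (CB n j)"
proof -
  obtain a x xs z where l: "l = a # x # xs @ [z]" and c: "a \<in> carrier A" "x \<in> carrier A" "z \<in> carrier A"
    "set xs \<subseteq> carrier A" "length xs = n" using assms(1) by (rule TL_E)
  obtain da dx dxs dz where d: "ds = da # dx # dxs @ [dz]" "a \<in> homog A da" "x \<in> homog A dx" "z \<in> homog A dz"
    "list_all2 (\<lambda>x d. x \<in> homog A d) xs dxs"
    using assms(2) unfolding l by (auto simp: list_all2_Cons1 list_all2_append1)
  have "list_all2 (\<lambda>v d. v \<in> fsp {b. deg b = d}) (\<kappa> (z \<otimes>\<^bsub>A\<^esub> a \<otimes>\<^bsub>A\<^esub> x) # map \<kappa> xs) ((dz + da + dx) # dxs)"
    using c d(2-5) by (auto simp: list_all2_map1 homog \<kappa>_mult mult_closed elim: list_all2_mono intro!: mulv_homog)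
  from tens_homog[OF this] show ?thesis
    using c assms(3) d(1) by (simp add: Phi_def l to_hochschild_simp tau_def CB_def add.commute add.left_commute del: tens.simps)
qed

text \<open>\<open>Phi\<close> adds up the degrees of a homogeneous list; conversely
  \<open>Psi\<close> only inserts units, which have degree 0.\<close>

lemma tor_chains_homog_fib: "tor_chains_homog A n j = fib n ` fsp (CB n j)"
proof -
  let ?G = "{sg xs | xs. xs \<in> TL n \<and> (\<exists>ds. list_all2 (\<lambda>x d. x \<in> homog A d) xs ds \<and> sum_list ds = j)}"
  let ?S = "{x \<in> fsp (TL n). lin_ext Phi x \<in> fsp (CB n j)}"
  have "fvs.subspace ?S" by (auto simp: fvs.subspace_def fsp_add fsp_scale lin_ext_linear)
  moreover have "?G \<subseteq> ?S" by (auto intro!: fsp_single Phi_homog)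
  ultimately have span: "fvs.span ?G \<subseteq> ?S" by (rule fvs.span_minimal[rotated])
  have Psi: "lin_ext Psi c \<in> fvs.span ?G" if c: "c \<in> fsp (CB n j)" for c
  proof (rule span_lin_ext[OF fvs.subspace_span])
    fix bs assume "bs \<in> Poly_Mapping.keys c"
    then have "bs \<in> CB n j" using c by (auto simp: fsp_def)
    then obtain b cs where bs: "bs = b # cs" "length cs = n" "deg b + sum_list (map deg cs) = j"
      by (cases bs) (auto simp: CB_def)
    have "list_all2 (\<lambda>x d. x \<in> homog A d) (map (\<lambda>b. \<iota> (sg b)) cs) (map deg cs)"
      by (auto simp: list_all2_map1 list_all2_map2 homog intro!: list_all2_refl fsp_single)
    then have "list_all2 (\<lambda>x d. x \<in> homog A d) (of_hochschild A (map (\<lambda>b. \<iota> (sg b)) bs)) (deg b # 0 # map deg cs @ [0])"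
      using homog_0_one by (auto simp: bs of_hochschild_def homog intro!: list_all2_appendI fsp_single)
    moreover have "of_hochschild A (map (\<lambda>b. \<iota> (sg b)) bs) \<in> TL n"
      using bs(1,2) by (intro of_hochschild_TL basis_TL) simp
    moreover have "sum_list (deg b # 0 # map deg cs @ [0]) = j" using bs(3) by simp
    ultimately have "Psi bs \<in> ?G" unfolding Psi_def by blast
    then show "Psi bs \<in> fvs.span ?G" by (rule fvs.span_base)
  qed
  show ?thesis
  proof
    show "tor_chains_homog A n j \<subseteq> fib n ` fsp (CB n j)"
    proof
      fix X assume "X \<in> tor_chains_homog A n j"
      then obtain x where x: "x \<in> fvs.span ?G" "X = tor_rels A n +>\<^bsub>FS n\<^esub> x"
        unfolding tor_chains_homog_def by (rule imageE)
      then have "x \<in> ?S" using span by blast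
      then have "X = fib n (lin_ext Phi x)" "lin_ext Phi x \<in> fsp (CB n j)" using x(2) chain_coset by auto
      then show "X \<in> fib n ` fsp (CB n j)" by (rule image_eqI)
    qed
    show "fib n ` fsp (CB n j) \<subseteq> tor_chains_homog A n j"
    proof
      fix X assume "X \<in> fib n ` fsp (CB n j)"
      then obtain c where c: "c \<in> fsp (CB n j)" "X = fib n c" by auto
      then have "X = tor_rels A n +>\<^bsub>FS n\<^esub> lin_ext Psi c"
        using chain_coset[OF Psi_fsp[OF CB_len[OF c(1)]]] Phi_Psi_ext[OF CB_len[OF c(1)]] by simp
      then show "X \<in> tor_chains_homog A n j" unfolding tor_chains_homog_def using Psi[OF c(1)] by (rule image_eqI)
    qed
  qed
qed

lemma cyc_len: "c \<in> cyc n j \<Longrightarrow> c \<in> fsp (len (Suc n))"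
  unfolding cyc_def by (blast dest: CB_len)

lemma carrier_cycles: "carrier (cycles A n j) = fib n ` cyc n j"
proof (cases n)
  case 0
  then show ?thesis by (auto simp: cycles_def tor_chains_homog_fib cyc_def b_CB_0)
next
  case (Suc m)
  have "tor_diff A m (fib (Suc m) c) = zero (tor_chains A m) \<longleftrightarrow> b_op c = 0" if c: "c \<in> fsp (CB (Suc m) j)" for c
    using inj_on_eq_iff[OF inj_fib[of m] CB_len[OF b_CB[OF c]] fsp_0] by (simp add: tor_diff_fib[OF CB_len[OF c]] tor_chains_ops(1))
  then have "{c \<in> fsp (CB (Suc m) j). tor_diff A m (fib (Suc m) c) = zero (tor_chains A m)} = cyc (Suc m) j"
    unfolding cyc_def by (intro Collect_cong) (simp cong: conj_cong)
  then show ?thesis unfolding Suc by (simp add: cycles_def tor_chains_homog_fib Collect_image)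
qed

lemma boundaries_fib: "boundaries A n j = fib n ` bd n j"
  unfolding boundaries_def tor_chains_homog_fib bd_def image_image
  by (rule image_cong) (simp_all add: tor_diff_fib CB_len)

interpretation hh: coords_quotient "cycles A n j" "fib n" "cyc n j" "bd n j" for n j
  by unfold_locales (simp_all add: subspace_cyc subspace_bd bd_cyc cycles_def tor_chains_ops cyc_len)

lemma inj_fib_cyc: "inj_on (fib n) (cyc n j)"
  by (rule inj_on_subset[OF inj_fib]) (auto simp: cyc_len)

lemma HH_eq: "HH A n j = quotient (cycles A n j) (fib n ` bd n j)"
  by (simp add: HH_def boundaries_fib)

lemma carrier_HH: "carrier (HH A n j) = hh.cls n j ` cyc n j"
  unfolding HH_eq by (rule hh.carrier_quotient[OF carrier_cycles])

theorem HH_iso: "quot_dim (cyc n j) (bd n j) k \<Longrightarrow> lin_dim (HH A n j) k"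
  unfolding HH_eq by (rule hh.iso[OF _ inj_fib_cyc carrier_cycles])

lemma HH_zero: "cyc n j \<subseteq> bd n j \<Longrightarrow> carrier (HH A n j) = {zero (HH A n j)}"
proof -
  assume "cyc n j \<subseteq> bd n j"
  then have "hh.cls n j z = hh.cls n j 0" if "z \<in> cyc n j" for z using that by (intro hh.cls_eqI) auto
  then have "hh.cls n j ` cyc n j = {hh.cls n j 0}" using fvs.subspace_0[OF subspace_cyc] by (rule image_eq_singletonI)
  then show ?thesis unfolding carrier_HH unfolding HH_eq hh.quotient_simps(1) .
qed

lemma reduced_HH_Suc: "reduced_HH A (Suc n) j = HH A (Suc n) j"
  by (simp add: reduced_HH_def HH_def reduced_boundaries_def)

lemma connes_cls:
  assumes "z \<in> cyc (Suc n) j"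
  shows "connes A (Suc n) j (hh.cls (Suc n) j z) = hh.cls (Suc (Suc n)) j (Bop (Suc n) z)"
proof -
  have *: "fib (Suc (Suc n)) ` bd (Suc (Suc n)) j +>\<^bsub>cycles A (Suc (Suc n)) j\<^esub> connes_chains A (Suc n) (fib (Suc n) (b + z))
      = hh.cls (Suc (Suc n)) j (Bop (Suc n) z)" if b: "b \<in> bd (Suc n) j" for b
  proof -
    have bz: "b + z \<in> cyc (Suc n) j" using b bd_cyc assms fvs.subspace_add[OF subspace_cyc] by blast
    have "Bop (Suc n) (b + z) - Bop (Suc n) z = Bop (Suc n) b" by (simp add: lin_add[OF lin_Bop])
    then have "hh.cls (Suc (Suc n)) j (Bop (Suc n) (b + z)) = hh.cls (Suc (Suc n)) j (Bop (Suc n) z)"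
      using B_bd[OF b] by (intro hh.cls_eqI) simp
    then show ?thesis using hh.coset[OF B_cyc[OF bz]] by (simp add: connes_chains_fib[OF cyc_len[OF bz]])
  qed
  have "0 \<in> bd (Suc n) j" by (rule fvs.subspace_0[OF subspace_bd])
  then show ?thesis
    unfolding connes_def induced_def reduced_boundaries_def hh.cls_def[of "Suc n" j z]
    by (auto simp: boundaries_fib *)
qed

text \<open>Index shift: cyclic homology of index n + 1 is a kernel inside Hochschild homology of
  index n + 2.\<close>

lemma carrier_HC:
  "carrier (reduced_HC A (Suc n) j)
    = hh.cls (Suc (Suc n)) j ` {z \<in> cyc (Suc (Suc n)) j. Bop (Suc (Suc n)) z \<in> bd (Suc (Suc (Suc n))) j}"
proof -
  have "hh.cls (Suc (Suc (Suc n))) j (Bop (Suc (Suc n)) z) = hh.cls (Suc (Suc (Suc n))) j 0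
      \<longleftrightarrow> Bop (Suc (Suc n)) z \<in> bd (Suc (Suc (Suc n))) j" if "z \<in> cyc (Suc (Suc n)) j" for z
    using hh.cls_eq_iff[OF inj_fib_cyc B_cyc[OF that] fvs.subspace_0[OF subspace_cyc]] by simp
  then have "{z \<in> cyc (Suc (Suc n)) j. connes A (Suc (Suc n)) j (hh.cls (Suc (Suc n)) j z) = zero (HH A (Suc (Suc (Suc n))) j)}
      = {z \<in> cyc (Suc (Suc n)) j. Bop (Suc (Suc n)) z \<in> bd (Suc (Suc (Suc n))) j}"
    by (intro Collect_cong) (simp add: HH_eq hh.quotient_simps connes_cls cong: conj_cong)
  then show ?thesis by (simp add: reduced_HC_def reduced_HH_Suc carrier_HH Collect_image)
qed

text \<open>The Connes map has target zero, so its kernel is everything.\<close>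

lemma HC_eq_HH:
  assumes "cyc (Suc (Suc (Suc n))) j \<subseteq> bd (Suc (Suc (Suc n))) j"
  shows "reduced_HC A (Suc n) j = HH A (Suc (Suc n)) j"
proof -
  have "{z \<in> cyc (Suc (Suc n)) j. Bop (Suc (Suc n)) z \<in> bd (Suc (Suc (Suc n))) j} = cyc (Suc (Suc n)) j"
    using assms B_cyc by blast
  then have "carrier (reduced_HC A (Suc n) j) = carrier (HH A (Suc (Suc n)) j)" by (simp add: carrier_HC carrier_HH)
  then show ?thesis by (simp add: reduced_HC_def reduced_HH_Suc)
qed

text \<open>The Connes map is injective by \<open>connes_injective\<close>, so its kernel is
  zero.\<close>

lemma HC_zero:
  assumes "cyc (Suc n) j \<subseteq> bd (Suc n) j" "j \<noteq> 0"
  shows "carrier (reduced_HC A (Suc n) j) = {zero (HH A (Suc (Suc n)) j)}"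
proof -
  let ?K = "{z \<in> cyc (Suc (Suc n)) j. Bop (Suc (Suc n)) z \<in> bd (Suc (Suc (Suc n))) j}"
  have "z \<in> bd (Suc (Suc n)) j" if "z \<in> ?K" for z
    using that assms connes_injective[of z "Suc n" j] by (auto simp: cyc_def bd_def subset_iff)
  then have "hh.cls (Suc (Suc n)) j z = hh.cls (Suc (Suc n)) j 0" if "z \<in> ?K" for z
    using that by (intro hh.cls_eqI) auto
  moreover have "0 \<in> ?K"
    using fvs.subspace_0[OF subspace_cyc] fvs.subspace_0[OF subspace_bd] by (simp add: lin_0)
  ultimately have "hh.cls (Suc (Suc n)) j ` ?K = {hh.cls (Suc (Suc n)) j 0}" by (rule image_eq_singletonI)
  then show ?thesis unfolding carrier_HC unfolding HH_eq hh.quotient_simps(1) .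
qed

lemma HC_dim_0:
  assumes "cyc (Suc n) j \<subseteq> bd (Suc n) j" "j \<noteq> 0"
  shows "lin_dim (reduced_HC A (Suc n) j) 0"
proof (rule lin_dim_quotient[where Z = "{0 :: 'b list \<Rightarrow>\<^sub>0 complex}" and N = "{0}" and cls = "hh.cls (Suc (Suc n)) j"])
  show "quot_dim {0 :: 'b list \<Rightarrow>\<^sub>0 complex} {0} 0" using quot_dim_fsp[of "{} :: 'b list set"] by simp
  show "carrier (reduced_HC A (Suc n) j) = hh.cls (Suc (Suc n)) j ` {0}"
    unfolding HC_zero[OF assms] HH_eq hh.quotient_simps(1) by simp
  have 0: "0 \<in> cyc (Suc (Suc n)) j" by (rule fvs.subspace_0[OF subspace_cyc])
  have "add (reduced_HC A (Suc n) j) = add (HH A (Suc (Suc n)) j)" "smult (reduced_HC A (Suc n) j) = smult (HH A (Suc (Suc n)) j)"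
    by (simp_all add: reduced_HC_def reduced_HH_Suc)
  then show "hh.cls (Suc (Suc n)) j x \<oplus>\<^bsub>reduced_HC A (Suc n) j\<^esub> hh.cls (Suc (Suc n)) j y = hh.cls (Suc (Suc n)) j (x + y)"
    "c \<odot>\<^bsub>reduced_HC A (Suc n) j\<^esub> hh.cls (Suc (Suc n)) j x = hh.cls (Suc (Suc n)) j (fscale c x)"
    if "x \<in> {0}" "y \<in> {0}" for x y c
    using that hh.quotient_simps(2)[OF 0 0] hh.quotient_simps(3)[OF 0, of c] by (simp_all add: HH_eq)
qed simp_all

lemma deg0_iso:
  assumes z: "zero A \<in> carrier A" "\<kappa> (zero A) = 0" and fin: "finite {b. deg b = 0}"
  shows "lin_dim (deg0 A j) (if j = 0 then card {b. deg b = 0} else 0)"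
proof -
  let ?X = "if j = 0 then {b. deg b = 0} else {}"
  have zero: "\<iota> 0 = zero A" using \<iota>_\<kappa>[OF z(1)] z(2) by simp
  have "homog A 0 = \<iota> ` fsp {b. deg b = 0}" unfolding homog
  proof (intro equalityI subsetI)
    fix x assume "x \<in> {x \<in> carrier A. \<kappa> x \<in> fsp {b. deg b = 0}}"
    then show "x \<in> \<iota> ` fsp {b. deg b = 0}" by (intro image_eqI[of x \<iota> "\<kappa> x"]) (simp_all add: \<iota>_\<kappa>)
  qed auto
  then have car: "carrier (deg0 A j) = \<iota> ` fsp ?X" by (simp add: deg0_def zero)
  have add: "\<iota> x \<oplus>\<^bsub>A\<^esub> \<iota> y = \<iota> (x + y)" for x y by (rule \<kappa>_inj) (simp_all add: add_closed \<kappa>_add)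
  have smult: "c \<odot>\<^bsub>A\<^esub> \<iota> x = \<iota> (fscale c x)" for c x by (rule \<kappa>_inj) (simp_all add: smult_closed \<kappa>_smult)
  have inj: "\<iota> x = \<iota> y \<longleftrightarrow> x - y \<in> {0}" for x y
  proof -
    have "x = y" if "\<iota> x = \<iota> y" using arg_cong[OF that, of \<kappa>] by simp
    then show ?thesis by auto
  qed
  have "lin_dim (deg0 A j) (card ?X)"
    by (rule lin_dim_quotient[OF quot_dim_fsp subspace_fsp car])
      (use fin in \<open>simp_all add: inj deg0_def add smult\<close>)
  then show ?thesis by (simp split: if_splits)
qed

end


section \<open>The almost Calabi-Yau algebra in coordinates\<close>

text \<open>Corners and midpoints, numbered along the orbits of the rotation so that the edges match
  the labels \<open>eD\<close>, \<open>eC\<close> and \<open>eU\<close>.\<close>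

fun px pm :: "ix \<Rightarrow> int \<times> int" where
  "px I0 = (0, 0)" | "px I1 = (0, 2)" | "px I2 = (2, 0)"
| "pm I0 = (1, 0)" | "pm I1 = (0, 1)" | "pm I2 = (1, 1)"

type_synonym arc5 = "(int \<times> int) \<times> (int \<times> int)"

abbreviation aD :: "ix \<Rightarrow> arc5" where "aD i \<equiv> (px i, pm i)"
abbreviation aC :: "ix \<Rightarrow> arc5" where "aC i \<equiv> (pm i, pm (nx i))"
abbreviation aU :: "ix \<Rightarrow> arc5" where "aU i \<equiv> (pm (nx i), px i)"

abbreviation "T5 \<equiv> graph_A 5"

lemma verts_T5: "verts T5 = {(0, 0), (1, 0), (0, 1), (2, 0), (1, 1), (0, 2)}"
proof (intro equalityI subsetI)
  fix v assume "v \<in> verts T5"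
  then obtain a b where v: "v = (a, b)" "0 \<le> a" "0 \<le> b" "a + b \<le> 2" by (auto simp: graph_A_def verts_A_def)
  then have "(a = 0 \<or> a = 1 \<or> a = 2) \<and> (b = 0 \<or> b = 1 \<or> b = 2)" by presburger
  then show "v \<in> {(0, 0), (1, 0), (0, 1), (2, 0), (1, 1), (0, 2)}" using v by auto
qed (auto simp: graph_A_def verts_A_def)

lemma arcs_T5: "arcs T5 = {((0, 0), (1, 0)), ((0, 2), (0, 1)), ((2, 0), (1, 1)),
    ((1, 0), (0, 1)), ((0, 1), (1, 1)), ((1, 1), (1, 0)),
    ((0, 1), (0, 0)), ((1, 1), (0, 2)), ((1, 0), (2, 0))}" (is "_ = ?S")
proof -
  have "arcs T5 = {(v, w). v \<in> verts T5 \<and> w \<in> verts T5 \<and>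
      w \<in> {(fst v + 1, snd v), (fst v - 1, snd v + 1), (fst v, snd v - 1)}}"
    by (auto simp: graph_A_def)
  then have iff: "(v, w) \<in> arcs T5 \<longleftrightarrow> v \<in> verts T5 \<and> w \<in> verts T5 \<and>
      (w = (fst v + 1, snd v) \<or> w = (fst v - 1, snd v + 1) \<or> w = (fst v, snd v - 1))" for v w by simp
  show ?thesis
  proof (intro equalityI subsetI)
    fix a assume "a \<in> arcs T5"
    moreover obtain v w where "a = (v, w)" by (cases a)
    ultimately show "a \<in> ?S" by (simp only: iff verts_T5 insert_iff empty_iff; elim conjE disjE; simp)
  next
    fix a assume "a \<in> ?S"
    then show "a \<in> arcs T5" by (simp only: insert_iff empty_iff; elim disjE; simp add: iff verts_T5)
  qed
qed

lemma T5_tail_head [simp]: "tail T5 = fst" "head T5 = snd"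
  by (simp_all add: graph_A_def)

lemma arcs_T5_range: "arcs T5 = range aD \<union> range aC \<union> range aU"
  unfolding arcs_T5 ix_UNIV by auto

lemma verts_T5_range: "verts T5 = range px \<union> range pm"
  unfolding verts_T5 ix_UNIV by auto

lemma arc_cases:
  assumes "a \<in> arcs T5"
  obtains i where "a = aD i" | i where "a = aC i" | i where "a = aU i"
  using assms unfolding arcs_T5_range by blast

lemma arcs_T5_I [simp]: "aD i \<in> arcs T5" "aC i \<in> arcs T5" "aU i \<in> arcs T5"
  by (auto simp: arcs_T5_range)

lemma arcs_T5_I' [simp]: "(pm i, px (pv i)) \<in> arcs T5" "(pm (nx i), pm (pv i)) \<in> arcs T5"
  "(pm (pv i), pm i) \<in> arcs T5"
  using arcs_T5_I(3)[of "pv i"] arcs_T5_I(2)[of "nx i"] arcs_T5_I(2)[of "pv i"] by simp_all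

lemma verts_T5_I [simp]: "px i \<in> verts T5" "pm i \<in> verts T5"
  by (auto simp: verts_T5_range)

lemma arc_verts: "a \<in> arcs T5 \<Longrightarrow> fst a \<in> verts T5 \<and> snd a \<in> verts T5"
  by (erule arc_cases) auto

lemma edges_T5: "edges T5 v w = (if (v, w) \<in> arcs T5 then {(v, w)} else {})"
  by (auto simp: edges_def)

text \<open>The paths of length 2 that close \<open>aU i\<close>, \<open>aD i\<close> and
  \<open>aC i\<close> to triangles. An edge of the inner triangle lies in two triangles, every other
  edge in one.\<close>

lemma sum_paths2:
  fixes F :: "arc5 \<Rightarrow> arc5 \<Rightarrow> 'c :: comm_monoid_add"
  shows "(\<Sum>k\<in>verts T5. \<Sum>b\<in>edges T5 (px i) k. \<Sum>b'\<in>edges T5 k (pm (nx i)). F b b') = F (aD i) (aC i)"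
    and "(\<Sum>k\<in>verts T5. \<Sum>b\<in>edges T5 (pm i) k. \<Sum>b'\<in>edges T5 k (px i). F b b') = F (aC i) (aU i)"
    and "(\<Sum>k\<in>verts T5. \<Sum>b\<in>edges T5 (pm (nx i)) k. \<Sum>b'\<in>edges T5 k (pm i). F b b')
      = F (aC (nx i)) (aC (pv i)) + F (aU i) (aD i)"
  by (cases i; simp add: verts_T5 edges_T5 arcs_T5 add.commute)+

definition endv :: "int \<times> int \<Rightarrow> arc5 list \<Rightarrow> int \<times> int" where
  "endv u p = last (pre_digraph.awalk_verts T5 u p)"

lemma endv_simps [simp]: "endv u [] = u" "endv u (a # p) = endv (snd a) p"
proof -
  have "pre_digraph.awalk_verts T5 u p \<noteq> []" for u p
    by (cases p) (simp_all add: pre_digraph.awalk_verts.simps)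
  then show "endv u [] = u" "endv u (a # p) = endv (snd a) p"
    by (simp_all add: endv_def pre_digraph.awalk_verts.simps)
qed

lemma endv_append: "endv u (p @ q) = endv (endv u p) q"
  by (induction p arbitrary: u) auto

lemma paths_simps:
  "(u, []) \<in> paths T5 \<longleftrightarrow> u \<in> verts T5"
  "(u, a # p) \<in> paths T5 \<longleftrightarrow> a \<in> arcs T5 \<and> fst a = u \<and> (snd a, p) \<in> paths T5"
  using arc_verts[of a] by (auto simp: paths_def pre_digraph.awalk_def pre_digraph.cas.simps)

lemma paths_verts: "(u, p) \<in> paths T5 \<Longrightarrow> u \<in> verts T5"
  using arc_verts by (cases p) (auto simp: paths_simps)

lemma paths_append: "(u, p) \<in> paths T5 \<Longrightarrow> (endv u p, q) \<in> paths T5 \<Longrightarrow> (u, p @ q) \<in> paths T5"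
  by (induction p arbitrary: u) (auto simp: paths_simps)

abbreviation pmul :: "((int \<times> int) \<times> arc5 list \<Rightarrow>\<^sub>0 complex) \<Rightarrow> _ \<Rightarrow> _" where
  "pmul \<equiv> path_mult T5"

lemma pmul_lin_left: "lin (\<lambda>x. pmul x y)"
  by (simp add: path_mult_def)

lemma pmul_lin_right: "lin (pmul x)"
  unfolding path_mult_def lin_def case_prod_unfold by (simp add: lin_ext_linear lin_ext_fun_add lin_ext_fun_scale)

lemma pmul_sg: "pmul (sg (u, p)) (sg (v, q)) = (if endv u p = v then sg (u, p @ q) else 0)"
  by (simp add: path_mult_def endv_def)

lemma pmul_assoc: "pmul (pmul x y) z = pmul x (pmul y z)"
proof (rule el.lin_eq_UNIV[of "\<lambda>x. pmul (pmul x y) z" "\<lambda>x. pmul x (pmul y z)"])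
  fix a show "pmul (pmul (sg a) y) z = pmul (sg a) (pmul y z)"
  proof (rule el.lin_eq_UNIV[of "\<lambda>y. pmul (pmul (sg a) y) z" "\<lambda>y. pmul (sg a) (pmul y z)"])
    fix b show "pmul (pmul (sg a) (sg b)) z = pmul (sg a) (pmul (sg b) z)"
    proof (rule el.lin_eq_UNIV[of "pmul (pmul (sg a) (sg b))" "\<lambda>z. pmul (sg a) (pmul (sg b) z)"])
      fix c show "pmul (pmul (sg a) (sg b)) (sg c) = pmul (sg a) (pmul (sg b) (sg c))"
        by (cases a; cases b; cases c)
          (simp add: pmul_sg endv_append lin_0[OF pmul_lin_left] lin_0[OF pmul_lin_right])
    qed (rule pmul_lin_right lin_comp[OF pmul_lin_right pmul_lin_right])+
  qed (rule lin_comp[OF pmul_lin_left pmul_lin_right] lin_comp[OF pmul_lin_right pmul_lin_left])+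
qed (rule lin_comp[OF pmul_lin_left pmul_lin_left] pmul_lin_left)+

lemma pmul_fsp: "x \<in> fsp (paths T5) \<Longrightarrow> y \<in> fsp (paths T5) \<Longrightarrow> pmul x y \<in> fsp (paths T5)"
  unfolding path_mult_def case_prod_unfold endv_def[symmetric]
  by (rule fsp_lin_ext, assumption, rule fsp_lin_ext, assumption)
    (auto intro!: fsp_single paths_append)

definition pone :: "(int \<times> int) \<times> arc5 list \<Rightarrow>\<^sub>0 complex" where
  "pone = (\<Sum>v\<in>verts T5. sg (v, []))"

lemma finite_verts_T5: "finite (verts T5)"
  by (simp add: verts_T5)

lemma pone_fsp: "pone \<in> fsp (paths T5)"
  by (auto simp: pone_def paths_simps intro!: fsp_sum fsp_single)

lemma pone_pmul: "x \<in> fsp (paths T5) \<Longrightarrow> pmul pone x = x" "x \<in> fsp (paths T5) \<Longrightarrow> pmul x pone = x"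
proof -
  assume x: "x \<in> fsp (paths T5)"
  have l: "pmul pone (sg \<pi>) = sg \<pi>" "pmul (sg \<pi>) pone = sg \<pi>" if "\<pi> \<in> paths T5" for \<pi>
  proof -
    obtain u p where \<pi>: "\<pi> = (u, p)" by (cases \<pi>)
    have u: "u \<in> verts T5" using that by (auto simp: \<pi> paths_verts)
    have v: "endv u p \<in> verts T5" using that unfolding \<pi>
      by (induction p arbitrary: u) (auto simp: paths_simps)
    have "pmul pone (sg \<pi>) = (\<Sum>v\<in>verts T5. if v = u then sg \<pi> else 0)"
      unfolding pone_def lin_sum[OF pmul_lin_left] by (intro sum.cong) (auto simp: pmul_sg \<pi>)
    then show "pmul pone (sg \<pi>) = sg \<pi>" using u by (simp add: finite_verts_T5)
    have "pmul (sg \<pi>) pone = (\<Sum>v\<in>verts T5. if v = endv u p then sg \<pi> else 0)"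
      unfolding pone_def lin_sum[OF pmul_lin_right] by (intro sum.cong) (auto simp: pmul_sg \<pi>)
    then show "pmul (sg \<pi>) pone = sg \<pi>" using v by (simp add: finite_verts_T5)
  qed
  show "pmul pone x = x" by (rule lin_eqI[OF _ _ x, of "pmul pone" "\<lambda>x. x"]) (simp_all add: pmul_lin_right lin_id l)
  show "pmul x pone = x" by (rule lin_eqI[OF _ _ x, of "\<lambda>x. pmul x pone" "\<lambda>x. x"]) (simp_all add: pmul_lin_left lin_id l)
qed

abbreviation "P5 \<equiv> path_algebra T5"

lemma P5_simps: "carrier P5 = fsp (paths T5)" "monoid.mult P5 = pmul" "one P5 = pone" "zero P5 = 0" "add P5 = (+)"
  "smult P5 = fscale"
  by (simp_all add: path_algebra_def fsp_def pone_def)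

lemma homog_P5: "homog P5 d = fsp {(u, p). (u, p) \<in> paths T5 \<and> int (length p) = d}"
  by (simp add: path_algebra_def fsp_def)

lemma ring_P5: "ring P5"
proof (rule ringI)
  show "abelian_group P5"
  proof (rule abelian_groupI)
    fix x assume "x \<in> carrier P5"
    then show "\<exists>y\<in>carrier P5. y \<oplus>\<^bsub>P5\<^esub> x = \<zero>\<^bsub>P5\<^esub>"
      by (intro bexI[of _ "- x"]) (simp_all add: P5_simps fsp_uminus)
  qed (auto simp: P5_simps fsp_add algebra_simps)
  show "Group.monoid P5"
    by (rule monoidI) (simp_all add: P5_simps pmul_fsp pone_fsp pmul_assoc pone_pmul)
qed (simp_all add: P5_simps lin_add[OF pmul_lin_left] lin_add[OF pmul_lin_right])

text \<open>A ring ideal absorbs scalars because multiples of the unit lie in the path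
  algebra.\<close>

lemma ideal_scale: "ideal J P5 \<Longrightarrow> x \<in> J \<Longrightarrow> fscale c x \<in> J"
proof -
  assume J: "ideal J P5" and x: "x \<in> J"
  then have xP: "x \<in> fsp (paths T5)" using ideal.Icarr[OF J x] by (simp add: P5_simps)
  have "pmul (fscale c pone) x \<in> J"
    using ideal.I_l_closed[OF J x, of "fscale c pone"] by (simp add: P5_simps fsp_scale pone_fsp)
  then show ?thesis by (simp add: lin_scale[OF pmul_lin_left] pone_pmul xP)
qed

lemma ideal_subspace: "ideal J P5 \<Longrightarrow> fvs.subspace J"
proof -
  assume J: "ideal J P5"
  then have "0 \<in> J" "x \<in> J \<Longrightarrow> y \<in> J \<Longrightarrow> x + y \<in> J" for x y
    using additive_subgroup.a_closed[OF ideal.axioms(1)[OF J], of x y] additive_subgroup.zero_closed[OF ideal.axioms(1)[OF J]]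
    by (simp_all add: P5_simps)
  then show ?thesis using ideal_scale[OF J] by (simp add: fvs.subspace_def)
qed

fun \<beta> :: "int \<times> int \<Rightarrow> el" where
  "\<beta> v = (if v = (0, 0) then vX I0 else if v = (0, 2) then vX I1 else if v = (2, 0) then vX I2
     else if v = (1, 0) then vM I0 else if v = (0, 1) then vM I1 else vM I2)"

declare \<beta>.simps [simp del]

lemma \<beta>_simps [simp]: "\<beta> (px i) = vX i" "\<beta> (pm i) = vM i"
  by (cases i; simp add: \<beta>.simps)+

lemma \<beta>_inj: "u \<in> verts T5 \<Longrightarrow> v \<in> verts T5 \<Longrightarrow> \<beta> u = \<beta> v \<Longrightarrow> u = v"
  unfolding verts_T5_range by auto

lemma \<beta>_verts: "\<beta> ` verts T5 = el_vs"
  by (simp add: verts_T5 el_vs_def \<beta>.simps) blast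

text \<open>
  The arrows into the corners are rescaled by \<open>- w / s i\<close>, which turns the relations into equalities
  of paths and zero relations.
\<close>

locale triangle_cells =
  fixes W :: "arc5 \<Rightarrow> arc5 \<Rightarrow> arc5 \<Rightarrow> complex" and s :: "ix \<Rightarrow> complex" and w :: complex
  assumes rel_D: "cell_relation T5 W (aD i) = Poly_Mapping.single (pm i, [aC i, aU i]) (s i)"
    and rel_U: "cell_relation T5 W (aU i) = Poly_Mapping.single (px i, [aD i, aC i]) (s i)"
    and rel_C: "cell_relation T5 W (aC i) = Poly_Mapping.single (pm (nx i), [aC (nx i), aC (pv i)]) w
      + Poly_Mapping.single (pm (nx i), [aU i, aD i]) (s i)"
    and s_nz: "s i \<noteq> 0" and w_nz: "w \<noteq> 0"
begin

definition "k i = - w / s i"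

lemma k_nz: "k i \<noteq> 0"
  using s_nz w_nz by (simp add: k_def)

definition \<alpha> :: "arc5 \<Rightarrow> (el \<Rightarrow>\<^sub>0 complex)" where
  "\<alpha> a = (case (\<beta> (fst a), \<beta> (snd a)) of (vX i, _) \<Rightarrow> sg (eD i)
     | (vM i, vX j) \<Rightarrow> Poly_Mapping.single (eU j) (k j) | (vM i, _) \<Rightarrow> sg (eC i) | _ \<Rightarrow> 0)"

lemma \<alpha>_simps [simp]:
  "\<alpha> (aD i) = sg (eD i)" "\<alpha> (aC i) = sg (eC i)" "\<alpha> (aU i) = Poly_Mapping.single (eU i) (k i)"
  "\<alpha> (pm i, px (pv i)) = Poly_Mapping.single (eU (pv i)) (k (pv i))"
  "\<alpha> (pm (nx i), pm (pv i)) = sg (eC (nx i))" "\<alpha> (pm (pv i), pm i) = sg (eC (pv i))"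
  by (simp_all add: \<alpha>_def)

fun K :: "int \<times> int \<Rightarrow> arc5 list \<Rightarrow> (el \<Rightarrow>\<^sub>0 complex)" where
  "K u [] = sg (\<beta> u)"
| "K u (a # p) = el.mulv (\<alpha> a) (K (snd a) p)"

abbreviation K2 :: "(int \<times> int) \<times> arc5 list \<Rightarrow> (el \<Rightarrow>\<^sub>0 complex)" where
  "K2 \<equiv> (\<lambda>(u, p). K u p)"

definition span_el :: "el \<Rightarrow> el \<Rightarrow> int \<Rightarrow> el set" where
  "span_el a b d = {x. el_src x = a \<and> el_tgt x = b \<and> el_deg x = d}"

lemma mulv_span_el: "x \<in> fsp (span_el a b c) \<Longrightarrow> y \<in> fsp (span_el b d e) \<Longrightarrow> el.mulv x y \<in> fsp (span_el a d (c + e))"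
  unfolding el.mulv_def
proof (rule fsp_lin_ext, assumption, rule fsp_lin_ext, assumption)
  fix x y assume "x \<in> span_el a b c" "y \<in> span_el b d e"
  then show "osg (el_mul x y) \<in> fsp (span_el a d (c + e))"
    using el_mul_Some[of x y] by (cases "el_mul x y") (auto simp: span_el_def intro!: fsp_single)
qed

lemma mulv_mismatch:
  assumes "x \<in> fsp (span_el a b c)" "y \<in> fsp (span_el b' d e)" "b \<noteq> b'"
  shows "el.mulv x y = 0"
proof -
  have "lin_ext (\<lambda>b. osg (el_mul a' b)) y = 0" if "a' \<in> span_el a b c" for a'
    using lin_ext_eqI[OF assms(2), of "\<lambda>b. osg (el_mul a' b)" "\<lambda>_. 0"] that assms(3)
    by (simp add: span_el_def el_mul_None)
  then show ?thesis using lin_ext_eqI[OF assms(1), of "\<lambda>a. lin_ext (\<lambda>b. osg (el_mul a b)) y" "\<lambda>_. 0"] by (simp add: el.mulv_def)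
qed

lemma mulv_unit: "y \<in> fsp (span_el b d e) \<Longrightarrow> el.mulv (sg b) y = y"
proof -
  assume y: "y \<in> fsp (span_el b d e)"
  have "lin_ext (\<lambda>c. osg (el_mul b c)) y = lin_ext sg y"
    by (rule lin_ext_eqI[OF y]) (auto simp: span_el_def)
  then show ?thesis by (simp add: el.mulv_def)
qed

lemma \<beta>_fix: "v \<in> verts T5 \<Longrightarrow> el_src (\<beta> v) = \<beta> v \<and> el_tgt (\<beta> v) = \<beta> v \<and> el_deg (\<beta> v) = 0"
  by (auto simp: verts_T5_range)

lemma \<alpha>_span: "a \<in> arcs T5 \<Longrightarrow> \<alpha> a \<in> fsp (span_el (\<beta> (fst a)) (\<beta> (snd a)) 1)"
  by (erule arc_cases) (auto simp: span_el_def intro!: fsp_single)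

lemma K_span: "(u, p) \<in> paths T5 \<Longrightarrow> K u p \<in> fsp (span_el (\<beta> u) (\<beta> (endv u p)) (int (length p)))"
proof (induction p arbitrary: u)
  case Nil
  then show ?case using \<beta>_fix[of u] by (auto simp: paths_simps span_el_def intro!: fsp_single)
next
  case (Cons a p)
  then have "el.mulv (\<alpha> a) (K (snd a) p) \<in> fsp (span_el (\<beta> (fst a)) (\<beta> (endv (snd a) p)) (1 + int (length p)))"
    using mulv_span_el[OF \<alpha>_span[of a] Cons.IH[of "snd a"]] by (simp add: paths_simps)
  then show ?case using Cons.prems by (simp add: paths_simps)
qed

lemma endv_verts: "(u, p) \<in> paths T5 \<Longrightarrow> endv u p \<in> verts T5"
  by (induction p arbitrary: u) (auto simp: paths_simps)

lemma K_append:
  "(u, p) \<in> paths T5 \<Longrightarrow> (endv u p, q) \<in> paths T5 \<Longrightarrow> K u (p @ q) = el.mulv (K u p) (K (endv u p) q)"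
proof (induction p arbitrary: u)
  case Nil
  then show ?case using mulv_unit[OF K_span[OF Nil(2)]] by simp
next
  case (Cons a p)
  then show ?case by (simp add: paths_simps el.mulv_assoc)
qed

abbreviation \<kappa>0 :: "((int \<times> int) \<times> arc5 list \<Rightarrow>\<^sub>0 complex) \<Rightarrow> (el \<Rightarrow>\<^sub>0 complex)" where
  "\<kappa>0 \<equiv> lin_ext K2"

lemma \<kappa>0_pmul_sg:
  assumes "\<pi> \<in> paths T5" "\<rho> \<in> paths T5"
  shows "\<kappa>0 (pmul (sg \<pi>) (sg \<rho>)) = el.mulv (K2 \<pi>) (K2 \<rho>)"
proof -
  obtain u p v q where \<pi>: "\<pi> = (u, p)" "\<rho> = (v, q)" by (cases \<pi>; cases \<rho>)
  show ?thesis
  proof (cases "endv u p = v")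
    case True
    then show ?thesis using K_append[of u p q] assms by (simp add: \<pi> pmul_sg)
  next
    case False
    then have "\<beta> (endv u p) \<noteq> \<beta> v"
      using \<beta>_inj[OF endv_verts[of u p] paths_verts[of v q]] assms by (auto simp: \<pi>)
    then show ?thesis
      using mulv_mismatch[OF K_span[of u p] K_span[of v q]] assms False by (simp add: \<pi> pmul_sg)
  qed
qed

lemma \<kappa>0_pmul:
  assumes x: "x \<in> fsp (paths T5)" and y: "y \<in> fsp (paths T5)"
  shows "\<kappa>0 (pmul x y) = el.mulv (\<kappa>0 x) (\<kappa>0 y)"
proof (rule lin_eqI[OF _ _ x, of "\<lambda>x. \<kappa>0 (pmul x y)" "\<lambda>x. el.mulv (\<kappa>0 x) (\<kappa>0 y)"])
  show "lin (\<lambda>x. \<kappa>0 (pmul x y))" by (rule lin_comp[OF lin_lin_ext pmul_lin_left])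
  show "lin (\<lambda>x. el.mulv (\<kappa>0 x) (\<kappa>0 y))" by (rule lin_comp[OF el.mulv_lin_left lin_lin_ext])
  fix \<pi> assume \<pi>: "\<pi> \<in> paths T5"
  show "\<kappa>0 (pmul (sg \<pi>) y) = el.mulv (\<kappa>0 (sg \<pi>)) (\<kappa>0 y)"
  proof (rule lin_eqI[OF _ _ y, of "\<lambda>y. \<kappa>0 (pmul (sg \<pi>) y)" "\<lambda>y. el.mulv (\<kappa>0 (sg \<pi>)) (\<kappa>0 y)"])
    show "lin (\<lambda>y. \<kappa>0 (pmul (sg \<pi>) y))" by (rule lin_comp[OF lin_lin_ext pmul_lin_right])
    show "lin (\<lambda>y. el.mulv (\<kappa>0 (sg \<pi>)) (\<kappa>0 y))" by (rule lin_comp[OF el.mulv_lin_right lin_lin_ext])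
  qed (use \<pi> \<kappa>0_pmul_sg in simp)
qed

definition ker :: "((int \<times> int) \<times> arc5 list \<Rightarrow>\<^sub>0 complex) set" where
  "ker = {x \<in> fsp (paths T5). \<kappa>0 x = 0}"

lemma ideal_ker: "ideal ker P5"
proof (rule idealI[OF ring_P5])
  interpret P5: ring P5 by (rule ring_P5)
  show "subgroup ker (add_monoid P5)"
  proof
    fix x assume x: "x \<in> ker"
    then have "\<ominus>\<^bsub>P5\<^esub> x = - x"
      by (intro P5.minus_equality) (simp_all add: P5_simps ker_def fsp_uminus)
    then show "inv\<^bsub>add_monoid P5\<^esub> x \<in> ker"
      using x unfolding a_inv_def[symmetric] by (simp add: ker_def fsp_uminus lin_ext_uminus)
  qed (auto simp: P5_simps ker_def fsp_add lin_ext_add)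
qed (auto simp: P5_simps ker_def pmul_fsp \<kappa>0_pmul lin_0[OF el.mulv_lin_left] lin_0[OF el.mulv_lin_right])

text \<open>A section of \<open>\<kappa>0\<close> by multiples of paths; the inverse constants undo
  the rescaling in \<open>\<alpha>\<close>.\<close>

fun nf :: "el \<Rightarrow> ((int \<times> int) \<times> arc5 list \<Rightarrow>\<^sub>0 complex)" where
  "nf (vX i) = sg (px i, [])" | "nf (vM i) = sg (pm i, [])"
| "nf (eD i) = sg (px i, [aD i])" | "nf (eC i) = sg (pm i, [aC i])"
| "nf (eU i) = Poly_Mapping.single (pm (nx i), [aU i]) (inverse (k i))"
| "nf (pV i) = Poly_Mapping.single (px i, [aD i, aU (pv i)]) (inverse (k (pv i)))"
| "nf (pW i) = sg (pm i, [aC i, aC (nx i)])"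

lemma mulv_single: "el.mulv (Poly_Mapping.single a c) (Poly_Mapping.single b d) = fscale (c * d) (osg (el_mul a b))"
  by (simp add: el.mulv_def del: fscale_single)

lemma pmul_single:
  "pmul (Poly_Mapping.single (u, p) c) (Poly_Mapping.single (v, q) d)
    = (if endv u p = v then Poly_Mapping.single (u, p @ q) (c * d) else 0)"
  by (simp add: path_mult_def endv_def)


lemma nf_paths: "nf b \<in> fsp {(u, p). (u, p) \<in> paths T5 \<and> int (length p) = el_deg b}"
  by (cases b) (auto simp: paths_simps intro!: fsp_single)

lemma \<kappa>0_nf: "\<kappa>0 (nf b) = sg b"
  by (cases b) (simp_all add: mulv_single el_mul_def k_nz)

lemma nf_fsp: "lin_ext nf v \<in> fsp (paths T5)"
  using fsp_mono[OF nf_paths] by (intro fsp_lin_ext[of v UNIV]) auto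

lemma \<kappa>0_nf_ext: "\<kappa>0 (lin_ext nf v) = v"
  by (simp only: lin_ext_comp \<kappa>0_nf lin_ext_sg)

section \<open>An ideal containing the relations contains the kernel of the coordinates\<close>

context
  fixes J
  assumes J: "ideal J P5" and gens: "cell_relation T5 W ` arcs T5 \<subseteq> J"
begin

lemma J_left: "x \<in> J \<Longrightarrow> (u, p) \<in> paths T5 \<Longrightarrow> pmul (sg (u, p)) x \<in> J"
  using ideal.I_l_closed[OF J, of x "sg (u, p)"] by (simp add: P5_simps fsp_single)

lemma J_right: "x \<in> J \<Longrightarrow> (u, p) \<in> paths T5 \<Longrightarrow> pmul x (sg (u, p)) \<in> J"
  using ideal.I_r_closed[OF J, of x "sg (u, p)"] by (simp add: P5_simps fsp_single)

lemma J_rel: "a \<in> arcs T5 \<Longrightarrow> cell_relation T5 W a \<in> J"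
  using gens by blast

lemma J_single: "sg \<pi> \<in> J \<Longrightarrow> Poly_Mapping.single \<pi> c \<in> J"
  using ideal_scale[OF J, of "sg \<pi>" c] by simp

lemma CU: "sg (pm i, [aC i, aU i]) \<in> J"
  using ideal_scale[OF J J_rel[of "aD i"], of "inverse (s i)"] s_nz[of i] by (simp add: rel_D)

lemma DC: "sg (px i, [aD i, aC i]) \<in> J"
  using ideal_scale[OF J J_rel[of "aU i"], of "inverse (s i)"] s_nz[of i] by (simp add: rel_U)

lemma UD: "sg (pm (nx i), [aU i, aD i]) - Poly_Mapping.single (pm (nx i), [aC (nx i), aC (pv i)]) (k i) \<in> J"
proof -
  have "fscale (inverse (s i)) (cell_relation T5 W (aC i))
      = sg (pm (nx i), [aU i, aD i]) - Poly_Mapping.single (pm (nx i), [aC (nx i), aC (pv i)]) (k i)"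
    using s_nz[of i] by (simp add: rel_C fvs.scale_right_distrib k_def single_uminus[symmetric] divide_inverse mult.commute)
  then show ?thesis using ideal_scale[OF J J_rel[of "aC i"], of "inverse (s i)"] by simp
qed

lemma DCC: "sg (px i, [aD i, aC i, aC (nx i)]) \<in> J"
  using J_right[OF DC[of i], of "pm (nx i)" "[aC (nx i)]"] by (simp add: paths_simps pmul_single)

lemma CUD: "sg (pm i, [aC i, aU i, aD i]) \<in> J"
  using J_right[OF CU[of i], of "px i" "[aD i]"] by (simp add: paths_simps pmul_single)

lemma CCU: "sg (pm (nx i), [aC (nx i), aC (pv i), aU (pv i)]) \<in> J"
  using J_left[OF CU[of "pv i"], of "pm (nx i)" "[aC (nx i)]"] by (simp add: paths_simps pmul_single)

text \<open>Multiplying the relation for U D by C shows that C U D and a nonzero multiple of C C C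
  agree modulo J, and C U lies in J.\<close>

lemma CCC: "sg (pm i, [aC i, aC (nx i), aC (pv i)]) \<in> J"
proof -
  have "sg (pm i, [aC i, aU i, aD i]) - Poly_Mapping.single (pm i, [aC i, aC (nx i), aC (pv i)]) (k i) \<in> J"
    using J_left[OF UD[of i], of "pm i" "[aC i]"] by (simp add: paths_simps pmul_single lin_diff[OF pmul_lin_right])
  from fvs.subspace_diff[OF ideal_subspace[OF J] CUD[of i] this]
  have "Poly_Mapping.single (pm i, [aC i, aC (nx i), aC (pv i)]) (k i) \<in> J" by simp
  from ideal_scale[OF J this, of "inverse (k i)"] show ?thesis by (simp add: k_nz)
qed

text \<open>Modulo J the path U D U is a multiple of C C U, which contains C U.\<close>

lemma UDU: "sg (pm (nx i), [aU i, aD i, aU (pv i)]) \<in> J"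
proof -
  have "sg (pm (nx i), [aU i, aD i, aU (pv i)])
      - Poly_Mapping.single (pm (nx i), [aC (nx i), aC (pv i), aU (pv i)]) (k i) \<in> J"
    using J_right[OF UD[of i], of "pm i" "[aU (pv i)]"] by (simp add: paths_simps pmul_single lin_diff[OF pmul_lin_left])
  from fvs.subspace_add[OF ideal_subspace[OF J] this J_single[OF CCU[of i], of "k i"]] show ?thesis by simp
qed

lemma J_0: "0 \<in> J"
  by (rule fvs.subspace_0[OF ideal_subspace[OF J]])

text \<open>Prefixing an arrow to a normal form gives, modulo J, a multiple of a normal form, or a
  path already known to lie in J.\<close>

lemma reduce_step:
  assumes a: "a \<in> arcs T5" and b: "el_src b = \<beta> (snd a)"
  shows "pmul (sg (fst a, [a])) (nf b) - lin_ext nf (el.mulv (\<alpha> a) (sg b)) \<in> J"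
  using a
proof (cases rule: arc_cases)
  case (1 i)
  then have "b = vM i \<or> b = eC i \<or> b = eU (pv i) \<or> b = pW i" using b by (cases b) auto
  then show ?thesis using DC[of i] DCC[of i] unfolding 1
    by (elim disjE) (simp_all add: pmul_single mulv_single el_mul_def J_0)
next
  case (2 i)
  then have "b = vM (nx i) \<or> b = eC (nx i) \<or> b = eU i \<or> b = pW (nx i)" using b by (cases b) auto
  then show ?thesis using J_single[OF CU[of i]] CCC[of i] unfolding 2
    by (elim disjE) (simp_all add: pmul_single mulv_single el_mul_def J_0)
next
  case (3 i)
  then have "b = vX i \<or> b = eD i \<or> b = pV i" using b by (cases b) auto
  then show ?thesis using J_single[OF UDU[of i]] UD[of i] k_nz[of i] unfolding 3
    by (elim disjE) (simp_all add: pmul_single mulv_single el_mul_def J_0)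
qed

lemma reduce_path: "(u, p) \<in> paths T5 \<Longrightarrow> sg (u, p) - lin_ext nf (K u p) \<in> J"
proof (induction p arbitrary: u)
  case Nil
  then show ?case by (auto simp: paths_simps verts_T5_range J_0)
next
  case (Cons a p)
  then have a: "a \<in> arcs T5" "fst a = u" "(snd a, p) \<in> paths T5" by (auto simp: paths_simps)
  let ?v = "K (snd a) p" and ?m = "pmul (sg (u, [a]))"
  have ua: "(u, [a]) \<in> paths T5" using a arc_verts[OF a(1)] by (simp add: paths_simps)
  have "?m (sg (snd a, p)) - ?m (lin_ext nf ?v) \<in> J"
    using J_left[OF Cons.IH[OF a(3)] ua] by (simp add: lin_diff[OF pmul_lin_right])
  moreover have "lin_ext (\<lambda>b. ?m (nf b) - lin_ext nf (el.mulv (\<alpha> a) (sg b))) ?v \<in> J"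
  proof (rule span_lin_ext[OF ideal_subspace[OF J]])
    fix b assume "b \<in> Poly_Mapping.keys ?v"
    then have "el_src b = \<beta> (snd a)" using K_span[OF a(3)] by (auto simp: fsp_def span_el_def)
    then show "?m (nf b) - lin_ext nf (el.mulv (\<alpha> a) (sg b)) \<in> J" using reduce_step[OF a(1)] a(2) by simp
  qed
  moreover have "lin_ext (\<lambda>b. ?m (nf b)) ?v = ?m (lin_ext nf ?v)"
    using lin_eq_lin_ext[OF lin_comp[OF pmul_lin_right lin_lin_ext], of "sg (u, [a])" nf ?v] by simp
  moreover have "lin_ext (\<lambda>b. lin_ext nf (el.mulv (\<alpha> a) (sg b))) ?v = lin_ext nf (el.mulv (\<alpha> a) ?v)"
    using lin_eq_lin_ext[OF lin_comp[OF lin_lin_ext el.mulv_lin_right], of nf "\<alpha> a" ?v] by simp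
  ultimately have "?m (sg (snd a, p)) - ?m (lin_ext nf ?v) + (?m (lin_ext nf ?v) - lin_ext nf (el.mulv (\<alpha> a) ?v)) \<in> J"
    using fvs.subspace_add[OF ideal_subspace[OF J]] by (simp only: lin_ext_fun_diff)
  moreover have "?m (sg (snd a, p)) = sg (u, a # p)" by (simp add: pmul_single)
  ultimately show ?case by simp
qed

lemma ker_subset: "ker \<subseteq> J"
proof
  fix x assume "x \<in> ker"
  then have x: "x \<in> fsp (paths T5)" "\<kappa>0 x = 0" by (auto simp: ker_def)
  have "lin_ext (\<lambda>\<pi>. sg \<pi> - lin_ext nf (K2 \<pi>)) x \<in> J"
    by (rule span_lin_ext[OF ideal_subspace[OF J]]) (use x(1) reduce_path in \<open>auto simp: fsp_def\<close>)
  moreover have "lin_ext (\<lambda>\<pi>. sg \<pi> - lin_ext nf (K2 \<pi>)) x = x - lin_ext nf (\<kappa>0 x)"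
    by (simp only: lin_ext_fun_diff lin_ext_comp lin_ext_sg)
  ultimately show "x \<in> J" using x(2) by simp
qed

end

text \<open>The kernel is an ideal containing the relations, and by \<open>ker_subset\<close> it is
  the least one.\<close>

lemma genideal_eq: "Idl\<^bsub>P5\<^esub> (cell_relation T5 W ` arcs T5) = ker"
proof -
  have "cell_relation T5 W a \<in> ker" if "a \<in> arcs T5" for a
    using that
  proof (cases rule: arc_cases)
    case (1 i)
    then show ?thesis by (auto simp: ker_def rel_D paths_simps mulv_single el_mul_def intro!: fsp_single)
  next
    case (2 i)
    have "w + s i * k i = 0" using s_nz[of i] by (simp add: k_def)
    then have "Poly_Mapping.single (pW (nx i)) w + Poly_Mapping.single (pW (nx i)) (s i * k i) = 0"
      by (simp add: single_add[symmetric])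
    then show ?thesis unfolding 2
      by (auto simp: ker_def rel_C paths_simps mulv_single el_mul_def lin_ext_add intro!: fsp_single fsp_add)
  next
    case (3 i)
    then show ?thesis by (auto simp: ker_def rel_U paths_simps mulv_single el_mul_def intro!: fsp_single)
  qed
  then have "cell_relation T5 W ` arcs T5 \<subseteq> ker" by blast
  then show ?thesis unfolding genideal_def using ideal_ker ker_subset by blast
qed

interpretation q: coords_quotient P5 "\<lambda>x. x" "fsp (paths T5)" ker
  by unfold_locales (auto simp: subspace_fsp ker_def P5_simps fvs.subspace_def fsp_add fsp_scale lin_ext_linear)

abbreviation "A5 \<equiv> acy_algebra T5 W"

text \<open>The choice of representative is harmless, since \<open>\<kappa>0\<close> is constant on
  cosets of its kernel.\<close>

definition \<kappa> :: "((int \<times> int) \<times> arc5 list \<Rightarrow>\<^sub>0 complex) set \<Rightarrow> (el \<Rightarrow>\<^sub>0 complex)" where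
  "\<kappa> X = \<kappa>0 (SOME x. x \<in> X)"

lemma cls_fsp: "x \<in> fsp (paths T5) \<Longrightarrow> y \<in> q.cls x \<Longrightarrow> y \<in> fsp (paths T5) \<and> \<kappa>0 y = \<kappa>0 x"
  unfolding q.cls_def by (auto simp: ker_def fsp_add lin_ext_add)

lemma \<kappa>_cls: "x \<in> fsp (paths T5) \<Longrightarrow> \<kappa> (q.cls x) = \<kappa>0 x"
  unfolding \<kappa>_def using cls_fsp[of x] someI[of "\<lambda>y. y \<in> q.cls x", OF q.cls_mem] by blast

lemma A5_quotient:
  "carrier A5 = carrier (quotient P5 ker)" "monoid.mult A5 = monoid.mult (quotient P5 ker)"
  "one A5 = one (quotient P5 ker)" "zero A5 = zero (quotient P5 ker)" "add A5 = add (quotient P5 ker)"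
  "smult A5 = smult (quotient P5 ker)" "homog A5 d = (\<lambda>x. ker +>\<^bsub>P5\<^esub> x) ` homog P5 d"
  by (simp_all add: acy_algebra_def Let_def genideal_eq module.defs graded_algebra.defs)

lemma A5_carrier: "carrier A5 = q.cls ` fsp (paths T5)"
  using q.carrier_quotient by (simp add: A5_quotient P5_simps)

lemma A5_mult:
  assumes x: "x \<in> fsp (paths T5)" and y: "y \<in> fsp (paths T5)"
  shows "q.cls x \<otimes>\<^bsub>A5\<^esub> q.cls y = q.cls (pmul x y)"
proof -
  have "ker +>\<^bsub>P5\<^esub> pmul a b = q.cls (pmul x y)" if ab: "a \<in> q.cls x" "b \<in> q.cls y" for a b
  proof -
    have a: "a \<in> fsp (paths T5)" "\<kappa>0 a = \<kappa>0 x" using cls_fsp[OF x ab(1)] by auto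
    have b: "b \<in> fsp (paths T5)" "\<kappa>0 b = \<kappa>0 y" using cls_fsp[OF y ab(2)] by auto
    have "pmul a b - pmul x y \<in> ker"
      using a b x y by (simp add: ker_def fsp_diff pmul_fsp lin_ext_diff \<kappa>0_pmul)
    then show ?thesis using q.coset[OF pmul_fsp[OF a(1) b(1)]] q.cls_eqI by simp
  qed
  then show ?thesis using q.cls_mem[of x] q.cls_mem[of y]
    unfolding A5_quotient quotient_def rcoset_mult_def by (auto simp: P5_simps)
qed

lemma A5_ops:
  "zero A5 = q.cls 0" "one A5 = q.cls pone"
  "x \<in> fsp (paths T5) \<Longrightarrow> y \<in> fsp (paths T5) \<Longrightarrow> q.cls x \<oplus>\<^bsub>A5\<^esub> q.cls y = q.cls (x + y)"
  "x \<in> fsp (paths T5) \<Longrightarrow> c \<odot>\<^bsub>A5\<^esub> q.cls x = q.cls (fscale c x)"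
  using q.quotient_simps q.coset[OF pone_fsp] by (simp_all add: A5_quotient quotient_def P5_simps)

lemma A5_E:
  assumes "X \<in> carrier A5" obtains x where "x \<in> fsp (paths T5)" "X = q.cls x"
  using assms unfolding A5_carrier by blast

lemma A5_I: "x \<in> fsp (paths T5) \<Longrightarrow> q.cls x \<in> carrier A5"
  unfolding A5_carrier by (rule imageI)

lemma \<kappa>0_pone: "\<kappa>0 pone = (\<Sum>e\<in>el_vs. sg e)"
proof -
  have "inj_on \<beta> (verts T5)" by (rule inj_onI) (rule \<beta>_inj)
  then have "(\<Sum>e\<in>\<beta> ` verts T5. sg e) = (\<Sum>v\<in>verts T5. sg (\<beta> v))" by (simp add: sum.reindex)
  then show ?thesis unfolding \<beta>_verts by (simp add: pone_def lin_ext_sum)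
qed

lemma A5_homog: "homog A5 d = {x \<in> carrier A5. \<kappa> x \<in> fsp {b. el_deg b = d}}"
proof (intro equalityI subsetI)
  fix X assume "X \<in> homog A5 d"
  then obtain x where x: "x \<in> fsp {(u, p). (u, p) \<in> paths T5 \<and> int (length p) = d}" "X = ker +>\<^bsub>P5\<^esub> x"
    unfolding A5_quotient homog_P5 by (rule imageE)
  have xP: "x \<in> fsp (paths T5)" by (rule fsp_mono[OF x(1)]) auto
  have "\<kappa>0 x \<in> fsp {b. el_deg b = d}"
  proof (rule fsp_lin_ext[OF x(1)], clarify)
    fix u p assume "(u, p) \<in> paths T5"
    from fsp_mono[OF K_span[OF this], of "{b. el_deg b = int (length p)}"]
    show "K u p \<in> fsp {b. el_deg b = int (length p)}" by (auto simp: span_el_def)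
  qed
  then show "X \<in> {x \<in> carrier A5. \<kappa> x \<in> fsp {b. el_deg b = d}}"
    using q.coset[OF xP] x(2) A5_I[OF xP] \<kappa>_cls[OF xP] by simp
next
  fix X assume "X \<in> {x \<in> carrier A5. \<kappa> x \<in> fsp {b. el_deg b = d}}"
  then obtain x where x: "x \<in> fsp (paths T5)" "X = q.cls x" "\<kappa>0 x \<in> fsp {b. el_deg b = d}"
    using \<kappa>_cls by (auto elim: A5_E)
  let ?y = "lin_ext nf (\<kappa>0 x)"
  have "?y \<in> fsp {(u, p). (u, p) \<in> paths T5 \<and> int (length p) = d}"
    using nf_paths by (intro fsp_lin_ext[OF x(3)]) auto
  moreover have "X = ker +>\<^bsub>P5\<^esub> ?y"
  proof -
    have "x - ?y \<in> ker" using x(1) nf_fsp by (simp add: ker_def fsp_diff lin_ext_diff \<kappa>0_nf_ext)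
    then show ?thesis using q.coset[OF nf_fsp, of "\<kappa>0 x"] q.cls_eqI x(2) by simp
  qed
  ultimately show "X \<in> homog A5 d" unfolding A5_quotient homog_P5 by (intro image_eqI)
qed

theorem coords_A5: "algebra_coords el_mul el_src el_tgt el_vs el_deg A5 \<kappa>"
proof (intro algebra_coords.intro el.mult_basis_axioms algebra_coords_axioms.intro)
  show "bij_betw \<kappa> (carrier A5) UNIV"
  proof (rule bij_betw_imageI)
    show "inj_on \<kappa> (carrier A5)"
    proof (rule inj_onI)
      fix X Y assume "X \<in> carrier A5" "Y \<in> carrier A5" and eq: "\<kappa> X = \<kappa> Y"
      then obtain x y where xy: "x \<in> fsp (paths T5)" "X = q.cls x" "y \<in> fsp (paths T5)" "Y = q.cls y"
        by (auto elim!: A5_E)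
      then have "\<kappa>0 x = \<kappa>0 y" using eq by (simp add: \<kappa>_cls)
      then have "x - y \<in> ker" using xy(1,3) by (simp add: ker_def fsp_diff lin_ext_diff)
      then show "X = Y" using xy q.cls_eqI by simp
    qed
    show "\<kappa> ` carrier A5 = UNIV"
      using \<kappa>_cls[OF nf_fsp] A5_I[OF nf_fsp] by (auto simp: \<kappa>0_nf_ext intro: image_eqI[OF sym])
  qed
  show "\<one>\<^bsub>A5\<^esub> \<in> carrier A5" "\<kappa> \<one>\<^bsub>A5\<^esub> = (\<Sum>e\<in>el_vs. sg e)"
    by (simp_all add: A5_ops A5_I pone_fsp \<kappa>_cls \<kappa>0_pone)
  show "homog A5 d = {x \<in> carrier A5. \<kappa> x \<in> fsp {b. el_deg b = d}}" for d by (rule A5_homog)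
qed (auto elim!: A5_E simp: A5_ops A5_mult A5_I fsp_add fsp_scale pmul_fsp \<kappa>_cls lin_ext_linear \<kappa>0_pmul)

lemma zero_A5: "zero A5 \<in> carrier A5" "\<kappa> (zero A5) = 0"
  by (simp_all add: A5_ops A5_I \<kappa>_cls)

end

text \<open>Here q^5 = -1 and q is not real. If the second number were 0, then q^4 = 1 and q = -1.
  If the third were 1, then (q^2 - 1)(q^4 + 1) = 0, so q^4 = -1 and q = 1.\<close>

lemma qnum_5: "qnum 5 2 \<noteq> 0" "qnum 5 3 \<noteq> 1"
proof -
  define q where "q = exp (\<i> * of_real pi / 5)"
  have "q ^ 5 = exp (of_nat 5 * (\<i> * of_real pi / 5))" unfolding q_def by (rule exp_of_nat_mult[symmetric])
  then have q5: "q ^ 5 = -1" by (simp add: exp_pi_i')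
  have "Im q = sin (pi / 5)" by (simp add: q_def Im_exp)
  moreover have "sin (pi / 5) > 0" by (rule sin_gt_zero) (simp_all add: pi_gt_zero)
  ultimately have nr: "q \<noteq> 1" "q \<noteq> -1" by auto
  have q0: "q \<noteq> 0" by (simp add: q_def)
  have q5': "q * q ^ 4 = -1" using q5 by (simp add: power_Suc[symmetric] del: power_Suc)
  have q4: "q ^ 4 \<noteq> 1" using q5' nr by auto
  have q4': "q ^ 4 \<noteq> -1" using q5' nr by auto
  have den: "q - inverse q \<noteq> 0"
  proof
    assume "q - inverse q = 0"
    then have "q * q = 1" using q0 by (simp add: field_simps)
    then have "q ^ 4 = 1" by (simp add: power4_eq_xxxx mult.assoc)
    then show False using q4 by simp
  qed
  have "q ^ 2 - inverse q ^ 2 \<noteq> 0"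
  proof
    assume "q ^ 2 - inverse q ^ 2 = 0"
    then have "q ^ 4 = 1" using q0 by (simp add: field_simps power2_eq_square power4_eq_xxxx)
    then show False using q4 by simp
  qed
  then show "qnum 5 2 \<noteq> 0" using den by (simp add: qnum_def Let_def q_def[symmetric])
  show "qnum 5 3 \<noteq> 1"
  proof
    assume "qnum 5 3 = 1"
    then have "q ^ 3 - inverse q ^ 3 = q - inverse q" using den by (simp add: qnum_def Let_def q_def[symmetric])
    then have "q ^ 3 * (q ^ 3 - inverse q ^ 3) = q ^ 3 * (q - inverse q)" by simp
    moreover have "q ^ 3 * inverse q ^ 3 = 1"
      by (simp only: power_mult_distrib[symmetric] right_inverse[OF q0] power_one)
    moreover have "q ^ 3 * inverse q = q ^ 2" using q0 by (simp add: power3_eq_cube power2_eq_square)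
    ultimately have "q ^ 3 * q ^ 3 - 1 = q ^ 3 * q - q ^ 2" by (simp only: right_diff_distrib)
    moreover have "(q * q - 1) * (q ^ 4 + 1) = (q ^ 3 * q ^ 3 - 1) - (q ^ 3 * q - q ^ 2)"
      by (simp add: algebra_simps eval_nat_numeral)
    ultimately have "(q * q - 1) * (q ^ 4 + 1) = 0" by simp
    moreover have "q * q - 1 \<noteq> 0" using den q0 by (simp add: field_simps)
    ultimately show False using q4' by (simp add: add_eq_0_iff2)
  qed
qed

text \<open>Condition (I) at \<open>aU i\<close> and \<open>aD i\<close> gives |s i|^2 in two ways,
  so \<phi> is constant on the midpoints; at \<open>aC i\<close> it gives |w|^2 + |s i|^2. If w were
  0, \<phi> would agree at a corner and a midpoint, and the eigenvector equation at the corner would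
  force the eigenvalue 1.\<close>

theorem triangle_cells_if_cell_system:
  assumes pf: "perron_frobenius T5 5 \<phi>" and cs: "cell_system T5 5 \<phi> W"
  shows "triangle_cells W (\<lambda>i. W (aD i) (aC i) (aU i)) (W (aC I0) (aC I1) (aC I2))"
proof -
  define s where "s i = W (aD i) (aC i) (aU i)" for i
  define w where "w = W (aC I0) (aC I1) (aC I2)"
  have cyc: "W (x, y) (y, z) (z, x) = W (y, z) (z, x) (x, y)"
    if "(x, y) \<in> arcs T5" "(y, z) \<in> arcs T5" "(z, x) \<in> arcs T5" for x y z
  proof -
    have "x \<in> verts T5" "y \<in> verts T5" "z \<in> verts T5" using that arc_verts by fastforce+
    moreover have "\<forall>i \<in> verts T5. \<forall>j \<in> verts T5. \<forall>k \<in> verts T5.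
        \<forall>a \<in> edges T5 i j. \<forall>b \<in> edges T5 j k. \<forall>c \<in> edges T5 k i. W a b c = W b c a"
      using cs unfolding cell_system_def by (elim conjE)
    moreover have "(x, y) \<in> edges T5 x y" "(y, z) \<in> edges T5 y z" "(z, x) \<in> edges T5 z x"
      using that by (simp_all add: edges_T5)
    ultimately show ?thesis by blast
  qed
  have norm: "(\<Sum>k\<in>verts T5. \<Sum>b1\<in>edges T5 y k. \<Sum>b2\<in>edges T5 k x. W (x, y) b1 b2 * cnj (W (x, y) b1 b2))
      = qnum 5 2 * of_real (\<phi> x) * of_real (\<phi> y)" if a: "(x, y) \<in> arcs T5" for x y
  proof -
    have xy: "x \<in> verts T5" "y \<in> verts T5" "(x, y) \<in> edges T5 x y" using arc_verts[OF a] a by (auto simp: edges_T5)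
    have "\<forall>i \<in> verts T5. \<forall>j \<in> verts T5. \<forall>a \<in> edges T5 i j. \<forall>a' \<in> edges T5 i j.
        (\<Sum>k \<in> verts T5. \<Sum>b1 \<in> edges T5 j k. \<Sum>b2 \<in> edges T5 k i. W a b1 b2 * cnj (W a' b1 b2))
          = of_bool (a = a') * qnum 5 2 * of_real (\<phi> i) * of_real (\<phi> j)"
      using cs unfolding cell_system_def by (elim conjE)
    from this[rule_format, OF xy xy(3)] show ?thesis by simp
  qed
  have pos: "\<phi> v > 0" if "v \<in> verts T5" for v using pf that by (auto simp: perron_frobenius_def)
  have W: "W (aU i) (aD i) (aC i) = s i" "W (aC i) (aU i) (aD i) = s i" for i
    using cyc[of "px i" "pm i" "pm (nx i)"] cyc[of "pm i" "pm (nx i)" "px i"] by (simp_all add: s_def)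
  have W3: "W (aC i) (aC (nx i)) (aC (pv i)) = w" for i
    using cyc[of "pm I0" "pm I1" "pm I2"] cyc[of "pm I1" "pm I2" "pm I0"] arcs_T5_I(2)[of I0] arcs_T5_I(2)[of I1] arcs_T5_I(2)[of I2]
    by (cases i) (simp_all add: w_def del: pm.simps px.simps)
  have nU: "s i * cnj (s i) = qnum 5 2 * of_real (\<phi> (pm (nx i))) * of_real (\<phi> (px i))" for i
    using norm[OF arcs_T5_I(3)[of i]] unfolding sum_paths2 W .
  have nD: "s i * cnj (s i) = qnum 5 2 * of_real (\<phi> (px i)) * of_real (\<phi> (pm i))" for i
    using norm[OF arcs_T5_I(1)[of i]] unfolding sum_paths2 s_def[symmetric] .
  have nC: "w * cnj w + s i * cnj (s i) = qnum 5 2 * of_real (\<phi> (pm i)) * of_real (\<phi> (pm (nx i)))" for i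
    using norm[OF arcs_T5_I(2)[of i]] unfolding sum_paths2 W W3 .
  have \<phi>nz: "complex_of_real (\<phi> (px i)) \<noteq> 0" "complex_of_real (\<phi> (pm i)) \<noteq> 0" for i
    using pos[of "px i"] pos[of "pm i"] by auto
  have s: "s i \<noteq> 0" for i using nD[of i] \<phi>nz[of i] qnum_5 by auto
  have m: "complex_of_real (\<phi> (pm (nx i))) = of_real (\<phi> (pm i))" for i
    using nU[of i] nD[of i] \<phi>nz[of i] qnum_5 by simp
  have w: "w \<noteq> 0"
  proof
    assume "w = 0"
    then have "complex_of_real (\<phi> (pm I0)) = of_real (\<phi> (px I0))"
      using nC[of I0] nD[of I0] m[of I0] \<phi>nz(2)[of I0] qnum_5 by simp
    moreover have "(\<Sum>j\<in>verts T5. of_nat (card (edges T5 (px I0) j)) * complex_of_real (\<phi> j))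
        = qnum 5 3 * complex_of_real (\<phi> (px I0))"
      using pf verts_T5_I(1)[of I0] unfolding perron_frobenius_def by blast
    then have "complex_of_real (\<phi> (pm I0)) = qnum 5 3 * of_real (\<phi> (px I0))"
      by (simp add: verts_T5 edges_T5 arcs_T5)
    ultimately show False using qnum_5 \<phi>nz(1)[of I0] by simp
  qed
  show ?thesis unfolding s_def[symmetric] w_def[symmetric]
  proof
    show "cell_relation T5 W (aD i) = Poly_Mapping.single (pm i, [aC i, aU i]) (s i)" for i
      by (simp add: cell_relation_def sum_paths2 s_def)
    show "cell_relation T5 W (aU i) = Poly_Mapping.single (px i, [aD i, aC i]) (s i)" for i
      using sum_paths2(1)[where i = i and F = "\<lambda>b b'. Poly_Mapping.single (px i, [b, b']) (W (aU i) b b')"]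
      by (simp add: cell_relation_def W)
    show "cell_relation T5 W (aC i) = Poly_Mapping.single (pm (nx i), [aC (nx i), aC (pv i)]) w
      + Poly_Mapping.single (pm (nx i), [aU i, aD i]) (s i)" for i
      using sum_paths2(3)[where i = i and F = "\<lambda>b b'. Poly_Mapping.single (pm (nx i), [b, b']) (W (aC i) b b')"]
      by (simp add: cell_relation_def W W3[of i, simplified])
  qed (rule s w)+
qed


section \<open>Dimensions\<close>

lemma cspace_simps:
  "carrier (cspace k) = ({..<k} \<rightarrow>\<^sub>E UNIV)" "f \<oplus>\<^bsub>cspace k\<^esub> g = (\<lambda>i\<in>{..<k}. f i + g i)"
  "c \<odot>\<^bsub>cspace k\<^esub> f = (\<lambda>i\<in>{..<k}. c * f i)"
  by (simp_all add: cspace_def)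

lemma linear_isoE:
  assumes "linear_iso V V'"
  obtains f where "bij_betw f (carrier V) (carrier V')"
    "\<And>x y. x \<in> carrier V \<Longrightarrow> y \<in> carrier V \<Longrightarrow> f (x \<oplus>\<^bsub>V\<^esub> y) = f x \<oplus>\<^bsub>V'\<^esub> f y"
    "\<And>c x. x \<in> carrier V \<Longrightarrow> f (c \<odot>\<^bsub>V\<^esub> x) = c \<odot>\<^bsub>V'\<^esub> f x"
proof -
  show thesis using assms unfolding linear_iso_def
  proof (elim exE conjE)
    fix f assume 1: "bij_betw f (carrier V) (carrier V')"
      and 2: "\<forall>x\<in>carrier V. \<forall>y\<in>carrier V. f (x \<oplus>\<^bsub>V\<^esub> y) = f x \<oplus>\<^bsub>V'\<^esub> f y"
      and 3: "\<forall>c. \<forall>x\<in>carrier V. f (c \<odot>\<^bsub>V\<^esub> x) = c \<odot>\<^bsub>V'\<^esub> f x"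
    show thesis by (rule that[OF 1 2[rule_format] 3[rule_format]])
  qed
qed

lemma lin_dimD: "lin_dim V k \<Longrightarrow> linear_iso V (cspace k)"
  by (simp add: lin_dim_def)

lemma linear_iso_if_lin_dim:
  fixes V :: "(complex, 'v, 'm) module_scheme" and V' :: "(complex, 'w, 'n) module_scheme"
  assumes V: "lin_dim V k" and V': "lin_dim V' k"
  shows "linear_iso V V'"
proof -
  obtain f where f: "bij_betw f (carrier V) (carrier (cspace k))"
    "\<And>x y. x \<in> carrier V \<Longrightarrow> y \<in> carrier V \<Longrightarrow> f (x \<oplus>\<^bsub>V\<^esub> y) = f x \<oplus>\<^bsub>cspace k\<^esub> f y"
    "\<And>c x. x \<in> carrier V \<Longrightarrow> f (c \<odot>\<^bsub>V\<^esub> x) = c \<odot>\<^bsub>cspace k\<^esub> f x"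
    using lin_dimD[OF V] by (rule linear_isoE) (rule that)
  obtain g where g: "bij_betw g (carrier V') (carrier (cspace k))"
    "\<And>x y. x \<in> carrier V' \<Longrightarrow> y \<in> carrier V' \<Longrightarrow> g (x \<oplus>\<^bsub>V'\<^esub> y) = g x \<oplus>\<^bsub>cspace k\<^esub> g y"
    "\<And>c x. x \<in> carrier V' \<Longrightarrow> g (c \<odot>\<^bsub>V'\<^esub> x) = c \<odot>\<^bsub>cspace k\<^esub> g x"
    using lin_dimD[OF V'] by (rule linear_isoE) (rule that)
  have closed: "x \<oplus>\<^bsub>V'\<^esub> y \<in> carrier V'" "c \<odot>\<^bsub>V'\<^esub> x \<in> carrier V'" if "x \<in> carrier V'" "y \<in> carrier V'" for x y c
    using V' that unfolding lin_dim_def by blast+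
  define h where "h = the_inv_into (carrier V') g"
  have hb: "bij_betw h (carrier (cspace k)) (carrier V')"
    unfolding h_def by (rule bij_betw_the_inv_into[OF g(1)])
  have gh: "g (h a) = a" "h a \<in> carrier V'" if "a \<in> carrier (cspace k)" for a
    using that g(1) hb by (auto simp: h_def f_the_inv_into_f bij_betw_def)
  have hg: "h (g y) = y" if "y \<in> carrier V'" for y
    using that g(1) by (auto simp: h_def bij_betw_def the_inv_into_f_f)
  have fc: "f x \<in> carrier (cspace k)" if "x \<in> carrier V" for x using that f(1) by (auto simp: bij_betw_def)
  have 1: "h (f (x \<oplus>\<^bsub>V\<^esub> y)) = h (f x) \<oplus>\<^bsub>V'\<^esub> h (f y)" if "x \<in> carrier V" "y \<in> carrier V" for x y
    using hg[OF closed(1)[OF gh(2)[OF fc] gh(2)[OF fc]], of x y] that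
    by (simp add: f(2) g(2) gh fc)
  have 2: "h (f (c \<odot>\<^bsub>V\<^esub> x)) = c \<odot>\<^bsub>V'\<^esub> h (f x)" if "x \<in> carrier V" for c x
    using hg[OF closed(2)[OF gh(2)[OF fc] gh(2)[OF fc]], of x x c] that
    by (simp add: f(3) g(3) gh fc)
  have "bij_betw (\<lambda>x. h (f x)) (carrier V) (carrier V')"
    using bij_betw_trans[OF f(1) hb] by (simp add: comp_def)
  then show ?thesis unfolding linear_iso_def by (intro exI[of _ "\<lambda>x. h (f x)"] conjI ballI allI 1 2)
qed

lemma lin_dim_param:
  fixes V :: "(complex, 'v, 'm) module_scheme"
  assumes g: "bij_betw g ({..<k} \<rightarrow>\<^sub>E UNIV) (carrier V)"
    and add: "\<And>a b. a \<in> {..<k} \<rightarrow>\<^sub>E UNIV \<Longrightarrow> b \<in> {..<k} \<rightarrow>\<^sub>E UNIV \<Longrightarrow> g a \<oplus>\<^bsub>V\<^esub> g b = g (\<lambda>i\<in>{..<k}. a i + b i)"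
    and smult: "\<And>c a. a \<in> {..<k} \<rightarrow>\<^sub>E UNIV \<Longrightarrow> c \<odot>\<^bsub>V\<^esub> g a = g (\<lambda>i\<in>{..<k}. c * a i)"
  shows "lin_dim V k"
proof -
  let ?C = "{..<k} \<rightarrow>\<^sub>E (UNIV :: complex set)"
  define f where "f = the_inv_into ?C g"
  have f: "bij_betw f (carrier V) ?C" unfolding f_def by (rule bij_betw_the_inv_into[OF g])
  have fg: "f (g a) = a" if "a \<in> ?C" for a using that g by (auto simp: f_def bij_betw_def the_inv_into_f_f)
  have car: "carrier V = g ` ?C" using g by (simp add: bij_betw_def)
  have C: "(\<lambda>i\<in>{..<k}. a i + b i) \<in> ?C" "(\<lambda>i\<in>{..<k}. c * a i) \<in> ?C" for a b :: "nat \<Rightarrow> complex" and c by auto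
  have 1: "g a \<oplus>\<^bsub>V\<^esub> g b \<in> carrier V \<and> f (g a \<oplus>\<^bsub>V\<^esub> g b) = f (g a) \<oplus>\<^bsub>cspace k\<^esub> f (g b)" if "a \<in> ?C" "b \<in> ?C" for a b
    using that fg[OF C(1)] C(1) by (simp add: add car fg cspace_simps)
  have 2: "c \<odot>\<^bsub>V\<^esub> g a \<in> carrier V \<and> f (c \<odot>\<^bsub>V\<^esub> g a) = c \<odot>\<^bsub>cspace k\<^esub> f (g a)" if "a \<in> ?C" for a c
    using that fg[OF C(2)] C(2) by (simp add: smult car fg cspace_simps)
  show ?thesis unfolding lin_dim_def linear_iso_def
  proof (intro conjI exI[of _ f] ballI allI)
    show "bij_betw f (carrier V) (carrier (cspace k))" using f by (simp add: cspace_simps)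
    show "f (x \<oplus>\<^bsub>V\<^esub> y) = f x \<oplus>\<^bsub>cspace k\<^esub> f y" "x \<oplus>\<^bsub>V\<^esub> y \<in> carrier V" if xy: "x \<in> carrier V" "y \<in> carrier V" for x y
    proof -
      obtain a b where "a \<in> ?C" "b \<in> ?C" "x = g a" "y = g b" using xy unfolding car by auto
      then show "f (x \<oplus>\<^bsub>V\<^esub> y) = f x \<oplus>\<^bsub>cspace k\<^esub> f y" "x \<oplus>\<^bsub>V\<^esub> y \<in> carrier V" using 1 by simp_all
    qed
    show "f (c \<odot>\<^bsub>V\<^esub> x) = c \<odot>\<^bsub>cspace k\<^esub> f x" "c \<odot>\<^bsub>V\<^esub> x \<in> carrier V" if x: "x \<in> carrier V" for c x
    proof -
      obtain a where "a \<in> ?C" "x = g a" using x unfolding car by auto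
      then show "f (c \<odot>\<^bsub>V\<^esub> x) = c \<odot>\<^bsub>cspace k\<^esub> f x" "c \<odot>\<^bsub>V\<^esub> x \<in> carrier V" using 2 by simp_all
    qed
  qed
qed

lemma ex1_eq: "\<exists>!x. P x \<Longrightarrow> P a \<Longrightarrow> P b \<Longrightarrow> a = b"
  by blast

lemma lin_dim_if_has_dim:
  fixes V :: "(complex, 'v, 'm) module_scheme"
  assumes "Module.module complex_ring V" and "has_dim V n"
  shows "lin_dim V n"
proof -
  interpret V: Module.module complex_ring V by (rule assms(1))
  let ?C = "{..<n} \<rightarrow>\<^sub>E (UNIV :: complex set)"
  obtain b where b': "b ` {..<n} \<subseteq> carrier V \<and>
    (\<forall>x\<in>carrier V. \<exists>!c. c \<in> ?C \<and> x = (\<Oplus>\<^bsub>V\<^esub>i\<in>{..<n}. c i \<odot>\<^bsub>V\<^esub> b i))"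
    using assms(2) unfolding has_dim_def by (rule exE)
  note b = conjunct1[OF b'] conjunct2[OF b', rule_format]
  have cr: "carrier complex_ring = UNIV" "a \<oplus>\<^bsub>complex_ring\<^esub> c = a + c" "a \<otimes>\<^bsub>complex_ring\<^esub> c = a * c" for a c
    by (simp_all add: complex_ring_def)
  have bi: "b i \<in> carrier V" if "i < n" for i using b(1) that by auto
  have t: "(\<lambda>i. c i \<odot>\<^bsub>V\<^esub> b i) \<in> {..<n} \<rightarrow> carrier V" for c using bi by (auto simp: cr)
  define g where "g c = (\<Oplus>\<^bsub>V\<^esub>i\<in>{..<n}. c i \<odot>\<^bsub>V\<^esub> b i)" for c
  have gc: "g c \<in> carrier V" for c unfolding g_def using t by (rule V.M.finsum_closed)
  show ?thesis
  proof (rule lin_dim_param[of g])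
    have "inj_on g ?C"
    proof (rule inj_onI)
      fix c d assume "c \<in> ?C" "d \<in> ?C" "g c = g d"
      then show "c = d" using ex1_eq[OF b(2)[OF gc[of c], folded g_def], of c d] by simp
    qed
    moreover have "g ` ?C = carrier V"
    proof (intro equalityI subsetI)
      fix x assume "x \<in> carrier V"
      from ex1_implies_ex[OF b(2)[OF this, folded g_def]] obtain c where "c \<in> ?C \<and> x = g c" by (rule exE)
      then show "x \<in> g ` ?C" by (intro image_eqI[of x g c]) simp_all
    qed (use gc in auto)
    ultimately show "bij_betw g ?C (carrier V)" by (simp add: bij_betw_def)
    show "g c \<oplus>\<^bsub>V\<^esub> g d = g (\<lambda>i\<in>{..<n}. c i + d i)" for c d
      unfolding g_def V.M.finsum_addf[OF t t, symmetric]
      by (rule V.M.finsum_cong') (use bi V.smult_l_distr in \<open>auto simp: cr\<close>)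
    show "a \<odot>\<^bsub>V\<^esub> g c = g (\<lambda>i\<in>{..<n}. a * c i)" for a c
    proof -
      have "a \<odot>\<^bsub>V\<^esub> g c = (\<Oplus>\<^bsub>V\<^esub>i\<in>{..<n}. a \<odot>\<^bsub>V\<^esub> (c i \<odot>\<^bsub>V\<^esub> b i))"
        unfolding g_def by (rule V.finsum_smult_ldistr) (use t in \<open>simp_all add: cr\<close>)
      also have "\<dots> = g (\<lambda>i\<in>{..<n}. a * c i)" unfolding g_def
        by (rule V.M.finsum_cong') (use bi V.smult_assoc1 in \<open>auto simp: cr\<close>)
      finally show ?thesis .
    qed
  qed
qed

text \<open>The graded spaces to be dualised have components of dimension at most 1, so a functional
  is determined by its value on one vector \<open>e\<close>.\<close>

lemma lin_dim_dual_space: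
  fixes V :: "(complex, 'v, 'm) module_scheme"
  assumes V: "lin_dim V n" and n: "n \<le> 1"
  shows "lin_dim (dual_space V) n"
proof -
  let ?C = "{..<n} \<rightarrow>\<^sub>E (UNIV :: complex set)"
  obtain f where f: "bij_betw f (carrier V) ?C"
    "\<And>x y. x \<in> carrier V \<Longrightarrow> y \<in> carrier V \<Longrightarrow> f (x \<oplus>\<^bsub>V\<^esub> y) = (\<lambda>i\<in>{..<n}. f x i + f y i)"
    "\<And>c x. x \<in> carrier V \<Longrightarrow> f (c \<odot>\<^bsub>V\<^esub> x) = (\<lambda>i\<in>{..<n}. c * f x i)"
    using lin_dimD[OF V] by (rule linear_isoE) (simp add: cspace_simps that)
  have closed: "x \<oplus>\<^bsub>V\<^esub> y \<in> carrier V" "c \<odot>\<^bsub>V\<^esub> x \<in> carrier V" if "x \<in> carrier V" "y \<in> carrier V" for x y c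
    using V that unfolding lin_dim_def by blast+
  have finj: "x = y" if "x \<in> carrier V" "y \<in> carrier V" "f x = f y" for x y
    using f(1) that by (auto simp: bij_betw_def inj_on_def)
  have fC: "f x \<in> ?C" if "x \<in> carrier V" for x using f(1) that by (auto simp: bij_betw_def)
  have "(\<lambda>i\<in>{..<n}. 1) \<in> f ` carrier V" using f(1) by (auto simp: bij_betw_def)
  then obtain e where e: "e \<in> carrier V" "f e = (\<lambda>i\<in>{..<n}. 1)" by (metis imageE)
  \<comment> \<open>The only coordinate, read as 0 when n = 0, so that both dimensions are treated
    by the same formulas.\<close>
  define t where "t a = (if n = 0 then 0 else a 0)" for a :: "nat \<Rightarrow> complex"
  have C: "a = (\<lambda>i\<in>{..<n}. t a)" if "a \<in> ?C" for a
  proof (rule ext)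
    show "a i = (\<lambda>i\<in>{..<n}. t a) i" for i
      using that n by (cases "i = 0") (auto simp: t_def PiE_def extensional_def)
  qed
  have tC: "t (\<lambda>i\<in>{..<n}. h i) = t h" for h using n by (auto simp: t_def)
  have xe: "x = t (f x) \<odot>\<^bsub>V\<^esub> e" if "x \<in> carrier V" for x
  proof (intro finj that closed(2)[OF e(1) e(1)])
    have "f (t (f x) \<odot>\<^bsub>V\<^esub> e) = (\<lambda>i\<in>{..<n}. t (f x))"
      unfolding f(3)[OF e(1)] e(2) by (rule restrict_ext) simp
    then show "f x = f (t (f x) \<odot>\<^bsub>V\<^esub> e)" by (rule trans[OF C[OF fC[OF that]] sym])
  qed
  have te: "t (f e) = (if n = 0 then 0 else 1)" unfolding e(2) tC by (simp add: t_def)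
  define g where "g a = (\<lambda>x\<in>carrier V. t a * t (f x))" for a
  have t1: "t (\<lambda>i. u i + v i) = t u + t v" "t (\<lambda>i. c * u i) = c * t u" for u v :: "nat \<Rightarrow> complex" and c
    by (simp_all add: t_def)
  have tadd: "t (f (x \<oplus>\<^bsub>V\<^esub> y)) = t (f x) + t (f y)" if "x \<in> carrier V" "y \<in> carrier V" for x y
    unfolding f(2)[OF that] tC t1 ..
  have tsmult: "t (f (c \<odot>\<^bsub>V\<^esub> x)) = c * t (f x)" if "x \<in> carrier V" for x c
    unfolding f(3)[OF that] tC t1 ..
  show ?thesis
  proof (rule lin_dim_param[of g])
    have "inj_on g ?C"
    proof (rule inj_onI)
      fix a b assume ab: "a \<in> ?C" "b \<in> ?C" "g a = g b"
      from fun_cong[OF ab(3), of e] have "t a = t b" using e(1) te by (auto simp: g_def t_def split: if_splits)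
      then have "(\<lambda>i\<in>{..<n}. t a) = (\<lambda>i\<in>{..<n}. t b)" by simp
      then show "a = b" unfolding C[OF ab(1), symmetric] C[OF ab(2), symmetric] .
    qed
    moreover have "g ` ?C = carrier (dual_space V)"
    proof (intro equalityI subsetI)
      fix F assume "F \<in> carrier (dual_space V)"
      then have F: "F \<in> extensional (carrier V)" "\<And>c x. x \<in> carrier V \<Longrightarrow> F (c \<odot>\<^bsub>V\<^esub> x) = c * F x"
        by (auto simp: dual_space_def)
      let ?a = "\<lambda>i\<in>{..<n}. F e"
      have "F x = t (f x) * F e" if "x \<in> carrier V" for x using F(2)[OF e(1), of "t (f x)"] xe[OF that] by simp
      moreover have "t ?a * t (f x) = t (f x) * F e" for x unfolding tC by (simp add: t_def)
      ultimately have "F = g ?a" using F(1) by (auto simp: g_def fun_eq_iff extensional_def)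
      then show "F \<in> g ` ?C" by (rule image_eqI[of F g ?a]) auto
    next
      fix F assume "F \<in> g ` ?C"
      then obtain a where a: "F = g a" by (rule imageE)
      show "F \<in> carrier (dual_space V)"
        unfolding a by (simp add: dual_space_def g_def tadd tsmult closed(1) closed(2)[OF _ e(1)] distrib_left)
    qed
    ultimately show "bij_betw g ?C (carrier (dual_space V))" by (simp add: bij_betw_def)
    show "g a \<oplus>\<^bsub>dual_space V\<^esub> g b = g (\<lambda>i\<in>{..<n}. a i + b i)" for a b
      unfolding g_def tC t1 by (rule ext) (simp add: dual_space_def restrict_def distrib_right)
    show "c \<odot>\<^bsub>dual_space V\<^esub> g a = g (\<lambda>i\<in>{..<n}. c * a i)" for a c
      unfolding g_def tC t1 by (rule ext) (simp add: dual_space_def restrict_def)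
  qed
qed

section \<open>The tables of dimensions and their periodicity\<close>

lemma pos_small: "k \<le> 12 \<Longrightarrow> pos k = k"
  by (induction k) auto

lemma pos_12: "1 \<le> n \<Longrightarrow> pos (12 + n) = pos n"
proof (induction n rule: nat_induct_at_least)
  case base
  have "pos (Suc 12) = 1" by (simp only: pos.simps pos_small) simp
  then show ?case by (simp add: pos_small)
next
  case (Suc n)
  have "pos (Suc (12 + n)) = pos (Suc n)" by (simp only: pos.simps Suc.IH)
  then show ?case by (simp only: add_Suc_right)
qed

lemma gdeg_small: "gdeg 1 = 1" "gdeg 2 = 2" "gdeg 3 = 3" "gdeg 4 = 5" "gdeg 5 = 6" "gdeg 6 = 7" "gdeg 7 = 8"
  "gdeg 8 = 10" "gdeg 9 = 11" "gdeg 10 = 12" "gdeg 11 = 13" "gdeg 12 = 15"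
  using gdeg.simps(2)[of 0] gdeg.simps(2)[of 1] gdeg.simps(2)[of 2] gdeg.simps(2)[of 3] gdeg.simps(2)[of 4]
    gdeg.simps(2)[of 5] gdeg.simps(2)[of 6] gdeg.simps(2)[of 7] gdeg.simps(2)[of 8] gdeg.simps(2)[of 9]
    gdeg.simps(2)[of 10] gdeg.simps(2)[of 11]
  by (simp_all add: stage_def pos_small numeral_2_eq_2[symmetric] del: gdeg.simps(2) pos.simps(2))

lemma gdeg_12: "gdeg (12 + n) = gdeg n + 15"
proof (induction n)
  case (Suc n)
  have "stage (Suc (12 + n)) = stage (Suc n)" using pos_12[of "Suc n"] by (simp add: stage_def)
  then have "gdeg (Suc (12 + n)) = gdeg (Suc n) + 15" unfolding gdeg.simps(2) Suc.IH by simp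
  then show ?case by (simp only: add_Suc_right)
qed (simp add: gdeg_small)

definition hdim :: "nat \<Rightarrow> int \<Rightarrow> nat" where
  "hdim n j = card (HB n j)"

lemma hdim_pos: "1 \<le> n \<Longrightarrow> hdim n j = (if pos n \<in> {2..9} \<and> j = gdeg n + hz (pos n) then 1 else 0)"
  by (simp add: hdim_def HB_def)

lemma hdim_12: "1 \<le> n \<Longrightarrow> hdim (12 + n) j = hdim n (j - 15)"
  by (simp only: hdim_pos pos_12 gdeg_12) auto

text \<open>The entries 13 and 14 serve the cyclic homology of index up to 12, which looks two
  degrees ahead.\<close>

lemma hdim_table: "hdim 0 j = (if j = 0 then 6 else 0)" "hdim 1 j = 0"
  "hdim 2 j = (if j = 3 then 1 else 0)" "hdim 3 j = (if j = 3 then 1 else 0)"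
  "hdim 4 j = (if j = 6 then 1 else 0)" "hdim 5 j = (if j = 6 then 1 else 0)"
  "hdim 6 j = (if j = 9 then 1 else 0)" "hdim 7 j = (if j = 9 then 1 else 0)"
  "hdim 8 j = (if j = 12 then 1 else 0)" "hdim 9 j = (if j = 12 then 1 else 0)"
  "hdim 10 j = 0" "hdim 11 j = 0" "hdim 12 j = 0" "hdim 13 j = 0" "hdim 14 j = (if j = 18 then 1 else 0)"
proof -
  show "hdim 0 j = (if j = 0 then 6 else 0)" by (simp add: hdim_def HB_def card_cartesian_product el_vs_def)
  show 1: "hdim 1 j = 0" and 2: "hdim 2 j = (if j = 3 then 1 else 0)" for j
    using pos_small[of 1] pos_small[of 2] by (simp_all add: hdim_pos gdeg_small hz_def del: pos.simps(2))
  show "hdim 13 j = 0" "hdim 14 j = (if j = 18 then 1 else 0)" using hdim_12[of 1 j] hdim_12[of 2 j] 1 2 by simp_all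
qed (simp_all add: hdim_pos pos_small gdeg_small hz_def)

text \<open>Dimension of the kernel of the Connes map from HH of index n + 1 to HH of index n + 2:
  the whole source if the target is zero, and otherwise 0 by injectivity.\<close>

definition cdim :: "nat \<Rightarrow> int \<Rightarrow> nat" where
  "cdim n j = (if hdim (n + 2) j = 0 then hdim (n + 1) j else 0)"

lemma cdim_12: "1 \<le> n \<Longrightarrow> cdim (12 + n) j = cdim n (j - 15)"
  using hdim_12[of "n + 1" j] hdim_12[of "n + 2" j] by (simp add: cdim_def)

lemma cdim_table: "cdim 1 j = 0" "cdim 2 j = (if j = 3 then 1 else 0)" "cdim 3 j = 0"
  "cdim 4 j = (if j = 6 then 1 else 0)" "cdim 5 j = 0" "cdim 6 j = (if j = 9 then 1 else 0)" "cdim 7 j = 0"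
  "cdim 8 j = (if j = 12 then 1 else 0)" "cdim 9 j = 0" "cdim 10 j = 0" "cdim 11 j = 0" "cdim 12 j = 0"
  by (simp_all add: cdim_def hdim_table numeral_2_eq_2[symmetric] Suc_numeral)

text \<open>In a positive internal degree the classes sit in adjacent homological degrees 2m and 2m
  + 1, never two apart. This supplies the exactness and the condition j \<noteq> 0 required by
  \<open>connes_injective\<close>.\<close>

lemma hdim_gap: "1 \<le> n \<Longrightarrow> hdim (n + 2) j \<noteq> 0 \<Longrightarrow> hdim n j = 0 \<and> 0 < j"
proof (induction n arbitrary: j rule: less_induct)
  case (less n)
  show ?case
  proof (cases "n \<le> 12")
    case True
    then have "n = 1 \<or> n = 2 \<or> n = 3 \<or> n = 4 \<or> n = 5 \<or> n = 6 \<or> n = 7 \<or> n = 8 \<or> n = 9 \<or> n = 10 \<or> n = 11 \<or> n = 12"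
      using less.prems(1) by presburger
    then show ?thesis using less.prems(2) by (elim disjE) (simp_all add: hdim_table hdim_table(2)[simplified] numeral_3_eq_3[symmetric] split: if_splits)
  next
    case False
    then obtain m where m: "n = 12 + m" "1 \<le> m" using less.prems(1) le_Suc_ex[of 12 n] by auto
    then have "hdim (m + 2) (j - 15) \<noteq> 0" using less.prems(2) hdim_12[of "m + 2" j] by simp
    then have "hdim m (j - 15) = 0 \<and> 0 < j - 15" using less.IH[of m "j - 15"] m by simp
    then show ?thesis using hdim_12[OF m(2), of j] m(1) by simp
  qed
qed

lemma quot_dim_0:
  fixes Z :: "('a \<Rightarrow>\<^sub>0 complex) set"
  shows "quot_dim Z N 0 \<Longrightarrow> Z \<subseteq> N"
proof
  fix x assume "quot_dim Z N 0" and x: "x \<in> Z"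
  from this(1) obtain f :: "('a \<Rightarrow>\<^sub>0 complex) \<Rightarrow> nat \<Rightarrow> complex" where f':
    "\<And>x y. x \<in> Z \<Longrightarrow> y \<in> Z \<Longrightarrow> f (x + y) = (\<lambda>i\<in>{..<0}. f x i + f y i)"
    "\<And>c x. x \<in> Z \<Longrightarrow> f (fscale c x) = (\<lambda>i\<in>{..<0}. c * f x i)"
    and f: "f ` Z = ({..<0} \<rightarrow>\<^sub>E UNIV)" "\<And>x. x \<in> Z \<Longrightarrow> f x = (\<lambda>i\<in>{..<0}. 0) \<longleftrightarrow> x \<in> N"
    by (rule quot_dimE) (rule that)
  have "f x \<in> {..<0} \<rightarrow>\<^sub>E (UNIV :: complex set)" using f(1) x by (metis image_eqI)
  then have "f x = (\<lambda>i\<in>{..<0}. 0)" by (auto simp: PiE_def extensional_def fun_eq_iff)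
  then show "x \<in> N" using f(2)[OF x] by simp
qed

locale algebra_coords_el = algebra_coords el_mul el_src el_tgt el_vs el_deg A \<kappa>
  for A :: "(complex, 'a) graded_algebra" and \<kappa>
begin

lemma homology_dim: "quot_dim (cyc n j) (bd n j) (hdim n j)"
  using hochschild_homology_dim[of n j] by (simp add: cyc_def bd_def hdim_def)

lemma exact: "hdim n j = 0 \<Longrightarrow> cyc n j \<subseteq> bd n j"
  using quot_dim_0 homology_dim by metis

lemma HH_dim: "lin_dim (HH A n j) (hdim n j)"
  by (rule HH_iso[OF homology_dim])

lemma HH_dim_0: "hdim n j = 0 \<Longrightarrow> carrier (HH A n j) = {zero (HH A n j)}"
  by (rule HH_zero[OF exact])

lemma HC_cases:
  assumes "1 \<le> n"
  shows "lin_dim (HC A n j) (cdim n j) \<and> (cdim n j = 0 \<longrightarrow> carrier (HC A n j) = {zero (HC A n j)})"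
proof -
  obtain m where m: "n = Suc m" using assms by (cases n) auto
  show ?thesis
  proof (cases "hdim (n + 2) j = 0")
    case True
    then have "HC A n j = HH A (Suc n) j" using HC_eq_HH[OF exact, of m j] by (simp add: HC_def m)
    then show ?thesis using True HH_dim[of "Suc n" j] HH_dim_0[of "Suc n" j] by (simp add: cdim_def)
  next
    case False
    then have n: "cyc n j \<subseteq> bd n j" "j \<noteq> 0" using hdim_gap[OF assms False] exact by auto
    have "zero (HC A n j) = zero (HH A (Suc n) j)" by (simp add: HC_def m reduced_HC_def reduced_HH_Suc)
    then show ?thesis
      using False HC_zero[of m j] HC_dim_0[of m j] n by (simp add: cdim_def HC_def m)
  qed
qed

end

theorem theorem3p9:
  fixes \<phi> :: "int \<times> int \<Rightarrow> real"
    and W :: "(int \<times> int) \<times> (int \<times> int) \<Rightarrow> (int \<times> int) \<times> (int \<times> int)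
                \<Rightarrow> (int \<times> int) \<times> (int \<times> int) \<Rightarrow> complex"
    and A :: "(complex, ((int \<times> int) \<times> ((int \<times> int) \<times> (int \<times> int)) list \<Rightarrow>\<^sub>0 complex) set) graded_algebra"
    and X2 :: "int \<Rightarrow> (complex, 'x) module"
    and X3 :: "int \<Rightarrow> (complex, 'y) module"
  assumes "perron_frobenius (graph_A 5) 5 \<phi>"
    and "cell_system (graph_A 5) 5 \<phi> W"
    and "A = acy_algebra (graph_A 5) W"
    and "graded_space X2" and "has_hilbert_series X2 (fls_X ^ 3)"
    and "graded_space X3" and "has_hilbert_series X3 (fls_X ^ 6)"
  shows "HH A 0 \<cong>\<^sub>g\<^sub>r deg0 A \<and> graded_zero (HH A 1) \<and>
         HH A 2 \<cong>\<^sub>g\<^sub>r X2 \<and> HH A 3 \<cong>\<^sub>g\<^sub>r X2 \<and>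
         HH A 4 \<cong>\<^sub>g\<^sub>r X3 \<and> HH A 5 \<cong>\<^sub>g\<^sub>r X3 \<and>
         HH A 6 \<cong>\<^sub>g\<^sub>r gshift 15 (graded_dual X3) \<and> HH A 7 \<cong>\<^sub>g\<^sub>r gshift 15 (graded_dual X3) \<and>
         HH A 8 \<cong>\<^sub>g\<^sub>r gshift 15 (graded_dual X2) \<and> HH A 9 \<cong>\<^sub>g\<^sub>r gshift 15 (graded_dual X2) \<and>
         graded_zero (HH A 10) \<and> graded_zero (HH A 11) \<and> graded_zero (HH A 12) \<and>
         (\<forall>i\<ge>1. HH A (12 + i) \<cong>\<^sub>g\<^sub>r gshift 15 (HH A i)) \<and>
         HC A 0 \<cong>\<^sub>g\<^sub>r deg0 A \<and> graded_zero (HC A 1) \<and>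
         HC A 2 \<cong>\<^sub>g\<^sub>r X2 \<and> graded_zero (HC A 3) \<and>
         HC A 4 \<cong>\<^sub>g\<^sub>r X3 \<and> graded_zero (HC A 5) \<and>
         HC A 6 \<cong>\<^sub>g\<^sub>r gshift 15 (graded_dual X3) \<and> graded_zero (HC A 7) \<and>
         HC A 8 \<cong>\<^sub>g\<^sub>r gshift 15 (graded_dual X2) \<and> graded_zero (HC A 9) \<and>
         graded_zero (HC A 10) \<and> graded_zero (HC A 11) \<and> graded_zero (HC A 12) \<and>
         (\<forall>i\<ge>1. HC A (12 + i) \<cong>\<^sub>g\<^sub>r gshift 15 (HC A i))"
proof -
  define s where "s i = W (aD i) (aC i) (aU i)" for i
  interpret T: triangle_cells W s "W (aC I0) (aC I1) (aC I2)"
    using triangle_cells_if_cell_system[OF assms(1,2)] unfolding s_def .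
  interpret C: algebra_coords_el A T.\<kappa>
    unfolding algebra_coords_el_def assms(3) by (rule T.coords_A5)
  have dim: "lin_dim (X j) (if j = int d then 1 else 0)"
    if gr: "graded_space X" and hs: "has_hilbert_series X (fls_X ^ d)" for X :: "int \<Rightarrow> (complex, 'z) module" and d j
  proof -
    obtain n where n: "has_dim (X j) n" "fls_nth (fls_X ^ d :: int fls) j = int n"
      using hs unfolding has_hilbert_series_def by blast
    have "int n = (if j = int d then 1 else 0)" using n(2) by (simp only: fls_X_power_nth)
    then have eq: "n = (if j = int d then 1 else 0)" by (simp split: if_splits)
    have "Module.module complex_ring (X j)" using gr by (simp add: graded_space_def)
    from lin_dim_if_has_dim[OF this n(1)] show ?thesis unfolding eq .
  qed
  \<comment> \<open>Component j of the shifted dual is the dual of component 15 - j, so degrees 3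
    and 6 turn into 12 and 9.\<close>
  have dual: "lin_dim (gshift 15 (graded_dual X) j) (if j = 15 - int d then 1 else 0)"
    if "graded_space X" "has_hilbert_series X (fls_X ^ d)" for X :: "int \<Rightarrow> (complex, 'z) module" and d j
    using lin_dim_dual_space[OF dim[OF that, of "15 - j"]] by (auto simp: gshift_def graded_dual_def split: if_splits)
  have "{b. el_deg b = 0} = el_vs" by (auto simp: el_vs_iff)
  then have "finite {b. el_deg b = 0}" "card {b. el_deg b = 0} = 6" by (simp_all add: el_vs_def)
  then have S: "lin_dim (deg0 A j) (hdim 0 j)" for j
    using C.deg0_iso[of j] T.zero_A5 by (simp only: hdim_table assms(3))
  have X2: "lin_dim (X2 j) (if j = 3 then 1 else 0)" for j
    using dim[OF assms(4,5), of j] by (simp only: of_nat_numeral)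
  have X3: "lin_dim (X3 j) (if j = 6 then 1 else 0)" for j
    using dim[OF assms(6,7), of j] by (simp only: of_nat_numeral)
  have X2': "lin_dim (gshift 15 (graded_dual X2) j) (if j = 12 then 1 else 0)" for j
  proof -
    have "15 - int 3 = 12" by simp
    then show ?thesis using dual[OF assms(4,5), of j] by (simp only:)
  qed
  have X3': "lin_dim (gshift 15 (graded_dual X3) j) (if j = 9 then 1 else 0)" for j
  proof -
    have "15 - int 6 = 9" by simp
    then show ?thesis using dual[OF assms(6,7), of j] by (simp only:)
  qed
  have HH: "HH A n \<cong>\<^sub>g\<^sub>r V" if "\<And>j. lin_dim (V j) (hdim n j)"
    for n and V :: "int \<Rightarrow> (complex, 'v, 'm) module_scheme"
    unfolding graded_iso_def by (rule allI) (rule linear_iso_if_lin_dim[OF C.HH_dim that])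
  have HC_dim: "lin_dim (HC A n j) (cdim n j)" if "1 \<le> n" for n j
    using C.HC_cases[OF that] by (rule conjunct1)
  have HC: "HC A n \<cong>\<^sub>g\<^sub>r V" if n: "1 \<le> n" and V: "\<And>j. lin_dim (V j) (cdim n j)"
    for n and V :: "int \<Rightarrow> (complex, 'v, 'm) module_scheme"
    unfolding graded_iso_def by (rule allI) (rule linear_iso_if_lin_dim[OF HC_dim[OF n] V])
  have HH0: "graded_zero (HH A n)" if "\<And>j. hdim n j = 0" for n
    unfolding graded_zero_def by (rule allI) (rule C.HH_dim_0[OF that])
  have HC0: "graded_zero (HC A n)" if n: "1 \<le> n" and 0: "\<And>j. cdim n j = 0" for n
    unfolding graded_zero_def by (rule allI) (rule C.HC_cases[OF n, THEN conjunct2, THEN mp, OF 0])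
  have HH12: "HH A (12 + i) \<cong>\<^sub>g\<^sub>r gshift 15 (HH A i)" if "1 \<le> i" for i
    by (rule HH) (simp only: hdim_12[OF that] gshift_def C.HH_dim)
  have HC12: "HC A (12 + i) \<cong>\<^sub>g\<^sub>r gshift 15 (HC A i)" if "1 \<le> i" for i
    by (rule HC) (use that in simp, simp only: cdim_12[OF that] gshift_def HC_dim[OF that])
  have HC_0: "HC A 0 = HH A 0" by (simp add: HC_def)
  have HH_2_9: "HH A 2 \<cong>\<^sub>g\<^sub>r X2" "HH A 3 \<cong>\<^sub>g\<^sub>r X2" "HH A 4 \<cong>\<^sub>g\<^sub>r X3" "HH A 5 \<cong>\<^sub>g\<^sub>r X3"
    "HH A 6 \<cong>\<^sub>g\<^sub>r gshift 15 (graded_dual X3)" "HH A 7 \<cong>\<^sub>g\<^sub>r gshift 15 (graded_dual X3)"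
    "HH A 8 \<cong>\<^sub>g\<^sub>r gshift 15 (graded_dual X2)" "HH A 9 \<cong>\<^sub>g\<^sub>r gshift 15 (graded_dual X2)"
    by (rule HH; simp only: hdim_table X2 X3 X2' X3')+
  have HC_even: "HC A 2 \<cong>\<^sub>g\<^sub>r X2" "HC A 4 \<cong>\<^sub>g\<^sub>r X3"
    "HC A 6 \<cong>\<^sub>g\<^sub>r gshift 15 (graded_dual X3)" "HC A 8 \<cong>\<^sub>g\<^sub>r gshift 15 (graded_dual X2)"
    by (rule HC; simp only: cdim_table X2 X3 X2' X3' one_le_numeral)+
  have HH_zero: "graded_zero (HH A 1)" "graded_zero (HH A 10)" "graded_zero (HH A 11)" "graded_zero (HH A 12)"
    by (rule HH0; simp only: hdim_table)+
  have HC_zero: "graded_zero (HC A 1)" "graded_zero (HC A 3)" "graded_zero (HC A 5)" "graded_zero (HC A 7)"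
    "graded_zero (HC A 9)" "graded_zero (HC A 10)" "graded_zero (HC A 11)" "graded_zero (HC A 12)"
    by (rule HC0; simp only: cdim_table one_le_numeral order_refl)+
  show ?thesis unfolding HC_0
    by (intro conjI allI impI HH[OF S] HH_2_9 HC_even HH_zero HC_zero HH12 HC12)
qed

end
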